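(* A strongly permutative epigroup variety $\mathcal V$ is an upper-modular element of the lattice $\mathbf{EPI}$ if and only if one of the following holds: (i) $\mathcal V=\mathcal M\vee\mathcal N$ where $\mathcal M$ is one of the varieties $\mathcal T$ or $\mathcal{SL}$, and $\mathcal N$ is a nilvariety satisfying the commutative law $xy=yx$ and the identity $x^2y=xy^2$; (ii) $\mathcal V=\mathcal G\vee\mathcal C_m\vee\mathcal N$ where $\mathcal G$ is an Abelian group variety, $0\le m\le2$, and $\mathcal N$ is a variety satisfying the commutative law and the identity $x^2y=0$.
   Context: An epigroup is a semigroup $S$ such that for every $x\in S$ some power $x^n$ ($n\ge 1$) lies in a subgroup of $S$. For $x\in S$ some power of $x$ lies in a maximal subgroup $G_x$ of $S$; its unit is denoted $x^\omega$. Then $xx^\omega=x^\omega x\in G_x$, and the pseudoinverse $\overline{x}$ of $x$ is the inverse of $xx^\omega$ in $G_x$. Epigroups are considered as algebras with multiplication and the unary operation $x\mapsto\overline{x}$; an epigroup variety is a variety of such algebras consisting of epigroups. $\mathbf{EPI}$ is the lattice of all epigroup varieties under inclusion: $\wedge$ is intersection, and $\mathcal X\vee\mathcal Y$ is the least epigroup variety containing $\mathcal X$ and $\mathcal Y$. Periodic semigroup varieties are identified with periodic epigroup varieties (in periodic epigroups pseudoinversion is expressible through multiplication). A variety is strongly permutative if it satisfies an identity $x_1x_2\cdots x_n=x_{1\pi}x_{2\pi}\cdots x_{n\pi}$ for some $n$ and some permutation $\pi$ of $\{1,\dots,n\}$ with $1\pi\ne1$ and $n\pi\ne n$. A nilvariety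 is a variety consisting of nil-semigroups (semigroups with $0$ in which every element has a power equal to $0$). An Abelian group variety is an epigroup variety all of whose members are Abelian groups (possibly trivial). The symbol $w=0$ abbreviates the pair of identities $wz=zw=w$ where $z$ is a letter not occurring in $w$. $\mathcal T$ is the trivial variety, $\mathcal{SL}$ the variety of all semilattices; $\mathcal C_m$ is the variety of all epigroups satisfying $x^m=x^{m+1}$ and $xy=yx$ for $m\ge1$ (so $\mathcal C_1=\mathcal{SL}$), and $\mathcal C_0=\mathcal T$. An element $x$ of a lattice $\langle L;\vee,\wedge\rangle$ is upper-modular if $(z\vee y)\wedge x=(z\wedge x)\vee y$ for all $y,z\in L$ with $y\le x$. *)

theory Defs
  imports "HOL-Algebra.Group" "HOL-Algebra.Lattice" "HOL-Combinatorics.Permutations"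
begin

section \<open>Epigroups\<close>

record 'a unary_semigroup = "'a partial_object" +
  smult :: "'a \<Rightarrow> 'a \<Rightarrow> 'a" (infixl \<open>\<cdot>\<index>\<close> 70)
  pinv :: "'a \<Rightarrow> 'a"

definition algebra_2_1 :: "'a unary_semigroup \<Rightarrow> bool" where
  "algebra_2_1 S \<longleftrightarrow> carrier S \<noteq> {} \<and>
     (\<forall>x\<in>carrier S. \<forall>y\<in>carrier S. x \<cdot>\<^bsub>S\<^esub> y \<in> carrier S) \<and>
     (\<forall>x\<in>carrier S. pinv S x \<in> carrier S)"

definition associative :: "'a unary_semigroup \<Rightarrow> bool" where
  "associative S \<longleftrightarrow> (\<forall>x\<in>carrier S. \<forall>y\<in>carrier S. \<forall>z\<in>carrier S.
     (x \<cdot>\<^bsub>S\<^esub> y) \<cdot>\<^bsub>S\<^esub> z = x \<cdot>\<^bsub>S\<^esub> (y \<cdot>\<^bsub>S\<^esub> z))"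

text \<open>The power \<open>x\<^sup>n\<close> in a semigroup; meaningful only for \<open>n \<ge> 1\<close>.\<close>

definition spow :: "'a unary_semigroup \<Rightarrow> 'a \<Rightarrow> nat \<Rightarrow> 'a" where
  "spow S x n = ((\<lambda>y. y \<cdot>\<^bsub>S\<^esub> x) ^^ (n - 1)) x"

definition submonoid_on :: "'a unary_semigroup \<Rightarrow> 'a set \<Rightarrow> 'a \<Rightarrow> 'a monoid" where
  "submonoid_on S G e = \<lparr>carrier = G, monoid.mult = smult S, one = e\<rparr>"

text \<open>A subgroup of a semigroup is a subset that is a group under the restricted
  multiplication; its unit \<open>e\<close> is an arbitrary idempotent of the semigroup.\<close>

definition is_subgroup :: "'a unary_semigroup \<Rightarrow> 'a set \<Rightarrow> 'a \<Rightarrow> bool" where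
  "is_subgroup S G e \<longleftrightarrow> G \<subseteq> carrier S \<and> group (submonoid_on S G e)"

definition is_maximal_subgroup :: "'a unary_semigroup \<Rightarrow> 'a set \<Rightarrow> 'a \<Rightarrow> bool" where
  "is_maximal_subgroup S G e \<longleftrightarrow> is_subgroup S G e \<and>
     (\<forall>H f. is_subgroup S H f \<and> G \<subseteq> H \<longrightarrow> H = G)"

text \<open>Here \<open>G\<close> is the maximal subgroup containing a power of \<open>x\<close>, and \<open>e\<close> is
  \<open>x\<^sup>\<omega>\<close>; both are unique if they exist, and then \<open>x \<cdot> e\<close> lies in \<open>G\<close>.\<close>

definition is_pseudoinverse :: "'a unary_semigroup \<Rightarrow> 'a \<Rightarrow> 'a \<Rightarrow> bool" where
  "is_pseudoinverse S x y \<longleftrightarrow>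
     (\<exists>G e n. is_maximal_subgroup S G e \<and> 1 \<le> n \<and> spow S x n \<in> G \<and>
        y = inv\<^bsub>submonoid_on S G e\<^esub> (x \<cdot>\<^bsub>S\<^esub> e))"

definition epigroup :: "'a unary_semigroup \<Rightarrow> bool" where
  "epigroup S \<longleftrightarrow> algebra_2_1 S \<and> associative S \<and>
     (\<forall>x\<in>carrier S. \<exists>n\<ge>1. \<exists>G e. is_subgroup S G e \<and> spow S x n \<in> G) \<and>
     (\<forall>x\<in>carrier S. is_pseudoinverse S x (pinv S x))"


section \<open>Identities\<close>

datatype uterm = Var nat | Mul uterm uterm | Bar uterm

type_synonym identity = "uterm \<times> uterm"

primrec eval :: "'a unary_semigroup \<Rightarrow> (nat \<Rightarrow> 'a) \<Rightarrow> uterm \<Rightarrow> 'a" where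
  "eval S \<rho> (Var i) = \<rho> i"
| "eval S \<rho> (Mul s t) = eval S \<rho> s \<cdot>\<^bsub>S\<^esub> eval S \<rho> t"
| "eval S \<rho> (Bar t) = pinv S (eval S \<rho> t)"

definition satisfies :: "'a unary_semigroup \<Rightarrow> identity \<Rightarrow> bool" where
  "satisfies S p \<longleftrightarrow>
     (\<forall>\<rho>. (\<forall>i. \<rho> i \<in> carrier S) \<longrightarrow> eval S \<rho> (fst p) = eval S \<rho> (snd p))"

definition class_satisfies :: "'a unary_semigroup set \<Rightarrow> identity set \<Rightarrow> bool" where
  "class_satisfies V \<Sigma> \<longleftrightarrow> (\<forall>S\<in>V. \<forall>p\<in>\<Sigma>. satisfies S p)"

text \<open>The product of the letters of a nonempty word.\<close>

definition word :: "nat list \<Rightarrow> uterm" where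
  "word w = foldl Mul (Var (hd w)) (map Var (tl w))"

definition commutative_law :: identity where
  "commutative_law = (word [0, 1], word [1, 0])"

text \<open>\<open>w = 0\<close> stands for \<open>wz = zw = w\<close>; the letter \<open>z\<close> must not occur in \<open>w\<close>.\<close>

definition zero_law :: "uterm \<Rightarrow> nat \<Rightarrow> identity set" where
  "zero_law w z = {(Mul w (Var z), w), (Mul (Var z) w, w)}"


section \<open>The lattice of epigroup varieties\<close>

text \<open>Classes of algebras are relative to the universe \<open>'u\<close> of possible elements. A variety
  is determined by its countable members, so for infinite \<open>'u\<close> these classes, ordered by
  inclusion, represent the varieties faithfully. A variety of epigroups is an equational class
  among all algebras with one binary and one unary operation: the epigroups satisfying a set
  of identities need not be closed under products.\<close>

definition models :: "identity set \<Rightarrow> 'u unary_semigroup set" where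
  "models \<Sigma> = {S. algebra_2_1 S \<and> (\<forall>p\<in>\<Sigma>. satisfies S p)}"

definition epigroup_variety :: "'u unary_semigroup set \<Rightarrow> bool" where
  "epigroup_variety V \<longleftrightarrow> (\<exists>\<Sigma>. V = models \<Sigma>) \<and> (\<forall>S\<in>V. epigroup S)"

definition EPI :: "'u unary_semigroup set gorder" where
  "EPI = \<lparr>carrier = {V. epigroup_variety V}, eq = (=), le = (\<subseteq>)\<rparr>"

lemma EPI_meet:
  assumes "X \<in> carrier EPI" "Y \<in> carrier EPI" shows "X \<sqinter>\<^bsub>EPI\<^esub> Y = X \<inter> Y"
proof -
  from assms obtain A B where AB: "X = models A" "Y = models B" and e: "\<forall>S\<in>X. epigroup S"
    by (auto simp: EPI_def epigroup_variety_def)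
  have "X \<inter> Y = models (A \<union> B)" by (auto simp: AB models_def)
  then have v: "epigroup_variety (X \<inter> Y)" using e unfolding epigroup_variety_def by blast
  have g: "greatest EPI (X \<inter> Y) (Lower EPI {X,Y})"
    using v assms by (auto simp: greatest_def Lower_def EPI_def)
  have "W = X \<inter> Y" if "greatest EPI W (Lower EPI {X,Y})" for W
  proof (rule equalityI)
    have c: "W \<in> Lower EPI {X,Y}" "X \<inter> Y \<in> Lower EPI {X,Y}" using that g unfolding greatest_def by (auto simp only:)
    have le: "(A \<sqsubseteq>\<^bsub>EPI\<^esub> B) = (A \<subseteq> B)" for A B :: "'a unary_semigroup set" by (simp add: EPI_def)
    have "W \<sqsubseteq>\<^bsub>EPI\<^esub> X \<inter> Y" using g c(1) unfolding greatest_def by (elim conjE) (erule bspec)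
    then show "W \<subseteq> X \<inter> Y" by (simp only: le)
    have "X \<inter> Y \<sqsubseteq>\<^bsub>EPI\<^esub> W" using that c(2) unfolding greatest_def by (elim conjE) (erule bspec)
    then show "X \<inter> Y \<subseteq> W" by (simp only: le)
  qed
  with g show ?thesis unfolding meet_def inf_def by (rule some_equality)
qed

definition upper_modular :: "('a, 'b) gorder_scheme \<Rightarrow> 'a \<Rightarrow> bool" where
  "upper_modular L x \<longleftrightarrow> x \<in> carrier L \<and>
     (\<forall>y\<in>carrier L. \<forall>z\<in>carrier L. y \<sqsubseteq>\<^bsub>L\<^esub> x \<longrightarrow>
        (z \<squnion>\<^bsub>L\<^esub> y) \<sqinter>\<^bsub>L\<^esub> x = (z \<sqinter>\<^bsub>L\<^esub> x) \<squnion>\<^bsub>L\<^esub> y)"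


section \<open>Particular varieties\<close>

definition strongly_permutative :: "'u unary_semigroup set \<Rightarrow> bool" where
  "strongly_permutative V \<longleftrightarrow>
     (\<exists>n\<ge>1. \<exists>\<pi>. \<pi> permutes {1..n} \<and> \<pi> 1 \<noteq> 1 \<and> \<pi> n \<noteq> n \<and>
        class_satisfies V {(word [1..<n+1], word (map \<pi> [1..<n+1]))})"

definition nil_semigroup :: "'a unary_semigroup \<Rightarrow> bool" where
  "nil_semigroup S \<longleftrightarrow> (\<exists>z\<in>carrier S.
     (\<forall>x\<in>carrier S. x \<cdot>\<^bsub>S\<^esub> z = z \<and> z \<cdot>\<^bsub>S\<^esub> x = z) \<and>
     (\<forall>x\<in>carrier S. \<exists>n\<ge>1. spow S x n = z))"

definition nilvariety :: "'u unary_semigroup set \<Rightarrow> bool" where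
  "nilvariety V \<longleftrightarrow> epigroup_variety V \<and> (\<forall>S\<in>V. nil_semigroup S)"

definition abelian_group_variety :: "'u unary_semigroup set \<Rightarrow> bool" where
  "abelian_group_variety V \<longleftrightarrow> epigroup_variety V \<and>
     (\<forall>S\<in>V. \<exists>e. comm_group (submonoid_on S (carrier S) e))"

definition trivial_variety :: "'u unary_semigroup set" where
  "trivial_variety = {S. epigroup S \<and> (\<exists>a. carrier S = {a})}"

definition SL :: "'u unary_semigroup set" where
  "SL = {S. epigroup S \<and> (\<forall>x\<in>carrier S. x \<cdot>\<^bsub>S\<^esub> x = x) \<and>
     (\<forall>x\<in>carrier S. \<forall>y\<in>carrier S. x \<cdot>\<^bsub>S\<^esub> y = y \<cdot>\<^bsub>S\<^esub> x)}"

definition C :: "nat \<Rightarrow> 'u unary_semigroup set" where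
  "C m = (if m = 0 then trivial_variety else
     {S. epigroup S \<and> satisfies S commutative_law \<and>
       satisfies S (word (replicate m 0), word (replicate (m + 1) 0))})"

end

theory Submission
  imports Defs "HOL-Library.Extended_Nat" "HOL-Library.Countable" "HOL-Library.Multiset"
begin

text \<open>The proof takes place on the side of equational theories. Over an infinite universe every equational
  theory belongs to a variety, joins of varieties are intersections of theories, and meets are transitive closures of
  unions. So a variety with the theory \<open>\<Theta>\<close> is upper-modular iff \<open>Y \<inter> (Z \<union>
  \<Theta>)\<^sup>*\<close> is contained in \<open>(\<Theta> \<union> (Z \<inter> Y))\<^sup>*\<close> for all theories
  \<open>Y \<supseteq> \<Theta>\<close> and \<open>Z\<close> of epigroup varieties (\<open>upper_modular_iff\<close>).

  Call a term vanishing if it is equal modulo \<open>\<Theta>\<close> to a term with a bar. A strongly permutative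
  theory makes idempotents central and local monoids commutative (\<open>strongly_permutative_theory\<close>), and
  therefore an identity between two vanishing terms depends only on two numbers for each letter: its exponent, modulo
  the periods of the groups of the variety, and the number of its occurrences, up to the index of the local monoids
  (\<open>vanishes_identity\<close>). Consequently \<open>\<Theta>\<close> is the intersection of the theories of an
  Abelian group variety, of some \<open>C m\<close>, and of a nilvariety (\<open>theory_decomposition\<close>). In
  view of this, the two conditions of the theorem together say that \<open>\<Theta>\<close> is commutative and either
  contains \<open>x\<^sup>2y = xy\<^sup>2\<close> or makes \<open>x\<^sup>2y\<close> vanish. In the first case all
  integers are periods and the index is at most one, so only the trivial variety or the semilattices remain besides
  the nil part; in the second case the index is at most two.

  This condition is necessary because a failure of commutativity, or of both alternatives, restricts the class of
  \<open>xy\<close> or of \<open>xxy\<close> so much that \<open>\<Theta>\<close> is contained in the theory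
  \<open>Y\<close> of some small nil-semigroups. A theory \<open>Z\<close> with left zeros then gives a chain of
  identities from \<open>xy\<close> to \<open>yx\<close>, or from \<open>x\<^sup>2y\<close> to
  \<open>xy\<^sup>2\<close>, which violates the modular law (\<open>upper_commutative\<close>,
  \<open>upper_dichotomy\<close>).

  It is sufficient for the following reason. Let \<open>p = q\<close> be in \<open>Y \<inter> (Z \<union>
  \<Theta>)\<^sup>*\<close> and let \<open>X\<close> be \<open>(\<Theta> \<union> (Z \<inter> Y))\<^sup>*\<close>. If
  both sides vanish in \<open>X\<close>, the two invariants reduce the claim to the modular law for subgroups of the
  integers and to a statement about minimal occurrence numbers (\<open>modular_vanishing\<close>). Otherwise one side,
  say \<open>p\<close>, is a word of a very special kind: linear, a power of a letter, or, if \<open>x\<^sup>2y =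
  xy\<^sup>2\<close>, a permutation of \<open>xxy\<close>. For such words any identity that leads out of their class
  modulo \<open>\<Theta>\<close> implies an identity \<open>p = W\<close> that makes \<open>p\<close> vanish and in
  which \<open>W\<close> has nearly the same invariants. If \<open>p = q\<close> is not in \<open>X\<close>, then
  \<open>Y\<close> leaves the class, and so does \<open>Z\<close> unless already \<open>\<Theta>\<close> makes
  \<open>p\<close> vanish. Hence \<open>p = W\<close> belongs to both \<open>Y\<close> and \<open>Z\<close>, up to the
  choice of \<open>p\<close> in its class, and \<open>p\<close> vanishes in \<open>X\<close> after all
  (\<open>modular_escape\<close>). The difficult case is that of linear words (\<open>linear_identity\<close>). If the
  identity changes an exponent, then the theory is periodic, and the combinatorial normal form
  \<open>normal_form\<close> of linear words provides an idempotent next to which the exponents can be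
  corrected.\<close>

section \<open>Equational theories and varieties\<close>

instance uterm :: countable
  by countable_datatype

primrec subst :: "(nat \<Rightarrow> uterm) \<Rightarrow> uterm \<Rightarrow> uterm" where
  "subst \<sigma> (Var i) = \<sigma> i"
| "subst \<sigma> (Mul s t) = Mul (subst \<sigma> s) (subst \<sigma> t)"
| "subst \<sigma> (Bar t) = Bar (subst \<sigma> t)"

definition equational_theory :: "identity set \<Rightarrow> bool" where
  "equational_theory \<Theta> \<longleftrightarrow> equiv UNIV \<Theta> \<and>
     (\<forall>s t s' t'. (s, t) \<in> \<Theta> \<longrightarrow> (s', t') \<in> \<Theta> \<longrightarrow> (Mul s s', Mul t t') \<in> \<Theta>) \<and>
     (\<forall>s t. (s, t) \<in> \<Theta> \<longrightarrow> (Bar s, Bar t) \<in> \<Theta>) \<and>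
     (\<forall>s t \<sigma>. (s, t) \<in> \<Theta> \<longrightarrow> (subst \<sigma> s, subst \<sigma> t) \<in> \<Theta>)"

text \<open>The identities of a class of algebras over the universe \<open>'u\<close>, the other half of the Galois
  connection with \<open>models\<close>. For infinite \<open>'u\<close> every equational theory arises in this
  way.\<close>

definition Eq :: "'u unary_semigroup set \<Rightarrow> identity set" where
  "Eq V = {p. \<forall>S\<in>V. satisfies S p}"

lemma equational_theoryI:
  assumes "\<And>s. (s, s) \<in> \<Theta>" "\<And>s t. (s, t) \<in> \<Theta> \<Longrightarrow> (t, s) \<in> \<Theta>"
    "\<And>s t r. (s, t) \<in> \<Theta> \<Longrightarrow> (t, r) \<in> \<Theta> \<Longrightarrow> (s, r) \<in> \<Theta>"
    "\<And>s t s' t'. (s, t) \<in> \<Theta> \<Longrightarrow> (s', t') \<in> \<Theta> \<Longrightarrow> (Mul s s', Mul t t') \<in> \<Theta>"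
    "\<And>s t. (s, t) \<in> \<Theta> \<Longrightarrow> (Bar s, Bar t) \<in> \<Theta>"
    "\<And>s t \<sigma>. (s, t) \<in> \<Theta> \<Longrightarrow> (subst \<sigma> s, subst \<sigma> t) \<in> \<Theta>"
  shows "equational_theory \<Theta>"
  unfolding equational_theory_def
proof (intro conjI)
  show "equiv UNIV \<Theta>"
    by (rule equivI; (rule refl_onI symI transI)?) (auto intro: assms(1,2,3))
qed (auto intro: assms(4,5,6))

lemma
  assumes "equational_theory \<Theta>"
  shows et_refl: "(s, s) \<in> \<Theta>"
    and et_sym: "(s, t) \<in> \<Theta> \<Longrightarrow> (t, s) \<in> \<Theta>"
    and et_trans: "(s, t) \<in> \<Theta> \<Longrightarrow> (t, r) \<in> \<Theta> \<Longrightarrow> (s, r) \<in> \<Theta>"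
    and et_Mul: "(s, t) \<in> \<Theta> \<Longrightarrow> (s', t') \<in> \<Theta> \<Longrightarrow> (Mul s s', Mul t t') \<in> \<Theta>"
    and et_Bar: "(s, t) \<in> \<Theta> \<Longrightarrow> (Bar s, Bar t) \<in> \<Theta>"
    and et_subst: "(s, t) \<in> \<Theta> \<Longrightarrow> (subst \<sigma> s, subst \<sigma> t) \<in> \<Theta>"
proof -
  have e: "equiv UNIV \<Theta>" using assms by (simp add: equational_theory_def)
  show "(s, s) \<in> \<Theta>" using e by (simp add: equiv_def refl_on_def)
  show "(s, t) \<in> \<Theta> \<Longrightarrow> (t, s) \<in> \<Theta>" using e by (auto simp: equiv_def elim: symE)
  show "(s, t) \<in> \<Theta> \<Longrightarrow> (t, r) \<in> \<Theta> \<Longrightarrow> (s, r) \<in> \<Theta>"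
    using e unfolding equiv_def by (elim conjE) (rule transD)
qed (use assms in \<open>simp_all add: equational_theory_def\<close>)

lemma eval_subst: "eval S \<rho> (subst \<sigma> t) = eval S (\<lambda>i. eval S \<rho> (\<sigma> i)) t"
  by (induction t) auto

lemma eval_closed:
  assumes "algebra_2_1 S" "\<And>i. \<rho> i \<in> carrier S"
  shows "eval S \<rho> t \<in> carrier S"
  using assms by (induction t) (auto simp: algebra_2_1_def)

lemma equational_theory_Eq:
  assumes "\<And>S. S \<in> V \<Longrightarrow> algebra_2_1 S"
  shows "equational_theory (Eq V)"
proof (rule equational_theoryI)
  fix s t \<sigma> assume st: "(s, t) \<in> Eq V"
  show "(subst \<sigma> s, subst \<sigma> t) \<in> Eq V"
    using st assms unfolding Eq_def satisfies_def
    by (auto simp: eval_subst eval_closed)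
qed (auto simp: Eq_def satisfies_def)

lemma equational_theory_Eq_models: "equational_theory (Eq (models \<Sigma>))"
  by (rule equational_theory_Eq) (simp add: models_def)

lemma equational_theory_Int:
  assumes "equational_theory A" "equational_theory B"
  shows "equational_theory (A \<inter> B)"
proof (rule equational_theoryI)
  show "(s, r) \<in> A \<inter> B" if "(s, t) \<in> A \<inter> B" "(t, r) \<in> A \<inter> B" for s t r
    using that et_trans[OF assms(1), of s t r] et_trans[OF assms(2), of s t r] by simp
qed (auto intro: et_refl[OF assms(1)] et_refl[OF assms(2)] et_sym[OF assms(1)] et_sym[OF assms(2)]
    et_Mul[OF assms(1)] et_Mul[OF assms(2)] et_Bar[OF assms(1)] et_Bar[OF assms(2)]
    et_subst[OF assms(1)] et_subst[OF assms(2)])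

text \<open>The join of two fully invariant congruences is the transitive closure of their union: the union is
  symmetric, and each operation and each substitution can be applied to one step of a chain at a time.\<close>

lemma equational_theory_join:
  assumes A: "equational_theory A" and B: "equational_theory B"
  shows "equational_theory ((A \<union> B)\<^sup>*)"
proof (rule equational_theoryI)
  have sym: "sym (A \<union> B)"
    using et_sym[OF A] et_sym[OF B] by (auto simp: sym_def)
  show "(t, s) \<in> (A \<union> B)\<^sup>*" if "(s, t) \<in> (A \<union> B)\<^sup>*" for s t
    using sym_rtrancl[OF sym] that by (rule symD)
  have mapped: "(f s, f t) \<in> (A \<union> B)\<^sup>*" if "(s, t) \<in> (A \<union> B)\<^sup>*"
    "\<And>s t. (s, t) \<in> A \<union> B \<Longrightarrow> (f s, f t) \<in> A \<union> B" for f s t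
    using that(1)
  proof (induction rule: rtrancl_induct)
    case (step y z)
    from this(3) that(2)[OF this(2)] show ?case by (rule rtrancl_into_rtrancl)
  qed simp
  show "(Bar s, Bar t) \<in> (A \<union> B)\<^sup>*" if "(s, t) \<in> (A \<union> B)\<^sup>*" for s t
    using that by (rule mapped) (auto intro: et_Bar[OF A] et_Bar[OF B])
  show "(subst \<sigma> s, subst \<sigma> t) \<in> (A \<union> B)\<^sup>*" if "(s, t) \<in> (A \<union> B)\<^sup>*" for s t \<sigma>
    using that by (rule mapped) (auto intro: et_subst[OF A] et_subst[OF B])
  show "(Mul s s', Mul t t') \<in> (A \<union> B)\<^sup>*"
    if st: "(s, t) \<in> (A \<union> B)\<^sup>*" and st': "(s', t') \<in> (A \<union> B)\<^sup>*" for s t s' t'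
  proof -
    have "(Mul s s', Mul t s') \<in> (A \<union> B)\<^sup>*"
      using st by (rule mapped) (auto intro: et_Mul[OF A] et_Mul[OF B] et_refl[OF A] et_refl[OF B])
    also have "(Mul t s', Mul t t') \<in> (A \<union> B)\<^sup>*"
      using st' by (rule mapped) (auto intro: et_Mul[OF A] et_Mul[OF B] et_refl[OF A] et_refl[OF B])
    finally show ?thesis .
  qed
qed auto

definition nf :: "identity set \<Rightarrow> uterm \<Rightarrow> uterm" where
  "nf \<Theta> t = (SOME s. (t, s) \<in> \<Theta>)"

lemma nf_related:
  assumes "equational_theory \<Theta>" shows "(t, nf \<Theta> t) \<in> \<Theta>"
  unfolding nf_def by (rule someI[of _ t]) (rule et_refl[OF assms])

lemma nf_eq_iff:
  assumes "equational_theory \<Theta>" shows "nf \<Theta> s = nf \<Theta> t \<longleftrightarrow> (s, t) \<in> \<Theta>"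
proof
  assume "nf \<Theta> s = nf \<Theta> t"
  then show "(s, t) \<in> \<Theta>"
    using nf_related[OF assms] et_sym[OF assms] et_trans[OF assms] by metis
next
  assume "(s, t) \<in> \<Theta>"
  then have "(s, r) \<in> \<Theta> \<longleftrightarrow> (t, r) \<in> \<Theta>" for r
    using et_sym[OF assms] et_trans[OF assms] by blast
  then show "nf \<Theta> s = nf \<Theta> t" by (simp add: nf_def)
qed

lemma nf_Mul:
  assumes "equational_theory \<Theta>" shows "nf \<Theta> (Mul (nf \<Theta> s) (nf \<Theta> t)) = nf \<Theta> (Mul s t)"
  by (simp add: nf_eq_iff assms et_Mul et_sym nf_related)

lemma nf_Bar:
  assumes "equational_theory \<Theta>" shows "nf \<Theta> (Bar (nf \<Theta> t)) = nf \<Theta> (Bar t)"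
  by (simp add: nf_eq_iff assms et_Bar et_sym nf_related)

text \<open>Birkhoff's completeness theorem. The free algebra of countable rank has only countably many elements, so
  it has a copy inside any infinite universe; its identities are exactly those of the theory.\<close>

lemma free_algebra:
  assumes inf: "infinite (UNIV :: 'u set)" and T: "equational_theory \<Theta>"
  obtains S :: "'u unary_semigroup" and g where "algebra_2_1 S" "\<And>p. satisfies S p \<longleftrightarrow> p \<in> \<Theta>"
    "\<And>k. g k \<in> carrier S" "\<And>s t. eval S g s = eval S g t \<longleftrightarrow> (s, t) \<in> \<Theta>"
proof -
  obtain h :: "nat \<Rightarrow> 'u" where h: "inj h"
    using infinite_countable_subset[OF inf] by blast
  \<comment> \<open>The elements of the free algebra are the images under \<open>j\<close> of the chosen representatives of the classes.\<close>
  define j :: "uterm \<Rightarrow> 'u" where "j = h \<circ> to_nat"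
  have j: "inj j" unfolding j_def using h by (simp add: inj_compose)
  define i where "i = inv_into UNIV j"
  have ij [simp]: "i (j t) = t" for t unfolding i_def by (rule inv_f_f[OF j])
  define S :: "'u unary_semigroup" where
    "S = \<lparr>carrier = range (j \<circ> nf \<Theta>), smult = \<lambda>a b. j (nf \<Theta> (Mul (i a) (i b))),
       pinv = \<lambda>a. j (nf \<Theta> (Bar (i a)))\<rparr>"
  have ev: "eval S (\<lambda>k. j (nf \<Theta> (\<sigma> k))) t = j (nf \<Theta> (subst \<sigma> t))" for \<sigma> t
    by (induction t) (simp_all add: S_def nf_Mul nf_Bar T)
  define g where "g = (\<lambda>k. j (nf \<Theta> (Var k)))"
  have "subst Var t = t" for t by (induction t) auto
  then have g: "eval S g s = eval S g t \<longleftrightarrow> (s, t) \<in> \<Theta>" for s t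
    unfolding g_def ev using j by (simp add: inj_eq nf_eq_iff T)
  have gS: "g k \<in> carrier S" for k by (simp add: S_def g_def)
  have "satisfies S p \<longleftrightarrow> p \<in> \<Theta>" for p
  proof
    assume "satisfies S p"
    then have "eval S g (fst p) = eval S g (snd p)"
      unfolding satisfies_def by (simp add: gS)
    then show "p \<in> \<Theta>" by (simp add: g)
  next
    assume p: "p \<in> \<Theta>"
    show "satisfies S p"
      unfolding satisfies_def
    proof (intro allI impI)
      fix \<rho> :: "nat \<Rightarrow> 'u" assume "\<forall>k. \<rho> k \<in> carrier S"
      then have "\<forall>k. \<exists>s. \<rho> k = j (nf \<Theta> s)" by (auto simp: S_def)
      then obtain \<sigma> where \<sigma>: "\<And>k. \<rho> k = j (nf \<Theta> (\<sigma> k))" by metis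
      then have "\<rho> = (\<lambda>k. j (nf \<Theta> (\<sigma> k)))" by auto
      moreover have "nf \<Theta> (subst \<sigma> (fst p)) = nf \<Theta> (subst \<sigma> (snd p))"
        using et_subst[OF T, of "fst p" "snd p" \<sigma>] p by (simp add: nf_eq_iff T)
      ultimately show "eval S \<rho> (fst p) = eval S \<rho> (snd p)" by (simp add: ev)
    qed
  qed
  moreover have "algebra_2_1 S" by (auto simp: algebra_2_1_def S_def)
  ultimately show ?thesis using that gS g by blast
qed

lemma Eq_models:
  assumes "infinite (UNIV :: 'u set)" "equational_theory \<Theta>"
  shows "Eq (models \<Theta> :: 'u unary_semigroup set) = \<Theta>"
proof
  obtain S :: "'u unary_semigroup" where S: "algebra_2_1 S" "\<And>p. satisfies S p \<longleftrightarrow> p \<in> \<Theta>"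
    using free_algebra[OF assms] by metis
  then show "Eq (models \<Theta> :: 'u unary_semigroup set) \<subseteq> \<Theta>"
    by (auto simp: Eq_def models_def)
qed (auto simp: Eq_def models_def)

lemma models_Eq: "models (Eq (models \<Sigma> :: 'u unary_semigroup set)) = (models \<Sigma> :: 'u unary_semigroup set)"
proof
  have "\<Sigma> \<subseteq> Eq (models \<Sigma> :: 'u unary_semigroup set)" by (auto simp: models_def Eq_def)
  then show "models (Eq (models \<Sigma> :: 'u unary_semigroup set)) \<subseteq> (models \<Sigma> :: 'u unary_semigroup set)"
    by (auto simp: models_def)
qed (auto simp: models_def Eq_def)

lemma models_antimono: "A \<subseteq> B \<Longrightarrow> models B \<subseteq> models A"
  by (auto simp: models_def)

lemma Eq_antimono: "V \<subseteq> W \<Longrightarrow> Eq W \<subseteq> Eq V"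
  by (auto simp: Eq_def)

lemma models_join: "models ((A \<union> B)\<^sup>*) = models A \<inter> models B"
proof
  show "models ((A \<union> B)\<^sup>*) \<subseteq> models A \<inter> models B"
    by (auto simp: models_def)
  show "models A \<inter> models B \<subseteq> (models ((A \<union> B)\<^sup>*) :: 'a unary_semigroup set)"
  proof
    fix S :: "'a unary_semigroup" assume "S \<in> models A \<inter> models B"
    then have S: "algebra_2_1 S" "A \<union> B \<subseteq> Eq {S}" by (auto simp: models_def Eq_def)
    have "equational_theory (Eq {S})" by (rule equational_theory_Eq) (simp add: S)
    note eS = this
    have "(s, t) \<in> Eq {S}" if "(s, t) \<in> (A \<union> B)\<^sup>*" for s t
      using that
    proof (induction rule: rtrancl_induct)
      case (step t r)
      then have "(t, r) \<in> Eq {S}" using S(2) by blast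
      with step(3) show ?case by (rule et_trans[OF eS])
    qed (rule et_refl[OF eS])
    then have "(A \<union> B)\<^sup>* \<subseteq> Eq {S}" by auto
    then show "S \<in> models ((A \<union> B)\<^sup>*)" using S(1) by (auto simp: models_def Eq_def)
  qed
qed

section \<open>Epigroups with a unit\<close>

class epi_monoid = monoid_mult +
  fixes br :: "'a \<Rightarrow> 'a"
  assumes br_commutes: "x * br x = br x * x"
    and br_inner: "x * br x * br x = br x"
    and br_index: "\<exists>n. x ^ (n + 1) * br x = x ^ n"
begin

definition om :: "'a \<Rightarrow> 'a" where "om x = x * br x"

lemma br_om: "br x * om x = br x" "om x * br x = br x"
proof -
  show a: "om x * br x = br x" using br_inner by (simp add: om_def)
  have "br x * om x = (br x * x) * br x" by (simp add: om_def mult.assoc)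
  also have "\<dots> = om x * br x" by (simp add: om_def br_commutes)
  finally show "br x * om x = br x" using a by simp
qed

lemma om_commutes: "om x * x = x * om x"
proof -
  have "om x * x = x * (br x * x)" by (simp add: om_def mult.assoc)
  then show ?thesis by (simp add: br_commutes[symmetric] om_def)
qed

lemma om_idem: "om x * om x = om x"
proof -
  have "om x * om x = x * (br x * om x)" by (simp add: om_def mult.assoc)
  then show ?thesis by (simp only: br_om om_def[symmetric])
qed

lemma power_index_mono:
  assumes "x ^ (n + 1) * y = x ^ n" "n \<le> m" shows "x ^ (m + 1) * y = x ^ m"
proof -
  have "x ^ (m + 1) * y = x ^ (m - n) * (x ^ (n + 1) * y)"
    using assms(2) by (simp add: mult.assoc[symmetric] power_add[symmetric] del: power_Suc)
  then show ?thesis using assms by (simp add: power_add[symmetric])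
qed

lemma power_om: "\<exists>n. \<forall>m\<ge>n. x ^ m * om x = x ^ m \<and> om x * x ^ m = x ^ m"
proof -
  obtain n where n: "x ^ (n + 1) * br x = x ^ n" using br_index by blast
  show ?thesis
  proof (intro exI allI impI)
    fix m assume "n \<le> m"
    then have m: "x ^ (m + 1) * br x = x ^ m" by (rule power_index_mono[OF n])
    have a: "x ^ m * om x = x ^ m"
      unfolding om_def using m by (metis Suc_eq_plus1 mult.assoc power_Suc2)
    have "om x * x ^ m = x ^ m * om x"
      using power_commuting_commutes[OF om_commutes[symmetric], where n = m] by simp
    then show "x ^ m * om x = x ^ m \<and> om x * x ^ m = x ^ m" using a by simp
  qed
qed

text \<open>In the maximal subgroup with unit \<open>x y\<close> the powers of \<open>y\<close> cancel those of
  \<open>x\<close>.\<close>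

lemma power_inverse_power:
  assumes "x * y = y * x" "x * y * y = y"
  shows "y ^ Suc j * x ^ j = y" "x ^ Suc j * y ^ Suc j = x * y"
proof -
  show a: "y ^ Suc j * x ^ j = y" for j
  proof (induction j)
    case (Suc j)
    have "y ^ Suc (Suc j) * x ^ Suc j = y * (y ^ Suc j * x ^ j) * x"
      by (metis mult.assoc power_Suc power_Suc2)
    also have "\<dots> = y" using Suc assms by (metis mult.assoc)
    finally show ?case .
  qed simp
  show "x ^ Suc j * y ^ Suc j = x * y"
    using a[of j] assms(1) power_commuting_commutes[OF assms(1)]
    by (metis mult.assoc power_Suc power_commuting_commutes)
qed

text \<open>The pseudoinverse is the only commuting element with the two cancellation properties: this is the
  uniqueness of the Drazin inverse. Both \<open>x y\<close> and \<open>x \<cdot> br x\<close> act as a unit on high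
  powers of \<open>x\<close> and are products of such powers with inverse powers, so they are the same
  idempotent.\<close>

lemma br_unique:
  assumes c: "x * y = y * x" and i: "x * y * y = y" and k: "x ^ (k + 1) * y = x ^ k"
  shows "y = br x"
proof -
  define b where "b = br x"
  have cb: "x * b = b * x" and ib: "x * b * b = b" unfolding b_def by (rule br_commutes br_inner)+
  obtain n where n: "x ^ (n + 1) * b = x ^ n" unfolding b_def using br_index by blast
  define N where "N = k + n"
  have ky: "x ^ (N + 1) * y = x ^ N" by (rule power_index_mono[OF k]) (simp add: N_def)
  have kb: "x ^ (N + 1) * b = x ^ N" by (rule power_index_mono[OF n]) (simp add: N_def)
  have ky': "y * x ^ (N + 1) = x ^ N" using ky power_commuting_commutes[OF c, of "N + 1"] by (simp only:)
  have "(x * y) * (x * b) = x * y"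
  proof -
    have "(x * y) * (x * b) = (y ^ Suc N * x ^ Suc N) * (x * b)"
      using power_inverse_power(2)[OF c i, of N] power_commuting_commutes[OF c]
      by (metis power_commuting_commutes)
    also have "\<dots> = y ^ Suc N * (x * (x ^ (N + 1) * b))"
      using power_commutes[of x "Suc N"] by (metis Suc_eq_plus1 mult.assoc)
    also have "\<dots> = y ^ Suc N * x ^ Suc N" by (simp only: kb power_Suc)
    also have "\<dots> = x * y"
      using power_inverse_power(2)[OF c i, of N] power_commuting_commutes[OF c]
      by (metis power_commuting_commutes)
    finally show ?thesis .
  qed
  moreover have "(x * y) * (x * b) = x * b"
  proof -
    have "(x * y) * (x * b) = (x * y) * (x ^ Suc N * b ^ Suc N)"
      using power_inverse_power(2)[OF cb ib, of N] by simp
    also have "\<dots> = x * (y * x ^ (N + 1)) * b ^ Suc N" by (simp add: mult.assoc)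
    also have "\<dots> = x ^ Suc N * b ^ Suc N" by (simp only: ky' power_Suc)
    also have "\<dots> = x * b" by (rule power_inverse_power(2)[OF cb ib])
    finally show ?thesis .
  qed
  ultimately have xy: "x * y = x * b" by simp
  then have "y = x * b * y" using i by metis
  also have "\<dots> = b * (x * y)" using cb by (simp add: mult.assoc)
  also have "\<dots> = b" using xy cb ib by (metis mult.assoc)
  finally show ?thesis by (simp add: b_def)
qed

lemma br_idem: "e * e = e \<Longrightarrow> br e = e"
  by (rule br_unique[symmetric, of _ _ 1]) (auto simp: mult.assoc)

lemma br_1 [simp]: "br 1 = 1"
  by (rule br_idem) simp

text \<open>An element that commutes with \<open>a\<close> commutes with the idempotent of \<open>a\<close>, since
  this idempotent is a product of powers of \<open>a\<close> and of its pseudoinverse on either side; inside the local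
  monoid it then commutes with the inverse.\<close>

lemma commutes_br:
  assumes ab: "a * b = b * a" shows "br a * b = b * br a"
proof -
  define y where "y = br a"
  have c: "a * y = y * a" and i: "a * y * y = y" unfolding y_def by (rule br_commutes br_inner)+
  obtain n where n: "a ^ n * om a = a ^ n" "om a * a ^ n = a ^ n" using power_om by blast
  have E: "om a = a * y" by (simp add: om_def y_def)
  have pn: "a ^ n * b = b * a ^ n" by (rule power_commuting_commutes[OF ab])
  have y1: "y = y ^ Suc n * a ^ n" using power_inverse_power(1)[OF c i] by simp
  have y2: "y = a ^ n * y ^ Suc n"
    using y1 power_commuting_commutes[OF c, of n] power_commuting_commutes by metis
  have "y * b = y ^ Suc n * (b * a ^ n)" using y1 pn by (metis mult.assoc)
  also have "\<dots> = y ^ Suc n * (b * a ^ n) * om a" using n(1) by (simp add: mult.assoc)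
  also have "\<dots> = y * b * om a" using y1 pn by (metis mult.assoc)
  finally have yb: "y * b = y * b * om a" .
  have "b * y = (a ^ n * b) * y ^ Suc n" using y2 pn by (metis mult.assoc)
  also have "\<dots> = om a * (a ^ n * b) * y ^ Suc n" using n(2) by (metis mult.assoc)
  also have "\<dots> = om a * (b * y)" using y2 pn by (metis mult.assoc)
  finally have by': "b * y = om a * (b * y)" .
  have "om a * b = a * (y * b)" by (simp add: E mult.assoc)
  also have "\<dots> = a * (y * b * om a)" using yb by (rule arg_cong)
  also have "\<dots> = om a * b * om a" by (simp add: E mult.assoc)
  finally have e1: "om a * b = om a * b * om a" .
  have "b * om a = b * y * a" by (simp add: E c mult.assoc)
  then have "b * om a = om a * (b * y) * a" using by' by simp
  then have "b * om a = om a * b * om a" by (simp add: E c mult.assoc)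
  with e1 have Eb: "om a * b = b * om a" by simp
  have "y * b = y * om a * b" unfolding y_def by (simp add: br_om)
  also have "\<dots> = y * (b * om a)" by (simp only: mult.assoc Eb)
  also have "\<dots> = y * (b * a) * y" by (simp add: E mult.assoc)
  also have "\<dots> = (y * a) * b * y" by (simp add: ab[symmetric] mult.assoc)
  also have "\<dots> = om a * b * y" by (simp add: E c)
  also have "\<dots> = b * (om a * y)" by (simp add: Eb mult.assoc)
  also have "\<dots> = b * y" by (simp add: br_om y_def)
  finally show ?thesis by (simp add: y_def)
qed

lemma commutes_br_br: "a * b = b * a \<Longrightarrow> br a * br b = br b * br a"
  by (metis commutes_br)

lemma br_mult:
  assumes ab: "a * b = b * a" shows "br (a * b) = br a * br b"
proof -
  have c1: "br a * b = b * br a" and c2: "br b * a = a * br b"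
    and c3: "br a * br b = br b * br a"
    using ab commutes_br[of a b] commutes_br[of b a] commutes_br_br[of a b] by simp_all
  have p1: "a * b * (br a * br b) = br a * br b * (a * b)"
    by (metis ab br_commutes c1 c2 mult.assoc)
  have p2: "a * b * (br a * br b) * (br a * br b) = br a * br b"
  proof -
    have "a * b * (br a * br b) * (br a * br b) = (a * br a * br a) * (b * br b * br b)"
      by (metis c1 c3 mult.assoc)
    then show ?thesis by (simp add: br_inner)
  qed
  obtain n where n: "a ^ (n + 1) * br a = a ^ n" using br_index by blast
  obtain m where m: "b ^ (m + 1) * br b = b ^ m" using br_index by blast
  have n': "a ^ (n + m + 1) * br a = a ^ (n + m)" by (rule power_index_mono[OF n]) simp
  have m': "b ^ (n + m + 1) * br b = b ^ (n + m)" by (rule power_index_mono[OF m]) simp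
  have p: "(a * b) ^ k = a ^ k * b ^ k" for k
  proof (induction k)
    case (Suc k)
    have "(a * b) ^ Suc k = a * (b * a ^ k) * b ^ k" using Suc by (simp add: mult.assoc)
    also have "b * a ^ k = a ^ k * b" using power_commuting_commutes[OF ab, of k] by simp
    finally show ?case by (simp add: mult.assoc)
  qed simp
  have "b ^ (n + m + 1) * br a = br a * b ^ (n + m + 1)"
    by (rule power_commuting_commutes) (simp add: c1)
  then have "(a * b) ^ (n + m + 1) * (br a * br b) = (a * b) ^ (n + m)"
    unfolding p using n' m' by (metis mult.assoc)
  with p1 p2 show ?thesis by (intro br_unique[symmetric])
qed

subsection \<open>Integral powers in the group part\<close>

text \<open>\<open>gp f j\<close> is \<open>f\<^sup>\<omega>\<^sup>+\<^sup>j\<close>, the \<open>j\<close>-th power of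
  \<open>f f\<^sup>\<omega>\<close> in its maximal subgroup. Both factors have a positive exponent, so that the unit
  of that subgroup is always present.\<close>

definition gp :: "'a \<Rightarrow> int \<Rightarrow> 'a" where
  "gp f j = f ^ Suc (nat j) * br f ^ Suc (nat (- j))"

lemma gp_cancel: "f ^ Suc (a + c) * br f ^ Suc (b + c) = f ^ Suc a * br f ^ Suc b"
proof (induction c)
  case (Suc c)
  have l: "f ^ Suc (a + Suc c) = f ^ Suc (a + c) * f"
    by (simp only: add_Suc_right power_Suc2[of f "Suc (a + c)"])
  have r: "br f ^ Suc (b + Suc c) = br f * (br f * br f ^ (b + c))" by simp
  have "f ^ Suc (a + Suc c) * br f ^ Suc (b + Suc c)
      = f ^ Suc (a + c) * ((f * br f * br f) * br f ^ (b + c))"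
    by (simp only: l r mult.assoc)
  also have "\<dots> = f ^ Suc (a + c) * br f ^ Suc (b + c)" by (simp only: br_inner power_Suc)
  finally show ?case using Suc by simp
qed simp

lemma gp_eq: "f ^ Suc a * br f ^ Suc b = gp f (int a - int b)"
proof (cases "a \<le> b")
  case True
  then show ?thesis using gp_cancel[of f 0 a "b - a"] by (simp add: gp_def nat_diff_distrib)
next
  case False
  then show ?thesis using gp_cancel[of f "a - b" b 0] by (simp add: gp_def nat_diff_distrib)
qed

lemma gp_mult: "gp f i * gp f j = gp f (i + j)"
proof -
  have c: "br f ^ m * f ^ n = f ^ n * br f ^ m" for m n
    by (rule power_commuting_commutes, rule power_commuting_commutes[symmetric], rule br_commutes)
  have "gp f i * gp f j = f ^ Suc (nat i) * (br f ^ Suc (nat (- i)) * f ^ Suc (nat j)) * br f ^ Suc (nat (- j))"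
    by (simp only: gp_def mult.assoc)
  also have "\<dots> = f ^ (Suc (nat i) + Suc (nat j)) * br f ^ (Suc (nat (- i)) + Suc (nat (- j)))"
    by (simp only: c power_add mult.assoc)
  also have "\<dots> = gp f (int (Suc (nat i + nat j)) - int (Suc (nat (- i) + nat (- j))))"
    using gp_eq[of f "Suc (nat i + nat j)" "Suc (nat (- i) + nat (- j))"] by simp
  also have "int (Suc (nat i + nat j)) - int (Suc (nat (- i) + nat (- j))) = i + j" by simp
  finally show ?thesis .
qed

lemma gp_0: "gp f 0 = om f"
  by (simp add: gp_def om_def)

lemma gp_neg_1: "gp f (- 1) = br f"
  using br_inner[of f] by (simp add: gp_def mult.assoc)

lemma power_gp: "f ^ m * gp f j = gp f (int m + j)"
proof -
  have "f ^ m * gp f j = f ^ Suc (m + nat j) * br f ^ Suc (nat (- j))"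
    by (simp only: gp_def mult.assoc[symmetric] power_add[symmetric] add_Suc_right)
  also have "\<dots> = gp f (int m + j)" by (simp only: gp_eq) simp
  finally show ?thesis .
qed

lemma commutes_power: "x * f = f * x \<Longrightarrow> x * f ^ m = f ^ m * x"
  using power_commuting_commutes[of f x m] by simp

lemma commutes_mult: "x * f = f * x \<Longrightarrow> x * g = g * x \<Longrightarrow> x * (f * g) = f * g * x"
  by (metis mult.assoc)

lemma commutes_gp: "x * f = f * x \<Longrightarrow> x * gp f j = gp f j * x"
  unfolding gp_def by (intro commutes_mult commutes_power) (metis commutes_br)+

lemma gp_power: "gp f j * f ^ m = gp f (int m + j)"
  using commutes_power[OF commutes_gp[of f f j, symmetric], of m] by (simp add: power_gp)

lemma br_gp: "br (gp f j) = gp f (- j)"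
  by (rule br_unique[symmetric, where k = 1]) (simp_all add: gp_mult)

lemma br_power: "br (f ^ Suc m) = gp f (- int (Suc m))"
proof -
  obtain n where n: "\<And>k. k \<ge> n \<Longrightarrow> f ^ k * om f = f ^ k" using power_om by blast
  have "(f ^ Suc m) ^ (n + 1) * gp f (- int (Suc m)) = (f ^ Suc m) ^ n * (f ^ Suc m * gp f (- int (Suc m)))"
    by (simp only: Suc_eq_plus1[symmetric] power_Suc2 mult.assoc)
  also have "\<dots> = f ^ (Suc m * n) * om f"
    by (simp only: power_gp gp_0 right_minus power_mult)
  also have "\<dots> = f ^ (Suc m * n)" by (rule n) simp
  also have "\<dots> = (f ^ Suc m) ^ n" by (rule power_mult)
  finally show ?thesis
    by (intro br_unique[symmetric, where k = n])
      (simp_all only: power_gp gp_power gp_mult right_minus add_0_left)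
qed

subsection \<open>Values of terms at commuting elements\<close>

primrec ev :: "(nat \<Rightarrow> 'a) \<Rightarrow> uterm \<Rightarrow> 'a" where
  "ev \<rho> (Var i) = \<rho> i"
| "ev \<rho> (Mul s t) = ev \<rho> s * ev \<rho> t"
| "ev \<rho> (Bar t) = br (ev \<rho> t)"

end

text \<open>The number of occurrences of a letter, infinite as soon as one of them lies under a bar, and the exponent
  of the letter in the free abelian group. These are the two invariants that govern the values of terms at commuting
  elements.\<close>

primrec occ :: "nat \<Rightarrow> uterm \<Rightarrow> enat" where
  "occ y (Var i) = (if i = y then 1 else 0)"
| "occ y (Mul s t) = occ y s + occ y t"
| "occ y (Bar t) = (if occ y t = 0 then 0 else \<infinity>)"

primrec ex :: "nat \<Rightarrow> uterm \<Rightarrow> int" where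
  "ex y (Var i) = (if i = y then 1 else 0)"
| "ex y (Mul s t) = ex y s + ex y t"
| "ex y (Bar t) = - ex y t"

lemma ex_occ: "occ y t = enat m \<Longrightarrow> ex y t = int m"
proof (induction t arbitrary: m)
  case (Mul s t)
  then show ?case by (cases "occ y s"; cases "occ y t") auto
qed (auto simp: zero_enat_def one_enat_def split: if_splits)

context epi_monoid
begin

text \<open>The contribution of a letter with value \<open>f\<close>, \<open>k\<close> occurrences and exponent
  \<open>j\<close> to the value of a term: an ordinary power if all occurrences are free of bars, and otherwise an
  element of the group part.\<close>

definition part :: "'a \<Rightarrow> enat \<Rightarrow> int \<Rightarrow> 'a" where
  "part f k j = (case k of enat m \<Rightarrow> f ^ m | \<infinity> \<Rightarrow> gp f j)"

lemma part_0 [simp]: "part f 0 j = 1"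
  by (simp add: part_def zero_enat_def)

lemma commutes_part: "x * f = f * x \<Longrightarrow> x * part f k j = part f k j * x"
  by (cases k) (simp_all add: part_def commutes_power commutes_gp)

lemma part_commutes_part: "f * g = g * f \<Longrightarrow> part f k j * part g k' j' = part g k' j' * part f k j"
  by (intro commutes_part commutes_part[symmetric])

lemma part_mult: "part f (occ y s + occ y t) (ex y s + ex y t) = part f (occ y s) (ex y s) * part f (occ y t) (ex y t)"
proof (cases "occ y s")
  case (enat m)
  then show ?thesis
    using ex_occ[OF enat] by (cases "occ y t") (simp_all add: part_def power_add power_gp)
next
  case infinity
  then show ?thesis
    using ex_occ[of y t] by (cases "occ y t") (simp_all add: part_def gp_mult gp_power add.commute)
qed

lemma part_br: "part f (occ y (Bar t)) (ex y (Bar t)) = br (part f (occ y t) (ex y t))"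
proof (cases "occ y t")
  case (enat m)
  then show ?thesis
    using ex_occ[OF enat] by (cases m) (simp_all add: part_def br_power zero_enat_def del: power_Suc)
qed (simp add: part_def br_gp)

text \<open>The product \<open>f 0 \<cdots> f (n - 1)\<close>; the factors will commute only in the
  applications.\<close>

primrec pr :: "(nat \<Rightarrow> 'a) \<Rightarrow> nat \<Rightarrow> 'a" where
  "pr f 0 = 1"
| "pr f (Suc n) = pr f n * f n"

lemma pr_cong: "(\<And>i. i < n \<Longrightarrow> f i = g i) \<Longrightarrow> pr f n = pr g n"
  by (induction n) auto

lemma commutes_pr: "(\<And>i. x * f i = f i * x) \<Longrightarrow> x * pr f n = pr f n * x"
  by (induction n) (auto intro: commutes_mult)

lemma pr_mult:
  assumes "\<And>i j. f i * g j = g j * f i"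
  shows "pr (\<lambda>i. f i * g i) n = pr f n * pr g n"
proof (induction n)
  case (Suc n)
  have "f n * pr g n = pr g n * f n" using assms by (rule commutes_pr)
  with Suc show ?case by simp (metis mult.assoc)
qed simp

lemma pr_br:
  assumes "\<And>i j. f i * f j = f j * f i"
  shows "pr (\<lambda>i. br (f i)) n = br (pr f n)"
proof (induction n)
  case (Suc n)
  have "f n * pr f n = pr f n * f n" using assms by (rule commutes_pr)
  with Suc show ?case by (simp add: br_mult)
qed simp

lemma pr_delta: "j < n \<Longrightarrow> pr (\<lambda>i. if j = i then a else 1) n = a"
proof (induction n)
  case (Suc n)
  have "pr (\<lambda>i. if n = i then a else 1) n = pr (\<lambda>i. 1) n" by (rule pr_cong) auto
  also have "pr (\<lambda>i. 1) n = 1" by (induction n) auto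
  finally show ?case using Suc by (cases "j = n") auto
qed simp

text \<open>At commuting values a term is the product of the contributions of its letters, because pseudoinversion is
  multiplicative on commuting elements.\<close>

lemma ev_commuting:
  assumes c: "\<And>i j. \<rho> i * \<rho> j = \<rho> j * \<rho> i" and n: "\<And>i. n \<le> i \<Longrightarrow> occ i t = 0"
  shows "ev \<rho> t = pr (\<lambda>i. part (\<rho> i) (occ i t) (ex i t)) n"
  using n
proof (induction t)
  case (Var k)
  then have "k < n" by (metis not_le occ.simps(1) zero_neq_one)
  moreover have "(\<lambda>i. part (\<rho> i) (occ i (Var k)) (ex i (Var k))) = (\<lambda>i. if k = i then \<rho> k else 1)"
    by (auto simp: part_def one_enat_def zero_enat_def)
  ultimately show ?case by (simp only: pr_delta ev.simps)
next
  case (Mul s t)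
  have "ev \<rho> s = pr (\<lambda>i. part (\<rho> i) (occ i s) (ex i s)) n" "ev \<rho> t = pr (\<lambda>i. part (\<rho> i) (occ i t) (ex i t)) n"
    using Mul by (simp_all add: add_eq_0_iff_both_eq_0)
  then show ?case by (simp add: part_mult pr_mult part_commutes_part c)
next
  case (Bar t)
  have "ev \<rho> t = pr (\<lambda>i. part (\<rho> i) (occ i t) (ex i t)) n"
  proof (rule Bar.IH)
    show "occ i t = 0" if "n \<le> i" for i using Bar.prems[OF that] by (simp split: if_splits)
  qed
  then show ?case by (simp only: ev.simps part_br pr_br part_commutes_part c)
qed

lemma commutes_ev: "(\<And>i. x * \<rho> i = \<rho> i * x) \<Longrightarrow> x * ev \<rho> t = ev \<rho> t * x"
  by (induction t) (auto intro: commutes_mult commutes_br[symmetric])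

lemma ev_absorb:
  assumes e: "e * e = e" and c: "\<And>i. e * \<rho> i = \<rho> i * e"
  shows "ev (\<lambda>i. e * \<rho> i) t = e * ev \<rho> t"
proof (induction t)
  case (Mul s t)
  have "e * ev \<rho> s * (e * ev \<rho> t) = e * (ev \<rho> s * e) * ev \<rho> t" by (simp only: mult.assoc)
  also have "ev \<rho> s * e = e * ev \<rho> s" using c by (rule commutes_ev[symmetric])
  also have "e * (e * ev \<rho> s) * ev \<rho> t = e * (ev \<rho> s * ev \<rho> t)" by (simp only: mult.assoc[symmetric] e)
  finally show ?case by (simp only: ev.simps Mul.IH)
next
  case (Bar t)
  have "e * ev \<rho> t = ev \<rho> t * e" using c by (rule commutes_ev)
  then have "br (e * ev \<rho> t) = br e * br (ev \<rho> t)" by (rule br_mult)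
  then show ?case by (simp only: ev.simps Bar.IH br_idem[OF e])
qed simp

lemma occ_bound: "\<exists>n. \<forall>i\<ge>n. occ i t = 0"
proof (induction t)
  case (Var j)
  show ?case by (rule exI[of _ "Suc j"]) auto
next
  case (Mul s t)
  then obtain m n where "\<forall>i\<ge>m. occ i s = 0" "\<forall>i\<ge>n. occ i t = 0" by blast
  then show ?case by (intro exI[of _ "max m n"]) simp
qed auto

text \<open>Evaluating all letters but \<open>y\<close> at a local unit isolates the contribution of
  \<open>y\<close>.\<close>

lemma ev_single:
  assumes e: "e * e = e" and f: "e * f = f" "f * e = f"
  shows "ev (\<lambda>i. if i = y then f else e) t = e * part f (occ y t) (ex y t)"
proof -
  let ?\<rho> = "\<lambda>i. if i = y then f else e"
  obtain n where n: "\<And>i. n \<le> i \<Longrightarrow> occ i t = 0" using occ_bound by blast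
  have c: "?\<rho> i * ?\<rho> j = ?\<rho> j * ?\<rho> i" for i j using f by simp
  have "e * ?\<rho> i = ?\<rho> i" for i using e f by simp
  moreover have "e * ?\<rho> i = ?\<rho> i * e" for i using e f by simp
  ultimately have absorb: "ev ?\<rho> t = e * ev ?\<rho> t" using ev_absorb[OF e, of ?\<rho> t] by simp
  have "e * ev ?\<rho> t = e * pr (\<lambda>i. part (?\<rho> i) (occ i t) (ex i t)) n"
    using ev_commuting[of ?\<rho> n t, OF c n] by (rule arg_cong)
  also have "e * pr (\<lambda>i. part (?\<rho> i) (occ i t) (ex i t)) m
      = e * (if y < m then part f (occ y t) (ex y t) else 1)" for m
  proof (induction m)
    case (Suc m)
    have gpe: "gp e j = e" for j
    proof -
      have "e ^ Suc k = e" for k by (induction k) (simp_all add: e)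
      then show ?thesis by (simp only: gp_def br_idem[OF e] e)
    qed
    have pe: "e * part e k j = e" for k j
    proof (cases k)
      case (enat p)
      have "e * e ^ p = e" by (induction p) (simp_all add: e mult.assoc[symmetric])
      then show ?thesis by (simp add: enat part_def)
    qed (simp add: part_def gpe e)
    have ec: "e * part f k j = part f k j * e" for k j by (rule commutes_part) (simp add: f)
    show ?case
    proof (cases "m = y")
      case True
      then show ?thesis using Suc by (simp add: mult.assoc[symmetric])
    next
      case False
      have "e * pr (\<lambda>i. part (?\<rho> i) (occ i t) (ex i t)) (Suc m)
          = e * (if y < m then part f (occ y t) (ex y t) else 1) * part e (occ m t) (ex m t)"
        using Suc False by (simp add: mult.assoc[symmetric])
      also have "\<dots> = (if y < m then part f (occ y t) (ex y t) else 1) * (e * part e (occ m t) (ex m t))"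
        by (cases "y < m") (simp_all add: ec mult.assoc)
      also have "\<dots> = e * (if y < m then part f (occ y t) (ex y t) else 1)" using ec by (simp add: pe)
      finally show ?thesis using False by (simp add: less_Suc_eq)
    qed
  qed simp
  also have "(if y < n then part f (occ y t) (ex y t) else 1) = part f (occ y t) (ex y t)"
    using n[of y] by (simp add: not_less)
  finally show ?thesis using absorb by simp
qed

end

section \<open>Linear words in periodic theories\<close>

abbreviation sub :: "('a \<Rightarrow> 'b list) \<Rightarrow> 'a list \<Rightarrow> 'b list" where
  "sub \<phi> a \<equiv> concat (map \<phi> a)"

abbreviation pw :: "'a list \<Rightarrow> nat \<Rightarrow> 'a list" where
  "pw t k \<equiv> concat (replicate k t)"

lemma pw_Suc_right: "pw t (Suc k) = pw t k @ t"
  by (induction k) auto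

lemma pw_add: "pw t (j + k) = pw t j @ pw t k"
  by (simp add: replicate_add)

lemma sub_singleton: "sub (\<lambda>x. [\<sigma> x]) a = map \<sigma> a"
  by (induction a) auto

lemma sub_id: "(\<And>x. x \<in> set a \<Longrightarrow> \<phi> x = [x]) \<Longrightarrow> sub \<phi> a = a"
  by (induction a) auto

lemma sub_const: "(\<And>x. x \<in> set a \<Longrightarrow> \<phi> x = g) \<Longrightarrow> sub \<phi> a = pw g (length a)"
  by (induction a) auto

lemma sub_cong: "(\<And>x. x \<in> set a \<Longrightarrow> \<phi> x = \<psi> x) \<Longrightarrow> sub \<phi> a = sub \<psi> a"
  by (induction a) auto

lemma length_sub: "(\<And>x. \<phi> x \<noteq> []) \<Longrightarrow> length a \<le> length (sub \<phi> a)"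
proof (induction a)
  case (Cons x a)
  then have "length (\<phi> x) \<ge> 1" by (simp add: Suc_le_eq)
  with Cons show ?case by fastforce
qed simp

lemma rev_sub: "rev (sub \<phi> a) = sub (\<lambda>x. rev (\<phi> x)) (rev a)"
  by (induction a) auto

lemma ex_letter_map:
  assumes "distinct v" "length f = length v"
  shows "\<exists>\<sigma>. map \<sigma> v = f"
  using assms
proof (induction v arbitrary: f)
  case (Cons a v)
  then obtain b f' where f: "f = b # f'" by (cases f) auto
  with Cons obtain \<sigma> where "map \<sigma> v = f'" by auto
  then have "map (\<sigma>(a := b)) (a # v) = f" using Cons(2) f by auto
  then show ?case by blast
qed simp

text \<open>A word that is at least as long as the linear word \<open>v\<close> can be cut into blocks, one for each
  letter of \<open>v\<close>.\<close>

lemma ex_block_map: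
  assumes "distinct v" "v \<noteq> []" "length v \<le> length f"
  shows "\<exists>\<phi>. (\<forall>x. \<phi> x \<noteq> []) \<and> sub \<phi> v = f"
  using assms
proof (induction v arbitrary: f)
  case (Cons a v)
  show ?case
  proof (cases "v = []")
    case True
    with Cons show ?thesis by (intro exI[of _ "\<lambda>_. f"]) auto
  next
    case False
    from Cons obtain b f' where f: "f = b # f'" by (cases f) auto
    with Cons False obtain \<phi> where p: "\<forall>x. \<phi> x \<noteq> []" "sub \<phi> v = f'" by auto
    define \<psi> where "\<psi> = \<phi>(a := [b])"
    have "sub \<psi> v = sub \<phi> v" by (rule sub_cong) (use Cons(2) in \<open>auto simp: \<psi>_def\<close>)
    then have "sub \<psi> (a # v) = f" using p f by (simp add: \<psi>_def)
    moreover have "\<psi> x \<noteq> []" for x using p by (simp add: \<psi>_def)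
    ultimately show ?thesis by blast
  qed
qed simp

lemma ex_common_prefix:
  "length u \<le> length w \<Longrightarrow>
   \<exists>r\<le>length u. take r u = take r w \<and> (r < length u \<longrightarrow> u ! r \<noteq> w ! r)"
proof (induction u arbitrary: w)
  case (Cons a u)
  then obtain b w' where w: "w = b # w'" by (cases w) auto
  show ?case
  proof (cases "a = b")
    case True
    from Cons w obtain r where "r \<le> length u" "take r u = take r w'" "r < length u \<longrightarrow> u ! r \<noteq> w' ! r"
      by auto
    then show ?thesis using True w by (intro exI[of _ "Suc r"]) auto
  qed (use w in \<open>auto intro: exI[of _ 0]\<close>)
qed simp

lemma count_list_distinct: "distinct u \<Longrightarrow> count_list u x \<le> 1"
  by (induction u) auto

lemma take_append_cong: "take r x = take r y \<Longrightarrow> take r (a @ x) = take r (a @ y)"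
  by (metis min.cobounded2 min_def take_append take_take diff_le_self)

text \<open>A fully invariant congruence on words that preserves contents and satisfies \<open>t\<^sup>n =
  t\<^sup>n\<^sup>+\<^sup>g\<close>, together with an identity \<open>u = w\<close> that makes a linear word
  \<open>u\<close> longer. The aim is a factorization of \<open>u\<close> in which every letter either occurs exactly
  once or lies in a part that absorbs an idempotent whose local monoid has these letters as units. The empty word is
  only a notational convenience; substitutions must not erase letters.\<close>

locale word_congruence =
  fixes R :: "'a list \<Rightarrow> 'a list \<Rightarrow> bool" (infix \<open>\<approx>\<close> 50)
    and u w :: "'a list" and n g :: nat
  assumes refl: "a \<approx> a" and sym: "a \<approx> b \<Longrightarrow> b \<approx> a"
    and trans [trans]: "a \<approx> b \<Longrightarrow> b \<approx> c \<Longrightarrow> a \<approx> c"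
    and app: "a \<approx> b \<Longrightarrow> c \<approx> d \<Longrightarrow> a @ c \<approx> b @ d"
    and sub: "(\<And>x. \<phi> x \<noteq> []) \<Longrightarrow> a \<approx> b \<Longrightarrow> sub \<phi> a \<approx> sub \<phi> b"
    and content: "a \<approx> b \<Longrightarrow> set a = set b"
    and periodic: "t \<noteq> [] \<Longrightarrow> pw t n \<approx> pw t (n + g)" and n: "1 \<le> n" and g: "1 \<le> g"
    and uw: "u \<approx> w" and dist: "distinct u" and longer: "length u < length w"
begin

lemma eq_trans1 [trans]: "a = b \<Longrightarrow> b \<approx> c \<Longrightarrow> a \<approx> c" by simp
lemma eq_trans2 [trans]: "a \<approx> b \<Longrightarrow> b = c \<Longrightarrow> a \<approx> c" by simp

lemma appl: "a \<approx> b \<Longrightarrow> x @ a \<approx> x @ b"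
  by (intro app refl)

lemma appr: "a \<approx> b \<Longrightarrow> a @ x \<approx> b @ x"
  by (intro app refl)

lemma ctx: "a \<approx> b \<Longrightarrow> x @ a @ y \<approx> x @ b @ y"
  by (intro app refl)

text \<open>The hypotheses are symmetric under reversal, so statements about prefixes give statements about
  suffixes.\<close>

lemma dual: "word_congruence (\<lambda>a b. rev a \<approx> rev b) (rev u) (rev w) n g"
proof
  show "rev (sub \<phi> a) \<approx> rev (sub \<phi> b)" if "\<And>x. \<phi> x \<noteq> []" "rev a \<approx> rev b" for \<phi> a b
    using that unfolding rev_sub by (intro sub) auto
  show "rev (pw t n) \<approx> rev (pw t (n + g))" if "t \<noteq> []" for t
    using periodic[of "rev t"] that by (simp add: rev_concat)
  show "rev a \<approx> rev c" if "rev a \<approx> rev b" "rev b \<approx> rev c" for a b c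
    using that by (rule trans)
  show "rev (a @ c) \<approx> rev (b @ d)" if "rev a \<approx> rev b" "rev c \<approx> rev d" for a b c d
    using app[OF that(2,1)] by simp
  show "set a = set b" if "rev a \<approx> rev b" for a b using content[OF that] by simp
qed (use refl sym n g uw dist longer in auto)

lemma content_w: "set w = set u"
  using content[OF uw] by simp

definition idem :: "'a list \<Rightarrow> bool" where "idem e \<longleftrightarrow> e \<noteq> [] \<and> e @ e \<approx> e"

lemma idemD: "idem e \<Longrightarrow> e @ e \<approx> e" "idem e \<Longrightarrow> e \<noteq> []"
  by (auto simp: idem_def)

lemma periodic_mult: "t \<noteq> [] \<Longrightarrow> n \<le> m \<Longrightarrow> pw t m \<approx> pw t (m + j * g)"
proof (induction j)
  case (Suc j)
  have "pw t (m + j * g) = pw t n @ pw t (m + j * g - n)"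
    using Suc by (simp add: pw_add[symmetric])
  also have "\<dots> \<approx> pw t (n + g) @ pw t (m + j * g - n)" by (rule appr[OF periodic[OF Suc(2)]])
  also have "\<dots> = pw t (m + Suc j * g)"
  proof -
    have "n + g + (m + j * g - n) = m + Suc j * g" using Suc(3) by simp
    then show ?thesis by (simp only: pw_add[symmetric])
  qed
  finally show ?case using Suc by (blast intro: trans)
qed (simp add: refl)

lemma ex_idem_power:
  assumes "t \<noteq> []" obtains N where "2 \<le> N" "idem (pw t N)"
proof
  have "n * 1 \<le> n * (2 * g)" by (rule mult_le_mono2) (use g in simp)
  then have le: "n \<le> 2 * (n * g)" by simp
  show "2 \<le> 2 * (n * g)" using n g by simp
  then obtain m where m: "2 * (n * g) = Suc m" by (cases "2 * (n * g)") auto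
  have "pw t (2 * (n * g)) \<approx> pw t (2 * (n * g) + 2 * n * g)"
    using periodic_mult[OF assms le, of "2 * n"] by simp
  also have "pw t (2 * (n * g) + 2 * n * g) = pw t (2 * (n * g)) @ pw t (2 * (n * g))"
    by (simp add: pw_add[symmetric] mult.assoc)
  finally have "pw t (2 * (n * g)) @ pw t (2 * (n * g)) \<approx> pw t (2 * (n * g))" by (rule sym)
  moreover have "pw t (2 * (n * g)) \<noteq> []" unfolding m using assms by simp
  ultimately show "idem (pw t (2 * (n * g)))" by (simp add: idem_def)
qed

lemma idem_pw: "idem e \<Longrightarrow> pw e j @ e \<approx> e"
proof (induction j)
  case (Suc j)
  have "pw e (Suc j) @ e = e @ (pw e j @ e)" by simp
  also have "\<dots> \<approx> e @ e" by (rule appl) (use Suc in simp)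
  also have "\<dots> \<approx> e" by (rule idemD) (use Suc in simp)
  finally show ?case .
qed (simp add: refl)

lemma absorb_power:
  assumes "c \<approx> x @ c @ y" shows "c \<approx> pw x m @ c @ pw y m"
proof (induction m)
  case (Suc m)
  have "pw x m @ c @ pw y m \<approx> pw x m @ (x @ c @ y) @ pw y m" by (rule ctx[OF assms])
  also have "\<dots> = pw x (Suc m) @ c @ pw y (Suc m)" by (simp only: pw_Suc_right[where t = x]) simp
  finally show ?case using Suc by (blast intro: trans)
qed (simp add: refl)

subsection \<open>Local units\<close>

text \<open>If \<open>q = x y\<close> and \<open>x\<close> already lies in the local monoid at \<open>q\<close> on the
  right, then \<open>q = x\<^sup>N y\<^sup>N\<close>. For an idempotent power of \<open>x\<close> this gives
  \<open>x\<^sup>N = x\<^sup>N q = x\<^sup>N x\<^sup>N y\<^sup>N = q\<close>.\<close>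

lemma left_factor_unit:
  assumes q: "q @ q \<approx> q" and xy: "q \<approx> x @ y" and xq: "x @ q \<approx> x" and x: "x \<noteq> []"
  obtains N where "2 \<le> N" "pw x N \<approx> q"
proof -
  obtain N where N: "2 \<le> N" "idem (pw x N)" by (rule ex_idem_power[OF x])
  have p: "q \<approx> pw x (Suc m) @ pw y (Suc m)" for m
  proof (induction m)
    case (Suc m)
    have "q \<approx> x @ y" by (rule xy)
    also have "\<dots> \<approx> (x @ q) @ y" by (rule appr[OF sym[OF xq]])
    also have "\<dots> = x @ q @ y" by simp
    also have "\<dots> \<approx> x @ (pw x (Suc m) @ pw y (Suc m)) @ y" by (rule ctx[OF Suc])
    also have "\<dots> = pw x (Suc (Suc m)) @ pw y (Suc (Suc m))"
      by (simp only: pw_Suc_right[of "Suc m" y]) simp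
    finally show ?case .
  qed (use xy in simp)
  have pN: "q \<approx> pw x N @ pw y N" using p[of "N - 1"] N(1) by simp
  have "pw x N = pw x (N - 1) @ x" using N(1) pw_Suc_right[of "N - 1" x] by simp
  then have "pw x N \<approx> pw x N @ q" using appl[OF sym[OF xq], of "pw x (N - 1)"] by simp
  also have "\<dots> \<approx> pw x N @ pw x N @ pw y N" by (rule appl[OF pN])
  also have "\<dots> = (pw x N @ pw x N) @ pw y N" by simp
  also have "\<dots> \<approx> pw x N @ pw y N" by (rule appr[OF idemD(1)[OF N(2)]])
  also have "\<dots> \<approx> q" by (rule sym[OF pN])
  finally show ?thesis using that N by blast
qed

text \<open>A factor of \<open>q\<close> in the local monoid is a unit there: the left factor \<open>x\<close> is a
  unit by the previous lemma, and after cancelling it \<open>z\<close> becomes the leftmost factor.\<close>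

lemma factor_unit:
  assumes q: "q @ q \<approx> q" and e: "q \<approx> x @ z @ y"
    and x: "x @ q \<approx> x" "x \<noteq> []" and z: "q @ z \<approx> z" "z @ q \<approx> z" "z \<noteq> []"
  obtains N where "2 \<le> N" "pw z N \<approx> q"
proof -
  obtain N where N: "2 \<le> N" "pw x N \<approx> q" by (rule left_factor_unit[OF q e x])
  have pN: "pw x N = pw x (N - 1) @ x" using N(1) pw_Suc_right[of "N - 1" x] by simp
  have pN1: "pw x (N - 1) = pw x (N - 2) @ x"
    using N(1) pw_Suc_right[of "N - 2" x] by (simp add: Suc_diff_Suc numeral_2_eq_2)
  have "z @ y \<approx> q @ z @ y" using appr[OF sym[OF z(1)], of y] by simp
  also have "\<dots> \<approx> pw x N @ z @ y" by (rule appr[OF sym[OF N(2)]])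
  also have "\<dots> = pw x (N - 1) @ x @ z @ y" by (simp add: pN)
  also have "\<dots> \<approx> pw x (N - 1) @ q" by (rule appl[OF sym[OF e]])
  also have "\<dots> \<approx> pw x (N - 1)" unfolding pN1 using appl[OF x(1)] by simp
  finally have "(z @ y) @ x \<approx> pw x (N - 1) @ x" by (rule appr)
  also have "\<dots> \<approx> q" using N(2) pN by simp
  finally have "q \<approx> (z @ y) @ x" by (rule sym)
  then have "q \<approx> z @ y @ x" by simp
  from left_factor_unit[OF q this z(2,3)] that show ?thesis by blast
qed

text \<open>The letters of \<open>u\<close> are the steps of a path. As \<open>w\<close> is longer than
  \<open>u\<close>, it contains two adjacent letters that are not consecutive on this path.\<close>

lemma bad_adjacency:
  obtains w1 w2 i j where "w = w1 @ [u ! i, u ! j] @ w2" "i < length u" "j < length u" "j \<noteq> Suc i"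
proof -
  have "\<exists>m i j. Suc m < length w \<and> i < length u \<and> j < length u \<and> w ! m = u ! i \<and> w ! Suc m = u ! j \<and> j \<noteq> Suc i"
  proof (rule ccontr)
    assume c: "\<not> ?thesis"
    have idx: "\<exists>i<length u. w ! m = u ! i" if "m < length w" for m
      using that content_w by (metis in_set_conv_nth)
    obtain i0 where i0: "i0 < length u" "w ! 0 = u ! i0" using idx[of 0] longer by (metis gr_zeroI not_less_zero)
    have "m < length w \<Longrightarrow> i0 + m < length u \<and> w ! m = u ! (i0 + m)" for m
    proof (induction m)
      case (Suc m)
      then obtain j where "j < length u" "w ! Suc m = u ! j" using idx by blast
      with Suc c show ?case by (metis Suc_lessD add_Suc_right)
    qed (use i0 in simp)
    from this[of "length u"] longer show False by simp
  qed
  then obtain m i j where m: "Suc m < length w" "i < length u" "j < length u"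
    "w ! m = u ! i" "w ! Suc m = u ! j" "j \<noteq> Suc i" by blast
  have "w = take m w @ [w ! m, w ! Suc m] @ drop (Suc (Suc m)) w"
    using m(1) by (simp add: Cons_nth_drop_Suc)
  then show ?thesis using that m by metis
qed

text \<open>Suppose that \<open>q = r l\<close>. For a set \<open>v\<close> of positions let a boundary between
  letters of \<open>u\<close> be split as \<open>r l\<close> at the positions in \<open>v\<close> and as \<open>q
  q\<close> at the others. Sending the \<open>m\<close>-th letter of \<open>u\<close> to the second half of the
  boundary before it followed by the first half of the boundary after it makes all interior boundaries of
  \<open>u\<close> collapse to \<open>q\<close>. The same map applied to \<open>w\<close> joins halves of the two
  different boundaries \<open>Suc i\<close> and \<open>j\<close>, so that this mixed product divides \<open>q\<close>
  and is a unit. If only one of these two boundaries is split, then the mixed product is \<open>r q\<close> or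
  \<open>q l\<close>.\<close>

lemma local_unit:
  assumes q: "idem q" and rl: "r @ l \<approx> q" and qr: "q @ r \<approx> r" and lq: "l @ q \<approx> l"
    and ne: "r \<noteq> []" "l \<noteq> []"
  shows "(\<exists>N\<ge>2. pw (r @ q) N \<approx> q) \<and> (\<exists>N\<ge>2. pw (q @ l) N \<approx> q)"
proof -
  obtain w1 w2 i j where w: "w = w1 @ [u ! i, u ! j] @ w2" "i < length u" "j < length u" "j \<noteq> Suc i"
    by (rule bad_adjacency)
  note qq = idemD(1)[OF q]
  have key: "\<exists>N\<ge>2. pw ((if v (Suc i) then r else q) @ (if v j then l else q)) N \<approx> q" for v :: "nat \<Rightarrow> bool"
  proof -
    \<comment> \<open>The \<open>m\<close>-th letter of \<open>u\<close> stands between the boundaries \<open>m\<close> and \<open>Suc m\<close>; \<open>P m\<close> and \<open>L m\<close> are the halves of boundary \<open>m\<close>.\<close>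
    define L where "L = (\<lambda>m. if v m then l else q)"
    define P where "P = (\<lambda>m. if v m then r else q)"
    have Lq: "L m @ q \<approx> L m" and qP: "q @ P m \<approx> P m" and PL: "P m @ L m \<approx> q"
      and ne: "L m \<noteq> []" "P m \<noteq> []" for m
      using lq qr rl qq idemD(2)[OF q] ne by (auto simp: L_def P_def)
    obtain \<sigma> where "map \<sigma> u = [0..<length u]"
      using ex_letter_map[OF dist, of "[0..<length u]"] by auto
    then have \<sigma>: "\<sigma> (u ! m) = m" if "m < length u" for m using that
      by (metis nth_map nth_upt add_0 diff_zero)
    define \<phi> where "\<phi> = (\<lambda>x. L (\<sigma> x) @ P (Suc (\<sigma> x)))"
    have "Suc m \<le> length u \<Longrightarrow> sub \<phi> (take (Suc m) u) \<approx> L 0 @ P (Suc m)" for m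
    proof (induction m)
      case 0
      then have "take (Suc 0) u = [u ! 0]" by (cases u) auto
      moreover have "\<sigma> (u ! 0) = 0" using 0 by (intro \<sigma>) auto
      ultimately have "sub \<phi> (take (Suc 0) u) = L 0 @ P (Suc 0)" by (simp add: \<phi>_def)
      then show ?case by (simp only: refl)
    next
      case (Suc m)
      have "sub \<phi> (take (Suc (Suc m)) u) = sub \<phi> (take (Suc m) u) @ L (Suc m) @ P (Suc (Suc m))"
        using Suc(2) \<sigma>[of "Suc m"] by (simp add: take_Suc_conv_app_nth \<phi>_def)
      also have "\<dots> \<approx> (L 0 @ P (Suc m)) @ L (Suc m) @ P (Suc (Suc m))"
        by (rule appr) (use Suc in simp)
      also have "\<dots> = L 0 @ (P (Suc m) @ L (Suc m)) @ P (Suc (Suc m))" by simp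
      also have "\<dots> \<approx> L 0 @ q @ P (Suc (Suc m))" by (rule ctx[OF PL])
      also have "\<dots> \<approx> L 0 @ P (Suc (Suc m))" by (rule appl[OF qP])
      finally show ?case .
    qed
    from this[of "length u - 1"] w(2) have u: "sub \<phi> u \<approx> L 0 @ P (length u)"
      by (cases "length u") auto
    have "q \<approx> q @ q" by (rule sym[OF qq])
    also have "\<dots> \<approx> (P 0 @ L 0) @ P (length u) @ L (length u)" by (rule app[OF sym[OF PL] sym[OF PL]])
    also have "\<dots> = P 0 @ (L 0 @ P (length u)) @ L (length u)" by simp
    also have "\<dots> \<approx> P 0 @ sub \<phi> u @ L (length u)" by (rule ctx[OF sym[OF u]])
    also have "\<dots> \<approx> P 0 @ sub \<phi> w @ L (length u)"
      by (intro ctx sub uw) (simp add: \<phi>_def ne)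
    also have "\<dots> = (P 0 @ sub \<phi> w1 @ L i) @ (P (Suc i) @ L j) @ P (Suc j) @ sub \<phi> w2 @ L (length u)"
      using w \<sigma> by (simp add: \<phi>_def)
    finally have e: "q \<approx> (P 0 @ sub \<phi> w1 @ L i) @ (P (Suc i) @ L j) @ P (Suc j) @ sub \<phi> w2 @ L (length u)" .
    have "(P 0 @ sub \<phi> w1 @ L i) @ q \<approx> P 0 @ sub \<phi> w1 @ L i"
      using appl[OF Lq, of "P 0 @ sub \<phi> w1"] by simp
    moreover have "q @ P (Suc i) @ L j \<approx> P (Suc i) @ L j"
      using appr[OF qP] by simp
    moreover have "(P (Suc i) @ L j) @ q \<approx> P (Suc i) @ L j"
      using appl[OF Lq] by simp
    ultimately obtain N where "2 \<le> N" "pw (P (Suc i) @ L j) N \<approx> q"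
      using factor_unit[OF qq e] ne by (metis append_is_Nil_conv)
    then show ?thesis by (auto simp: L_def P_def)
  qed
  show ?thesis using key[of "\<lambda>m. m = Suc i"] key[of "\<lambda>m. m = j"] w(4) by auto
qed

text \<open>Hence every letter \<open>x\<close> that divides an idempotent \<open>q = y\<^sub>1 x y\<^sub>2\<close>
  gives a unit of the local monoid at \<open>q\<close>: first \<open>q x y\<^sub>2 q\<close> is a unit, then \<open>q
  x\<close> has a right inverse \<open>l\<close>, and the previous lemma applies once more.\<close>

lemma letter_unit:
  assumes q: "idem q" and x: "x \<in> set q"
  shows "\<exists>N\<ge>2. pw (q @ [x] @ q) N \<approx> q"
proof -
  note qq = idemD(1)[OF q]
  obtain y1 y2 where y: "q = y1 @ [x] @ y2" using x by (metis append_Cons append_Nil split_list)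
  have "(q @ y1) @ [x] @ y2 @ q = q @ q @ q" using y by simp
  also have "\<dots> \<approx> q @ q" by (rule appl[OF qq])
  also have "\<dots> \<approx> q" by (rule qq)
  finally have "(q @ y1) @ [x] @ y2 @ q \<approx> q" .
  moreover have "q @ q @ y1 \<approx> q @ y1" using appr[OF qq] by simp
  moreover have "([x] @ y2 @ q) @ q \<approx> [x] @ y2 @ q" using appl[OF qq, of "[x] @ y2"] by simp
  ultimately obtain N where N: "2 \<le> N" "pw (q @ [x] @ y2 @ q) N \<approx> q"
    using local_unit[OF q, of "q @ y1" "[x] @ y2 @ q"] idemD(2)[OF q] by auto
  \<comment> \<open>A right inverse of \<open>q x\<close> at \<open>q\<close>, read off from \<open>(q x y\<^sub>2 q)\<^sup>N = q\<close>.\<close>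
  define l where "l = y2 @ q @ pw (q @ [x] @ y2 @ q) (N - 1)"
  have Nm: "N = Suc (N - 1)" "N - 1 = Suc (N - 2)" using N(1) by simp_all
  have l: "l = y2 @ q @ pw (q @ [x] @ y2 @ q) (N - 2) @ q @ [x] @ y2 @ q"
    unfolding l_def by (subst Nm(2), subst pw_Suc_right) simp
  have "(q @ [x]) @ l = pw (q @ [x] @ y2 @ q) N"
    by (subst Nm(1)) (simp add: l_def)
  then have "(q @ [x]) @ l \<approx> q" using N(2) by simp
  moreover have "q @ q @ [x] \<approx> q @ [x]" using appr[OF qq] by simp
  moreover have "l @ q \<approx> l"
    using appl[OF qq, of "y2 @ q @ pw (q @ [x] @ y2 @ q) (N - 2) @ q @ [x] @ y2"] by (simp add: l)
  ultimately show ?thesis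
    using local_unit[OF q, of "q @ [x]" l] idemD(2)[OF q] by (auto simp: l)
qed

subsection \<open>Moving idempotents next to the fixed prefix\<close>

text \<open>If the letter \<open>w ! r\<close> after the common prefix occurs in the prefix itself, then it can be
  accumulated there: substitute the power reached so far behind the last letter of the prefix and distribute the rest
  over the remaining letters of \<open>u\<close>, so that \<open>u\<close> is sent to an equal word and
  \<open>w\<close> contributes one more copy.\<close>

lemma prefix_power:
  assumes r: "r < length u" "take r u = take r w" and z: "w ! r \<in> set (take r u)"
  shows "\<exists>\<rho>. u \<approx> take r u @ pw [w ! r] (Suc m) @ \<rho> \<and> length u - r \<le> length \<rho>"
proof (induction m)
  case 0
  have "w = take r w @ [w ! r] @ drop (Suc r) w" using r(1) longer by (simp add: id_take_nth_drop)
  then have "u \<approx> take r u @ pw [w ! r] (Suc 0) @ drop (Suc r) w" using uw r(2) by simp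
  moreover have "length u - r \<le> length (drop (Suc r) w)" using longer by simp
  ultimately show ?case by blast
next
  case (Suc m)
  then obtain \<rho> where \<rho>: "u \<approx> take r u @ pw [w ! r] (Suc m) @ \<rho>" "length u - r \<le> length \<rho>" by blast
  have d: "distinct (drop r u)" using dist by simp
  obtain \<psi> where \<psi>: "\<And>x. \<psi> x \<noteq> []" "sub \<psi> (drop r u) = \<rho>"
    using ex_block_map[OF d, of \<rho>] r(1) \<rho>(2) by auto
  obtain r' where r': "r = Suc r'" using z by (cases r) auto
  define t where "t = u ! r'"
  have tu: "take r u = take r' u @ [t]" using r(1) by (simp add: r' t_def take_Suc_conv_app_nth)
  have dt: "distinct (take r u)" using dist by simp
  \<comment> \<open>The map fixes the letters of the prefix, except that the power follows the last of them.\<close>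
  define \<phi> where "\<phi> = (\<lambda>x. if x \<in> set (take r' u) then [x] else if x = t then [t] @ pw [w ! r] (Suc m) else \<psi> x)"
  have s1: "sub \<phi> (take r' u) = take r' u" by (rule sub_id) (simp add: \<phi>_def)
  have pt: "\<phi> t = [t] @ pw [w ! r] (Suc m)" using dt by (simp add: tu \<phi>_def)
  have s2: "sub \<phi> (take r u) = take r u @ pw [w ! r] (Suc m)" by (simp add: tu s1 pt)
  have disj: "set (take r u) \<inter> set (drop r u) = {}" using dist by (rule set_take_disj_set_drop_if_distinct) simp
  have s3: "sub \<phi> (drop r u) = \<rho>"
    unfolding \<psi>(2)[symmetric] by (rule sub_cong) (use disj in \<open>auto simp: tu \<phi>_def\<close>)
  have "sub \<phi> u = sub \<phi> (take r u) @ sub \<phi> (drop r u)"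
    by (simp only: concat_append[symmetric] map_append[symmetric] append_take_drop_id)
  then have l: "sub \<phi> u = take r u @ pw [w ! r] (Suc m) @ \<rho>" by (simp only: s2 s3 append_assoc)
  have w: "w = take r u @ [w ! r] @ drop (Suc r) w"
    using r longer by (simp add: id_take_nth_drop)
  define \<rho>' where "\<rho>' = (if w ! r = t then pw [w ! r] (Suc m) else []) @ sub \<phi> (drop (Suc r) w)"
  have pz: "\<phi> (w ! r) = [w ! r] @ (if w ! r = t then pw [w ! r] (Suc m) else [])"
    using z by (auto simp: pt) (auto simp: tu \<phi>_def)
  have "sub \<phi> w = sub \<phi> (take r u) @ \<phi> (w ! r) @ sub \<phi> (drop (Suc r) w)"
    by (subst w) (simp only: map_append concat_append list.map concat.simps append_Nil2)
  also have "\<dots> = take r u @ (pw [w ! r] (Suc m) @ [w ! r]) @ \<rho>'" by (simp only: s2 pz \<rho>'_def append_assoc)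
  also have "\<dots> = take r u @ pw [w ! r] (Suc (Suc m)) @ \<rho>'" by (simp only: pw_Suc_right[symmetric])
  finally have rr: "sub \<phi> w = take r u @ pw [w ! r] (Suc (Suc m)) @ \<rho>'" .
  have ne: "\<phi> x \<noteq> []" for x using \<psi>(1) by (simp add: \<phi>_def)
  have "u \<approx> sub \<phi> u" using \<rho>(1) l by simp
  also have "\<dots> \<approx> sub \<phi> w" by (rule sub[OF ne uw])
  finally have "u \<approx> take r u @ pw [w ! r] (Suc (Suc m)) @ \<rho>'" by (simp only: rr)
  moreover have "length (drop (Suc r) w) \<le> length (sub \<phi> (drop (Suc r) w))" by (rule length_sub) (rule ne)
  then have "length u - r \<le> length \<rho>'" using longer by (simp add: \<rho>'_def)
  ultimately show ?case by blast
qed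

text \<open>Let \<open>r\<close> be the length of the common prefix of \<open>u\<close> and \<open>w\<close>. The
  letter of \<open>w\<close> after this prefix is either a later letter of \<open>u\<close>, for which an idempotent
  further to the right can be substituted, or a letter of the prefix, which can be repeated as often as
  desired.\<close>

lemma idempotent_after_prefix:
  assumes r: "r < length u" "take r u = take r w" "u ! r \<noteq> w ! r" and y: "y \<noteq> []" and e: "idem e"
  shows "\<exists>f C. idem f \<and> take r u @ y @ e \<approx> take r u @ f @ C @ e"
proof -
  have u: "u = take r u @ [u ! r] @ drop (Suc r) u" using r(1) by (simp add: id_take_nth_drop)
  have w: "w = take r u @ [w ! r] @ drop (Suc r) w" using r longer by (simp add: id_take_nth_drop)
  have ur: "u ! r \<notin> set (take r u)" "u ! r \<notin> set (drop (Suc r) u)" using dist u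
    by (metis disjoint_iff distinct_append list.set_intros(1) append_Cons not_distinct_conv_prefix)
      (metis append_Cons append_Nil dist distinct.simps(2) distinct_append u)
  have disj: "set (take r u) \<inter> set (drop (Suc r) u) = {}"
    using dist by (rule set_take_disj_set_drop_if_distinct) simp
  have split: "sub \<phi> u = sub \<phi> (take r u) @ \<phi> (u ! r) @ sub \<phi> (drop (Suc r) u)"
    "sub \<phi> w = sub \<phi> (take r u) @ \<phi> (w ! r) @ sub \<phi> (drop (Suc r) w)" for \<phi>
    by (subst u, simp only: map_append concat_append list.map concat.simps append_Nil2)
      (subst w, simp only: map_append concat_append list.map concat.simps append_Nil2)
  have "w ! r \<in> set u" using content_w r(1) longer by (metis less_trans nth_mem)
  then have "w ! r \<in> set (take r u) \<union> {u ! r} \<union> set (drop (Suc r) u)" by (subst (asm) u) auto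
  then consider "w ! r \<in> set (drop (Suc r) u)" | "w ! r \<in> set (take r u)" using r(3) by auto
  then show ?thesis
  proof cases
    case 1
    define \<phi> where "\<phi> = (\<lambda>x. if x \<in> set (take r u) then [x] else if x = u ! r then y else e)"
    have ne: "\<phi> x \<noteq> []" for x using y idemD(2)[OF e] by (simp add: \<phi>_def)
    have s1: "sub \<phi> (take r u) = take r u" by (rule sub_id) (simp add: \<phi>_def)
    have s2: "sub \<phi> (drop (Suc r) u) = pw e (length (drop (Suc r) u))"
      by (rule sub_const) (use disj ur in \<open>auto simp: \<phi>_def\<close>)
    have s3: "\<phi> (u ! r) = y" "\<phi> (w ! r) = e" using 1 ur disj r(3) by (auto simp: \<phi>_def)
    have "take r u @ y @ e \<approx> take r u @ y @ pw e (length (drop (Suc r) u)) @ e"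
      using appl[OF sym[OF idem_pw[OF e]], of "take r u @ y"] by simp
    also have "\<dots> = sub \<phi> u @ e" by (simp only: split s1 s2 s3 append_assoc)
    also have "\<dots> \<approx> sub \<phi> w @ e" by (rule appr[OF sub[OF ne uw]])
    also have "\<dots> = take r u @ e @ sub \<phi> (drop (Suc r) w) @ e" by (simp only: split s1 s3 append_assoc)
    finally show ?thesis using e by blast
  next
    case 2
    obtain N where N: "2 \<le> N" "idem (pw [w ! r] N)" using ex_idem_power[of "[w ! r]"] by auto
    obtain \<rho> where \<rho>: "u \<approx> take r u @ pw [w ! r] N @ \<rho>"
      using prefix_power[OF r(1,2) 2, of "N - 1"] N(1) by auto
    define \<phi> where "\<phi> = (\<lambda>x. if x \<in> set (take r u) then [x] else if x = u ! r then y @ e else e)"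
    have ne: "\<phi> x \<noteq> []" for x using y idemD(2)[OF e] by (simp add: \<phi>_def)
    have s1: "sub \<phi> (take r u) = take r u" by (rule sub_id) (simp add: \<phi>_def)
    have s2: "sub \<phi> (drop (Suc r) u) = pw e (length (drop (Suc r) u))"
      by (rule sub_const) (use disj ur in \<open>auto simp: \<phi>_def\<close>)
    have s3: "\<phi> (u ! r) = y @ e" using ur by (auto simp: \<phi>_def)
    have s4: "sub \<phi> (pw [w ! r] N) = pw [w ! r] N"
      by (rule sub_id) (use 2 in \<open>auto simp: \<phi>_def\<close>)
    have "take r u @ y @ e \<approx> take r u @ y @ e @ e"
      using appl[OF sym[OF idemD(1)[OF e]], of "take r u @ y"] by simp
    also have "\<dots> \<approx> take r u @ y @ e @ pw e (length (drop (Suc r) u)) @ e"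
      using appl[OF sym[OF idem_pw[OF e]], of "take r u @ y @ e"] by simp
    also have "\<dots> = sub \<phi> u @ e" by (simp only: split s1 s2 s3 append_assoc)
    also have "\<dots> \<approx> sub \<phi> (take r u @ pw [w ! r] N @ \<rho>) @ e" by (rule appr[OF sub[OF ne \<rho>]])
    also have "\<dots> = take r u @ pw [w ! r] N @ sub \<phi> \<rho> @ e"
      by (simp only: map_append concat_append s1 s4 append_assoc)
    finally show ?thesis using N(2) by blast
  qed
qed

lemma idempotent_before_suffix:
  assumes s: "s < length u" "take s (rev u) = take s (rev w)" "rev u ! s \<noteq> rev w ! s"
    and y: "y \<noteq> []" and e: "idem e"
  shows "\<exists>f C. idem f \<and> e @ y @ drop (length u - s) u \<approx> e @ C @ f @ drop (length u - s) u"
proof -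
  interpret d: word_congruence "\<lambda>a b. rev a \<approx> rev b" "rev u" "rev w" n g by (rule dual)
  have "d.idem (rev e)" using e by (simp add: d.idem_def idem_def)
  with d.idempotent_after_prefix[of s "rev y" "rev e"] s y obtain f C where
    "d.idem f" "rev (take s (rev u) @ rev y @ rev e) \<approx> rev (take s (rev u) @ f @ C @ rev e)"
    by auto
  then show ?thesis
    by (intro exI[of _ "rev f"] exI[of _ "rev C"])
      (simp add: d.idem_def idem_def take_rev)
qed

text \<open>Applying the identity to the last factor of length \<open>length u\<close>, which is an image of
  \<open>u\<close>, makes the word longer and keeps the prefix and the suffix.\<close>

lemma long_word:
  assumes r: "r \<le> length u" "take r u = take r w" and s: "s \<le> length u" "take s (rev u) = take s (rev w)"
  shows "\<exists>W. u \<approx> W \<and> length u + m < length W \<and> take r W = take r u \<and> take s (rev W) = take s (rev u)"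
proof (induction m)
  case 0
  show ?case using uw longer r s by (intro exI[of _ w]) simp
next
  case (Suc m)
  then obtain W where W: "u \<approx> W" "length u + m < length W" "take r W = take r u"
    "take s (rev W) = take s (rev u)" by blast
  define f where "f = drop (length W - length u) W"
  have lf: "length f = length u" using W(2) by (simp add: f_def)
  obtain \<sigma> where \<sigma>: "map \<sigma> u = f" using ex_letter_map[OF dist lf] by blast
  define W' where "W' = take (length W - length u) W"
  have Wf: "W = W' @ f" by (simp add: W'_def f_def)
  have "f \<approx> map \<sigma> w" using sub[of "\<lambda>x. [\<sigma> x]", OF _ uw] by (simp add: sub_singleton \<sigma>)
  then have "u \<approx> W' @ map \<sigma> w" using W(1) Wf appl trans by blast
  moreover have "length u + Suc m < length (W' @ map \<sigma> w)" using W(2) Wf longer lf by simp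
  moreover have "take r (map \<sigma> w) = take r f" using r(2) \<sigma> by (metis take_map)
  then have "take r (W' @ map \<sigma> w) = take r (W' @ f)" by (rule take_append_cong)
  then have "take r (W' @ map \<sigma> w) = take r u" using W(3) Wf by simp
  moreover have "take s (rev (map \<sigma> w)) = take s (rev f)" using s(2) \<sigma> by (metis take_map rev_map)
  then have "take s (rev (W' @ map \<sigma> w)) = take s (rev (W' @ f))"
    using s(1) longer lf by simp
  then have "take s (rev (W' @ map \<sigma> w)) = take s (rev u)" using W(4) Wf by simp
  ultimately show ?case by blast
qed

text \<open>A long word contains a factor of the length of \<open>u\<close> that is an image of \<open>u\<close> under
  a map of the letters to themselves. The iterates of this map repeat on \<open>u\<close>, which yields \<open>z
  \<approx> P z Q\<close>, and \<open>P\<close> can be raised to an idempotent power.\<close>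

lemma idempotent_inside:
  assumes r: "r < length u" "take r u = take r w" and s: "s < length u" "take s (rev u) = take s (rev w)"
  shows "\<exists>y e y'. y \<noteq> [] \<and> idem e \<and> y' \<noteq> [] \<and> u \<approx> take r u @ y @ e @ y' @ drop (length u - s) u"
proof -
  obtain W where W: "u \<approx> W" "length u + (r + s + 2) < length W" "take r W = take r u"
    "take s (rev W) = take s (rev u)"
    using long_word[of r s "r + s + 2"] r s by auto
  \<comment> \<open>The factor \<open>f\<close> avoids the prefix and the suffix, and \<open>p\<close> is longer than the prefix, so that words remain on both sides.\<close>
  define p f q where "p = take (Suc r) W" and "f = take (length u) (drop (Suc r) W)"
    and "q = drop (Suc r + length u) W"
  have Wp: "W = p @ f @ q"
    unfolding p_def f_def q_def by (metis append_take_drop_id drop_drop add.commute)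
  have lf: "length f = length u" using W(2) by (simp add: f_def)
  obtain \<sigma> where \<sigma>: "map \<sigma> u = f" using ex_letter_map[OF dist lf] by blast
  have su: "\<sigma> x \<in> set u" if "x \<in> set u" for x
  proof -
    have "\<sigma> x \<in> set f" using that \<sigma> by auto
    then show ?thesis using content[OF W(1)] Wp by simp
  qed
  define z where "z = (\<lambda>m. map (\<sigma> ^^ m) u)"
  have z_set: "set (z m) \<subseteq> set u \<and> length (z m) = length u" for m
    by (induction m) (auto simp: z_def su)
  have step: "z m \<approx> map (\<sigma> ^^ m) p @ z (Suc m) @ map (\<sigma> ^^ m) q" for m
  proof -
    have "z m \<approx> map (\<sigma> ^^ m) W"
      using sub[of "\<lambda>x. [(\<sigma> ^^ m) x]", OF _ W(1)] by (simp add: sub_singleton z_def)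
    then show ?thesis unfolding Wp by (simp add: z_def \<sigma>[symmetric] funpow_swap1 comp_def)
  qed
  have pne: "p \<noteq> []" using W(2) by (auto simp: p_def)
  have steps: "\<exists>P Q. z a \<approx> P @ z (a + k) @ Q \<and> (0 < k \<longrightarrow> P \<noteq> [])" for a k
  proof (induction k)
    case 0
    show ?case by (rule exI[of _ "[]"], rule exI[of _ "[]"]) (simp add: refl)
  next
    case (Suc k)
    then obtain P Q where "z a \<approx> P @ z (a + k) @ Q" by blast
    also have "\<dots> \<approx> P @ (map (\<sigma> ^^ (a + k)) p @ z (Suc (a + k)) @ map (\<sigma> ^^ (a + k)) q) @ Q"
      by (rule ctx[OF step])
    finally have "z a \<approx> (P @ map (\<sigma> ^^ (a + k)) p) @ z (a + Suc k) @ (map (\<sigma> ^^ (a + k)) q @ Q)" by simp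
    then show ?case using pne by blast
  qed
  have "finite {xs. set xs \<subseteq> set u \<and> length xs = length u}" by (rule finite_lists_length_eq) simp
  then have "finite (range (\<lambda>m. z (Suc m)))" by (rule finite_subset[rotated]) (use z_set in blast)
  then have "\<not> inj (\<lambda>m. z (Suc m))" using finite_imageD infinite_UNIV_nat by blast
  then obtain a b where ab: "a < b" "z (Suc a) = z (Suc b)"
    unfolding inj_def by (metis linorder_neqE_nat)
  obtain P Q where PQ: "z (Suc a) \<approx> P @ z (Suc a) @ Q" "P \<noteq> []"
    using steps[of "Suc a" "b - a"] ab by auto
  obtain N where N: "2 \<le> N" "idem (pw P N)" by (rule ex_idem_power[OF PQ(2)])
  obtain X X' where X: "z 1 \<approx> X @ z (Suc a) @ X'" using steps[of 1 a] by auto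
  have "u = z 0" by (simp add: z_def)
  also have "z 0 \<approx> p @ z 1 @ q" using step[of 0] by simp
  also have "\<dots> \<approx> p @ (X @ z (Suc a) @ X') @ q" by (rule ctx[OF X])
  also have "\<dots> = (p @ X) @ z (Suc a) @ X' @ q" by simp
  also have "\<dots> \<approx> (p @ X) @ (pw P N @ z (Suc a) @ pw Q N) @ X' @ q" by (rule ctx[OF absorb_power[OF PQ(1)]])
  finally have *: "u \<approx> p @ X @ pw P N @ z (Suc a) @ pw Q N @ X' @ q" by simp
  have "take r p = take r u" using W(3) by (simp add: p_def min_def)
  then have p: "p = take r u @ drop r p" by (metis append_take_drop_id)
  have lq: "s \<le> length q" using W(2) by (simp add: q_def)
  have "take s (rev q) = take s (rev u)" using W(4) lq unfolding Wp by simp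
  then have "drop (length q - s) q = drop (length u - s) u" by (simp add: take_rev)
  then have q: "q = take (length q - s) q @ drop (length u - s) u" by (metis append_take_drop_id)
  have "z (Suc a) \<noteq> []" using z_set[of "Suc a"] r(1) by auto
  moreover have "drop r p \<noteq> []" using W(2) by (simp add: p_def)
  moreover have "u \<approx> take r u @ (drop r p @ X) @ pw P N @ (z (Suc a) @ pw Q N @ X' @ take (length q - s) q) @ drop (length u - s) u"
    using * by (subst (asm) p, subst (asm) q) simp
  ultimately show ?thesis using N(2) by (metis append_is_Nil_conv)
qed

text \<open>By the last condition a letter of \<open>u\<close> outside \<open>c\<close> has exactly one occurrence in
  \<open>A @ c @ B\<close>.\<close>

definition normal :: "'a list \<Rightarrow> 'a list \<Rightarrow> 'a list \<Rightarrow> bool" where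
  "normal A c B \<longleftrightarrow> u \<approx> A @ c @ B \<and> c \<noteq> [] \<and> (\<exists>e f. idem e \<and> idem f \<and> e @ c \<approx> c \<and> c @ f \<approx> c) \<and>
     (\<forall>x. x \<notin> set c \<longrightarrow> count_list (A @ B) x \<le> 1)"

lemma ex_normal_prefix:
  assumes "w = u @ v"
  shows "\<exists>A c B. normal A c B"
proof -
  have v: "v \<noteq> []" using assms longer by auto
  have p: "u \<approx> u @ pw v m" for m
  proof (induction m)
    case (Suc m)
    have "u \<approx> u @ pw v m" by (rule Suc)
    also have "\<dots> \<approx> (u @ v) @ pw v m" by (rule appr) (use uw assms in simp)
    finally show ?case by simp
  qed (simp add: refl)
  obtain N where N: "2 \<le> N" "idem (pw v N)" by (rule ex_idem_power[OF v])
  have "normal u (pw v N) []"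
    unfolding normal_def using p[of N] N(2) idemD[OF N(2)] count_list_distinct[OF dist] by auto
  then show ?thesis by blast
qed

lemma normal_rev:
  assumes "word_congruence.normal (\<lambda>a b. rev a \<approx> rev b) (rev u) A c B"
  shows "normal (rev B) (rev c) (rev A)"
proof -
  interpret d: word_congruence "\<lambda>a b. rev a \<approx> rev b" "rev u" "rev w" n g by (rule dual)
  have i: "d.idem e \<Longrightarrow> idem (rev e)" for e by (simp add: d.idem_def idem_def)
  have cl: "count_list (rev B @ rev A) x = count_list (A @ B) x" for x
    by (simp add: count_list_append)
  from assms obtain e f where "d.idem e" "d.idem f" "rev (e @ c) \<approx> rev c" "rev (c @ f) \<approx> rev c"
    unfolding d.normal_def by blast
  then have "\<exists>e f. idem e \<and> idem f \<and> e @ rev c \<approx> rev c \<and> rev c @ f \<approx> rev c" using i by auto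
  with assms show ?thesis unfolding d.normal_def normal_def cl by simp
qed

text \<open>Take for \<open>A\<close> and \<open>B\<close> the longest common prefix and suffix of \<open>u\<close>
  and \<open>w\<close>, create an idempotent between them and move copies of it outwards until they touch
  \<open>A\<close> and \<open>B\<close>. Prefix and suffix may overlap; if they do, the letters of the overlap are put
  into the middle part.\<close>

lemma ex_normal: "\<exists>A c B. normal A c B"
proof -
  interpret d: word_congruence "\<lambda>a b. rev a \<approx> rev b" "rev u" "rev w" n g by (rule dual)
  obtain r where r: "r \<le> length u" "take r u = take r w" "r < length u \<longrightarrow> u ! r \<noteq> w ! r"
    using ex_common_prefix[of u w] longer by auto
  obtain s where s: "s \<le> length u" "take s (rev u) = take s (rev w)" "s < length u \<longrightarrow> rev u ! s \<noteq> rev w ! s"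
    using ex_common_prefix[of "rev u" "rev w"] longer by auto
  consider "r = length u" | "s = length u" | "r < length u" "s < length u" using r(1) s(1) by linarith
  then show ?thesis
  proof cases
    case 1
    then have "w = u @ drop (length u) w" using r(2) by (metis append_take_drop_id take_all order_refl)
    then show ?thesis by (rule ex_normal_prefix)
  next
    case 2
    then have "rev w = rev u @ drop (length u) (rev w)"
      using s(2) by (metis append_take_drop_id take_all order_refl length_rev)
    then obtain A c B where "d.normal A c B" using d.ex_normal_prefix by blast
    then show ?thesis using normal_rev by blast
  next
    case 3
    define A B where "A = take r u" and "B = drop (length u - s) u"
    obtain y e y' where y: "y \<noteq> []" "idem e" "y' \<noteq> []" "u \<approx> A @ y @ e @ y' @ B"
      unfolding A_def B_def using idempotent_inside[OF 3(1) r(2) 3(2) s(2)] by blast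
    obtain f C where f: "idem f" "A @ y @ e \<approx> A @ f @ C @ e"
      using idempotent_after_prefix[of r y e] 3 r y unfolding A_def by blast
    obtain f' C' where f': "idem f'" "e @ y' @ B \<approx> e @ C' @ f' @ B"
      using idempotent_before_suffix[of s y' e] 3 s y unfolding B_def by blast
    define c where "c = f @ C @ e @ e @ C' @ f'"
    have "u \<approx> A @ y @ e @ y' @ B" by (rule y)
    also have "\<dots> = (A @ y) @ e @ (y' @ B)" by simp
    also have "\<dots> \<approx> (A @ y) @ (e @ e) @ (y' @ B)" by (rule ctx[OF sym[OF idemD(1)[OF y(2)]]])
    also have "\<dots> = (A @ y @ e) @ (e @ y' @ B)" by simp
    also have "\<dots> \<approx> (A @ f @ C @ e) @ (e @ C' @ f' @ B)" by (rule app[OF f(2) f'(2)])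
    also have "\<dots> = A @ c @ B" by (simp add: c_def)
    finally have c: "u \<approx> A @ c @ B" .
    have fc: "f @ c \<approx> c" using appr[OF idemD(1)[OF f(1)]] by (simp add: c_def)
    have cf: "c @ f' \<approx> c" using appl[OF idemD(1)[OF f'(1)], of "f @ C @ e @ e @ C'"] by (simp add: c_def)
    have cne: "c \<noteq> []" using idemD(2)[OF f(1)] by (simp add: c_def)
    have dA: "distinct A" and dB: "distinct B" using dist by (simp_all add: A_def B_def)
    have cAB: "count_list (A @ B) x \<le> 1" if "x \<notin> set A \<inter> set B" for x
      using that count_list_distinct[OF dA, of x] count_list_distinct[OF dB, of x]
      by (auto simp: count_list_append count_list_0_iff)
    show ?thesis
    proof (cases "r \<le> length u - s")
      case True
      then have "set A \<inter> set B = {}"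
        unfolding A_def B_def using dist by (rule set_take_disj_set_drop_if_distinct[rotated])
      then have "normal A c B" unfolding normal_def using c cne f f' fc cf cAB by blast
      then show ?thesis by blast
    next
      case False
      \<comment> \<open>The prefix and the suffix overlap in \<open>U\<close>; these letters are moved into the middle part.\<close>
      define U where "U = drop (length u - s) (take r u)"
      define D where "D = drop r u"
      have AU: "A = take (length u - s) u @ U"
        unfolding A_def U_def using False by (metis append_take_drop_id min.absorb1 nat_le_linear take_take)
      have BU: "B = U @ D"
        unfolding B_def U_def D_def using False 3
        by (metis append_take_drop_id drop_append length_take min.absorb2 diff_is_0_eq drop_0 nat_le_linear r(1))
      obtain r' where r': "r = Suc r'" using False by (cases r) auto
      define t where "t = u ! r'"
      have At: "A = take r' u @ [t]" using 3(1) by (simp add: A_def r' t_def take_Suc_conv_app_nth)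
      have Une: "U \<noteq> []" using False 3 by (simp add: U_def)
      then obtain U' where Ut: "U = U' @ [t]" using AU At by (metis append_butlast_last_id last_appendR last_snoc)
      \<comment> \<open>Behind the last letter of \<open>U\<close> the map inserts \<open>c U\<close>; then \<open>A D\<close> becomes \<open>A c U D = A c B\<close>, which is equal to \<open>u\<close>.\<close>
      define \<phi> where "\<phi> = (\<lambda>x. if x = t then [t] @ c @ U else [x])"
      have ne: "\<phi> x \<noteq> []" for x by (simp add: \<phi>_def)
      have uA: "u = A @ D" by (simp add: A_def D_def)
      have dAD: "distinct (A @ D)" using dist by (simp only: uA[symmetric])
      have tA: "t \<notin> set (take r' u)" using dA unfolding At by simp
      have tD: "t \<notin> set D" using dAD unfolding At by simp
      have tU: "t \<notin> set U'" using dA unfolding AU Ut by simp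
      have sA: "sub \<phi> A = A @ c @ U"
      proof -
        have "sub \<phi> (take r' u) = take r' u" by (rule sub_id) (use tA in \<open>auto simp: \<phi>_def\<close>)
        then show ?thesis by (simp add: At \<phi>_def)
      qed
      have sD: "sub \<phi> D = D" by (rule sub_id) (use tD in \<open>auto simp: \<phi>_def\<close>)
      have sU: "sub \<phi> U = U @ c @ U"
      proof -
        have "sub \<phi> U' = U'" by (rule sub_id) (use tU in \<open>auto simp: \<phi>_def\<close>)
        then show ?thesis by (simp add: Ut \<phi>_def)
      qed
      define c' where "c' = c @ U @ sub \<phi> c @ U @ c"
      have "u \<approx> A @ c @ B" by (rule c)
      also have "\<dots> = sub \<phi> u" by (simp add: uA sA sD BU)
      also have "\<dots> \<approx> sub \<phi> (A @ c @ B)" by (rule sub[OF ne c])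
      also have "\<dots> = A @ c' @ B" by (simp add: sA sU sD BU c'_def)
      finally have u': "u \<approx> A @ c' @ B" .
      have "f @ c' \<approx> c'" using appr[OF fc] by (simp add: c'_def)
      moreover have "c' @ f' \<approx> c'" using appl[OF cf, of "c @ U @ sub \<phi> c @ U"] by (simp add: c'_def)
      moreover have "set A \<inter> set B \<subseteq> set U"
      proof -
        have "set A \<inter> set D = {}" using dAD by simp
        then show ?thesis unfolding BU by auto
      qed
      then have "set A \<inter> set B \<subseteq> set c'" by (auto simp: c'_def)
      ultimately have "normal A c' B"
        unfolding normal_def using u' cne f f' cAB by (metis Nil_is_append_conv c'_def subsetD)
      then show ?thesis by blast
    qed
  qed
qed

text \<open>Substituting \<open>c\<close> itself for a letter that is repeated in \<open>w\<close>, and the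
  idempotents at the ends of \<open>c\<close> for the other letters of \<open>u\<close>, gives \<open>c \<approx> x c
  y c z\<close>; hence \<open>c\<close> absorbs an idempotent that contains all letters of \<open>c\<close>.\<close>

theorem normal_form:
  obtains A c q B where "u \<approx> A @ c @ q @ B" "c \<noteq> []" "idem q" "set q = set c" "c @ q \<approx> c"
    "\<And>x. x \<in> set c \<Longrightarrow> \<exists>N\<ge>2. pw (q @ [x] @ q) N \<approx> q"
    "\<And>x. x \<notin> set c \<Longrightarrow> count_list (A @ B) x \<le> 1"
proof -
  obtain A c B e f where c: "u \<approx> A @ c @ B" "c \<noteq> []" "idem e" "idem f" "e @ c \<approx> c" "c @ f \<approx> c"
    and cnt: "\<And>x. x \<notin> set c \<Longrightarrow> count_list (A @ B) x \<le> 1"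
    using ex_normal unfolding normal_def by blast
  have "\<not> distinct w"
  proof
    assume "distinct w"
    then have "length w = length u" using content_w dist by (metis distinct_card)
    then show False using longer by simp
  qed
  then obtain w1 w2 w3 x where w: "w = w1 @ [x] @ w2 @ [x] @ w3" using not_distinct_decomp by blast
  then have "x \<in> set u" using content_w by auto
  then obtain u1 u2 where u: "u = u1 @ [x] @ u2" by (metis append_Cons append_Nil split_list)
  \<comment> \<open>The idempotents \<open>e\<close> and \<open>f\<close> are absorbed by \<open>c\<close>, so \<open>u\<close> is sent to \<open>c\<close>.\<close>
  define \<phi> where "\<phi> = (\<lambda>y. if y = x then c else if y \<in> set u1 then e else f)"
  have ne: "\<phi> y \<noteq> []" for y using c(2) idemD(2)[OF c(3)] idemD(2)[OF c(4)] by (simp add: \<phi>_def)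
  have s1: "sub \<phi> u1 = pw e (length u1)" by (rule sub_const) (use dist u in \<open>auto simp: \<phi>_def\<close>)
  have s2: "sub \<phi> u2 = pw f (length u2)" by (rule sub_const) (use dist u in \<open>auto simp: \<phi>_def\<close>)
  have ec: "pw e j @ c \<approx> c" for j
  proof (induction j)
    case (Suc j)
    have "pw e (Suc j) @ c = e @ pw e j @ c" by simp
    also have "\<dots> \<approx> e @ c" by (rule appl[OF Suc])
    also have "\<dots> \<approx> c" by (rule c)
    finally show ?case .
  qed (simp add: refl)
  have cf: "c @ pw f j \<approx> c" for j
  proof (induction j)
    case (Suc j)
    have "c @ pw f (Suc j) = (c @ f) @ pw f j" by simp
    also have "\<dots> \<approx> c @ pw f j" by (rule appr[OF c(6)])
    also have "\<dots> \<approx> c" by (rule Suc)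
    finally show ?case .
  qed (simp add: refl)
  define Y where "Y = sub \<phi> w2 @ c @ sub \<phi> w3"
  have "c \<approx> pw e (length u1) @ c" by (rule sym[OF ec])
  also have "\<dots> \<approx> pw e (length u1) @ c @ pw f (length u2)" by (rule appl[OF sym[OF cf]])
  also have "\<dots> = sub \<phi> u" by (simp add: u s1 s2) (simp add: \<phi>_def)
  also have "\<dots> \<approx> sub \<phi> w" by (rule sub[OF ne uw])
  also have "\<dots> = sub \<phi> w1 @ c @ Y" by (simp add: w Y_def) (simp add: \<phi>_def)
  finally have cY: "c \<approx> sub \<phi> w1 @ c @ Y" .
  have Yne: "Y \<noteq> []" using c(2) by (simp add: Y_def)
  obtain N where N: "2 \<le> N" "idem (pw Y N)" by (rule ex_idem_power[OF Yne])
  define q where "q = pw Y N"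
  have cN: "c \<approx> pw (sub \<phi> w1) N @ c @ q" unfolding q_def by (rule absorb_power[OF cY])
  have cq: "c @ q \<approx> c"
  proof -
    have "c @ q \<approx> (pw (sub \<phi> w1) N @ c @ q) @ q" by (rule appr[OF cN])
    also have "\<dots> = (pw (sub \<phi> w1) N @ c) @ q @ q" by simp
    also have "\<dots> \<approx> (pw (sub \<phi> w1) N @ c) @ q"
      by (rule appl) (use idemD(1)[OF N(2)] in \<open>simp add: q_def\<close>)
    also have "\<dots> = pw (sub \<phi> w1) N @ c @ q" by simp
    also have "\<dots> \<approx> c" by (rule sym[OF cN])
    finally show ?thesis .
  qed
  have qY: "set q = set Y" using N(1) by (auto simp: q_def)
  have sq: "set q = set c"
  proof
    show "set q \<subseteq> set c" using content[OF cq] by auto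
    show "set c \<subseteq> set q" unfolding qY by (auto simp: Y_def)
  qed
  have qi: "idem q" using N(2) by (simp add: q_def)
  have "u \<approx> A @ c @ q @ B"
  proof -
    have "u \<approx> A @ c @ B" by (rule c)
    also have "\<dots> \<approx> A @ (c @ q) @ B" by (rule ctx[OF sym[OF cq]])
    finally show ?thesis by simp
  qed
  then show ?thesis using that c(2) qi sq cq letter_unit[OF qi] cnt by blast
qed

end

section \<open>Epigroups as Drazin invertible semigroups\<close>

locale associative_algebra =
  fixes S :: "'a unary_semigroup" (structure)
  assumes alg: "algebra_2_1 S" and asc: "associative S"
begin

lemma mult_closed [simp]: "x \<in> carrier S \<Longrightarrow> y \<in> carrier S \<Longrightarrow> x \<cdot> y \<in> carrier S"
  using alg by (simp add: algebra_2_1_def)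

lemma pinv_closed [simp]: "x \<in> carrier S \<Longrightarrow> pinv S x \<in> carrier S"
  using alg by (simp add: algebra_2_1_def)

lemma mult_assoc: "x \<in> carrier S \<Longrightarrow> y \<in> carrier S \<Longrightarrow> z \<in> carrier S \<Longrightarrow> x \<cdot> y \<cdot> z = x \<cdot> (y \<cdot> z)"
  using asc by (simp add: associative_def)

lemma spow_1: "spow S x 1 = x"
  by (simp add: spow_def)

lemma spow_Suc: "1 \<le> n \<Longrightarrow> spow S x (Suc n) = spow S x n \<cdot> x"
  by (cases n) (auto simp: spow_def)

lemma spow_closed [simp]: "x \<in> carrier S \<Longrightarrow> spow S x n \<in> carrier S"
proof -
  assume x: "x \<in> carrier S"
  have "((\<lambda>y. y \<cdot> x) ^^ k) x \<in> carrier S" for k by (induction k) (simp_all add: x)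
  then show ?thesis by (simp add: spow_def)
qed

lemma spow_commutes:
  assumes "1 \<le> n" "x \<in> carrier S" "y \<in> carrier S" "x \<cdot> y = y \<cdot> x"
  shows "spow S x n \<cdot> y = y \<cdot> spow S x n"
  using assms(1)
proof (induction n rule: nat_induct_at_least)
  case (Suc n)
  have "spow S x (Suc n) \<cdot> y = spow S x n \<cdot> (y \<cdot> x)"
    using Suc assms by (simp add: spow_Suc mult_assoc)
  also have "\<dots> = y \<cdot> spow S x (Suc n)" using Suc assms by (simp add: spow_Suc mult_assoc[symmetric])
  finally show ?case .
qed (use assms in \<open>simp add: spow_1[simplified]\<close>)

lemma is_subgroup_iff:
  "is_subgroup S G e \<longleftrightarrow> G \<subseteq> carrier S \<and> e \<in> G \<and> (\<forall>a\<in>G. \<forall>b\<in>G. a \<cdot> b \<in> G) \<and>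
     (\<forall>a\<in>G. e \<cdot> a = a \<and> a \<cdot> e = a \<and> (\<exists>b\<in>G. a \<cdot> b = e \<and> b \<cdot> a = e))"
proof
  assume s: "is_subgroup S G e"
  then interpret group "submonoid_on S G e" by (simp add: is_subgroup_def)
  have i: "\<exists>b\<in>G. a \<cdot> b = e \<and> b \<cdot> a = e" if "a \<in> G" for a
    using that inv_closed[of a] r_inv[of a] l_inv[of a]
    by (intro bexI[of _ "inv\<^bsub>submonoid_on S G e\<^esub> a"]) (simp_all add: submonoid_on_def)
  show "G \<subseteq> carrier S \<and> e \<in> G \<and> (\<forall>a\<in>G. \<forall>b\<in>G. a \<cdot> b \<in> G) \<and>
     (\<forall>a\<in>G. e \<cdot> a = a \<and> a \<cdot> e = a \<and> (\<exists>b\<in>G. a \<cdot> b = e \<and> b \<cdot> a = e))"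
    using s i m_closed one_closed l_one r_one
    by (simp add: is_subgroup_def submonoid_on_def)
next
  assume r: "G \<subseteq> carrier S \<and> e \<in> G \<and> (\<forall>a\<in>G. \<forall>b\<in>G. a \<cdot> b \<in> G) \<and>
     (\<forall>a\<in>G. e \<cdot> a = a \<and> a \<cdot> e = a \<and> (\<exists>b\<in>G. a \<cdot> b = e \<and> b \<cdot> a = e))"
  have "group (submonoid_on S G e)"
    by (rule groupI) (use r in \<open>auto simp: submonoid_on_def intro!: mult_assoc\<close>)
  then show "is_subgroup S G e" using r by (simp add: is_subgroup_def)
qed

lemma subgroup_inv_eq:
  assumes "is_subgroup S G e" "a \<in> G" "b \<in> G" "b \<cdot> a = e"
  shows "inv\<^bsub>submonoid_on S G e\<^esub> a = b"
proof -
  interpret group "submonoid_on S G e" using assms(1) by (simp add: is_subgroup_def)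
  show ?thesis using inv_equality[of b a] assms by (simp add: submonoid_on_def)
qed

text \<open>The maximal subgroup at an idempotent \<open>e\<close>, the group of units of the local monoid at
  \<open>e\<close>.\<close>

definition unit_group :: "'a \<Rightarrow> 'a set" where
  "unit_group e = {a \<in> carrier S. e \<cdot> a = a \<and> a \<cdot> e = a \<and>
     (\<exists>b\<in>carrier S. e \<cdot> b = b \<and> b \<cdot> e = b \<and> a \<cdot> b = e \<and> b \<cdot> a = e)}"

lemma unit_groupI:
  assumes "a \<in> carrier S" "b \<in> carrier S" "e \<cdot> a = a" "a \<cdot> e = a" "e \<cdot> b = b" "b \<cdot> e = b" "a \<cdot> b = e" "b \<cdot> a = e"
  shows "a \<in> unit_group e" "b \<in> unit_group e"
  using assms unfolding unit_group_def by blast+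

lemma unit_group_subgroup:
  assumes e: "e \<in> carrier S" "e \<cdot> e = e"
  shows "is_subgroup S (unit_group e) e"
  unfolding is_subgroup_iff
proof (intro conjI ballI)
  show "unit_group e \<subseteq> carrier S" by (auto simp: unit_group_def)
  show "e \<in> unit_group e" using e by (auto simp: unit_group_def)
next
  fix a b assume "a \<in> unit_group e" "b \<in> unit_group e"
  then obtain a' b' where a: "a \<in> carrier S" "e \<cdot> a = a" "a \<cdot> e = a" "a' \<in> carrier S" "e \<cdot> a' = a'" "a' \<cdot> e = a'"
    "a \<cdot> a' = e" "a' \<cdot> a = e" and b: "b \<in> carrier S" "e \<cdot> b = b" "b \<cdot> e = b" "b' \<in> carrier S" "e \<cdot> b' = b'"
    "b' \<cdot> e = b'" "b \<cdot> b' = e" "b' \<cdot> b = e" unfolding unit_group_def by blast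
  have "a \<cdot> b \<cdot> (b' \<cdot> a') = a \<cdot> ((b \<cdot> b') \<cdot> a')" using a(1,4) b(1,4) by (simp add: mult_assoc)
  then have 1: "a \<cdot> b \<cdot> (b' \<cdot> a') = e" using a b by simp
  have "b' \<cdot> a' \<cdot> (a \<cdot> b) = b' \<cdot> ((a' \<cdot> a) \<cdot> b)" using a(1,4) b(1,4) by (simp add: mult_assoc)
  then have 2: "b' \<cdot> a' \<cdot> (a \<cdot> b) = e" using a b by simp
  show "a \<cdot> b \<in> unit_group e"
  proof (rule unit_groupI(1)[OF _ _ _ _ _ _ 1 2])
    show "e \<cdot> (a \<cdot> b) = a \<cdot> b" using a b e by (simp add: mult_assoc[symmetric])
    show "e \<cdot> (b' \<cdot> a') = b' \<cdot> a'" using a b e by (simp add: mult_assoc[symmetric])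
  qed (use a b e in \<open>simp_all add: mult_assoc\<close>)
next
  fix a assume a: "a \<in> unit_group e"
  then show "e \<cdot> a = a" "a \<cdot> e = a" by (simp_all add: unit_group_def)
  show "\<exists>b\<in>unit_group e. a \<cdot> b = e \<and> b \<cdot> a = e"
    using a unfolding unit_group_def by blast
qed

lemma subgroup_unit_group: "is_subgroup S G e \<Longrightarrow> G \<subseteq> unit_group e"
  unfolding is_subgroup_iff unit_group_def by blast

lemma unit_group_maximal:
  assumes e: "e \<in> carrier S" "e \<cdot> e = e"
  shows "is_maximal_subgroup S (unit_group e) e"
  unfolding is_maximal_subgroup_def
proof (intro conjI allI impI)
  show s: "is_subgroup S (unit_group e) e" by (rule unit_group_subgroup[OF e])
  fix H f assume H: "is_subgroup S H f \<and> unit_group e \<subseteq> H"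
  then have "e \<in> H" using s by (auto simp: is_subgroup_iff)
  then obtain b where b: "b \<in> H" "e \<cdot> b = f" "f \<cdot> e = e" using H unfolding is_subgroup_iff by blast
  have "f = e \<cdot> (e \<cdot> b)" using H b e by (auto simp: is_subgroup_iff mult_assoc[symmetric] subset_iff)
  then have "f = e" using b H \<open>e \<in> H\<close> by (simp add: is_subgroup_iff)
  then show "H = unit_group e" using H subgroup_unit_group by blast
qed

text \<open>That \<open>pinv S x\<close> is the Drazin inverse of \<open>x\<close>. In this form being the
  pseudoinverse is a condition on the element alone, without maximal subgroups, and all of it but the exponent
  \<open>n\<close> is an identity.\<close>

definition drazin :: "'a \<Rightarrow> bool" where
  "drazin x \<longleftrightarrow> x \<cdot> pinv S x = pinv S x \<cdot> x \<and> x \<cdot> pinv S x \<cdot> pinv S x = pinv S x \<and>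
     (\<exists>n\<ge>1. spow S x (Suc n) \<cdot> pinv S x = spow S x n)"

text \<open>Let \<open>h\<close> be the inverse of \<open>x\<^sup>n\<close> in the subgroup. As \<open>e\<close> is
  \<open>h x\<^sup>n\<close> and \<open>x\<^sup>n h\<close>, it commutes with \<open>x\<close>, and
  \<open>x\<^sup>n\<^sup>-\<^sup>1 h\<close> is an inverse of \<open>x e\<close>. The defining conditions hold in the
  subgroup for \<open>x e\<close> and transfer to \<open>x\<close>, because \<open>e\<close> is absorbed by the
  inverse.\<close>

lemma pseudoinverse_drazin:
  assumes x: "x \<in> carrier S" and p: "is_pseudoinverse S x (pinv S x)"
  shows "drazin x"
proof -
  obtain G e n where G: "is_maximal_subgroup S G e" "1 \<le> n" "spow S x n \<in> G"
    "pinv S x = inv\<^bsub>submonoid_on S G e\<^esub> (x \<cdot> e)" using p by (auto simp: is_pseudoinverse_def)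
  have sG: "is_subgroup S G e" using G(1) by (simp add: is_maximal_subgroup_def)
  then have Gc: "G \<subseteq> carrier S" and eG: "e \<in> G" and eu: "\<And>a. a \<in> G \<Longrightarrow> e \<cdot> a = a \<and> a \<cdot> e = a"
    by (simp_all add: is_subgroup_iff)
  have ec: "e \<in> carrier S" "e \<cdot> e = e" using Gc eG eu by auto
  have GU: "G = unit_group e"
    using G(1) subgroup_unit_group[OF sG] unit_group_subgroup[OF ec] unfolding is_maximal_subgroup_def by blast
  define q where "q = spow S x n"
  have qc: "q \<in> carrier S" using x by (simp add: q_def)
  have xq: "q \<cdot> x = x \<cdot> q" unfolding q_def by (rule spow_commutes) (use G x in auto)
  have qe: "q \<cdot> e = q" "e \<cdot> q = q" using eu G(3) by (auto simp: q_def)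
  obtain h where h: "h \<in> G" "q \<cdot> h = e" "h \<cdot> q = e" using sG G(3) unfolding q_def is_subgroup_iff by blast
  have hc: "h \<in> carrier S" and he: "h \<cdot> e = h" "e \<cdot> h = h" using h Gc eu by auto
  have ex1: "e \<cdot> x = e \<cdot> x \<cdot> e"
  proof -
    have "e \<cdot> x = h \<cdot> (x \<cdot> q)" unfolding h(3)[symmetric] xq[symmetric] using hc qc x by (simp add: mult_assoc)
    also have "\<dots> = h \<cdot> (x \<cdot> (q \<cdot> e))" by (simp only: qe)
    also have "\<dots> = h \<cdot> (q \<cdot> x) \<cdot> e" using hc qc x ec xq by (simp add: mult_assoc)
    also have "\<dots> = e \<cdot> x \<cdot> e" using h hc qc x ec by (simp add: mult_assoc[symmetric])
    finally show ?thesis .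
  qed
  have ex2: "x \<cdot> e = e \<cdot> x \<cdot> e"
  proof -
    have "x \<cdot> e = (x \<cdot> q) \<cdot> h" using h hc qc x by (simp add: mult_assoc)
    also have "\<dots> = (e \<cdot> q) \<cdot> x \<cdot> h" by (simp only: qe xq)
    also have "\<dots> = e \<cdot> (x \<cdot> q) \<cdot> h" using hc qc x ec xq by (simp add: mult_assoc)
    also have "\<dots> = e \<cdot> x \<cdot> e" using h hc qc x ec by (simp add: mult_assoc)
    finally show ?thesis .
  qed
  have exe: "e \<cdot> x = x \<cdot> e" using ex1 ex2 by simp
  have hx: "h \<cdot> x \<cdot> e = x \<cdot> h"
  proof -
    have "h \<cdot> x \<cdot> e = h \<cdot> (x \<cdot> q) \<cdot> h" unfolding h(2)[symmetric] using hc qc x by (simp add: mult_assoc)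
    also have "\<dots> = (h \<cdot> q) \<cdot> x \<cdot> h" using hc qc x by (simp add: xq[symmetric] mult_assoc)
    also have "\<dots> = x \<cdot> h" using h he exe x hc ec by (simp add: mult_assoc)
    finally show ?thesis .
  qed
  have xeG: "x \<cdot> e \<in> G"
  proof (cases "n = 1")
    case True
    then have "x \<in> G" using G(3) by (simp add: spow_1[simplified])
    then show ?thesis using eu by simp
  next
    case False
    define s where "s = spow S x (n - 1)"
    have sc: "s \<in> carrier S" using x by (simp add: s_def)
    have qs: "q = s \<cdot> x" unfolding q_def s_def using spow_Suc[of "n - 1" x] False G(2) by simp
    have sx: "s \<cdot> x = x \<cdot> s" unfolding s_def by (rule spow_commutes) (use False G(2) x in auto)
    have se: "s \<cdot> e = e \<cdot> s" unfolding s_def by (rule spow_commutes) (use False G(2) x ec exe in auto)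
    show ?thesis unfolding GU
    proof (rule unit_groupI(1)[of _ "s \<cdot> h"])
      show "e \<cdot> (x \<cdot> e) = x \<cdot> e" using ex2 ec x by (simp add: mult_assoc)
      show "e \<cdot> (s \<cdot> h) = s \<cdot> h" using se he sc hc ec by (simp add: mult_assoc[symmetric]) (simp add: mult_assoc se[symmetric])
      have "x \<cdot> e \<cdot> (s \<cdot> h) = x \<cdot> (e \<cdot> s) \<cdot> h" using x ec sc hc by (simp add: mult_assoc)
      also have "\<dots> = (x \<cdot> s) \<cdot> (e \<cdot> h)" using x ec sc hc by (simp add: mult_assoc se[symmetric])
      also have "\<dots> = e" using he h qs sx by simp
      finally show "x \<cdot> e \<cdot> (s \<cdot> h) = e" .
      have "s \<cdot> h \<cdot> (x \<cdot> e) = s \<cdot> (h \<cdot> x \<cdot> e)" using x ec sc hc by (simp add: mult_assoc)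
      also have "\<dots> = e" using h qs x sc hc by (simp add: hx mult_assoc[symmetric])
      finally show "s \<cdot> h \<cdot> (x \<cdot> e) = e" .
    qed (use x ec sc hc he in \<open>simp_all add: mult_assoc\<close>)
  qed
  obtain y where y: "y \<in> G" "x \<cdot> e \<cdot> y = e" "y \<cdot> (x \<cdot> e) = e" using sG xeG unfolding is_subgroup_iff by blast
  have py: "pinv S x = y" unfolding G(4) by (rule subgroup_inv_eq[OF sG xeG y(1,3)])
  have yc: "y \<in> carrier S" "e \<cdot> y = y" "y \<cdot> e = y" using y Gc eu by auto
  have xy: "x \<cdot> y = e" using y(2) yc x ec by (simp add: mult_assoc)
  have "y \<cdot> x = (y \<cdot> e) \<cdot> x" by (simp only: yc)
  also have "\<dots> = y \<cdot> (x \<cdot> e)" by (simp only: mult_assoc[OF yc(1) ec(1) x] exe)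
  finally have yx: "y \<cdot> x = e" by (simp only: y(3))
  have "spow S x (Suc n) \<cdot> y = q \<cdot> (x \<cdot> y)" using G(2) x yc by (simp add: spow_Suc q_def mult_assoc)
  then have "spow S x (Suc n) \<cdot> y = spow S x n" by (simp only: xy qe q_def[symmetric])
  then show ?thesis unfolding drazin_def py using xy yx yc G(2) by auto
qed

text \<open>Conversely \<open>e = x \<cdot> pinv S x\<close> is an idempotent, high powers of \<open>x\<close> and
  \<open>x e\<close> are units of its local monoid, and \<open>pinv S x\<close> is the inverse of \<open>x e\<close>
  there.\<close>

lemma drazin_pseudoinverse:
  assumes x: "x \<in> carrier S" and d: "drazin x"
  shows "is_pseudoinverse S x (pinv S x) \<and> (\<exists>n\<ge>1. \<exists>G e. is_subgroup S G e \<and> spow S x n \<in> G)"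
proof -
  define y where "y = pinv S x"
  define e where "e = x \<cdot> y"
  have yc: "y \<in> carrier S" using x by (simp add: y_def)
  have ec: "e \<in> carrier S" using x yc by (simp add: e_def)
  obtain n where n: "1 \<le> n" "spow S x (Suc n) \<cdot> y = spow S x n" and xy: "x \<cdot> y = y \<cdot> x" and xyy: "x \<cdot> y \<cdot> y = y"
    using d by (auto simp: drazin_def y_def)
  have ey: "e \<cdot> y = y" using xyy by (simp add: e_def)
  have "y \<cdot> e = (y \<cdot> x) \<cdot> y" using x yc by (simp add: e_def mult_assoc)
  then have ye: "y \<cdot> e = y" by (simp only: xy[symmetric] xyy)
  have ee: "e \<cdot> e = e" using ye x yc ec by (simp add: e_def mult_assoc) 
  have "e \<cdot> x = x \<cdot> (y \<cdot> x)" using x yc by (simp add: e_def mult_assoc)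
  then have xe: "x \<cdot> e = e \<cdot> x" by (simp only: xy[symmetric] e_def)
  have pe: "spow S x n \<cdot> e = spow S x n" using n x yc by (simp add: e_def spow_Suc mult_assoc)
  have "spow S x n \<cdot> e = e \<cdot> spow S x n" by (rule spow_commutes) (use n x ec xe in auto)
  then have ep: "e \<cdot> spow S x n = spow S x n" using pe by simp
  have yk: "e \<cdot> spow S y k = spow S y k \<and> spow S y k \<cdot> e = spow S y k \<and> spow S x k \<cdot> spow S y k = e
      \<and> spow S y k \<cdot> spow S x k = e" if "1 \<le> k" for k
    using that
  proof (induction k rule: nat_induct_at_least)
    case base
    show ?case using ey ye xy by (simp add: spow_1[simplified] e_def)
  next
    case (Suc k)
    have cx: "spow S x k \<cdot> x = x \<cdot> spow S x k" by (rule spow_commutes) (use Suc x in auto)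
    have cy: "spow S y k \<cdot> y = y \<cdot> spow S y k" by (rule spow_commutes) (use Suc yc in auto)
    have "spow S x (Suc k) \<cdot> spow S y (Suc k) = x \<cdot> (spow S x k \<cdot> spow S y k) \<cdot> y"
      using x yc by (simp only: spow_Suc[OF Suc(1)] cx) (simp add: mult_assoc)
    also have "\<dots> = x \<cdot> e \<cdot> y" using Suc(2) by simp
    also have "\<dots> = e" unfolding mult_assoc[OF x ec yc] ey by (simp only: e_def)
    finally have 1: "spow S x (Suc k) \<cdot> spow S y (Suc k) = e" .
    have "spow S y (Suc k) \<cdot> spow S x (Suc k) = y \<cdot> (spow S y k \<cdot> spow S x k) \<cdot> x"
      using x yc by (simp only: spow_Suc[OF Suc(1)] cy) (simp add: mult_assoc)
    also have "\<dots> = y \<cdot> e \<cdot> x" using Suc(2) by simp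
    also have "\<dots> = e" unfolding ye by (simp only: e_def xy)
    finally have 2: "spow S y (Suc k) \<cdot> spow S x (Suc k) = e" .
    show ?case using 1 2 Suc x yc ec ye by (simp add: spow_Suc mult_assoc) (metis Suc.IH mult_assoc spow_closed)
  qed
  have u: "spow S x n \<in> unit_group e"
    by (rule unit_groupI(1)[of _ "spow S y n"]) (use yk[OF n(1)] pe ep x yc in auto)
  have xyu: "x \<cdot> e \<in> unit_group e" and yu: "y \<in> unit_group e"
  proof -
    have a: "e \<cdot> (x \<cdot> e) = x \<cdot> e" using x ec ee by (simp add: xe) (simp add: mult_assoc[symmetric])
    have b: "x \<cdot> e \<cdot> e = x \<cdot> e" using x ec ee by (simp add: mult_assoc)
    have c: "x \<cdot> e \<cdot> y = e" using x yc ec ey by (simp add: mult_assoc) (simp add: e_def)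
    have d: "y \<cdot> (x \<cdot> e) = e" using x yc ec ee xy by (simp add: mult_assoc[symmetric]) (simp add: e_def[symmetric])
    show "x \<cdot> e \<in> unit_group e" "y \<in> unit_group e"
      using unit_groupI[of "x \<cdot> e" y e] a b c d x yc ec ey ye by auto
  qed
  have "inv\<^bsub>submonoid_on S (unit_group e) e\<^esub> (x \<cdot> e) = y"
    by (rule subgroup_inv_eq[OF unit_group_subgroup[OF ec ee] xyu yu])
      (use x yc ec ee xy in \<open>simp add: mult_assoc[symmetric]\<close>, simp add: e_def)
  then have "is_pseudoinverse S x y"
    unfolding is_pseudoinverse_def using unit_group_maximal[OF ec ee] n(1) u by metis
  then show ?thesis using unit_group_subgroup[OF ec ee] n(1) u unfolding y_def by blast
qed

end

lemma epigroup_iff: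
  "epigroup S \<longleftrightarrow> algebra_2_1 S \<and> associative S \<and> (\<forall>x\<in>carrier S. associative_algebra.drazin S x)"
proof (cases "algebra_2_1 S \<and> associative S")
  case True
  then interpret associative_algebra S by unfold_locales auto
  show ?thesis unfolding epigroup_def using True pseudoinverse_drazin drazin_pseudoinverse by blast
qed (auto simp: epigroup_def)

section \<open>Epigroup theories\<close>

primrec tpow :: "uterm \<Rightarrow> nat \<Rightarrow> uterm" where
  "tpow t 0 = t"
| "tpow t (Suc k) = Mul (tpow t k) t"

abbreviation "Om t \<equiv> Mul t (Bar t)"

text \<open>The equational theories of epigroup varieties: the index of an element has to be bounded uniformly, since
  otherwise some direct product of members would not be an epigroup. Here \<open>tpow t n\<close> is
  \<open>t\<^sup>n\<^sup>+\<^sup>1\<close>, as there is no empty term.\<close>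

definition epi_theory :: "identity set \<Rightarrow> bool" where
  "epi_theory \<Theta> \<longleftrightarrow> equational_theory \<Theta> \<and>
     (Mul (Mul (Var 0) (Var 1)) (Var 2), Mul (Var 0) (Mul (Var 1) (Var 2))) \<in> \<Theta> \<and>
     (Om (Var 0), Mul (Bar (Var 0)) (Var 0)) \<in> \<Theta> \<and>
     (Mul (Om (Var 0)) (Bar (Var 0)), Bar (Var 0)) \<in> \<Theta> \<and>
     (\<exists>n. (Mul (tpow (Var 0) (Suc n)) (Bar (Var 0)), tpow (Var 0) n) \<in> \<Theta>)"

lemma eval_tpow: "eval S \<rho> (tpow t k) = spow S (eval S \<rho> t) (Suc k)"
  by (induction k) (simp_all add: spow_def)

lemma subst_tpow: "subst \<sigma> (tpow t k) = tpow (subst \<sigma> t) k"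
  by (induction k) simp_all

lemma satisfies_associative:
  assumes "algebra_2_1 S"
  shows "satisfies S (Mul (Mul (Var 0) (Var 1)) (Var 2), Mul (Var 0) (Mul (Var 1) (Var 2))) \<longleftrightarrow> associative S"
proof
  assume s: "satisfies S (Mul (Mul (Var 0) (Var 1)) (Var 2), Mul (Var 0) (Mul (Var 1) (Var 2)))"
  show "associative S" unfolding associative_def
  proof (intro ballI)
    fix x y z assume "x \<in> carrier S" "y \<in> carrier S" "z \<in> carrier S"
    then show "x \<cdot>\<^bsub>S\<^esub> y \<cdot>\<^bsub>S\<^esub> z = x \<cdot>\<^bsub>S\<^esub> (y \<cdot>\<^bsub>S\<^esub> z)"
      using s[unfolded satisfies_def, rule_format, of "\<lambda>i. if i = 0 then x else if i = 1 then y else z"] by simp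
  qed
qed (auto simp: associative_def satisfies_def)

lemma satisfies_one_letter:
  assumes "satisfies S p" "x \<in> carrier S"
  shows "eval S (\<lambda>_. x) (fst p) = eval S (\<lambda>_. x) (snd p)"
  using assms by (simp add: satisfies_def)

lemma models_epigroup:
  assumes T: "epi_theory \<Theta>" and S: "S \<in> models \<Theta>"
  shows "epigroup S"
proof -
  have alg: "algebra_2_1 S" and sat: "\<And>p. p \<in> \<Theta> \<Longrightarrow> satisfies S p" using S by (simp_all add: models_def)
  have asc: "associative S" using T sat satisfies_associative[OF alg] by (simp add: epi_theory_def)
  interpret associative_algebra S by unfold_locales (rule alg asc)+
  obtain n where n: "(Mul (tpow (Var 0) (Suc n)) (Bar (Var 0)), tpow (Var 0) n) \<in> \<Theta>"
    using T by (auto simp: epi_theory_def)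
  have "drazin x" if x: "x \<in> carrier S" for x
  proof -
    have "(Om (Var 0), Mul (Bar (Var 0)) (Var 0)) \<in> \<Theta>" "(Mul (Om (Var 0)) (Bar (Var 0)), Bar (Var 0)) \<in> \<Theta>"
      using T by (simp_all add: epi_theory_def)
    from this[THEN sat, THEN satisfies_one_letter, OF x] n[THEN sat, THEN satisfies_one_letter, OF x]
    show ?thesis unfolding drazin_def by (intro conjI exI[of _ "Suc n"]) (simp_all add: eval_tpow del: tpow.simps)
  qed
  then show ?thesis unfolding epigroup_iff using alg asc by blast
qed

text \<open>The free algebra of a variety belongs to the variety, hence is an epigroup, and the index of its generator
  is a bound that is valid throughout the variety.\<close>

lemma epi_theory_Eq:
  assumes inf: "infinite (UNIV :: 'u set)" and V: "epigroup_variety (V :: 'u unary_semigroup set)"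
  shows "epi_theory (Eq V)" "models (Eq V) = V"
proof -
  obtain \<Sigma> where \<Sigma>: "V = models \<Sigma>" and epi: "\<And>S. S \<in> V \<Longrightarrow> epigroup S"
    using V by (auto simp: epigroup_variety_def)
  show m: "models (Eq V) = V" unfolding \<Sigma> by (rule models_Eq)
  have T: "equational_theory (Eq V)" unfolding \<Sigma> by (rule equational_theory_Eq_models)
  obtain S :: "'u unary_semigroup" and g where S: "algebra_2_1 S" "\<And>p. satisfies S p \<longleftrightarrow> p \<in> Eq V"
    and g: "\<And>k. g k \<in> carrier S" "\<And>s t. eval S g s = eval S g t \<longleftrightarrow> (s, t) \<in> Eq V"
    using free_algebra[OF inf T] by metis
  have "S \<in> V" using S m unfolding models_def by blast
  then have "epigroup S" by (rule epi)
  then have asc: "associative S" and dr: "\<And>x. x \<in> carrier S \<Longrightarrow> associative_algebra.drazin S x"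
    by (auto simp: epigroup_iff)
  interpret associative_algebra S by unfold_locales (rule S asc)+
  note d = dr[OF g(1)[of 0], unfolded drazin_def]
  \<comment> \<open>The index of the generic element bounds the index of every element of every member.\<close>
  obtain n where n: "1 \<le> n" "spow S (g 0) (Suc n) \<cdot>\<^bsub>S\<^esub> pinv S (g 0) = spow S (g 0) n" using d by blast
  have "(Mul (tpow (Var 0) (Suc (n - 1))) (Bar (Var 0)), tpow (Var 0) (n - 1)) \<in> Eq V"
    unfolding g(2)[symmetric] using n by (simp add: eval_tpow del: tpow.simps)
  moreover have "(Om (Var 0), Mul (Bar (Var 0)) (Var 0)) \<in> Eq V"
    "(Mul (Om (Var 0)) (Bar (Var 0)), Bar (Var 0)) \<in> Eq V"
    unfolding g(2)[symmetric] eval.simps using d by blast+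
  moreover have "(Mul (Mul (Var 0) (Var 1)) (Var 2), Mul (Var 0) (Mul (Var 1) (Var 2))) \<in> Eq V"
    using satisfies_associative[OF S(1)] asc S(2) by blast
  ultimately show "epi_theory (Eq V)"
    unfolding epi_theory_def using T by blast
qed

lemma epigroup_variety_models: "epi_theory \<Theta> \<Longrightarrow> epigroup_variety (models \<Theta>)"
  using models_epigroup unfolding epigroup_variety_def by blast

lemma epi_theory_Int:
  assumes A: "epi_theory A" and B: "epi_theory B" shows "epi_theory (A \<inter> B)"
proof -
  have T: "equational_theory A" "equational_theory B" using A B by (simp_all add: epi_theory_def)
  let ?x = "Var 0"
  have step: "(Mul (tpow ?x (Suc (n + k))) (Bar ?x), tpow ?x (n + k)) \<in> \<Theta>"
    if E: "epi_theory \<Theta>" and n: "(Mul (tpow ?x (Suc n)) (Bar ?x), tpow ?x n) \<in> \<Theta>" for \<Theta> n k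
  proof (induction k)
    case (Suc k)
    have T: "equational_theory \<Theta>" using E by (simp add: epi_theory_def)
    have assoc: "(Mul (Mul r s) t, Mul r (Mul s t)) \<in> \<Theta>" for r s t
      using et_subst[OF T, of _ _ "\<lambda>i. if i = 0 then r else if i = 1 then s else t"] E
      unfolding epi_theory_def by fastforce
    have "(Mul (Mul (tpow ?x (Suc (n + k))) ?x) (Bar ?x), Mul (tpow ?x (Suc (n + k))) (Om ?x)) \<in> \<Theta>"
      by (rule assoc)
    also have "(Mul (tpow ?x (Suc (n + k))) (Om ?x), Mul (tpow ?x (Suc (n + k))) (Mul (Bar ?x) ?x)) \<in> \<Theta>"
      using E et_Mul[OF T et_refl[OF T]] by (simp add: epi_theory_def)
    also (et_trans[OF T]) have "(Mul (tpow ?x (Suc (n + k))) (Mul (Bar ?x) ?x), Mul (Mul (tpow ?x (Suc (n + k))) (Bar ?x)) ?x) \<in> \<Theta>"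
      by (rule et_sym[OF T assoc])
    also (et_trans[OF T]) have "(Mul (Mul (tpow ?x (Suc (n + k))) (Bar ?x)) ?x, Mul (tpow ?x (n + k)) ?x) \<in> \<Theta>"
      by (rule et_Mul[OF T Suc et_refl[OF T]])
    finally (et_trans[OF T]) show ?case by simp
  qed (use n in simp)
  obtain m where m: "(Mul (tpow ?x (Suc m)) (Bar ?x), tpow ?x m) \<in> A" using A by (auto simp: epi_theory_def)
  obtain n where n: "(Mul (tpow ?x (Suc n)) (Bar ?x), tpow ?x n) \<in> B" using B by (auto simp: epi_theory_def)
  have "(Mul (tpow ?x (Suc (m + n))) (Bar ?x), tpow ?x (m + n)) \<in> A \<inter> B"
    using step[OF A m, of n] step[OF B n, of m] by (simp add: add.commute)
  then show ?thesis
    using A B equational_theory_Int[OF T] unfolding epi_theory_def by blast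
qed

lemma epi_theory_mono:
  "epi_theory A \<Longrightarrow> A \<subseteq> B \<Longrightarrow> equational_theory B \<Longrightarrow> epi_theory B"
  unfolding epi_theory_def by blast

subsection \<open>The lattice of epigroup varieties in terms of theories\<close>

lemma EPI_join:
  assumes inf: "infinite (UNIV :: 'u set)"
    and X: "epigroup_variety (X :: 'u unary_semigroup set)" and Y: "epigroup_variety Y"
  shows "X \<squnion>\<^bsub>EPI\<^esub> Y = models (Eq X \<inter> Eq Y)"
proof -
  let ?J = "models (Eq X \<inter> Eq Y) :: 'u unary_semigroup set"
  have le: "(A \<sqsubseteq>\<^bsub>EPI\<^esub> B) = (A \<subseteq> B)" for A B :: "'u unary_semigroup set" by (simp add: EPI_def)
  have v: "epigroup_variety ?J"
    by (intro epigroup_variety_models epi_theory_Int epi_theory_Eq inf X Y)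
  have up: "X \<subseteq> ?J" "Y \<subseteq> ?J"
    using epi_theory_Eq(2)[OF inf X] epi_theory_Eq(2)[OF inf Y]
      models_antimono[of "Eq X \<inter> Eq Y" "Eq X"] models_antimono[of "Eq X \<inter> Eq Y" "Eq Y"] by auto
  have low: "?J \<subseteq> W" if W: "epigroup_variety W" "X \<subseteq> W" "Y \<subseteq> W" for W
  proof -
    have "Eq W \<subseteq> Eq X \<inter> Eq Y" using W by (simp add: Eq_antimono)
    then have "?J \<subseteq> models (Eq W)" by (rule models_antimono)
    then show ?thesis using epi_theory_Eq(2)[OF inf W(1)] by simp
  qed
  have l: "least EPI ?J (Upper EPI {X, Y})"
    using v X Y up low by (auto simp: least_def Upper_def EPI_def)
  have "W = ?J" if W: "least EPI W (Upper EPI {X, Y})" for W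
  proof (rule equalityI)
    have c: "W \<in> Upper EPI {X, Y}" "?J \<in> Upper EPI {X, Y}" using W l unfolding least_def by (auto simp only:)
    have "W \<sqsubseteq>\<^bsub>EPI\<^esub> ?J" using W c(2) unfolding least_def by (elim conjE) (erule bspec)
    then show "W \<subseteq> ?J" by (simp only: le)
    have "?J \<sqsubseteq>\<^bsub>EPI\<^esub> W" using l c(1) unfolding least_def by (elim conjE) (erule bspec)
    then show "?J \<subseteq> W" by (simp only: le)
  qed
  with l show ?thesis unfolding join_def sup_def by (rule some_equality)
qed

lemma Eq_EPI_join:
  assumes inf: "infinite (UNIV :: 'u set)"
    and X: "epigroup_variety (X :: 'u unary_semigroup set)" and Y: "epigroup_variety Y"
  shows "Eq (X \<squnion>\<^bsub>EPI\<^esub> Y) = Eq X \<inter> Eq Y" "epigroup_variety (X \<squnion>\<^bsub>EPI\<^esub> Y)"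
proof -
  have T: "epi_theory (Eq X \<inter> Eq Y)" by (intro epi_theory_Int epi_theory_Eq inf X Y)
  show "Eq (X \<squnion>\<^bsub>EPI\<^esub> Y) = Eq X \<inter> Eq Y"
    unfolding EPI_join[OF assms] by (rule Eq_models[OF inf]) (use T in \<open>simp add: epi_theory_def\<close>)
  show "epigroup_variety (X \<squnion>\<^bsub>EPI\<^esub> Y)"
    unfolding EPI_join[OF assms] by (rule epigroup_variety_models[OF T])
qed

lemma Eq_variety_Int:
  assumes inf: "infinite (UNIV :: 'u set)"
    and X: "epigroup_variety (X :: 'u unary_semigroup set)" and Y: "epigroup_variety Y"
  shows "Eq (X \<inter> Y) = (Eq X \<union> Eq Y)\<^sup>*" "epigroup_variety (X \<inter> Y)"
proof -
  have T: "equational_theory ((Eq X \<union> Eq Y)\<^sup>*)"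
    using epi_theory_Eq(1)[OF inf X] epi_theory_Eq(1)[OF inf Y]
    by (intro equational_theory_join) (simp_all add: epi_theory_def)
  have m: "models ((Eq X \<union> Eq Y)\<^sup>*) = X \<inter> Y"
    unfolding models_join by (simp add: epi_theory_Eq(2)[OF inf] X Y)
  show "Eq (X \<inter> Y) = (Eq X \<union> Eq Y)\<^sup>*"
    unfolding m[symmetric] by (rule Eq_models[OF inf T])
  have "epi_theory ((Eq X \<union> Eq Y)\<^sup>*)"
    using epi_theory_mono[OF epi_theory_Eq(1)[OF inf X] _ T] by blast
  then show "epigroup_variety (X \<inter> Y)" unfolding m[symmetric] by (rule epigroup_variety_models)
qed

text \<open>Passing to theories turns the order around: joins become intersections, meets become transitive closures,
  and one inclusion of the modular law is automatic.\<close>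

lemma upper_modular_iff:
  assumes inf: "infinite (UNIV :: 'u set)" and V: "epigroup_variety (V :: 'u unary_semigroup set)"
  shows "upper_modular EPI V \<longleftrightarrow>
    (\<forall>Y Z. epi_theory Y \<longrightarrow> epi_theory Z \<longrightarrow> Eq V \<subseteq> Y \<longrightarrow>
      Y \<inter> (Z \<union> Eq V)\<^sup>* \<subseteq> (Eq V \<union> (Z \<inter> Y))\<^sup>*)" (is "_ \<longleftrightarrow> ?R")
proof -
  have car: "W \<in> carrier EPI \<longleftrightarrow> epigroup_variety W" for W :: "'u unary_semigroup set" by (simp add: EPI_def)
  have le: "(A \<sqsubseteq>\<^bsub>EPI\<^esub> B) = (A \<subseteq> B)" for A B :: "'u unary_semigroup set" by (simp add: EPI_def)
  have lhs: "epigroup_variety ((Z \<squnion>\<^bsub>EPI\<^esub> Y) \<sqinter>\<^bsub>EPI\<^esub> V) \<and> Eq ((Z \<squnion>\<^bsub>EPI\<^esub> Y) \<sqinter>\<^bsub>EPI\<^esub> V) = (Eq V \<union> (Eq Z \<inter> Eq Y))\<^sup>*"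
    and rhs: "epigroup_variety ((Z \<sqinter>\<^bsub>EPI\<^esub> V) \<squnion>\<^bsub>EPI\<^esub> Y) \<and> Eq ((Z \<sqinter>\<^bsub>EPI\<^esub> V) \<squnion>\<^bsub>EPI\<^esub> Y) = (Eq Z \<union> Eq V)\<^sup>* \<inter> Eq Y"
    if YZ: "epigroup_variety Y" "epigroup_variety Z" for Y Z
  proof -
    note j = Eq_EPI_join[OF inf YZ(2,1)]
    have "(Z \<squnion>\<^bsub>EPI\<^esub> Y) \<sqinter>\<^bsub>EPI\<^esub> V = (Z \<squnion>\<^bsub>EPI\<^esub> Y) \<inter> V" by (rule EPI_meet) (simp_all add: car j V)
    then show "epigroup_variety ((Z \<squnion>\<^bsub>EPI\<^esub> Y) \<sqinter>\<^bsub>EPI\<^esub> V) \<and> Eq ((Z \<squnion>\<^bsub>EPI\<^esub> Y) \<sqinter>\<^bsub>EPI\<^esub> V) = (Eq V \<union> (Eq Z \<inter> Eq Y))\<^sup>*"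
      using Eq_variety_Int[OF inf j(2) V] j(1) by (simp add: Un_commute)
    have "Z \<sqinter>\<^bsub>EPI\<^esub> V = Z \<inter> V" by (rule EPI_meet) (simp_all add: car YZ V)
    then show "epigroup_variety ((Z \<sqinter>\<^bsub>EPI\<^esub> V) \<squnion>\<^bsub>EPI\<^esub> Y) \<and> Eq ((Z \<sqinter>\<^bsub>EPI\<^esub> V) \<squnion>\<^bsub>EPI\<^esub> Y) = (Eq Z \<union> Eq V)\<^sup>* \<inter> Eq Y"
      using Eq_variety_Int[OF inf YZ(2) V] Eq_EPI_join[OF inf _ YZ(1), of "Z \<inter> V"] by simp
  qed
  show ?thesis
  proof
    assume um: "upper_modular EPI V"
    show ?R
    proof (intro allI impI)
      fix Y Z assume Y: "epi_theory Y" and Z: "epi_theory Z" and YV: "Eq V \<subseteq> Y"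
      let ?Y = "models Y :: 'u unary_semigroup set" and ?Z = "models Z :: 'u unary_semigroup set"
      have v: "epigroup_variety ?Y" "epigroup_variety ?Z" using Y Z by (simp_all add: epigroup_variety_models)
      have E: "Eq ?Y = Y" "Eq ?Z = Z" using Y Z by (simp_all add: Eq_models[OF inf] epi_theory_def)
      have "?Y \<subseteq> V" using models_antimono[OF YV] epi_theory_Eq(2)[OF inf V] by blast
      then have "(?Z \<squnion>\<^bsub>EPI\<^esub> ?Y) \<sqinter>\<^bsub>EPI\<^esub> V = (?Z \<sqinter>\<^bsub>EPI\<^esub> V) \<squnion>\<^bsub>EPI\<^esub> ?Y"
        using um v by (simp add: upper_modular_def car le)
      then show "Y \<inter> (Z \<union> Eq V)\<^sup>* \<subseteq> (Eq V \<union> (Z \<inter> Y))\<^sup>*"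
        using lhs[OF v] rhs[OF v] by (simp add: E Int_commute)
    qed
  next
    assume R: ?R
    show "upper_modular EPI V" unfolding upper_modular_def car le
    proof (intro conjI V ballI impI)
      fix Y Z :: "'u unary_semigroup set" assume "Y \<in> carrier EPI" "Z \<in> carrier EPI" and YV: "Y \<subseteq> V"
      then have v: "epigroup_variety Y" "epigroup_variety Z" by (simp_all add: car)
      have VY: "Eq V \<subseteq> Eq Y" using YV by (rule Eq_antimono)
      have "Eq Y \<inter> (Eq Z \<union> Eq V)\<^sup>* \<subseteq> (Eq V \<union> (Eq Z \<inter> Eq Y))\<^sup>*"
        using R v VY by (simp add: epi_theory_Eq[OF inf])
      moreover have "(Eq V \<union> (Eq Z \<inter> Eq Y))\<^sup>* \<subseteq> (Eq Z \<union> Eq V)\<^sup>*" by (rule rtrancl_mono) blast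
      moreover have "(Eq V \<union> (Eq Z \<inter> Eq Y))\<^sup>* \<subseteq> Eq Y"
      proof -
        have T: "equational_theory (Eq Y)" using epi_theory_Eq(1)[OF inf v(1)] by (simp add: epi_theory_def)
        have "(s, t) \<in> Eq Y" if "(s, t) \<in> (Eq V \<union> (Eq Z \<inter> Eq Y))\<^sup>*" for s t
          using that
        proof (induction rule: rtrancl_induct)
          case (step t r)
          then have "(t, r) \<in> Eq Y" using VY by blast
          with step(3) show ?case by (rule et_trans[OF T])
        qed (rule et_refl[OF T])
        then show ?thesis by auto
      qed
      ultimately have "Eq ((Z \<squnion>\<^bsub>EPI\<^esub> Y) \<sqinter>\<^bsub>EPI\<^esub> V) = Eq ((Z \<sqinter>\<^bsub>EPI\<^esub> V) \<squnion>\<^bsub>EPI\<^esub> Y)"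
        using lhs[OF v] rhs[OF v] by auto
      then show "(Z \<squnion>\<^bsub>EPI\<^esub> Y) \<sqinter>\<^bsub>EPI\<^esub> V = (Z \<sqinter>\<^bsub>EPI\<^esub> V) \<squnion>\<^bsub>EPI\<^esub> Y"
        using lhs[OF v] rhs[OF v] epi_theory_Eq(2)[OF inf] by metis
    qed
  qed
qed

section \<open>Generic elements of an epigroup theory\<close>

text \<open>Adding a unit to the free algebra of a theory gives an epigroup with a unit, in which the computations
  take place; \<open>None\<close> is the new unit and \<open>cl\<close> sends a term to its class.\<close>

definition cl :: "identity set \<Rightarrow> uterm \<Rightarrow> uterm option" where
  "cl \<Theta> t = Some (nf \<Theta> t)"

fun tmul :: "identity set \<Rightarrow> uterm option \<Rightarrow> uterm option \<Rightarrow> uterm option" where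
  "tmul \<Theta> None b = b"
| "tmul \<Theta> (Some s) None = Some s"
| "tmul \<Theta> (Some s) (Some t) = Some (nf \<Theta> (Mul s t))"

definition tbr :: "identity set \<Rightarrow> uterm option \<Rightarrow> uterm option" where
  "tbr \<Theta> = map_option (\<lambda>s. nf \<Theta> (Bar s))"

lemma epi_theory_instances:
  assumes T: "epi_theory \<Theta>"
  shows "(Mul (Mul r s) t, Mul r (Mul s t)) \<in> \<Theta>" "(Om t, Mul (Bar t) t) \<in> \<Theta>"
    "(Mul (Om t) (Bar t), Bar t) \<in> \<Theta>" "\<exists>n. \<forall>t. (Mul (tpow t (Suc n)) (Bar t), tpow t n) \<in> \<Theta>"
proof -
  have E: "equational_theory \<Theta>" using T by (simp add: epi_theory_def)
  let ?\<sigma> = "\<lambda>i::nat. if i = 0 then r else if i = 1 then s else t" and ?\<tau> = "\<lambda>t i. t"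
  note i = T[unfolded epi_theory_def]
  show "(Mul (Mul r s) t, Mul r (Mul s t)) \<in> \<Theta>"
    using et_subst[OF E i[THEN conjunct2, THEN conjunct1], of ?\<sigma>] by simp
  show "(Om t, Mul (Bar t) t) \<in> \<Theta>"
    using et_subst[OF E i[THEN conjunct2, THEN conjunct2, THEN conjunct1], of "?\<tau> t"] by simp
  show "(Mul (Om t) (Bar t), Bar t) \<in> \<Theta>"
    using et_subst[OF E i[THEN conjunct2, THEN conjunct2, THEN conjunct2, THEN conjunct1], of "?\<tau> t"] by simp
  obtain n where n: "(Mul (tpow (Var 0) (Suc n)) (Bar (Var 0)), tpow (Var 0) n) \<in> \<Theta>" using i by blast
  have "(Mul (tpow t (Suc n)) (Bar t), tpow t n) \<in> \<Theta>" for t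
    using et_subst[OF E n, of "?\<tau> t"] by (simp add: subst_tpow)
  then show "\<exists>n. \<forall>t. (Mul (tpow t (Suc n)) (Bar t), tpow t n) \<in> \<Theta>" by blast
qed

lemma cl_eq_iff: "equational_theory \<Theta> \<Longrightarrow> cl \<Theta> s = cl \<Theta> t \<longleftrightarrow> (s, t) \<in> \<Theta>"
  by (simp add: cl_def nf_eq_iff)

lemma cl_Mul: "equational_theory \<Theta> \<Longrightarrow> cl \<Theta> (Mul s t) = tmul \<Theta> (cl \<Theta> s) (cl \<Theta> t)"
  by (simp add: cl_def nf_Mul)

lemma cl_Bar: "equational_theory \<Theta> \<Longrightarrow> cl \<Theta> (Bar t) = tbr \<Theta> (cl \<Theta> t)"
  by (simp add: cl_def nf_Bar tbr_def)

lemma theory_epi_monoid: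
  assumes T: "epi_theory \<Theta>"
  shows "class.epi_monoid None (tmul \<Theta>) (tbr \<Theta>)"
proof -
  have E: "equational_theory \<Theta>" using T by (simp add: epi_theory_def)
  note R = et_refl[OF E] and S = et_sym[OF E] and tr = et_trans[OF E] and M = et_Mul[OF E] and I = epi_theory_instances[OF T]
  have nfr: "(nf \<Theta> t, t) \<in> \<Theta>" for t by (rule S[OF nf_related[OF E]])
  have assoc: "tmul \<Theta> (tmul \<Theta> a b) c = tmul \<Theta> a (tmul \<Theta> b c)" for a b c
  proof (cases "a = None \<or> b = None \<or> c = None")
    case False
    then obtain r s t where "a = Some r" "b = Some s" "c = Some t" by auto
    moreover have "(Mul (nf \<Theta> (Mul r s)) t, Mul r (nf \<Theta> (Mul s t))) \<in> \<Theta>"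
      using tr[OF tr[OF M[OF nfr R] I(1)] S[OF M[OF R nfr]]] .
    ultimately show ?thesis by (simp add: nf_eq_iff E)
  qed (cases a; cases b; cases c; auto)+
  interpret m: monoid_mult None "tmul \<Theta>"
  proof
    show "tmul \<Theta> a None = a" for a by (cases a) simp_all
  qed (rule assoc, simp)
  obtain n where n: "\<And>t. (Mul (tpow t (Suc n)) (Bar t), tpow t n) \<in> \<Theta>" using I(4) by blast
  have pw: "m.power (Some t) (Suc (Suc k)) = cl \<Theta> (tpow t (Suc k))" for t k
  proof (induction k)
    case (Suc k)
    have "m.power (Some t) (Suc (Suc (Suc k))) = tmul \<Theta> (cl \<Theta> (tpow t (Suc k))) (Some t)"
      using Suc by (simp only: m.power_Suc2[of _ "Suc (Suc k)"])
    also have "\<dots> = cl \<Theta> (tpow t (Suc (Suc k)))"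
      by (simp add: cl_def nf_eq_iff E M nfr R)
    finally show ?case .
  qed (simp add: cl_def)
  show ?thesis
  proof unfold_locales
    fix a
    show "tmul \<Theta> a (tbr \<Theta> a) = tmul \<Theta> (tbr \<Theta> a) a"
    proof (cases a)
      case (Some t)
      have "(Mul t (nf \<Theta> (Bar t)), Mul (nf \<Theta> (Bar t)) t) \<in> \<Theta>"
        using tr[OF tr[OF M[OF R nfr] I(2)] S[OF M[OF nfr R]]] .
      then show ?thesis by (simp add: Some tbr_def nf_eq_iff E)
    qed (simp add: tbr_def)
    show "tmul \<Theta> (tmul \<Theta> a (tbr \<Theta> a)) (tbr \<Theta> a) = tbr \<Theta> a"
    proof (cases a)
      case (Some t)
      have "(Mul (nf \<Theta> (Mul t (nf \<Theta> (Bar t)))) (nf \<Theta> (Bar t)), Bar t) \<in> \<Theta>"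
        by (rule tr[OF M[OF tr[OF nfr M[OF R nfr]] nfr] I(3)])
      then show ?thesis by (simp add: Some tbr_def nf_eq_iff E)
    qed (simp add: tbr_def)
    show "\<exists>n. tmul \<Theta> (m.power a (n + 1)) (tbr \<Theta> a) = m.power a n"
    proof (cases a)
      case None
      then show ?thesis by (intro exI[of _ 0]) (simp add: tbr_def)
    next
      case (Some t)
      have "(Mul (nf \<Theta> (tpow t (Suc (Suc n)))) (nf \<Theta> (Bar t)), tpow t (Suc n)) \<in> \<Theta>"
      proof -
        have "(Mul (Mul (tpow t (Suc n)) t) (Bar t), Mul (tpow t (Suc n)) (Mul (Bar t) t)) \<in> \<Theta>"
          by (rule tr[OF I(1) M[OF R I(2)]])
        then have "(Mul (Mul (tpow t (Suc n)) t) (Bar t), Mul (tpow t n) t) \<in> \<Theta>"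
          by (rule tr[OF tr[OF _ S[OF I(1)]] M[OF n R]])
        then show ?thesis using tr[OF M[OF nfr nfr]] by simp
      qed
      then have "tmul \<Theta> (cl \<Theta> (tpow t (Suc (Suc n)))) (tbr \<Theta> (Some t)) = cl \<Theta> (tpow t (Suc n))"
        by (simp add: cl_def tbr_def nf_eq_iff E)
      then show ?thesis unfolding Some
        by (intro exI[of _ "Suc (Suc n)"]) (simp only: pw Suc_eq_plus1[symmetric])
    qed
  qed
qed

definition gpt :: "uterm \<Rightarrow> int \<Rightarrow> uterm" where
  "gpt t j = Mul (tpow t (nat j)) (tpow (Bar t) (nat (- j)))"

text \<open>\<open>periods \<Theta>\<close> consists of all \<open>j\<close> with
  \<open>x\<^sup>\<omega>\<^sup>+\<^sup>j = x\<^sup>\<omega>\<close>, that is, of the multiples of the exponent of the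
  groups of the variety.\<close>

definition periods :: "identity set \<Rightarrow> int set" where
  "periods \<Theta> = {j. (gpt (Var 0) j, gpt (Var 0) 0) \<in> \<Theta>}"

text \<open>\<open>tloc k\<close> is \<open>e f\<^sup>k\<close> for the generic idempotent \<open>e =
  x\<^sup>\<omega>\<close> and the generic element \<open>f = e y e\<close> of its local monoid, and \<open>index
  \<Theta> k\<close> says that \<open>f\<^sup>k\<close> always lies in a subgroup of that monoid. Unlike
  \<open>x\<^sup>k = x\<^sup>k x\<^sup>\<omega>\<close> this is insensitive to the nil-semigroups of the variety, and
  the case \<open>k = 0\<close> makes sense.\<close>

primrec tloc :: "nat \<Rightarrow> uterm" where
  "tloc 0 = Om (Var 0)"
| "tloc (Suc k) = Mul (tloc k) (Mul (Mul (Om (Var 0)) (Var 1)) (Om (Var 0)))"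

definition index :: "identity set \<Rightarrow> nat \<Rightarrow> bool" where
  "index \<Theta> k \<longleftrightarrow> (tloc k, Mul (tloc k) (Om (Mul (Mul (Om (Var 0)) (Var 1)) (Om (Var 0))))) \<in> \<Theta>"

primrec hasbar :: "uterm \<Rightarrow> bool" where
  "hasbar (Var i) = False"
| "hasbar (Mul s t) = (hasbar s \<or> hasbar t)"
| "hasbar (Bar t) = True"

text \<open>Modulo \<open>\<Theta>\<close> such a term contains a group element as a factor, so it takes the value
  zero in all nil-semigroups of the variety. This is how \<open>p = 0\<close> is expressed when there is no zero in
  general.\<close>

definition vanishes :: "identity set \<Rightarrow> uterm \<Rightarrow> bool" where
  "vanishes \<Theta> p \<longleftrightarrow> (\<exists>p'. (p, p') \<in> \<Theta> \<and> hasbar p')"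

text \<open>Idempotents are central and local monoids are commutative.\<close>

definition permutative :: "identity set \<Rightarrow> bool" where
  "permutative \<Theta> \<longleftrightarrow> (Mul (Om (Var 0)) (Var 1), Mul (Var 1) (Om (Var 0))) \<in> \<Theta> \<and>
     (Mul (Mul (Om (Var 0)) (Var 1)) (Var 2), Mul (Mul (Om (Var 0)) (Var 2)) (Var 1)) \<in> \<Theta>"

context epi_monoid
begin

text \<open>A term model that satisfies exactly the identities of \<open>\<Theta>\<close>; in the application
  \<open>K\<close> is \<open>cl \<Theta>\<close>.\<close>

definition model :: "identity set \<Rightarrow> (uterm \<Rightarrow> 'a) \<Rightarrow> bool" where
  "model \<Theta> K \<longleftrightarrow> (\<forall>s t. K (Mul s t) = K s * K t) \<and> (\<forall>t. K (Bar t) = br (K t)) \<and>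
     (\<forall>s t. (s, t) \<in> \<Theta> \<longleftrightarrow> K s = K t) \<and> equational_theory \<Theta>"

lemma left_commutes: "x * y = y * x \<Longrightarrow> x * (y * z) = y * (x * z)"
  by (metis mult.assoc)

lemma gp_unfold: "x ^ m * om x = gp x (int m)"
  using power_gp[of x m 0] by (simp add: gp_0)

lemma om_gp: "om x * gp x j = gp x j" "gp x j * om x = gp x j"
  using gp_mult[of x 0 j] gp_mult[of x j 0] by (simp_all add: gp_0)

lemma br_absorb_idem: "e * x = x \<Longrightarrow> x * e = x \<Longrightarrow> e * br x = br x" "e * x = x \<Longrightarrow> x * e = x \<Longrightarrow> br x * e = br x"
proof -
  assume a: "e * x = x" "x * e = x"
  have "br x = x * (br x * br x)" using br_inner[of x] by (simp add: mult.assoc)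
  then show "e * br x = br x" using a by (metis mult.assoc)
  then show "br x * e = br x" using a commutes_br[of x e] by simp
qed

lemma absorb_gp: "e * x = x \<Longrightarrow> e * gp x j = gp x j"
  unfolding gp_def by (simp add: mult.assoc[symmetric])

lemma part_absorb_om:
  assumes "e * e = e" "e * f = f" "f * e = f" "k = \<infinity> \<or> e * part f k j * om f = e * part f k j"
  shows "om f * (e * part f k j) = e * part f k j"
proof -
  have "om f * e = om f" unfolding om_def using br_absorb_idem(2)[OF assms(2,3)] by (simp add: mult.assoc)
  moreover have "e * om f = om f" unfolding om_def using assms(2) by (simp add: mult.assoc[symmetric])
  moreover have "om f * part f k j = part f k j * om f" by (rule commutes_part) (rule om_commutes)
  ultimately have "om f * (e * part f k j) = e * part f k j * om f" by (metis mult.assoc)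
  moreover have "part f \<infinity> j * om f = part f \<infinity> j" by (simp add: part_def om_gp)
  ultimately show ?thesis using assms(4) by (metis mult.assoc)
qed

lemma pr_absorb:
  assumes c: "\<And>i. a * g i = g i * a" "\<And>i. e * g i = g i * e" and a: "a * (e * g x) = e * g x" and x: "x < n"
    and ee: "e * e = e"
  shows "a * (e * pr g n) = e * pr g n"
  using x
proof (induction n)
  case (Suc n)
  have ce: "e * pr g n = pr g n * e" by (rule commutes_pr[OF c(2)])
  have ca: "a * pr g n = pr g n * a" by (rule commutes_pr[OF c(1)])
  show ?case
  proof (cases "x = n")
    case True
    have "a * (e * pr g (Suc n)) = pr g n * (a * (e * g n))" 
      by (simp add: mult.assoc left_commutes[OF ce] left_commutes[OF ca])
    also have "\<dots> = pr g n * (e * g n)" using a True by simp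
    also have "\<dots> = e * pr g (Suc n)" by (simp add: left_commutes[OF ce])
    finally show ?thesis .
  next
    case False
    then have "a * (e * pr g n) = e * pr g n" using Suc by simp
    then have "a * (e * pr g n) * g n = e * pr g n * g n" by simp
    then show ?thesis by (simp add: mult.assoc)
  qed
qed simp

lemma pr_eqI:
  assumes c: "\<And>i. e * g i = g i * e" "\<And>i. e * h i = h i * e" and ee: "e * e = e"
    and eq: "\<And>i. e * g i = e * h i"
  shows "e * pr g n = e * pr h n"
proof (induction n)
  case (Suc n)
  have ab: "e * (e * x) = e * x" for x using ee by (simp add: mult.assoc[symmetric])
  have "e * pr g (Suc n) = (e * pr g n) * (e * g n)"
    using left_commutes[OF commutes_pr[of e g n, OF c(1)]] by (simp add: mult.assoc ab)
  also have "\<dots> = (e * pr h n) * (e * h n)" using Suc eq by simp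
  also have "\<dots> = e * pr h (Suc n)"
    using left_commutes[OF commutes_pr[of e h n, OF c(2)]] by (simp add: mult.assoc ab)
  finally show ?case .
qed simp

context
  fixes \<Theta> K assumes mod: "model \<Theta> K"
begin

lemma K_simps: "K (Mul s t) = K s * K t" "K (Bar t) = br (K t)"
  using mod by (simp_all add: model_def)

lemma K_iff: "(s, t) \<in> \<Theta> \<longleftrightarrow> K s = K t"
  using mod by (simp add: model_def)

lemma K_theory: "equational_theory \<Theta>"
  using mod by (simp add: model_def)

lemma K_subst: "K (subst \<sigma> t) = ev (\<lambda>i. K (\<sigma> i)) t"
  by (induction t) (simp_all add: K_simps)

lemma subst_Var: "subst Var t = t"
  by (induction t) simp_all

lemma K_ev: "K t = ev (\<lambda>i. K (Var i)) t"
  using K_subst[of Var t] by (simp add: subst_Var)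

lemma K_instance: "(s, t) \<in> \<Theta> \<Longrightarrow> ev (\<lambda>i. K (\<sigma> i)) s = ev (\<lambda>i. K (\<sigma> i)) t"
  using et_subst[OF K_theory, of s t \<sigma>] by (simp add: K_iff K_subst)

lemma K_tpow: "K (tpow t k) = K t ^ Suc k"
  by (induction k) (simp_all only: tpow.simps K_simps power_Suc2 power_0 mult_1_left)

lemma K_Om: "K (Om t) = om (K t)"
  by (simp add: K_simps om_def)

lemma K_gpt: "K (gpt t j) = gp (K t) j"
  by (simp add: gpt_def K_simps K_tpow gp_def del: power_Suc)

lemma ev_gpt: "ev \<rho> (gpt (Var i) j) = gp (\<rho> i) j"
proof -
  have "ev \<rho> (tpow t k) = ev \<rho> t ^ Suc k" for t k
    by (induction k) (simp_all only: tpow.simps ev.simps power_Suc2 power_0 mult_1_left)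
  then show ?thesis by (simp add: gpt_def gp_def del: power_Suc)
qed

lemma periods_gp: "j \<in> periods \<Theta> \<Longrightarrow> gp (K t) j = gp (K t) 0"
  unfolding periods_def using K_instance[of "gpt (Var 0) j" "gpt (Var 0) 0" "\<lambda>_. t"] by (simp add: ev_gpt)

lemma gp_periods: "gp (K (Var 0)) i = gp (K (Var 0)) j \<Longrightarrow> i - j \<in> periods \<Theta>"
proof -
  assume e: "gp (K (Var 0)) i = gp (K (Var 0)) j"
  have "gp (K (Var 0)) (i - j) = gp (K (Var 0)) i * gp (K (Var 0)) (- j)" by (simp add: gp_mult)
  also have "\<dots> = gp (K (Var 0)) 0" by (simp add: e gp_mult)
  finally show ?thesis by (simp add: periods_def K_iff K_gpt)
qed

lemma periods_diff: "i - j \<in> periods \<Theta> \<Longrightarrow> gp (K t) i = gp (K t) j"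
  using periods_gp[of "i - j" t] gp_mult[of "K t" "i - j" j] gp_mult[of "K t" 0 j] by simp

lemma periods_subgroup: "0 \<in> periods \<Theta>" "i \<in> periods \<Theta> \<Longrightarrow> j \<in> periods \<Theta> \<Longrightarrow> i - j \<in> periods \<Theta>"
proof -
  show "0 \<in> periods \<Theta>" by (simp add: periods_def K_iff)
  assume "i \<in> periods \<Theta>" "j \<in> periods \<Theta>"
  then show "i - j \<in> periods \<Theta>" by (intro gp_periods) (simp add: periods_gp)
qed

text \<open>Substitute \<open>x\<^sup>\<omega>\<^sup>+\<^sup>1\<close> for \<open>y\<close> and
  \<open>x\<^sup>\<omega>\<close> for all other letters.\<close>

lemma ex_periods:
  assumes "(p, q) \<in> \<Theta>" shows "ex y p - ex y q \<in> periods \<Theta>"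
proof (rule gp_periods)
  define x where "x = K (Var 0)"
  define e where "e = om x"
  define f where "f = e * x"
  have ee: "e * e = e" unfolding e_def by (rule om_idem)
  have ex: "e * x = x * e" unfolding e_def by (rule om_commutes)
  have ef: "e * f = f" unfolding f_def using ee by (simp add: mult.assoc[symmetric])
  have fe: "f * e = f" unfolding f_def using ee ex by (metis mult.assoc)
  have gpf: "gp f j = gp x j" for j
  proof -
    have f1: "f = gp x 1" unfolding f_def e_def using gp_power[of x 0 1] by (simp add: gp_0)
    have "br f = gp x (- 1)" unfolding f1 by (simp add: br_gp)
    have p: "gp x i ^ Suc k = gp x (int (Suc k) * i)" for i k
      by (induction k) (simp_all add: gp_mult distrib_right)
    show ?thesis unfolding gp_def[of f] \<open>br f = gp x (- 1)\<close> unfolding f1 p gp_mult by simp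
  qed
  \<comment> \<open>After multiplication by the idempotent of \<open>f\<close> only the exponent of \<open>y\<close> remains visible.\<close>
  have key: "e * part f (occ y t) (ex y t) * om f = gp x (ex y t)" for t
  proof (cases "occ y t")
    case (enat m)
    have "e * part f (occ y t) (ex y t) * om f = e * gp f (int m)"
      by (simp add: enat part_def mult.assoc gp_unfold)
    then show ?thesis using ex_occ[OF enat] absorb_gp[OF ef] by (simp add: gpf)
  qed (simp add: part_def mult.assoc om_gp absorb_gp[OF ef], simp add: gpf)
  let ?\<sigma> = "\<lambda>i::nat. if i = y then Mul (Om (Var 0)) (Var 0) else Om (Var 0)"
  have \<sigma>: "(\<lambda>i. K (?\<sigma> i)) = (\<lambda>i. if i = y then f else e)"
    by (rule HOL.ext) (simp add: f_def e_def x_def K_simps om_def)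
  show "gp (K (Var 0)) (ex y p) = gp (K (Var 0)) (ex y q)"
    using K_instance[OF assms, of ?\<sigma>] key[of p] key[of q] unfolding \<sigma> ev_single[OF ee ef fe] by (simp add: x_def)
qed

lemma index_iff: "index \<Theta> k \<longleftrightarrow>
  (let e = om (K (Var 0)); f = e * K (Var 1) * e in e * f ^ k = e * f ^ k * om f)"
proof -
  have "K (tloc k) = om (K (Var 0)) * (om (K (Var 0)) * K (Var 1) * om (K (Var 0))) ^ k"
    by (induction k) (simp_all only: tloc.simps K_simps om_def power_Suc2 power_0 mult_1_right mult.assoc)
  then show ?thesis by (simp add: index_def K_iff K_simps Let_def om_def)
qed

lemma index_apply:
  assumes i: "index \<Theta> k" and e: "K s * K s = K s" and f_def: "f = K s * K t * K s"
  shows "K s * f ^ k = K s * f ^ k * om f"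
proof -
  have o: "om (K s) = K s" by (simp add: om_def br_idem[OF e] e)
  let ?\<sigma> = "\<lambda>i::nat. if i = 0 then s else t"
  define \<rho> where "\<rho> = (\<lambda>i. K (?\<sigma> i))"
  have evOm: "ev \<rho> (Om r) = om (ev \<rho> r)" for r by (simp add: om_def)
  have E: "ev \<rho> (Om (Var 0)) = K s"
    unfolding evOm by (simp add: \<rho>_def o)
  have "ev \<rho> (Var 1) = K t" by (simp add: \<rho>_def)
  with E have F: "ev \<rho> (Mul (Mul (Om (Var 0)) (Var 1)) (Om (Var 0))) = f"
    unfolding f_def by (simp del: ev.simps(1))
  have L: "ev \<rho> (tloc k) = K s * f ^ k" for k
  proof (induction k)
    case (Suc k)
    have "ev \<rho> (tloc (Suc k)) = ev \<rho> (tloc k) * ev \<rho> (Mul (Mul (Om (Var 0)) (Var 1)) (Om (Var 0)))"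
      by simp
    then have "ev \<rho> (tloc (Suc k)) = K s * f ^ k * f" by (simp only: Suc F)
    then show ?case by (simp only: power_Suc2 mult.assoc)
  qed (use E in simp)
  have "ev \<rho> (tloc k) = ev \<rho> (tloc k) * ev \<rho> (Om (Mul (Mul (Om (Var 0)) (Var 1)) (Om (Var 0))))"
    unfolding \<rho>_def using K_instance[OF i[unfolded index_def], of ?\<sigma>] by (simp del: tloc.simps)
  then show ?thesis by (simp only: evOm F L)
qed

lemma index_mono: "index \<Theta> k \<Longrightarrow> k \<le> m \<Longrightarrow> index \<Theta> m"
proof -
  assume i: "index \<Theta> k" and km: "k \<le> m"
  define e f where "e = om (K (Var 0))" and "f = e * K (Var 1) * e"
  have fm: "f ^ m = f ^ k * f ^ (m - k)" using km by (simp add: power_add[symmetric])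
  have "e * f ^ m = e * f ^ k * f ^ (m - k)" by (simp only: fm mult.assoc)
  also have "\<dots> = e * f ^ k * om f * f ^ (m - k)"
    using i by (simp add: index_iff Let_def e_def f_def)
  also have "\<dots> = e * f ^ k * (om f * f ^ (m - k))" by (simp add: mult.assoc)
  also have "\<dots> = e * f ^ k * (f ^ (m - k) * om f)"
    by (rule arg_cong) (rule commutes_power, rule om_commutes)
  also have "e * f ^ k * (f ^ (m - k) * om f) = e * f ^ m * om f"
    by (simp only: fm mult.assoc)
  finally show ?thesis by (simp add: index_iff Let_def e_def f_def)
qed

text \<open>Substitute the generic \<open>f\<close> for \<open>y\<close> and the generic \<open>e\<close> for all
  other letters. The result is \<open>e f\<^sup>k = e f\<^sup>m\<close> with \<open>k < m\<close>, or it equates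
  \<open>e f\<^sup>k\<close> with a group element.\<close>

lemma occ_index:
  assumes "(p, q) \<in> \<Theta>" "occ y p = enat k" "occ y p < occ y q"
  shows "index \<Theta> k"
proof -
  define e f where "e = om (K (Var 0))" and "f = e * K (Var 1) * e"
  have ee: "e * e = e" unfolding e_def by (rule om_idem)
  have ef: "e * f = f" and fe: "f * e = f" unfolding f_def using ee by (metis mult.assoc)+
  let ?\<sigma> = "\<lambda>i::nat. if i = y then Mul (Mul (Om (Var 0)) (Var 1)) (Om (Var 0)) else Om (Var 0)"
  have \<sigma>: "(\<lambda>i. K (?\<sigma> i)) = (\<lambda>i. if i = y then f else e)"
    by (rule HOL.ext) (simp add: f_def e_def K_simps om_def)
  have eq: "e * f ^ k = e * part f (occ y q) (ex y q)"
    using K_instance[OF assms(1), of ?\<sigma>] assms(2) unfolding \<sigma> ev_single[OF ee ef fe] by (simp add: part_def)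
  have "e * f ^ k = e * f ^ k * om f"
  proof (cases "occ y q")
    case (enat m)
    then have km: "k < m" using assms by simp
    have step: "e * f ^ k = e * f ^ k * f ^ (m - k)"
    proof -
      have "f ^ m = f ^ k * f ^ (m - k)" using km by (simp add: power_add[symmetric])
      then have "e * part f (occ y q) (ex y q) = e * f ^ k * f ^ (m - k)"
        by (simp only: enat part_def enat.case mult.assoc)
      with eq show ?thesis by (rule HOL.trans)
    qed
    have "e * f ^ k = e * f ^ k * (f ^ (m - k)) ^ j" for j
    proof (induction j)
      case (Suc j)
      then show ?case using step by (simp add: mult.assoc[symmetric])
    qed simp
    then have steps: "e * f ^ k = e * f ^ k * f ^ ((m - k) * j)" for j by (simp add: power_mult)
    obtain n where n: "\<And>k. n \<le> k \<Longrightarrow> f ^ k * om f = f ^ k" using power_om by blast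
    have "1 * n \<le> (m - k) * n" by (rule mult_le_mono1) (use km in simp)
    then have "n \<le> (m - k) * n" by (simp only: mult_1_left)
    then show ?thesis using steps[of n] n[of "(m - k) * n"] by (metis mult.assoc)
  next
    case infinity
    then show ?thesis using eq by (simp add: part_def mult.assoc om_gp)
  qed
  then show ?thesis by (simp add: index_iff Let_def e_def f_def)
qed

lemma permutative_K:
  assumes "permutative \<Theta>"
  shows "om (K r) * K s = K s * om (K r)" "om (K r) * K s * K t = om (K r) * K t * K s"
proof -
  let ?\<sigma> = "\<lambda>i::nat. if i = 0 then r else if i = 1 then s else t"
  show "om (K r) * K s = K s * om (K r)"
    using K_instance[OF assms[unfolded permutative_def, THEN conjunct1], of ?\<sigma>] by (simp add: om_def)
  show "om (K r) * K s * K t = om (K r) * K t * K s"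
    using K_instance[OF assms[unfolded permutative_def, THEN conjunct2], of ?\<sigma>] by (simp add: om_def)
qed

text \<open>The letters of a subterm under a bar have infinitely many occurrences, and the idempotent of that subterm,
  being central, can be pulled out to the left.\<close>

lemma vanishes_witness:
  assumes perm: "permutative \<Theta>" and "hasbar p"
  shows "\<exists>x r. occ x p = \<infinity> \<and> om (K r) * K p = K p"
  using assms(2)
proof (induction p)
  case (Mul s t)
  show ?case
  proof (cases "hasbar s")
    case True
    then obtain x r where x: "occ x s = \<infinity>" "om (K r) * K s = K s" using Mul by blast
    then have "om (K r) * K (Mul s t) = K (Mul s t)" by (simp add: K_simps mult.assoc[symmetric])
    then show ?thesis using x(1) by (intro exI[of _ x] exI[of _ r]) simp
  next
    case False
    then obtain x r where x: "occ x t = \<infinity>" "om (K r) * K t = K t" using Mul by auto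
    have "om (K r) * K (Mul s t) = K s * (om (K r) * K t)"
      using permutative_K(1)[OF perm, of r s] by (simp add: K_simps left_commutes)
    then show ?thesis using x by (intro exI[of _ x] exI[of _ r]) (simp add: K_simps)
  qed
next
  case (Bar t)
  have "\<exists>x. occ x t \<noteq> 0"
  proof (induction t)
    case (Mul s t)
    then show ?case by (metis add_eq_0_iff_both_eq_0 occ.simps(2))
  qed auto
  then obtain x where "occ x t \<noteq> 0" by blast
  then show ?case by (intro exI[of _ x] exI[of _ t]) (simp add: K_simps br_om)
qed simp

text \<open>Values below a central local unit \<open>e\<close> split into the contributions of the letters.\<close>

lemma split_letters:
  assumes perm: "permutative \<Theta>" and e: "e = om (K r)" and n: "\<And>i. n \<le> i \<Longrightarrow> occ i p = 0"
  shows "e * K p = pr (\<lambda>i. part (e * K (Var i)) (occ i p) (ex i p)) n"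
    and "e * (e * K s) = e * K s" "e * K s * e = e * K s" "e * K s * (e * K t) = e * K t * (e * K s)"
proof -
  have ee: "e * e = e" unfolding e by (rule om_idem)
  have ce: "e * K s = K s * e" for s unfolding e by (rule permutative_K(1)[OF perm])
  show l: "e * (e * K s) = e * K s" for s using ee by (simp add: mult.assoc[symmetric])
  show ese: "e * K s * e = e * K s" for s using l[of s] by (simp only: mult.assoc ce[symmetric])
  show cc: "e * K s * (e * K t) = e * K t * (e * K s)" for s t
  proof -
    have "e * K s * (e * K t) = (e * K s * e) * K t" by (simp only: mult.assoc)
    also have "\<dots> = e * K s * K t" by (simp only: ese)
    also have "\<dots> = e * K t * K s" unfolding e by (rule permutative_K(2)[OF perm])
    also have "\<dots> = (e * K t * e) * K s" by (simp only: ese)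
    also have "\<dots> = e * K t * (e * K s)" by (simp only: mult.assoc)
    finally show ?thesis .
  qed
  have "e * K p = ev (\<lambda>i. e * K (Var i)) p"
    using ev_absorb[OF ee ce] by (subst K_ev) (rule HOL.sym)
  also have "\<dots> = pr (\<lambda>i. part (e * K (Var i)) (occ i p) (ex i p)) n"
    by (rule ev_commuting[OF cc n])
  finally show "e * K p = pr (\<lambda>i. part (e * K (Var i)) (occ i p) (ex i p)) n" .
qed

text \<open>If the contribution of the letter \<open>x\<close> lies in a subgroup, then the whole value absorbs the
  idempotent of \<open>x\<close>, as the contributions commute.\<close>

lemma absorbs_letter:
  assumes perm: "permutative \<Theta>" and p: "om (K r) * K p = K p" and x: "occ x p = \<infinity> \<or> (\<exists>k. occ x p = enat k \<and> index \<Theta> k)"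
    and ne: "occ x p \<noteq> 0"
  shows "om (K (Var x)) * K p = K p"
proof -
  define e f where "e = om (K r)" and "f = e * K (Var x)"
  obtain n where n: "\<And>i. n \<le> i \<Longrightarrow> occ i p = 0" using occ_bound by blast
  note sp = split_letters[OF perm e_def n]
  have ee: "e * e = e" unfolding e_def by (rule om_idem)
  have ce: "e * K s = K s * e" for s unfolding e_def by (rule permutative_K(1)[OF perm])
  have ef: "e * f = f" "f * e = f" unfolding f_def using sp(2,3) by simp_all
  have xn: "x < n" using n[of x] ne by (meson not_le)
  have "occ x p = \<infinity> \<or> e * part f (occ x p) (ex x p) * om f = e * part f (occ x p) (ex x p)"
  proof -
    { fix k assume k: "occ x p = enat k" "index \<Theta> k"
      have Kr: "K (Om r) * K (Om r) = K (Om r)" using ee by (simp add: e_def K_simps om_def)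
      have "f = K (Om r) * K (Var x) * K (Om r)"
        using ef(2) by (simp add: f_def e_def K_simps om_def)
      from index_apply[OF k(2) Kr this] have "e * f ^ k = e * f ^ k * om f" by (simp add: e_def K_simps om_def)
      then have "e * part f (occ x p) (ex x p) * om f = e * part f (occ x p) (ex x p)"
        using k(1) by (simp add: part_def) }
    then show ?thesis using x by blast
  qed
  then have a: "om f * (e * part f (occ x p) (ex x p)) = e * part f (occ x p) (ex x p)"
    by (rule part_absorb_om[OF ee ef])
  have omf: "om f = e * om (K (Var x))"
  proof -
    have "br f = e * br (K (Var x))" unfolding f_def by (simp add: br_mult[OF ce] br_idem[OF ee])
    then have "om f = e * (K (Var x) * e) * br (K (Var x))" by (simp add: om_def f_def mult.assoc)
    also have "\<dots> = (e * e) * K (Var x) * br (K (Var x))" by (simp only: ce[symmetric] mult.assoc)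
    finally show ?thesis by (simp add: ee om_def mult.assoc)
  qed
  let ?g = "\<lambda>i. part (e * K (Var i)) (occ i p) (ex i p)"
  have c1: "om f * ?g i = ?g i * om f" for i
    by (rule commutes_part) (simp only: omf K_Om[symmetric] sp(4))
  have c2: "e * ?g i = ?g i * e" for i
    by (rule commutes_part) (simp only: sp(2,3))
  have "om f * (e * pr ?g n) = e * pr ?g n"
    using pr_absorb[of "om f" ?g e x n, OF c1 c2 _ xn ee] a by (simp add: f_def)
  then have *: "om f * K p = K p" using sp(1) p by (simp add: e_def[symmetric])
  have "om (K (Var x)) * e = om f" using ce[of "Om (Var x)"] by (simp add: omf K_Om[symmetric])
  then have "om (K (Var x)) * (e * K p) = om f * K p" by (simp add: mult.assoc[symmetric])
  then show ?thesis using * p by (simp add: e_def)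
qed

text \<open>An identity between two vanishing terms holds as soon as it holds in the Abelian groups of the variety and
  for occurrence numbers up to the index. Both sides absorb an idempotent of a letter; the conditions on occurrences
  make each side absorb the idempotent of the other side too. Below the product \<open>e\<close> of these two
  idempotents both sides split into contributions of single letters, which agree.\<close>

lemma vanishes_identity:
  assumes perm: "permutative \<Theta>" and "vanishes \<Theta> p" "vanishes \<Theta> q"
    and ex: "\<And>y. ex y p - ex y q \<in> periods \<Theta>"
    and oc: "\<And>y. occ y p = occ y q \<or> (\<exists>k. index \<Theta> k \<and> enat k \<le> occ y p \<and> enat k \<le> occ y q)"
  shows "(p, q) \<in> \<Theta>"
proof -
  note T = K_theory
  \<comment> \<open>A letter under a bar in an equal term: its idempotent is absorbed, and the number of its occurrences in \<open>p\<close>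
    is infinite or an index.\<close>
  have wit: "\<exists>x. om (K (Var x)) * K p = K p \<and> (occ x p = \<infinity> \<or> (\<exists>k. occ x p = enat k \<and> index \<Theta> k))"
    if v: "vanishes \<Theta> p" for p
  proof -
    obtain p1 where p1: "(p, p1) \<in> \<Theta>" "hasbar p1" using v by (auto simp: vanishes_def)
    obtain x r where x: "occ x p1 = \<infinity>" "om (K r) * K p1 = K p1" using vanishes_witness[OF perm p1(2)] by blast
    then have "om (K (Var x)) * K p1 = K p1" by (intro absorbs_letter[OF perm]) auto
    then have xp: "om (K (Var x)) * K p = K p" using p1(1) by (simp add: K_iff)
    moreover have "occ x p = \<infinity> \<or> (\<exists>k. occ x p = enat k \<and> index \<Theta> k)"
    proof (cases "occ x p")
      case (enat k)
      have "index \<Theta> k" by (rule occ_index[OF p1(1) enat]) (simp add: enat x(1))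
      then show ?thesis using enat by blast
    qed simp
    ultimately show ?thesis by blast
  qed
  have transfer: "om (K (Var x)) * K q = K q"
    if q: "om (K (Var y)) * K q = K q" and x: "om (K (Var x)) * K p = K p"
      "occ x p = \<infinity> \<or> (\<exists>k. occ x p = enat k \<and> index \<Theta> k)"
      and oc: "occ x p = occ x q \<or> (\<exists>k. index \<Theta> k \<and> enat k \<le> occ x p \<and> enat k \<le> occ x q)" for p q x y
  proof (cases "occ x q = 0 \<and> index \<Theta> 0")
    case False
    have i: "occ x q = \<infinity> \<or> (\<exists>k. occ x q = enat k \<and> index \<Theta> k)"
      using oc x(2) index_mono by (cases "occ x q") auto
    then have "occ x q \<noteq> 0" using False by (auto simp: zero_enat_def)
    then show ?thesis using absorbs_letter[OF perm q i] by blast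
  next
    case True
    \<comment> \<open>If \<open>0\<close> is an index, then local monoids are groups, and any two idempotents are equal.\<close>
    have e: "om (K r) = om (K r) * om (K s)" for r s
    proof -
      have Kr: "K (Om r) * K (Om r) = K (Om r)" using om_idem by (simp add: K_Om)
      define f where "f = K (Om r) * K (Om s) * K (Om r)"
      have "om (K r) = om (K r) * om f"
        using index_apply[OF _ Kr f_def, of 0] True by (simp add: K_Om)
      moreover have ff: "f = om (K r) * om (K s)"
        using permutative_K(1)[OF perm, of r "Om s"] om_idem[of "K r"]
        by (simp add: f_def K_Om) (metis mult.assoc)
      moreover have "f * f = f"
        using permutative_K(1)[OF perm, of r "Om s"] om_idem[of "K r"] om_idem[of "K s"]
        unfolding ff by (simp add: K_Om) (metis mult.assoc)
      ultimately show ?thesis using om_idem by (metis br_idem om_def mult.assoc)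
    qed
    have "om (K (Var y)) = om (K (Var x))"
      using e[of "Var x" "Var y"] e[of "Var y" "Var x"] permutative_K(1)[OF perm, of "Var x" "Om (Var y)"]
      by (simp add: K_Om)
    then show ?thesis using q by simp
  qed
  obtain x where x: "om (K (Var x)) * K p = K p" "occ x p = \<infinity> \<or> (\<exists>k. occ x p = enat k \<and> index \<Theta> k)"
    using wit[OF assms(2)] by blast
  obtain y where y: "om (K (Var y)) * K q = K q" "occ y q = \<infinity> \<or> (\<exists>k. occ y q = enat k \<and> index \<Theta> k)"
    using wit[OF assms(3)] by blast
  have yp: "om (K (Var y)) * K p = K p"
    by (rule transfer[OF x(1) y]) (use oc[of y] in auto)
  have xq: "om (K (Var x)) * K q = K q"
    by (rule transfer[OF y(1) x]) (use oc[of x] in auto)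
  define e where "e = om (K (Var x)) * om (K (Var y))"
  define r where "r = Mul (Om (Var x)) (Om (Var y))"
  have Kr: "K r = e" by (simp only: r_def e_def K_simps om_def)
  have er: "e * e = e"
    using permutative_K(1)[OF perm, of "Var x" "Om (Var y)"] om_idem[of "K (Var x)"] om_idem[of "K (Var y)"]
    by (simp add: e_def K_Om) (metis mult.assoc)
  then have e: "e = om (K r)" by (simp add: Kr om_def br_idem)
  obtain n1 where n1: "\<And>i. n1 \<le> i \<Longrightarrow> occ i p = 0" using occ_bound by blast
  obtain n2 where n2: "\<And>i. n2 \<le> i \<Longrightarrow> occ i q = 0" using occ_bound by blast
  define n where "n = max n1 n2"
  have np: "occ i p = 0" and nq: "occ i q = 0" if "n \<le> i" for i using n1 n2 that by (simp_all add: n_def)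
  note sp = split_letters[OF perm e np] and sq = split_letters[OF perm e nq]
  have same: "e * part (e * K (Var i)) (occ i p) (ex i p) = e * part (e * K (Var i)) (occ i q) (ex i q)" for i
  proof -
    define f where "f = e * K (Var i)"
    have f: "f = K (Mul r (Var i))" by (simp add: f_def K_simps Kr)
    have ef: "e * f = f" "f * e = f" unfolding f_def using sp(2,3) by simp_all
    have gpj: "gp f (ex i p) = gp f (ex i q)" unfolding f by (rule periods_diff[OF ex])
    have big: "e * part f k j = gp f j" if k: "index \<Theta> k0" "enat k0 \<le> k" and j: "\<And>m. k = enat m \<Longrightarrow> j = int m" for k0 k j
    proof (cases k)
      case (enat m)
      have im: "index \<Theta> m" using index_mono[OF k(1)] k(2) enat by simp
      have "f = K r * K (Var i) * K r" using ef(2) by (simp add: f_def Kr)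
      from index_apply[OF im _ this] er have "e * f ^ m = e * f ^ m * om f" by (simp add: Kr)
      also have "\<dots> = gp f (int m)" by (simp add: mult.assoc gp_unfold absorb_gp[OF ef(1)])
      finally show ?thesis using j[OF enat] by (simp add: enat part_def)
    qed (simp add: part_def absorb_gp[OF ef(1)])
    show ?thesis
    proof (cases "occ i p = occ i q")
      case True
      show ?thesis
      proof (cases "occ i q")
        case (enat m)
        then show ?thesis using True by (simp add: part_def)
      next
        case infinity
        then show ?thesis using True gpj by (simp add: part_def f_def)
      qed
    next
      case False
      then obtain k where k: "index \<Theta> k" "enat k \<le> occ i p" "enat k \<le> occ i q" using oc by blast
      show ?thesis
        using big[OF k(1,2), of "ex i p"] big[OF k(1,3), of "ex i q"] ex_occ gpj by (simp add: f_def)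
    qed
  qed
  have c: "e * part (e * K (Var i)) k j = part (e * K (Var i)) k j * e" for i k j
    by (rule commutes_part) (simp only: sp(2,3))
  have a: "e * K p = pr (\<lambda>i. part (e * K (Var i)) (occ i p) (ex i p)) n"
    by (rule split_letters(1)[OF perm e np])
  have b: "e * K q = pr (\<lambda>i. part (e * K (Var i)) (occ i q) (ex i q)) n"
    by (rule split_letters(1)[OF perm e nq])
  have "e * pr (\<lambda>i. part (e * K (Var i)) (occ i p) (ex i p)) n = e * pr (\<lambda>i. part (e * K (Var i)) (occ i q) (ex i q)) n"
    by (rule pr_eqI) (rule c, rule c, rule er, rule same)
  then have ab: "e * (e * K p) = e * (e * K q)" by (simp only: a b)
  have "e * K p = e * (e * K p)" using er by (simp add: mult.assoc[symmetric])
  also have "\<dots> = e * (e * K q)" by (rule ab)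
  also have "\<dots> = e * K q" using er by (simp add: mult.assoc[symmetric])
  finally have "e * K p = e * K q" .
  then have "K p = K q" using yp xq x(1) y(1) by (simp add: e_def mult.assoc)
  then show ?thesis by (simp add: K_iff)
qed

end

end

lemma theory_model:
  assumes "epi_theory \<Theta>"
  shows "epi_monoid.model (tmul \<Theta>) (tbr \<Theta>) \<Theta> (cl \<Theta>)"
proof -
  interpret epi_monoid None "tmul \<Theta>" "tbr \<Theta>" by (rule theory_epi_monoid[OF assms])
  show ?thesis using assms by (simp add: model_def cl_Mul cl_Bar cl_eq_iff epi_theory_def)
qed

section \<open>Words modulo an epigroup theory\<close>

text \<open>The facts about term models, stated for theories.\<close>

lemma theory_facts:
  assumes T: "epi_theory \<Theta>"
  shows theory_ex: "(p, q) \<in> \<Theta> \<Longrightarrow> ex y p - ex y q \<in> periods \<Theta>"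
    and theory_occ: "(p, q) \<in> \<Theta> \<Longrightarrow> occ y p = enat k \<Longrightarrow> occ y p < occ y q \<Longrightarrow> index \<Theta> k"
    and theory_index_mono: "index \<Theta> k \<Longrightarrow> k \<le> m \<Longrightarrow> index \<Theta> m"
    and theory_periods: "0 \<in> periods \<Theta>" "i \<in> periods \<Theta> \<Longrightarrow> j \<in> periods \<Theta> \<Longrightarrow> i - j \<in> periods \<Theta>"
    and theory_vanishes_identity: "permutative \<Theta> \<Longrightarrow> vanishes \<Theta> p \<Longrightarrow> vanishes \<Theta> q \<Longrightarrow>
      (\<And>y. ex y p - ex y q \<in> periods \<Theta>) \<Longrightarrow>
      (\<And>y. occ y p = occ y q \<or> (\<exists>k. index \<Theta> k \<and> enat k \<le> occ y p \<and> enat k \<le> occ y q)) \<Longrightarrow> (p, q) \<in> \<Theta>"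
proof -
  interpret epi_monoid None "tmul \<Theta>" "tbr \<Theta>" by (rule theory_epi_monoid[OF T])
  note m = theory_model[OF T]
  show "(p, q) \<in> \<Theta> \<Longrightarrow> ex y p - ex y q \<in> periods \<Theta>" by (rule ex_periods[OF m])
  show "(p, q) \<in> \<Theta> \<Longrightarrow> occ y p = enat k \<Longrightarrow> occ y p < occ y q \<Longrightarrow> index \<Theta> k" by (rule occ_index[OF m])
  show "index \<Theta> k \<Longrightarrow> k \<le> m \<Longrightarrow> index \<Theta> m" by (rule index_mono[OF m])
  show "0 \<in> periods \<Theta>" "i \<in> periods \<Theta> \<Longrightarrow> j \<in> periods \<Theta> \<Longrightarrow> i - j \<in> periods \<Theta>"
    by (rule periods_subgroup[OF m])+
  show "permutative \<Theta> \<Longrightarrow> vanishes \<Theta> p \<Longrightarrow> vanishes \<Theta> q \<Longrightarrow>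
      (\<And>y. ex y p - ex y q \<in> periods \<Theta>) \<Longrightarrow>
      (\<And>y. occ y p = occ y q \<or> (\<exists>k. index \<Theta> k \<and> enat k \<le> occ y p \<and> enat k \<le> occ y q)) \<Longrightarrow> (p, q) \<in> \<Theta>"
    by (rule vanishes_identity[OF m])
qed

lemma periods_add: "epi_theory A \<Longrightarrow> i \<in> periods A \<Longrightarrow> j \<in> periods A \<Longrightarrow> i + j \<in> periods A"
  using theory_periods(2)[of A i "0 - j"] theory_periods(2)[of A 0 j] theory_periods(1)[of A] by simp

lemma periods_all:
  assumes T: "epi_theory A" and one: "1 \<in> periods A" shows "i \<in> periods A"
proof -
  have n: "int k \<in> periods A" for k
    by (induction k) (use theory_periods(1)[OF T] periods_add[OF T one] in auto)
  show ?thesis using n[of "nat i"] theory_periods(2)[OF T theory_periods(1)[OF T] n[of "nat (- i)"]]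
    by (cases "0 \<le> i") auto
qed

lemma epi_equational: "epi_theory \<Theta> \<Longrightarrow> equational_theory \<Theta>"
  by (simp add: epi_theory_def)

lemma (in epi_monoid) power_absorb:
  assumes "p = a * p * b" shows "om a * p = p" "p * om b = p"
proof -
  have pn: "p = a ^ n * p * b ^ n" for n
  proof (induction n)
    case (Suc n)
    have "p = a ^ n * p * b ^ n" by (rule Suc)
    also have "\<dots> = a ^ n * (a * p * b) * b ^ n" using assms by simp
    also have "\<dots> = (a ^ n * a) * p * (b * b ^ n)" by (simp only: mult.assoc)
    finally show ?case by (simp only: power_Suc power_commutes)
  qed simp
  obtain n where n: "om a * a ^ n = a ^ n" using power_om[of a] by blast
  have "om a * p = om a * (a ^ n * p * b ^ n)" using pn by simp
  also have "\<dots> = om a * a ^ n * p * b ^ n" by (simp only: mult.assoc)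
  finally show "om a * p = p" using pn n by simp
  obtain n where n: "b ^ n * om b = b ^ n" using power_om[of b] by blast
  have "p * om b = (a ^ n * p * b ^ n) * om b" using pn by simp
  also have "\<dots> = a ^ n * p * (b ^ n * om b)" by (simp only: mult.assoc)
  finally show "p * om b = p" using pn n by simp
qed

text \<open>From \<open>p = s p t\<close> follows \<open>p = s\<^sup>n p t\<^sup>n\<close> for all \<open>n\<close>,
  hence \<open>p = s\<^sup>\<omega> p\<close>, where the right side has a bar.\<close>

lemma absorb_vanishes:
  assumes T: "epi_theory \<Theta>"
  shows "(p, Mul s p) \<in> \<Theta> \<Longrightarrow> vanishes \<Theta> p" "(p, Mul p t) \<in> \<Theta> \<Longrightarrow> vanishes \<Theta> p"
    "(p, Mul (Mul s p) t) \<in> \<Theta> \<Longrightarrow> vanishes \<Theta> p"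
proof -
  interpret epi_monoid None "tmul \<Theta>" "tbr \<Theta>" by (rule theory_epi_monoid[OF T])
  note m = theory_model[OF T] and K = K_simps[OF theory_model[OF T]] and KO = K_Om[OF theory_model[OF T]]
    and iff = K_iff[OF theory_model[OF T]]
  have l: "vanishes \<Theta> p" if "tmul \<Theta> (om (cl \<Theta> s)) (cl \<Theta> p) = cl \<Theta> p" for s
    unfolding vanishes_def by (rule exI[of _ "Mul (Om s) p"]) (simp add: iff K(1)[of "Om s"] KO that)
  have r: "vanishes \<Theta> p" if "tmul \<Theta> (cl \<Theta> p) (om (cl \<Theta> t)) = cl \<Theta> p" for t
    unfolding vanishes_def by (rule exI[of _ "Mul p (Om t)"]) (simp add: iff K(1)[of p "Om t"] KO that)
  show "(p, Mul s p) \<in> \<Theta> \<Longrightarrow> vanishes \<Theta> p"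
    by (rule l[of s], rule power_absorb(1)[of _ _ None]) (simp add: iff K)
  show "(p, Mul p t) \<in> \<Theta> \<Longrightarrow> vanishes \<Theta> p"
    by (rule r[of t], rule power_absorb(2)[of _ None]) (simp add: iff K)
  show "(p, Mul (Mul s p) t) \<in> \<Theta> \<Longrightarrow> vanishes \<Theta> p"
    by (rule l[of s], rule power_absorb(1)) (simp add: iff K)
qed

text \<open>The word of letters of a term; bars are forgotten, so \<open>flat\<close> determines a term only in the
  absence of bars and modulo associativity.\<close>

primrec flat :: "uterm \<Rightarrow> nat list" where
  "flat (Var i) = [i]"
| "flat (Mul s t) = flat s @ flat t"
| "flat (Bar t) = flat t"

lemma flat_nonempty [simp]: "flat t \<noteq> []"
  by (induction t) auto

lemma flat_subst: "flat (subst \<sigma> t) = sub (\<lambda>i. flat (\<sigma> i)) (flat t)"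
  by (induction t) auto

lemma hasbar_subst: "hasbar (subst \<sigma> t) \<longleftrightarrow> hasbar t \<or> (\<exists>i\<in>set (flat t). hasbar (\<sigma> i))"
  by (induction t) auto

lemma word_snoc: "xs \<noteq> [] \<Longrightarrow> word (xs @ [x]) = Mul (word xs) (Var x)"
  by (cases xs) (auto simp: word_def)

lemma word_single [simp]: "word [x] = Var x"
  by (simp add: word_def)

lemma word_induct [consumes 1, case_names single snoc]:
  assumes "xs \<noteq> []" "\<And>x. P [x]" "\<And>xs x. xs \<noteq> [] \<Longrightarrow> P xs \<Longrightarrow> P (xs @ [x])"
  shows "P xs"
  using assms(1) by (induction xs rule: rev_induct) (use assms in \<open>metis append_Nil\<close>)+

lemma flat_word [simp]: "xs \<noteq> [] \<Longrightarrow> flat (word xs) = xs"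
  by (induction xs rule: word_induct) (simp_all add: word_snoc)

lemma hasbar_word [simp]: "xs \<noteq> [] \<Longrightarrow> \<not> hasbar (word xs)"
  by (induction xs rule: word_induct) (simp_all add: word_snoc)

lemma occ_flat: "\<not> hasbar t \<Longrightarrow> occ y t = enat (count_list (flat t) y)"
  by (induction t) (auto simp: one_enat_def zero_enat_def)

lemma occ_0_iff: "occ y t = 0 \<longleftrightarrow> y \<notin> set (flat t)"
  by (induction t) (auto simp: add_eq_0_iff_both_eq_0)

lemma subst_id: "(\<And>i. i \<in> set (flat t) \<Longrightarrow> \<sigma> i = Var i) \<Longrightarrow> subst \<sigma> t = t"
  by (induction t) auto

lemma word_append:
  assumes T: "epi_theory \<Theta>" and "xs \<noteq> []" "ys \<noteq> []"
  shows "(Mul (word xs) (word ys), word (xs @ ys)) \<in> \<Theta>"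
  using assms(3)
proof (induction ys rule: word_induct)
  case (single y)
  show ?case using et_refl[OF epi_equational[OF T]] by (simp add: word_snoc assms(2))
next
  case (snoc ys y)
  note E = epi_equational[OF T]
  have "(Mul (word xs) (Mul (word ys) (Var y)), Mul (Mul (word xs) (word ys)) (Var y)) \<in> \<Theta>"
    by (rule et_sym[OF E epi_theory_instances(1)[OF T]])
  moreover have "(Mul (Mul (word xs) (word ys)) (Var y), Mul (word (xs @ ys)) (Var y)) \<in> \<Theta>"
    by (rule et_Mul[OF E snoc(2) et_refl[OF E]])
  ultimately have "(Mul (word xs) (word (ys @ [y])), Mul (word (xs @ ys)) (Var y)) \<in> \<Theta>"
    unfolding word_snoc[OF snoc(1)] by (rule et_trans[OF E])
  then show ?case using word_snoc[of "xs @ ys" y] assms(2) by simp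
qed

lemma word_flat:
  assumes T: "epi_theory \<Theta>" shows "\<not> hasbar t \<Longrightarrow> (t, word (flat t)) \<in> \<Theta>"
proof (induction t)
  case (Mul s t)
  note E = epi_equational[OF T]
  have "(Mul s t, Mul (word (flat s)) (word (flat t))) \<in> \<Theta>" using Mul by (intro et_Mul[OF E]) auto
  then show ?case using et_trans[OF E _ word_append[OF T]] by simp
qed (simp_all add: et_refl[OF epi_equational[OF T]])

lemma flat_eq_theory:
  assumes T: "epi_theory \<Theta>" and "\<not> hasbar s" "\<not> hasbar t" "flat s = flat t"
  shows "(s, t) \<in> \<Theta>"
  using et_trans[OF epi_equational[OF T] word_flat[OF T assms(2)] et_sym[OF epi_equational[OF T] word_flat[OF T assms(3), folded assms(4)]]] .

lemma word_context:
  assumes T: "epi_theory \<Theta>" and xy: "(word xs, word ys) \<in> \<Theta>" "xs \<noteq> []" "ys \<noteq> []"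
  shows "(word (a @ xs @ b), word (a @ ys @ b)) \<in> \<Theta>"
proof -
  note E = epi_equational[OF T]
  have l: "(word (a @ xs), word (a @ ys)) \<in> \<Theta>" if "(word xs, word ys) \<in> \<Theta>" "xs \<noteq> []" "ys \<noteq> []" for xs ys
  proof (cases "a = []")
    case False
    have "(Mul (word a) (word xs), Mul (word a) (word ys)) \<in> \<Theta>" by (rule et_Mul[OF E et_refl[OF E] that(1)])
    then show ?thesis
      using et_trans[OF E et_trans[OF E et_sym[OF E word_append[OF T False that(2)]]] word_append[OF T False that(3)]] by blast
  qed (use that in simp)
  have r: "(word (xs @ b), word (ys @ b)) \<in> \<Theta>"
  proof (cases "b = []")
    case False
    have "(Mul (word xs) (word b), Mul (word ys) (word b)) \<in> \<Theta>" by (rule et_Mul[OF E xy(1) et_refl[OF E]])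
    then show ?thesis
      using et_trans[OF E et_trans[OF E et_sym[OF E word_append[OF T xy(2) False]]] word_append[OF T xy(3) False]] by blast
  qed (use xy in simp)
  show ?thesis by (rule l[OF r]) (use xy in simp_all)
qed

lemma word_subst:
  assumes T: "epi_theory \<Theta>" and xy: "(word xs, word ys) \<in> \<Theta>" "xs \<noteq> []" "ys \<noteq> []" and ne: "\<And>i. \<phi> i \<noteq> []"
  shows "(word (sub \<phi> xs), word (sub \<phi> ys)) \<in> \<Theta>"
proof -
  note E = epi_equational[OF T]
  let ?\<sigma> = "\<lambda>i. word (\<phi> i)"
  have s: "(subst ?\<sigma> (word zs), word (sub \<phi> zs)) \<in> \<Theta>" if "zs \<noteq> []" for zs
  proof -
    have "\<not> hasbar (subst ?\<sigma> (word zs))" using that ne by (simp add: hasbar_subst)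
    moreover have "flat (subst ?\<sigma> (word zs)) = sub \<phi> zs" using that ne by (simp add: flat_subst)
    ultimately show ?thesis using word_flat[OF T] by metis
  qed
  show ?thesis
    by (rule et_trans[OF E et_trans[OF E et_sym[OF E s[OF xy(2)]] et_subst[OF E xy(1)]] s[OF xy(3)]])
qed

subsection \<open>Words that do not vanish\<close>

lemma vanishes_related: "epi_theory \<Theta> \<Longrightarrow> (p, q) \<in> \<Theta> \<Longrightarrow> vanishes \<Theta> q \<Longrightarrow> vanishes \<Theta> p"
  unfolding vanishes_def using et_trans[OF epi_equational] by blast

lemma vanishes_hasbar: "epi_theory \<Theta> \<Longrightarrow> hasbar p \<Longrightarrow> vanishes \<Theta> p"
  unfolding vanishes_def using et_refl[OF epi_equational] by blast

lemma vanishes_Mul: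
  assumes T: "epi_theory \<Theta>" and "vanishes \<Theta> p \<or> vanishes \<Theta> q" shows "vanishes \<Theta> (Mul p q)"
  using assms(2)
proof
  note E = epi_equational[OF T]
  assume "vanishes \<Theta> p"
  then obtain p' where "(p, p') \<in> \<Theta>" "hasbar p'" unfolding vanishes_def by blast
  then show ?thesis unfolding vanishes_def
    by (intro exI[of _ "Mul p' q"] conjI et_Mul[OF E _ et_refl[OF E]]) simp_all
next
  note E = epi_equational[OF T]
  assume "vanishes \<Theta> q"
  then obtain q' where "(q, q') \<in> \<Theta>" "hasbar q'" unfolding vanishes_def by blast
  then show ?thesis unfolding vanishes_def
    by (intro exI[of _ "Mul p q'"] conjI et_Mul[OF E et_refl[OF E]]) simp_all
qed

lemma vanishes_subst: "epi_theory \<Theta> \<Longrightarrow> vanishes \<Theta> p \<Longrightarrow> vanishes \<Theta> (subst \<sigma> p)"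
  unfolding vanishes_def using et_subst[OF epi_equational] by (metis hasbar_subst)

lemma vanishes_factor:
  assumes T: "epi_theory \<Theta>" and v: "vanishes \<Theta> (word xs)" "xs \<noteq> []"
  shows "vanishes \<Theta> (word (a @ xs @ b))"
proof -
  note E = epi_equational[OF T]
  have l: "vanishes \<Theta> (word (a @ xs))"
  proof (cases "a = []")
    case False
    then show ?thesis
      using vanishes_related[OF T et_sym[OF E word_append[OF T False v(2)]]] vanishes_Mul[OF T] v by blast
  qed (use v in simp)
  show ?thesis
  proof (cases "b = []")
    case False
    have "a @ xs \<noteq> []" using v by simp
    then show ?thesis
      using vanishes_related[OF T et_sym[OF E word_append[OF T _ False, of "a @ xs"]]] vanishes_Mul[OF T] l by simp
  qed (use l in simp)
qed

text \<open>If a letter occurs on one side only, it may be replaced by a term with a bar.\<close>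

lemma nonvanishing_class:
  assumes T: "epi_theory \<Theta>" and nv: "\<not> vanishes \<Theta> p" and pt: "(p, t) \<in> \<Theta>"
  shows "\<not> hasbar t" "set (flat t) = set (flat p)" "\<not> vanishes \<Theta> t"
proof -
  note E = epi_equational[OF T]
  show nt: "\<not> vanishes \<Theta> t" using nv pt vanishes_related[OF T] by blast
  show "\<not> hasbar t" using nt vanishes_hasbar[OF T] by blast
  have sub: "set (flat p) \<subseteq> set (flat t)" if nv: "\<not> vanishes \<Theta> p" and pt: "(p, t) \<in> \<Theta>" for p t
  proof (rule ccontr)
    assume "\<not> ?thesis"
    then obtain x where x: "x \<in> set (flat p)" "x \<notin> set (flat t)" by blast
    let ?\<sigma> = "\<lambda>i. if i = x then Om (Var x) else Var i"
    have "subst ?\<sigma> t = t" by (rule subst_id) (use x in auto)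
    then have "(subst ?\<sigma> p, t) \<in> \<Theta>" using et_subst[OF E pt, of ?\<sigma>] by simp
    then have "(p, subst ?\<sigma> p) \<in> \<Theta>" by (rule et_trans[OF E pt et_sym[OF E]])
    moreover have "hasbar (subst ?\<sigma> p)" unfolding hasbar_subst using x(1) by auto
    ultimately show False using nv unfolding vanishes_def by blast
  qed
  show "set (flat t) = set (flat p)" using sub[OF nv pt] sub[OF nt et_sym[OF E pt]] by blast
qed

lemma proper_factor_vanishes:
  assumes T: "epi_theory \<Theta>" and xs: "(word xs, word (a @ xs @ b)) \<in> \<Theta>" "xs \<noteq> []" "a @ b \<noteq> []"
  shows "vanishes \<Theta> (word xs)"
proof -
  note E = epi_equational[OF T]
  note tr = et_trans[OF E] and sy = et_sym[OF E] and wa = word_append[OF T]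
  consider "a = []" "b \<noteq> []" | "a \<noteq> []" "b = []" | "a \<noteq> []" "b \<noteq> []" using xs(3) by auto
  then show ?thesis
  proof cases
    case 1
    then have "(word xs, Mul (word xs) (word b)) \<in> \<Theta>" using tr[OF xs(1)] sy[OF wa[of xs b]] xs(2) by simp
    then show ?thesis by (rule absorb_vanishes[OF T])
  next
    case 2
    then have "(word xs, Mul (word a) (word xs)) \<in> \<Theta>" using tr[OF xs(1)] sy[OF wa[of a xs]] xs(2) by simp
    then show ?thesis by (rule absorb_vanishes[OF T])
  next
    case 3
    have "(Mul (word (a @ xs)) (word b), word (a @ xs @ b)) \<in> \<Theta>" using wa[of "a @ xs" b] 3 by simp
    then have "(word xs, Mul (word (a @ xs)) (word b)) \<in> \<Theta>" using tr[OF xs(1)] sy by blast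
    moreover have "(Mul (word (a @ xs)) (word b), Mul (Mul (word a) (word xs)) (word b)) \<in> \<Theta>"
      by (rule et_Mul[OF E sy[OF wa[OF 3(1) xs(2)]] et_refl[OF E]])
    ultimately have "(word xs, Mul (Mul (word a) (word xs)) (word b)) \<in> \<Theta>" by (rule tr)
    then show ?thesis by (rule absorb_vanishes[OF T])
  qed
qed

text \<open>A letter under a bar has infinitely many occurrences on one side and finitely many on the other.\<close>

lemma vanishing_word_index:
  assumes T: "epi_theory \<Theta>" and "permutative \<Theta>" and v: "vanishes \<Theta> p" and p: "\<not> hasbar p"
  shows "\<exists>y k. occ y p = enat k \<and> index \<Theta> k"
proof -
  interpret epi_monoid None "tmul \<Theta>" "tbr \<Theta>" by (rule theory_epi_monoid[OF T])
  obtain p' where p': "(p, p') \<in> \<Theta>" "hasbar p'" using v by (auto simp: vanishes_def)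
  obtain x where "occ x p' = \<infinity>" using vanishes_witness[OF theory_model[OF T] assms(2) p'(2)] by blast
  then have "index \<Theta> (count_list (flat p) x)"
    by (intro theory_occ[OF T p'(1)]) (auto simp: occ_flat[OF p])
  then show ?thesis using occ_flat[OF p] by blast
qed

subsection \<open>Commutative theories\<close>

definition commutative :: "identity set \<Rightarrow> bool" where
  "commutative \<Theta> \<longleftrightarrow> commutative_law \<in> \<Theta>"

lemma commutative_law_eq: "commutative_law = (Mul (Var 0) (Var 1), Mul (Var 1) (Var 0))"
  by (simp add: commutative_law_def word_def)

lemma commutative_Mul:
  assumes "equational_theory \<Theta>" "commutative \<Theta>" shows "(Mul s t, Mul t s) \<in> \<Theta>"
  using et_subst[OF assms(1) assms(2)[unfolded commutative_def commutative_law_eq], of "\<lambda>i. if i = 0 then s else t"]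
  by simp

lemma commutative_permutative:
  assumes T: "epi_theory \<Theta>" and "commutative \<Theta>" shows "permutative \<Theta>"
proof -
  note E = epi_equational[OF T] and c = commutative_Mul[OF epi_equational[OF T] assms(2)] and a = epi_theory_instances(1)[OF T]
  have "(Mul (Mul e y) z, Mul (Mul e z) y) \<in> \<Theta>" for e y z
    by (rule et_trans[OF E a et_trans[OF E et_Mul[OF E et_refl[OF E] c] et_sym[OF E a]]])
  then show ?thesis unfolding permutative_def using c by blast
qed

lemma word_mset:
  assumes T: "epi_theory \<Theta>" and c: "commutative \<Theta>" and "mset xs = mset ys" "xs \<noteq> []"
  shows "(word xs, word ys) \<in> \<Theta>"
  using assms(3,4)
proof (induction xs arbitrary: ys)
  case (Cons x xs)
  note E = epi_equational[OF T]
  have "x \<in> set ys" using Cons(2) by (metis list.set_intros(1) mset_eq_setD)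
  then obtain a b where ys: "ys = a @ [x] @ b" by (metis append_Cons append_Nil split_list)
  show ?case
  proof (cases "xs = []")
    case True
    then have "ys = [x]" using Cons(2) by simp
    then show ?thesis using True et_refl[OF E] by simp
  next
    case False
    have m: "mset xs = mset (a @ b)" using Cons(2) ys by simp
    have ne: "a @ b \<noteq> []" using m False by auto
    have 1: "(word ([x] @ xs), word ([x] @ a @ b)) \<in> \<Theta>"
      using word_context[OF T Cons(1)[OF m False] False ne, of "[x]" "[]"] by simp
    have 2: "(word ([x] @ a @ b), word (a @ [x] @ b)) \<in> \<Theta>"
    proof (cases "a = []")
      case False
      have "(word ([x] @ a), word (a @ [x])) \<in> \<Theta>"
        using et_trans[OF E et_trans[OF E et_sym[OF E word_append[OF T _ False, of "[x]"]] commutative_Mul[OF E c]] word_append[OF T False, of "[x]"]]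
        by simp
      from word_context[OF T this, of "[]" b] show ?thesis by simp
    qed (simp add: et_refl[OF E])
    show ?thesis using et_trans[OF E 1 2] ys by simp
  qed
qed simp

lemma nonvanishing_mset:
  assumes T: "epi_theory \<Theta>" and c: "commutative \<Theta>" and nv: "\<not> vanishes \<Theta> (word xs)" "xs \<noteq> []"
    and ys: "(word xs, word ys) \<in> \<Theta>" "mset xs \<subseteq># mset ys" "ys \<noteq> []"
  shows "mset xs = mset ys"
proof (rule ccontr)
  assume ne: "mset xs \<noteq> mset ys"
  obtain zs where zs: "mset zs = mset ys - mset xs" using ex_mset by blast
  then have m: "mset ys = mset (xs @ zs)" using ys(2) by simp
  then have z: "zs \<noteq> []" using ne by auto
  have "(word ys, word (xs @ zs)) \<in> \<Theta>" by (rule word_mset[OF T c m ys(3)])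
  then have "(word xs, word ([] @ xs @ zs)) \<in> \<Theta>" using et_trans[OF epi_equational[OF T] ys(1)] by simp
  from proper_factor_vanishes[OF T this] nv z show False by simp
qed

section \<open>Small test theories\<close>

text \<open>The theory of a Rees quotient of a free semigroup in some variety: terms that are words in the
  factor-closed set \<open>G\<close> are compared by the key \<open>k\<close>. All other terms are equal to each
  other, or, if \<open>m\<close> holds, are left zeros that are distinguished by their first letter.\<close>

definition rees :: "(nat list \<Rightarrow> bool) \<Rightarrow> (nat list \<Rightarrow> 'k) \<Rightarrow> bool \<Rightarrow> identity set" where
  "rees G k m = {(s, t).
     (\<not> hasbar s \<and> G (flat s)) \<and> (\<not> hasbar t \<and> G (flat t)) \<and> k (flat s) = k (flat t) \<or>
     \<not> (\<not> hasbar s \<and> G (flat s)) \<and> \<not> (\<not> hasbar t \<and> G (flat t)) \<and> (m \<longrightarrow> hd (flat s) = hd (flat t))}"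

lemma hd_sub: "a \<noteq> [] \<Longrightarrow> \<phi> (hd a) \<noteq> [] \<Longrightarrow> hd (sub \<phi> a) = hd (\<phi> (hd a))"
  by (cases a) auto

text \<open>The bound on the length makes \<open>x\<^sup>4\<close> a term outside \<open>G\<close>, and such terms do
  not change when they are multiplied on the right.\<close>

lemma rees_epi_theory:
  assumes fac: "\<And>a b. G (a @ b) \<Longrightarrow> a \<noteq> [] \<Longrightarrow> b \<noteq> [] \<Longrightarrow> G a \<and> G b"
    and app: "\<And>a a' b b'. G a \<Longrightarrow> G a' \<Longrightarrow> k a = k a' \<Longrightarrow> G b \<Longrightarrow> G b' \<Longrightarrow> k b = k b' \<Longrightarrow>
      (G (a @ b) \<longleftrightarrow> G (a' @ b')) \<and> (G (a @ b) \<longrightarrow> k (a @ b) = k (a' @ b'))"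
    and set: "\<And>a a'. G a \<Longrightarrow> G a' \<Longrightarrow> k a = k a' \<Longrightarrow> set a = set a'"
    and hd: "\<And>a a'. m \<Longrightarrow> G a \<Longrightarrow> G a' \<Longrightarrow> k a = k a' \<Longrightarrow> hd a = hd a'"
    and subs: "\<And>a a' (\<phi> :: nat \<Rightarrow> nat list). G a \<Longrightarrow> G a' \<Longrightarrow> k a = k a' \<Longrightarrow> (\<And>x. \<phi> x \<noteq> []) \<Longrightarrow>
      (G (sub \<phi> a) \<longleftrightarrow> G (sub \<phi> a')) \<and> (G (sub \<phi> a) \<longrightarrow> k (sub \<phi> a) = k (sub \<phi> a'))"
    and bad: "\<And>a (\<phi> :: nat \<Rightarrow> nat list). \<not> G a \<Longrightarrow> a \<noteq> [] \<Longrightarrow> (\<And>x. \<phi> x \<noteq> []) \<Longrightarrow> \<not> G (sub \<phi> a)"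
    and len: "\<And>a. G a \<Longrightarrow> length a \<le> 3"
  shows "epi_theory (rees G k m)"
proof -
  define good where "good = (\<lambda>s. \<not> hasbar s \<and> G (flat s))"
  have R: "(s, t) \<in> rees G k m \<longleftrightarrow> good s \<and> good t \<and> k (flat s) = k (flat t) \<or>
     \<not> good s \<and> \<not> good t \<and> (m \<longrightarrow> hd (flat s) = hd (flat t))" for s t
    by (simp add: rees_def good_def)
  have H: "(s, t) \<in> rees G k m \<Longrightarrow> m \<Longrightarrow> hd (flat s) = hd (flat t)" for s t
    using hd unfolding R good_def by blast
  have gM: "good (Mul s t) \<Longrightarrow> good s \<and> good t" for s t
    using fac[of "flat s" "flat t"] by (simp add: good_def)
  have E: "equational_theory (rees G k m)"
  proof (rule equational_theoryI)
    fix s t s' t' assume a: "(s, t) \<in> rees G k m" "(s', t') \<in> rees G k m"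
    have h: "m \<longrightarrow> hd (flat (Mul s s')) = hd (flat (Mul t t'))" using H[OF a(1)] by simp
    show "(Mul s s', Mul t t') \<in> rees G k m"
    proof (cases "good s \<and> good s'")
      case True
      then have g: "good s" "good t" "k (flat s) = k (flat t)" "good s'" "good t'" "k (flat s') = k (flat t')"
        using a by (auto simp: R)
      then have "(G (flat s @ flat s') \<longleftrightarrow> G (flat t @ flat t')) \<and> (G (flat s @ flat s') \<longrightarrow> k (flat s @ flat s') = k (flat t @ flat t'))"
        by (intro app) (auto simp: good_def)
      then show ?thesis using g h by (auto simp: R good_def)
    next
      case False
      have "good s = good t" "good s' = good t'" using a unfolding R by blast+
      then have "\<not> good (Mul s s')" "\<not> good (Mul t t')" using False gM by blast+
      then show ?thesis using h unfolding R by blast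
    qed
  next
    fix s t assume "(s, t) \<in> rees G k m"
    then have "m \<longrightarrow> hd (flat s) = hd (flat t)" using H by blast
    then show "(Bar s, Bar t) \<in> rees G k m" by (simp add: R good_def)
  next
    fix s t \<sigma> assume a: "(s, t) \<in> rees G k m"
    let ?\<phi> = "\<lambda>i::nat. flat (\<sigma> i)"
    have h: "m \<longrightarrow> hd (flat (subst \<sigma> s)) = hd (flat (subst \<sigma> t))"
      using H[OF a] by (simp add: flat_subst hd_sub)
    show "(subst \<sigma> s, subst \<sigma> t) \<in> rees G k m"
    proof (cases "good s")
      case True
      then have g: "good s" "good t" "k (flat s) = k (flat t)" using a by (auto simp: R)
      then have "set (flat s) = set (flat t)" by (intro set) (auto simp: good_def)
      then have hb: "hasbar (subst \<sigma> s) \<longleftrightarrow> hasbar (subst \<sigma> t)" using g by (simp add: hasbar_subst good_def)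
      have "(G (sub ?\<phi> (flat s)) \<longleftrightarrow> G (sub ?\<phi> (flat t))) \<and> (G (sub ?\<phi> (flat s)) \<longrightarrow> k (sub ?\<phi> (flat s)) = k (sub ?\<phi> (flat t)))"
        using g by (intro subs) (auto simp: good_def)
      then show ?thesis using h hb by (auto simp: R good_def flat_subst)
    next
      case False
      have "\<not> good (subst \<sigma> r)" if "\<not> good r" for r
        using that bad[of "flat r" ?\<phi>] by (auto simp: good_def hasbar_subst flat_subst)
      then show ?thesis using False a h by (auto simp: R)
    qed
  qed (auto simp: R)
  have len4: "length (flat s) > 3 \<Longrightarrow> \<not> good s" for s using len[of "flat s"] by (auto simp: good_def)
  have "\<not> good (Mul (tpow (Var 0) (Suc 3)) (Bar (Var 0)))" by (simp add: good_def)
  moreover have "\<not> good (tpow (Var 0) 3)" by (rule len4) (simp add: numeral_3_eq_3)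
  ultimately have "(Mul (tpow (Var 0) (Suc 3)) (Bar (Var 0)), tpow (Var 0) 3) \<in> rees G k m"
    by (simp add: R numeral_3_eq_3)
  moreover have "(Mul (Mul (Var 0) (Var 1)) (Var 2), Mul (Var 0) (Mul (Var 1) (Var 2))) \<in> rees G k m"
    by (auto simp: R good_def)
  moreover have "(Om (Var 0), Mul (Bar (Var 0)) (Var 0)) \<in> rees G k m" "(Mul (Om (Var 0)) (Bar (Var 0)), Bar (Var 0)) \<in> rees G k m"
    by (auto simp: R good_def)
  ultimately show ?thesis unfolding epi_theory_def using E by blast
qed

lemma length_sub_eq: "(\<And>x. x \<in> set a \<Longrightarrow> length (\<phi> x) = 1) \<Longrightarrow> length (sub \<phi> a) = length a"
  by (induction a) auto

lemma length_sub_less: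
  assumes "\<And>x. \<phi> x \<noteq> []" "x \<in> set a" "length (\<phi> x) \<noteq> 1" shows "length a < length (sub \<phi> a)"
proof -
  obtain b c where a: "a = b @ [x] @ c" using assms(2) by (metis append_Cons append_Nil split_list)
  have "length (\<phi> x) \<noteq> 0" using assms(1) by simp
  then have "1 < length (\<phi> x)" using assms(3) by linarith
  then show ?thesis using length_sub[of \<phi> b] length_sub[of \<phi> c] assms(1) by (simp add: a)
qed

lemma length_le_3_cases:
  assumes "length a \<le> 3"
  obtains "a = []" | x where "a = [x]" | x y where "a = [x, y]" | x y z where "a = [x, y, z]"
proof -
  have "length a = 0 \<or> length a = 1 \<or> length a = 2 \<or> length a = 3" using assms by presburger
  then show ?thesis using that by (auto simp: length_Suc_conv numeral_2_eq_2 numeral_3_eq_3)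
qed

text \<open>Left zero bands: a term is determined by its first letter.\<close>

definition theory_LZ :: "identity set" where
  "theory_LZ = rees (\<lambda>_. False) (\<lambda>a. a) True"

lemma theory_LZ: "epi_theory theory_LZ"
  unfolding theory_LZ_def by (rule rees_epi_theory) auto

text \<open>The commutative semigroups with \<open>x\<^sup>2 = xyz = 0\<close>.\<close>

definition theory_N2 :: "identity set" where
  "theory_N2 = rees (\<lambda>a. length a \<le> 2 \<and> distinct a) (\<lambda>a. (length a, set a)) False"

lemma distinct_sub: "(\<And>x. \<phi> x \<noteq> []) \<Longrightarrow> distinct (sub \<phi> a) \<Longrightarrow> distinct a"
proof (induction a)
  case (Cons x a)
  have "x \<notin> set a"
  proof
    assume "x \<in> set a"
    moreover obtain c where "c \<in> set (\<phi> x)" using Cons(2)[of x] by (cases "\<phi> x") auto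
    ultimately show False using Cons(3) by auto
  qed
  then show ?case using Cons by auto
qed simp

lemma theory_N2: "epi_theory theory_N2"
  unfolding theory_N2_def
proof (rule rees_epi_theory, goal_cases)
  case (5 a a' \<phi>)
  have l: "length a \<le> 3" "length a' \<le> 3" using 5 by auto
  from 5 show ?case
    by (cases rule: length_le_3_cases[OF l(1)]; cases rule: length_le_3_cases[OF l(2)]) (auto simp: doubleton_eq_iff)
next
  case (6 a \<phi>)
  then show ?case using length_sub[of \<phi> a] distinct_sub[of \<phi> a] by fastforce
qed auto

text \<open>The commutative semigroups with \<open>x\<^sup>2y = xy\<^sup>2\<close>, \<open>x\<^sup>3 = 0\<close> and
  \<open>xyzt = 0\<close>.\<close>

definition theory_N3 :: "identity set" where
  "theory_N3 = rees (\<lambda>a. length a \<le> 3 \<and> \<not> (length a = 3 \<and> card (set a) = 1)) (\<lambda>a. (length a, set a)) False"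

lemma theory_N3: "epi_theory theory_N3"
  unfolding theory_N3_def
proof (rule rees_epi_theory, goal_cases)
  case (1 a b)
  then have "0 < length a" "0 < length b" "length a + length b \<le> 3" by simp_all
  then have "length a < 3" "length b < 3" by linarith+
  then show ?case by simp
next
  case (5 a a' \<phi>)
  have s: "set (sub \<phi> a) = set (sub \<phi> a')" using 5 by auto
  have "length (sub \<phi> a) = length (sub \<phi> a') \<or> 3 < length (sub \<phi> a) \<and> 3 < length (sub \<phi> a')"
  proof (cases "length a = 3")
    case True
    show ?thesis
    proof (cases "\<forall>x\<in>set a. length (\<phi> x) = 1")
      case True
      then show ?thesis using length_sub_eq[of a \<phi>] length_sub_eq[of a' \<phi>] 5 by simp
    next
      case False
      then obtain x where x: "x \<in> set a" "length (\<phi> x) \<noteq> 1" by blast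
      then show ?thesis using length_sub_less[of \<phi> x a] length_sub_less[of \<phi> x a'] 5 True by auto
    qed
  next
    case False
    have l: "length a \<le> 3" "length a' \<le> 3" using 5 by auto
    from 5 False show ?thesis
      by (cases rule: length_le_3_cases[OF l(1)]; cases rule: length_le_3_cases[OF l(2)]) (auto simp: doubleton_eq_iff)
  qed
  then show ?case using s by auto
next
  case (6 a \<phi>)
  show ?case
  proof (cases "length a \<le> 3")
    case True
    then have a: "length a = 3" "card (set a) = 1" using 6 by auto
    then obtain x where x: "set a = {x}" by (meson card_1_singletonE)
    show ?thesis
    proof (cases "length (\<phi> x) = 1")
      case True
      then have "length (sub \<phi> a) = 3" using length_sub_eq[of a \<phi>] a x by auto
      moreover have "set (sub \<phi> a) = set (\<phi> x)" using x by simp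
      moreover have "card (set (\<phi> x)) = 1" using True by (auto simp: length_Suc_conv)
      ultimately show ?thesis by simp
    next
      case False
      then show ?thesis using length_sub_less[of \<phi> x a] 6 a x by auto
    qed
  next
    case False
    then show ?thesis using length_sub[of \<phi> a] 6 by fastforce
  qed
qed auto

text \<open>Words of the form \<open>xxy\<close>, words of length at least four and terms with bars are left zeros and
  are distinguished by their first letter only; each other word is alone in its class.\<close>

definition theory_Z :: "identity set" where
  "theory_Z = rees (\<lambda>a. length a \<le> 3 \<and> \<not> (length a = 3 \<and> a ! 0 = a ! 1)) (\<lambda>a. a) True"

lemma theory_Z: "epi_theory theory_Z"
  unfolding theory_Z_def
proof (rule rees_epi_theory, goal_cases)
  case (1 a b)
  then have "0 < length a" "0 < length b" "length a + length b \<le> 3" by simp_all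
  then have "length a < 3" "length b < 3" by linarith+
  then show ?case by simp
next
  case (6 a \<phi>)
  show ?case
  proof (cases "length a \<le> 3")
    case True
    then obtain x y where a: "a = [x, x, y]" using 6 by (auto simp: length_Suc_conv numeral_3_eq_3)
    have p: "length (\<phi> x) \<noteq> 0" "length (\<phi> y) \<noteq> 0" using 6 by simp_all
    show ?thesis
    proof (cases "length (\<phi> x) = 1")
      case True
      then obtain c where "\<phi> x = [c]" by (auto simp: length_Suc_conv)
      moreover obtain d ds where "\<phi> y = d # ds" using 6(3)[of y] by (cases "\<phi> y") auto
      ultimately show ?thesis using a by auto
    next
      case False
      then have "2 \<le> length (\<phi> x)" using p by linarith
      then show ?thesis using p a by auto
    qed
  next
    case False
    then show ?thesis using length_sub[of \<phi> a] 6 by fastforce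
  qed
qed auto

section \<open>Upper-modular theories: necessity\<close>

text \<open>The modular law that characterizes upper-modular varieties, in terms of theories.\<close>

definition upper :: "identity set \<Rightarrow> bool" where
  "upper \<Theta> \<longleftrightarrow> (\<forall>Y Z. epi_theory Y \<longrightarrow> epi_theory Z \<longrightarrow> \<Theta> \<subseteq> Y \<longrightarrow> Y \<inter> (Z \<union> \<Theta>)\<^sup>* \<subseteq> (\<Theta> \<union> (Z \<inter> Y))\<^sup>*)"

text \<open>How upper-modularity is refuted: a property of terms that is preserved by \<open>\<Theta>\<close> and by
  the common identities of \<open>Y\<close> and \<open>Z\<close> must hold on both sides of an identity of
  \<open>Y\<close> that \<open>\<Theta>\<close> and \<open>Z\<close> prove together.\<close>

lemma upper_invariant:
  assumes "upper \<Theta>" "epi_theory Y" "epi_theory Z" "\<Theta> \<subseteq> Y" "(p, q) \<in> Y" "(p, q) \<in> (Z \<union> \<Theta>)\<^sup>*" "P p"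
    and P: "\<And>s t. P s \<Longrightarrow> (s, t) \<in> \<Theta> \<Longrightarrow> P t" "\<And>s t. P s \<Longrightarrow> (s, t) \<in> Z \<Longrightarrow> (s, t) \<in> Y \<Longrightarrow> P t"
  shows "P q"
proof -
  have "(p, q) \<in> (\<Theta> \<union> (Z \<inter> Y))\<^sup>*" using assms(1-6) unfolding upper_def by blast
  then show ?thesis by (induction rule: rtrancl_induct) (use assms(7) P in blast)+
qed

context epi_monoid
begin

text \<open>The value of a word; in contrast to \<open>ev\<close> it is defined for the empty word.\<close>

primrec pl :: "(nat \<Rightarrow> 'a) \<Rightarrow> nat list \<Rightarrow> 'a" where
  "pl \<rho> [] = 1"
| "pl \<rho> (x # xs) = \<rho> x * pl \<rho> xs"

lemma pl_append: "pl \<rho> (xs @ ys) = pl \<rho> xs * pl \<rho> ys"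
  by (induction xs) (simp_all add: mult.assoc)

lemma ev_word: "xs \<noteq> [] \<Longrightarrow> ev \<rho> (word xs) = pl \<rho> xs"
  by (induction xs rule: word_induct) (simp_all add: word_snoc pl_append)

lemma pl_idem:
  assumes e: "e * e = e"
  shows "(\<And>x. x \<in> set xs \<Longrightarrow> \<rho> x = e) \<Longrightarrow> e * pl \<rho> xs = e"
    and "(\<And>x. x \<in> set xs \<Longrightarrow> \<rho> x = e) \<Longrightarrow> pl \<rho> xs * e = e"
proof -
  show "(\<And>x. x \<in> set xs \<Longrightarrow> \<rho> x = e) \<Longrightarrow> e * pl \<rho> xs = e"
    by (induction xs) (simp_all add: e mult.assoc[symmetric])
  show "(\<And>x. x \<in> set xs \<Longrightarrow> \<rho> x = e) \<Longrightarrow> pl \<rho> xs * e = e"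
    by (induction xs) (simp_all add: e mult.assoc)
qed

end

text \<open>A permutation identity that moves both outer letters makes all idempotents central: with the idempotent
  for all but the first letter it gives \<open>x e = e x e\<close>, and with the idempotent for all but the last
  letter \<open>e x = e x e\<close>. Substituting the idempotent for all letters but the first letters of the two
  sides makes the local monoids commutative.\<close>

lemma strongly_permutative_theory:
  assumes T: "epi_theory \<Theta>" and n: "1 \<le> n" and \<pi>: "\<pi> permutes {1..n}" "\<pi> 1 \<noteq> 1" "\<pi> n \<noteq> n"
    and id: "(word [1..<n+1], word (map \<pi> [1..<n+1])) \<in> \<Theta>"
  shows "permutative \<Theta>"
proof -
  interpret epi_monoid None "tmul \<Theta>" "tbr \<Theta>" by (rule theory_epi_monoid[OF T])
  note m = theory_model[OF T]
  define u v where "u = [1..<n+1]" and "v = map \<pi> u"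
  have n2: "2 \<le> n" using n \<pi> by (cases "n = 1") auto
  have u': "u = [1..<n] @ [n]" unfolding u_def using n2 by simp
  have u: "u = [1] @ [2..<n+1]" unfolding u_def using n2 upt_conv_Cons[of 1 "n + 1"] by (simp add: numeral_2_eq_2)
  have su: "set u = {1..n}" by (auto simp: u_def)
  have dv: "distinct v" unfolding v_def by (simp add: distinct_map u_def permutes_inj_on[OF \<pi>(1)] del: upt_Suc)
  have sv: "set v = set u" unfolding v_def set_map su by (rule permutes_image[OF \<pi>(1)])
  have un: "u \<noteq> []" "v \<noteq> []" using u by (auto simp: v_def)
  have eq: "pl (\<lambda>i. cl \<Theta> (\<sigma> i)) u = pl (\<lambda>i. cl \<Theta> (\<sigma> i)) v" for \<sigma>
    using K_instance[OF m id[folded u_def, folded v_def], of \<sigma>] by (simp add: ev_word un)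
  let ?x = "cl \<Theta> (Var 1)" and ?y = "cl \<Theta> (Var 2)" and ?e = "om (cl \<Theta> (Var 0))"
  have ee: "tmul \<Theta> ?e ?e = ?e" by (rule om_idem)
  note as = mult.assoc
  have xe: "tmul \<Theta> ?x ?e = tmul \<Theta> ?e (tmul \<Theta> ?x ?e)"
  proof -
    have "1 \<in> set v" using sv u by simp
    then obtain a b where ab: "v = a @ [1] @ b" by (metis append_Cons append_Nil split_list)
    have "hd v = \<pi> 1" using u by (simp add: v_def)
    then have a: "a \<noteq> []" using ab \<pi>(2) by auto
    then obtain a0 a' where a0: "a = a0 # a'" by (cases a) auto
    let ?\<sigma> = "\<lambda>i. if i = 1 then Var 1 else Om (Var 0)"
    define \<rho> where "\<rho> = (\<lambda>i::nat. cl \<Theta> (?\<sigma> i))"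
    have \<rho>: "\<rho> 1 = ?x" "\<And>i. i \<noteq> 1 \<Longrightarrow> \<rho> i = ?e" by (simp_all add: \<rho>_def K_Om[OF m])
    have 1: "\<rho> i = ?e" if "i \<in> set a'" for i using that dv by (intro \<rho>) (auto simp: ab a0)
    have 2: "\<rho> i = ?e" if "i \<in> set b" for i using that dv by (intro \<rho>) (auto simp: ab)
    have 3: "\<rho> i = ?e" if "i \<in> set [2..<n+1]" for i using that by (intro \<rho>) auto
    have 4: "\<rho> a0 = ?e" using dv by (intro \<rho>) (auto simp: ab a0)
    have "tmul \<Theta> (pl \<rho> u) ?e = tmul \<Theta> (pl \<rho> v) ?e" using eq[of ?\<sigma>] by (simp add: \<rho>_def)
    moreover have "tmul \<Theta> (pl \<rho> u) ?e = tmul \<Theta> ?x ?e"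
    proof -
      have "tmul \<Theta> (pl \<rho> [2..<n+1]) ?e = ?e" by (rule pl_idem(2)[OF ee]) (rule 3)
      then show ?thesis unfolding u pl_append by (simp add: as \<rho>(1) del: One_nat_def upt_Suc)
    qed
    moreover have "tmul \<Theta> (pl \<rho> v) ?e = tmul \<Theta> ?e (tmul \<Theta> ?x ?e)"
    proof -
      have "tmul \<Theta> (pl \<rho> v) ?e = tmul \<Theta> (tmul \<Theta> ?e (pl \<rho> a')) (tmul \<Theta> ?x (tmul \<Theta> (pl \<rho> b) ?e))"
        unfolding ab a0 pl_append by (simp add: as \<rho>(1) 4 del: One_nat_def)
      then show ?thesis by (simp only: pl_idem(1)[OF ee 1] pl_idem(2)[OF ee 2])
    qed
    ultimately show ?thesis by simp
  qed
  have ex: "tmul \<Theta> ?e ?x = tmul \<Theta> ?e (tmul \<Theta> ?x ?e)"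
  proof -
    have "n \<in> set v" using sv u' by simp
    then obtain a b where ab: "v = a @ [n] @ b" by (metis append_Cons append_Nil split_list)
    have "last v = \<pi> n" using u' by (simp add: v_def)
    then have "b \<noteq> []" using ab \<pi>(3) by auto
    then obtain b0 b' where b0: "b = b' @ [b0]" by (metis rev_exhaust)
    let ?\<sigma> = "\<lambda>i. if i = n then Var 1 else Om (Var 0)"
    define \<rho> where "\<rho> = (\<lambda>i::nat. cl \<Theta> (?\<sigma> i))"
    have \<rho>: "\<rho> n = ?x" "\<And>i. i \<noteq> n \<Longrightarrow> \<rho> i = ?e" by (simp_all add: \<rho>_def K_Om[OF m])
    have 1: "\<rho> i = ?e" if "i \<in> set a" for i using that dv by (intro \<rho>) (auto simp: ab)
    have 2: "\<rho> i = ?e" if "i \<in> set b'" for i using that dv by (intro \<rho>) (auto simp: ab b0)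
    have 3: "\<rho> i = ?e" if "i \<in> set [1..<n]" for i using that by (intro \<rho>) auto
    have 4: "\<rho> b0 = ?e" using dv by (intro \<rho>) (auto simp: ab b0)
    have "tmul \<Theta> ?e (pl \<rho> u) = tmul \<Theta> ?e (pl \<rho> v)" using eq[of ?\<sigma>] by (simp add: \<rho>_def)
    moreover have "tmul \<Theta> ?e (pl \<rho> u) = tmul \<Theta> (tmul \<Theta> ?e (pl \<rho> [1..<n])) ?x"
      unfolding u' pl_append by (simp add: as \<rho>(1) del: One_nat_def)
    moreover have "tmul \<Theta> (tmul \<Theta> ?e (pl \<rho> [1..<n])) ?x = tmul \<Theta> ?e ?x"
      by (simp only: pl_idem(1)[OF ee 3])
    moreover have "tmul \<Theta> ?e (pl \<rho> v) = tmul \<Theta> ?e (tmul \<Theta> ?x ?e)"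
    proof -
      have "tmul \<Theta> ?e (pl \<rho> v) = tmul \<Theta> (tmul \<Theta> ?e (pl \<rho> a)) (tmul \<Theta> ?x (tmul \<Theta> (pl \<rho> b') ?e))"
        unfolding ab b0 pl_append by (simp add: as \<rho>(1) 4 del: One_nat_def)
      then show ?thesis by (simp only: pl_idem(1)[OF ee 1] pl_idem(2)[OF ee 2])
    qed
    ultimately show ?thesis by simp
  qed
  have A2: "(Mul (Om (Var 0)) (Var 1), Mul (Var 1) (Om (Var 0))) \<in> \<Theta>"
    unfolding K_iff[OF m] K_simps(1)[OF m, of "Om (Var 0)"] K_simps(1)[OF m, of "Var 1"] K_Om[OF m] using xe ex by simp
  have "(Mul (Om (Var 0)) (Var 2), Mul (Var 2) (Om (Var 0))) \<in> \<Theta>"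
    using et_subst[OF epi_equational[OF T] A2, of "\<lambda>i. if i = 1 then Var 2 else Var i"] by simp
  then have ye: "tmul \<Theta> ?e ?y = tmul \<Theta> ?y ?e"
    unfolding K_iff[OF m] K_simps(1)[OF m, of "Om (Var 0)"] K_simps(1)[OF m, of "Var 2"] K_Om[OF m] .
  have xe': "tmul \<Theta> ?e ?x = tmul \<Theta> ?x ?e" using xe ex by simp
  have exy: "tmul \<Theta> (tmul \<Theta> ?e ?x) ?y = tmul \<Theta> (tmul \<Theta> ?e ?y) ?x"
  proof -
    let ?p = "\<pi> 1"
    have p: "?p \<in> set u" "?p \<noteq> 1" using \<pi>(2) permutes_in_image[OF \<pi>(1), of 1] n by (auto simp: u_def)
    let ?\<sigma> = "\<lambda>i. if i = 1 then Var 1 else if i = ?p then Var 2 else Om (Var 0)"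
    define \<rho> where "\<rho> = (\<lambda>i::nat. cl \<Theta> (?\<sigma> i))"
    have \<rho>: "\<rho> 1 = ?x" "\<rho> ?p = ?y" "\<And>i. i \<noteq> 1 \<Longrightarrow> i \<noteq> ?p \<Longrightarrow> \<rho> i = ?e" using p(2) by (simp_all add: \<rho>_def K_Om[OF m])
    have "?p \<in> set [2..<n+1]" using p u by auto
    then obtain c d where cd: "[2..<n+1] = c @ [?p] @ d" by (metis append_Cons append_Nil split_list)
    have ucd: "u = [1] @ c @ [?p] @ d" using u cd by simp
    have du: "distinct u" by (simp add: u_def)
    have "hd v = ?p" "1 \<in> set v" using u sv by (simp_all add: v_def)
    then obtain v' where v': "v = [?p] @ v'" by (metis append_Cons append_Nil list.exhaust_sel un(2))
    then have "1 \<in> set v'" using \<open>1 \<in> set v\<close> p(2) by auto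
    then obtain a b where "v' = a @ [1] @ b" by (metis append_Cons append_Nil split_list)
    then have vab: "v = [?p] @ a @ [1] @ b" using v' by simp
    have i1: "\<rho> i = ?e" if "i \<in> set c" for i using that du by (intro \<rho>) (auto simp: ucd)
    have i2: "\<rho> i = ?e" if "i \<in> set d" for i using that du by (intro \<rho>) (auto simp: ucd)
    have i3: "\<rho> i = ?e" if "i \<in> set a" for i using that dv by (intro \<rho>) (auto simp: vab)
    have i4: "\<rho> i = ?e" if "i \<in> set b" for i using that dv by (intro \<rho>) (auto simp: vab)
    have red: "tmul \<Theta> ?e (tmul \<Theta> r (tmul \<Theta> (pl \<rho> g) (tmul \<Theta> s (tmul \<Theta> (pl \<rho> h) ?e)))) = tmul \<Theta> (tmul \<Theta> ?e r) s"
      if g: "\<And>i. i \<in> set g \<Longrightarrow> \<rho> i = ?e" and h: "\<And>i. i \<in> set h \<Longrightarrow> \<rho> i = ?e"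
        and r: "tmul \<Theta> ?e r = tmul \<Theta> r ?e" and s: "tmul \<Theta> ?e s = tmul \<Theta> s ?e" for r s g h
    proof -
      have "tmul \<Theta> ?e (tmul \<Theta> r (tmul \<Theta> (pl \<rho> g) (tmul \<Theta> s (tmul \<Theta> (pl \<rho> h) ?e))))
          = tmul \<Theta> r (tmul \<Theta> (tmul \<Theta> ?e (pl \<rho> g)) (tmul \<Theta> s ?e))"
        by (simp only: pl_idem(2)[OF ee h] left_commutes[OF r] as)
      also have "\<dots> = tmul \<Theta> r (tmul \<Theta> ?e (tmul \<Theta> ?e s))" by (simp only: pl_idem(1)[OF ee g] s)
      also have "tmul \<Theta> ?e (tmul \<Theta> ?e s) = tmul \<Theta> ?e s" by (simp only: as[symmetric] ee)
      also have "tmul \<Theta> r (tmul \<Theta> ?e s) = tmul \<Theta> (tmul \<Theta> r ?e) s" by (rule as[symmetric])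
      finally show ?thesis by (simp only: r)
    qed
    have "tmul \<Theta> ?e (tmul \<Theta> (pl \<rho> u) ?e) = tmul \<Theta> ?e (tmul \<Theta> (pl \<rho> v) ?e)"
      using eq[of ?\<sigma>] by (simp add: \<rho>_def)
    then have "tmul \<Theta> ?e (tmul \<Theta> ?x (tmul \<Theta> (pl \<rho> c) (tmul \<Theta> ?y (tmul \<Theta> (pl \<rho> d) ?e))))
      = tmul \<Theta> ?e (tmul \<Theta> ?y (tmul \<Theta> (pl \<rho> a) (tmul \<Theta> ?x (tmul \<Theta> (pl \<rho> b) ?e))))"
      unfolding ucd vab pl_append by (simp add: as \<rho>(1,2) del: One_nat_def)
    then show ?thesis using red[OF i1 i2 xe' ye] red[OF i3 i4 ye xe'] by simp
  qed
  then have "(Mul (Mul (Om (Var 0)) (Var 1)) (Var 2), Mul (Mul (Om (Var 0)) (Var 2)) (Var 1)) \<in> \<Theta>"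
    unfolding K_iff[OF m] K_simps(1)[OF m, of "Mul (Om (Var 0)) _"] K_simps(1)[OF m, of "Om (Var 0)"] K_Om[OF m] .
  with A2 show ?thesis by (simp add: permutative_def)
qed

text \<open>Somewhere in the word the letter changes.\<close>

lemma adjacent_two_letters:
  assumes "set ts = {a, b}" "a \<noteq> b"
  shows "\<exists>c d. ts = c @ [a, b] @ d \<or> ts = c @ [b, a] @ d"
  using assms
proof (induction ts)
  case (Cons x ts)
  show ?case
  proof (cases "set ts = {a, b}")
    case True
    then obtain c d where "ts = c @ [a, b] @ d \<or> ts = c @ [b, a] @ d" using Cons by blast
    then show ?thesis by (intro exI[of _ "x # c"] exI[of _ d]) auto
  next
    case False
    have sub: "set ts \<subseteq> {a, b}" and x: "x = a \<or> x = b" using Cons(2) by auto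
    have "ts \<noteq> []" using Cons(2,3) by auto
    then obtain y d where yd: "ts = y # d" by (cases ts) auto
    have "x \<notin> set ts"
    proof
      assume "x \<in> set ts"
      then have "set ts = insert x (set ts)" by auto
      then show False using Cons(2) False by simp
    qed
    then have "y \<noteq> x" "y = a \<or> y = b" using sub yd by auto
    then show ?thesis using x yd by (intro exI[of _ "[]"] exI[of _ d]) auto
  qed
qed simp

lemma word_rename:
  assumes "epi_theory \<Theta>" "(word xs, word ys) \<in> \<Theta>" "xs \<noteq> []" "ys \<noteq> []"
  shows "(word (map f xs), word (map f ys)) \<in> \<Theta>"
  using word_subst[OF assms, of "\<lambda>x. [f x]"] by (simp add: sub_singleton)

lemma subst_Var_word: "xs \<noteq> [] \<Longrightarrow> subst (\<lambda>i. Var (f i)) (word xs) = word (map f xs)"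
  by (induction xs rule: word_induct) (simp_all add: word_snoc)

text \<open>A word of the class contains \<open>ab\<close> or \<open>ba\<close> as a factor. In both cases
  \<open>ab\<close> is equal to a word that contains \<open>ab\<close> itself, which must not be a proper
  factor.\<close>

lemma two_letter_class:
  assumes T: "epi_theory \<Theta>" and ab: "a \<noteq> b" and nv: "\<not> vanishes \<Theta> (word [a, b])"
    and nc: "(word [a, b], word [b, a]) \<notin> \<Theta>" and t: "(word [a, b], t) \<in> \<Theta>"
  shows "\<not> hasbar t \<and> flat t = [a, b]"
proof -
  note E = epi_equational[OF T]
  have nb: "\<not> hasbar t" and st: "set (flat t) = {a, b}" using nonvanishing_class[OF T nv t] by auto
  have wt: "(word [a, b], word (flat t)) \<in> \<Theta>" by (rule et_trans[OF E t word_flat[OF T nb]])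
  obtain c d where "flat t = c @ [a, b] @ d \<or> flat t = c @ [b, a] @ d"
    using adjacent_two_letters[OF st ab] by blast
  then show ?thesis
  proof
    assume f: "flat t = c @ [a, b] @ d"
    have "c @ d = []"
    proof (rule ccontr)
      assume "c @ d \<noteq> []"
      then show False using proper_factor_vanishes[OF T wt[unfolded f]] nv by simp
    qed
    then show ?thesis using nb f by simp
  next
    assume f: "flat t = c @ [b, a] @ d"
    let ?s = "\<lambda>x. if x = a then b else if x = b then a else x"
    have "(word (map ?s [a, b]), word (map ?s (flat t))) \<in> \<Theta>" by (rule word_rename[OF T wt]) simp_all
    then have "(word [b, a], word (map ?s c @ [a, b] @ map ?s d)) \<in> \<Theta>" using ab by (simp add: f)
    then have "(word (c @ [b, a] @ d), word (c @ (map ?s c @ [a, b] @ map ?s d) @ d)) \<in> \<Theta>"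
      by (rule word_context[OF T]) simp_all
    then have w: "(word [a, b], word ((c @ map ?s c) @ [a, b] @ (map ?s d @ d))) \<in> \<Theta>"
      using et_trans[OF E wt] f by simp
    have "c @ d = []"
    proof (rule ccontr)
      assume "c @ d \<noteq> []"
      then show False using proper_factor_vanishes[OF T w] nv by simp
    qed
    then show ?thesis using wt f nc by simp
  qed
qed

text \<open>If \<open>xy = yx\<close> fails, then \<open>xy\<close> does not vanish, and it is the only word in its
  class, so that \<open>\<Theta>\<close> is contained in \<open>theory_N2\<close>. The permutation identity, which
  changes the first letter, and the left zero bands lead from \<open>xy\<close> to \<open>yx\<close>, and this is an
  identity of \<open>theory_N2\<close>. But an identity common to \<open>theory_N2\<close> and to the left zero bands
  does not change the word \<open>xy\<close>.\<close>

lemma upper_commutative: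
  assumes T: "epi_theory \<Theta>" and u: "upper \<Theta>" and n: "1 \<le> n" and \<pi>: "\<pi> permutes {1..n}" "\<pi> 1 \<noteq> 1" "\<pi> n \<noteq> n"
    and id: "(word [1..<n+1], word (map \<pi> [1..<n+1])) \<in> \<Theta>"
  shows "commutative \<Theta>"
proof (rule ccontr)
  note E = epi_equational[OF T]
  have perm: "permutative \<Theta>" by (rule strongly_permutative_theory[OF T n \<pi> id])
  have law: "commutative_law = (word [0, 1], word [1, 0])" by (simp add: commutative_law_def)
  assume "\<not> commutative \<Theta>"
  then have nc01: "(word [0, 1], word [1, 0]) \<notin> \<Theta>" by (simp add: commutative_def law)
  have nc: "(word [a, b], word [b, a]) \<notin> \<Theta>" if "a \<noteq> b" for a b
  proof
    assume "(word [a, b], word [b, a]) \<in> \<Theta>"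
    from word_rename[OF T this, of "\<lambda>x. if x = a then 0 else 1"] nc01 that show False by auto
  qed
  have nv: "\<not> vanishes \<Theta> (word [a, b])" if ab: "a \<noteq> b" for a b
  proof
    assume v: "vanishes \<Theta> (word [a, b])"
    have v': "vanishes \<Theta> (word [b, a])"
      using vanishes_subst[OF T v, of "\<lambda>i. Var (if i = a then b else a)"] ab by (simp add: subst_Var_word)
    have "(word [a, b], word [b, a]) \<in> \<Theta>"
    proof (rule theory_vanishes_identity[OF T perm v v'])
      show "ex y (word [a, b]) - ex y (word [b, a]) \<in> periods \<Theta>" for y
        using theory_periods(1)[OF T] by (simp add: word_def)
      show "occ y (word [a, b]) = occ y (word [b, a]) \<or>
         (\<exists>k. index \<Theta> k \<and> enat k \<le> occ y (word [a, b]) \<and> enat k \<le> occ y (word [b, a]))" for y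
        by (simp add: word_def)
    qed
    then show False using nc[OF ab] by simp
  qed
  note cls = two_letter_class[OF T _ nv nc]
  have le: "\<not> hasbar t \<and> length (flat t) = length (flat s) \<and> set (flat t) = set (flat s) \<and> distinct (flat t)"
    if st: "(s, t) \<in> \<Theta>" and s: "\<not> hasbar s" "length (flat s) \<le> 2" "distinct (flat s)" for s t
  proof -
    have l: "length (flat s) \<le> 3" using s by simp
    consider x where "flat s = [x]" | x y where "flat s = [x, y]" "x \<noteq> y"
      using s by (cases rule: length_le_3_cases[OF l]) auto
    then show ?thesis
    proof cases
      case 1
      \<comment> \<open>A single letter is reduced to a product of two letters by means of the new letter \<open>Suc x\<close>.\<close>
      have "(word [x, Suc x], Mul t (Var (Suc x))) \<in> \<Theta>"
        using et_trans[OF E flat_eq_theory[OF T, of "word [x, Suc x]" "Mul s (Var (Suc x))"] et_Mul[OF E st et_refl[OF E]]]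
          s 1 by simp
      from cls[OF _ _ _ this] 1 show ?thesis by simp
    next
      case 2
      have "(word [x, y], t) \<in> \<Theta>" using et_trans[OF E et_sym[OF E word_flat[OF T s(1)]] st] 2 by simp
      from cls[OF _ _ _ this] 2 show ?thesis by simp
    qed
  qed
  have sub: "\<Theta> \<subseteq> theory_N2"
  proof (rule subrelI)
    fix s t assume "(s, t) \<in> \<Theta>"
    with le[OF this] le[OF et_sym[OF E this]] show "(s, t) \<in> theory_N2"
      unfolding theory_N2_def rees_def by auto
  qed
  \<comment> \<open>The two sides of the permutation identity have different first letters; identifying all letters but the first leaves two.\<close>
  define \<sigma> where "\<sigma> = (\<lambda>i::nat. if i = 1 then 0 else (1::nat))"
  have n2: "2 \<le> n" using n \<pi> by (cases "n = 1") auto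
  have "hd (map \<sigma> [1..<n+1]) = 0" "hd (map \<sigma> (map \<pi> [1..<n+1])) = 1"
    using n2 \<pi>(2) by (simp_all add: \<sigma>_def hd_map del: upt_Suc)
  moreover have "(word (map \<sigma> [1..<n+1]), word (map \<sigma> (map \<pi> [1..<n+1]))) \<in> \<Theta>"
    by (rule word_rename[OF T id]) (use n in simp_all)
  ultimately obtain xs ys where xy: "(word xs, word ys) \<in> \<Theta>" "xs \<noteq> []" "ys \<noteq> []" "hd xs = 0" "hd ys = 1"
    using n by (metis Nil_is_map_conv upt_eq_Nil_conv add_is_0 less_add_one not_less one_neq_zero)
  have lz: "(word a, word b) \<in> theory_LZ" if "hd a = hd b" "a \<noteq> []" "b \<noteq> []" for a b
    using that by (simp add: theory_LZ_def rees_def)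
  have "(word [0, 1], word xs) \<in> theory_LZ \<union> \<Theta>" using lz[of "[0, 1]" xs] xy by simp
  moreover have "(word xs, word ys) \<in> theory_LZ \<union> \<Theta>" using xy by simp
  moreover have "(word ys, word [1, 0]) \<in> theory_LZ \<union> \<Theta>" using lz[of ys "[1, 0]"] xy by simp
  ultimately have chain: "(word [0, 1], word [1, 0]) \<in> (theory_LZ \<union> \<Theta>)\<^sup>*"
    by (meson r_into_rtrancl rtrancl_trans)
  have N2: "(word [0, 1], word [1, 0]) \<in> theory_N2"
    by (auto simp: theory_N2_def rees_def)
  have "\<not> hasbar (word [1, 0]) \<and> flat (word [1, 0]) = [0, 1]"
  proof (rule upper_invariant[OF u theory_N2 theory_LZ sub N2 chain, of "\<lambda>t. \<not> hasbar t \<and> flat t = [0, 1]"])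
    show "\<not> hasbar t \<and> flat t = [0, 1]" if "\<not> hasbar s \<and> flat s = [0, 1]" "(s, t) \<in> \<Theta>" for s t
      using cls[of 0 1 t] et_trans[OF E flat_eq_theory[OF T, of "word [0, 1]" s] that(2)] that by simp
    show "\<not> hasbar t \<and> flat t = [0, 1]" if s: "\<not> hasbar s \<and> flat s = [0, 1]" "(s, t) \<in> theory_LZ" "(s, t) \<in> theory_N2" for s t
    proof -
      have t: "\<not> hasbar t" "length (flat t) = 2" "set (flat t) = {0, 1}" "hd (flat t) = 0"
        using s by (auto simp: theory_LZ_def theory_N2_def rees_def)
      obtain x y where "flat t = [x, y]" using t(2) by (auto simp: length_Suc_conv numeral_2_eq_2)
      then show ?thesis using t(1,3,4) by (simp add: doubleton_eq_iff)
    qed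
  qed simp
  then show False by simp
qed

text \<open>A word \<open>a\<^sup>ib\<^sup>j\<close> in the class of \<open>aab\<close> cannot be a proper multiple of
  it. There remains \<open>i = 1\<close>. Here \<open>j = 2\<close> is excluded, and \<open>j = 1\<close> or \<open>j
  \<ge> 3\<close> would again make \<open>aab\<close> equal to a proper multiple of itself, the latter by
  interchanging the two letters.\<close>

lemma three_letter_class:
  assumes T: "epi_theory \<Theta>" and c: "commutative \<Theta>" and ab: "a \<noteq> b" and nv: "\<not> vanishes \<Theta> (word [a, a, b])"
    and nc: "(word [a, a, b], word [a, b, b]) \<notin> \<Theta>" and p: "\<not> hasbar p" "mset (flat p) = {#a, a, b#}" and pt: "(p, t) \<in> \<Theta>"
  shows "\<not> hasbar t \<and> mset (flat t) = {#a, a, b#}"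
proof -
  note E = epi_equational[OF T]
  note tr = et_trans[OF E]
  have "(word [a, a, b], word (flat p)) \<in> \<Theta>" by (rule word_mset[OF T c]) (simp_all add: p)
  then have at: "(word [a, a, b], t) \<in> \<Theta>" using tr[OF tr[OF _ et_sym[OF E word_flat[OF T p(1)]]] pt] by blast
  have nb: "\<not> hasbar t" and st: "set (flat t) = {a, b}" using nonvanishing_class[OF T nv at] by auto
  have wt: "(word [a, a, b], word (flat t)) \<in> \<Theta>" by (rule tr[OF at word_flat[OF T nb]])
  define i j where "i = count (mset (flat t)) a" and "j = count (mset (flat t)) b"
  have ij: "1 \<le> i" "1 \<le> j" unfolding i_def j_def using st by (simp_all add: Suc_le_eq count_greater_zero_iff)
  have m: "mset (flat t) = replicate_mset i a + replicate_mset j b"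
  proof (rule multiset_eqI)
    fix x show "count (mset (flat t)) x = count (replicate_mset i a + replicate_mset j b) x"
      using st ab by (cases "x = a"; cases "x = b") (auto simp: i_def j_def count_eq_zero_iff)
  qed
  show ?thesis
  proof (cases "2 \<le> i")
    case True
    have "mset [a, a, b] \<subseteq># mset (flat t)"
      unfolding m using True ij ab by (auto simp: subseteq_mset_def)
    then have "mset [a, a, b] = mset (flat t)" using nonvanishing_mset[OF T c nv _ wt] by simp
    then show ?thesis using nb by simp
  next
    case False
    then have i: "i = 1" using ij by simp
    consider "j = 1" | "j = 2" | k where "j = Suc (Suc (Suc k))"
      using ij by (metis One_nat_def Suc_1 Suc_le_D nat.exhaust not_less_eq_eq le_zero_eq)
    then have False
    proof cases
      case 1
      have "(word (flat t), word [a, b]) \<in> \<Theta>" by (rule word_mset[OF T c]) (simp_all add: m i 1)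
      then have "(word [a, b], word [a, a, b]) \<in> \<Theta>" using tr[OF wt] et_sym[OF E] by blast
      from word_context[OF T this, of "[a]" "[]"] have "(word [a, a, b], word ([a] @ [a, a, b] @ [])) \<in> \<Theta>" by simp
      from proper_factor_vanishes[OF T this] nv show False by simp
    next
      case 2
      have "(word (flat t), word [a, b, b]) \<in> \<Theta>" by (rule word_mset[OF T c]) (simp_all add: m i 2 numeral_2_eq_2)
      then show False using tr[OF wt] nc by blast
    next
      case 3
      let ?s = "\<lambda>x. if x = a then b else if x = b then a else x"
      let ?u = "replicate (Suc k) b"
      have "(word (flat t), word ([a] @ replicate j b)) \<in> \<Theta>"
        by (rule word_mset[OF T c]) (simp_all add: m i)
      then have w: "(word [a, a, b], word ([a] @ replicate j b)) \<in> \<Theta>" by (rule tr[OF wt])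
      have "(word (map ?s [a, a, b]), word (map ?s ([a] @ replicate j b))) \<in> \<Theta>" by (rule word_rename[OF T w]) simp_all
      then have "(word [b, b, a], word ([b] @ replicate j a)) \<in> \<Theta>" using ab by (simp add: map_replicate)
      from word_context[OF T this, of "[]" ?u]
      have "(word ([b, b, a] @ ?u), word (([b] @ replicate j a) @ ?u)) \<in> \<Theta>" by simp
      moreover have "(word ([a] @ replicate j b), word ([b, b, a] @ ?u)) \<in> \<Theta>"
        by (rule word_mset[OF T c]) (simp_all add: 3)
      ultimately have w': "(word [a, a, b], word (([b] @ replicate j a) @ ?u)) \<in> \<Theta>" using tr w by blast
      have "mset [a, a, b] = mset (([b] @ replicate j a) @ ?u)"
        by (rule nonvanishing_mset[OF T c nv _ w']) (use ab in \<open>simp_all add: 3 subseteq_mset_def\<close>)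
      then have "size (mset [a, a, b]) = size (mset (([b] @ replicate j a) @ ?u))" by (rule arg_cong)
      then show False using 3 by simp
    qed
    then show ?thesis ..
  qed
qed

text \<open>Suppose that \<open>x\<^sup>2y = xy\<^sup>2\<close> fails and \<open>x\<^sup>2y\<close> does not vanish.
  Then the class of \<open>xxy\<close> consists of its permutations, and words of length at most three other than
  cubes are equal only to words of the same length and content, so that \<open>\<Theta>\<close> is contained in
  \<open>theory_N3\<close>. In \<open>theory_Z\<close> the words \<open>xxy\<close> and \<open>xyxy\<close> are equal,
  as are \<open>yxyx\<close> and \<open>yyx\<close>; with commutativity they lead from \<open>x\<^sup>2y\<close> to
  \<open>xy\<^sup>2\<close>, an identity of \<open>theory_N3\<close>. But an identity common to
  \<open>theory_N3\<close> and \<open>theory_Z\<close> does not lead from permutations of \<open>xxy\<close> to other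
  terms.\<close>

lemma upper_dichotomy:
  assumes T: "epi_theory \<Theta>" and u: "upper \<Theta>" and c: "commutative \<Theta>"
  shows "(word [0, 0, 1], word [0, 1, 1]) \<in> \<Theta> \<or> vanishes \<Theta> (word [0, 0, 1])"
proof (rule ccontr)
  assume as: "\<not> ?thesis"
  note E = epi_equational[OF T]
  have nc: "(word [a, a, b], word [a, b, b]) \<notin> \<Theta>" if "a \<noteq> b" for a b
  proof
    assume "(word [a, a, b], word [a, b, b]) \<in> \<Theta>"
    from word_rename[OF T this, of "\<lambda>x. if x = a then 0 else 1"] as that show False by auto
  qed
  have nv: "\<not> vanishes \<Theta> (word [a, a, b])" if ab: "a \<noteq> b" for a b
  proof
    assume v: "vanishes \<Theta> (word [a, a, b])"
    from vanishes_subst[OF T v, of "\<lambda>i. Var (if i = a then 0 else 1)"] as ab show False by (simp add: subst_Var_word)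
  qed
  note cls = three_letter_class[OF T c _ nv nc]
  have nvp: "\<not> vanishes \<Theta> p" if "a \<noteq> b" "\<not> hasbar p" "mset (flat p) = {#a, a, b#}" for p a b
  proof
    assume "vanishes \<Theta> p"
    then obtain p' where "(p, p') \<in> \<Theta>" "hasbar p'" by (auto simp: vanishes_def)
    then show False using cls[OF that(1) _ _ that(2,3)] that(1) by blast
  qed
  \<comment> \<open>Every word in question can be multiplied by letters, or its letters identified, so as to become a permutation of some \<open>aab\<close>.\<close>
  have len: "\<not> vanishes \<Theta> s \<and> length (flat t) = length (flat s)"
    if st: "(s, t) \<in> \<Theta>" and s: "\<not> hasbar s" "length (flat s) \<le> 3" "\<not> (length (flat s) = 3 \<and> card (set (flat s)) = 1)" for s t
  proof -
    have key: "\<not> vanishes \<Theta> p \<and> length (flat q) = 3"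
      if "(p, q) \<in> \<Theta>" "a \<noteq> b" "\<not> hasbar p" "mset (flat p) = {#a, a, b#}" for p q a b
    proof -
      have "mset (flat q) = {#a, a, b#}" using cls[OF that(2) _ _ that(3,4,1)] that(2) by blast
      then have "size (mset (flat q)) = 3" by simp
      then show ?thesis using nvp[OF that(2-4)] by simp
    qed
    consider x where "flat s = [x]" | x where "flat s = [x, x]" | x y where "flat s = [x, y]" "x \<noteq> y"
      | x y where "mset (flat s) = {#x, x, y#}" "x \<noteq> y" | x y z where "flat s = [x, y, z]" "distinct [x, y, z]"
    proof (cases rule: length_le_3_cases[OF s(2)])
      case (4 x y z)
      have ne: "\<not> (x = y \<and> y = z)" using s(3) 4 by auto
      have m1: "mset (flat s) = {#x, x, z#}" if "x = y" using 4 that by simp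
      have m2: "mset (flat s) = {#x, x, y#}" if "x = z" using 4 that by simp
      have m3: "mset (flat s) = {#y, y, x#}" if "y = z" using 4 that by simp
      consider "x = y" "x \<noteq> z" | "x = z" "x \<noteq> y" | "y = z" "y \<noteq> x" | "distinct [x, y, z]" using ne by auto
      then show ?thesis using m1 m2 m3 4 that(4,5) by cases blast+
    next
      case (3 x y)
      then show ?thesis using that(2,3) by (cases "x = y") auto
    qed (use that(1) in simp_all)
    then show ?thesis
    proof cases
      case 1
      have "(Mul (Mul (Var x) s) (Var (Suc x)), Mul (Mul (Var x) t) (Var (Suc x))) \<in> \<Theta>"
        by (intro et_Mul[OF E] et_refl[OF E] st)
      from key[OF this, of x "Suc x"] 1 s vanishes_Mul[OF T] show ?thesis by auto
    next
      case 2
      have "(Mul s (Var (Suc x)), Mul t (Var (Suc x))) \<in> \<Theta>"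
        by (intro et_Mul[OF E] et_refl[OF E] st)
      from key[OF this, of x "Suc x"] 2 s vanishes_Mul[OF T] show ?thesis by auto
    next
      case 3
      have "(Mul (Var x) s, Mul (Var x) t) \<in> \<Theta>"
        by (intro et_Mul[OF E] et_refl[OF E] st)
      from key[OF this, of x y] 3 s vanishes_Mul[OF T] show ?thesis by auto
    next
      case 4
      then have "length (flat s) = 3" by (metis size_mset size_add_mset size_empty numeral_3_eq_3)
      with key[OF st 4(2) s(1) 4(1)] show ?thesis by simp
    next
      case 5
      let ?\<sigma> = "\<lambda>i. Var (if i = x then y else i)"
      have st': "(subst ?\<sigma> s, subst ?\<sigma> t) \<in> \<Theta>" by (rule et_subst[OF E st])
      have nb: "\<not> hasbar (subst ?\<sigma> s)" using s by (simp add: hasbar_subst)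
      have fs: "flat (subst ?\<sigma> r) = map (\<lambda>i. if i = x then y else i) (flat r)" for r
        by (simp add: flat_subst sub_singleton)
      have "mset (flat (subst ?\<sigma> s)) = {#y, y, z#}" unfolding fs using 5 by auto
      from key[OF st' _ nb this] 5 have "\<not> vanishes \<Theta> (subst ?\<sigma> s)" "length (flat (subst ?\<sigma> t)) = 3" by auto
      then show ?thesis using vanishes_subst[OF T] 5 unfolding fs by auto
    qed
  qed
  have le: "\<not> hasbar t \<and> length (flat t) = length (flat s) \<and> set (flat t) = set (flat s)"
    if st: "(s, t) \<in> \<Theta>" "\<not> hasbar s" "length (flat s) \<le> 3" "\<not> (length (flat s) = 3 \<and> card (set (flat s)) = 1)" for s t
    using len[OF st] nonvanishing_class[OF T _ st(1)] by blast
  have sub: "\<Theta> \<subseteq> theory_N3"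
  proof (rule subrelI)
    fix s t assume st: "(s, t) \<in> \<Theta>"
    define g where "g = (\<lambda>s. \<not> hasbar s \<and> length (flat s) \<le> 3 \<and> \<not> (length (flat s) = 3 \<and> card (set (flat s)) = 1))"
    have l: "g t \<and> length (flat t) = length (flat s) \<and> set (flat t) = set (flat s)" if "(s, t) \<in> \<Theta>" "g s" for s t
      using le[OF that(1)] that(2) by (simp add: g_def)
    have "g s = g t" using l[OF st] l[OF et_sym[OF E st]] by blast
    then show "(s, t) \<in> theory_N3"
      unfolding theory_N3_def rees_def using l[OF st] by (auto simp: g_def)
  qed
  have Z: "(word [0, 0, 1], word [0, 1, 0, 1]) \<in> theory_Z" "(word [1, 0, 1, 0], word [1, 1, 0]) \<in> theory_Z"
    by (simp_all add: theory_Z_def rees_def)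
  have C: "(word [0, 1, 0, 1], word [1, 0, 1, 0]) \<in> \<Theta>" "(word [1, 1, 0], word [0, 1, 1]) \<in> \<Theta>"
    by (rule word_mset[OF T c], simp, simp)+
  have "(word [0, 0, 1], word [0, 1, 0, 1]) \<in> (theory_Z \<union> \<Theta>)\<^sup>*" using Z(1) by blast
  also have "(word [0, 1, 0, 1], word [1, 0, 1, 0]) \<in> (theory_Z \<union> \<Theta>)\<^sup>*" using C(1) by blast
  also have "(word [1, 0, 1, 0], word [1, 1, 0]) \<in> (theory_Z \<union> \<Theta>)\<^sup>*" using Z(2) by blast
  also have "(word [1, 1, 0], word [0, 1, 1]) \<in> (theory_Z \<union> \<Theta>)\<^sup>*" using C(2) by blast
  finally have chain: "(word [0, 0, 1], word [0, 1, 1]) \<in> (theory_Z \<union> \<Theta>)\<^sup>*" .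
  have N3: "(word [0, 0, 1], word [0, 1, 1]) \<in> theory_N3"
    by (auto simp: theory_N3_def rees_def)
  have "\<not> hasbar (word [0, 1, 1]) \<and> mset (flat (word [0, 1, 1])) = {#0, 0, 1#}"
  proof (rule upper_invariant[OF u theory_N3 theory_Z sub N3 chain, of "\<lambda>t. \<not> hasbar t \<and> mset (flat t) = {#0, 0, 1#}"])
    show "\<not> hasbar t \<and> mset (flat t) = {#0, 0, 1#}" if "\<not> hasbar s \<and> mset (flat s) = {#0, 0, 1#}" "(s, t) \<in> \<Theta>" for s t
      using cls[of 0 1 s t] that by simp
    show "\<not> hasbar t \<and> mset (flat t) = {#0, 0, 1#}"
      if s: "\<not> hasbar s \<and> mset (flat s) = {#0, 0, 1#}" "(s, t) \<in> theory_Z" "(s, t) \<in> theory_N3" for s t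
    proof -
      have ls: "length (flat s) = 3" using s(1) by (metis size_mset size_add_mset size_empty numeral_3_eq_3)
      have ss: "set (flat s) = {0, 1}" using s(1) by (metis set_mset_mset set_mset_add_mset_insert set_mset_empty insert_absorb2)
      have t: "\<not> hasbar t" "length (flat t) = 3" "set (flat t) = {0, 1}"
        using s ls ss by (auto simp: theory_N3_def rees_def)
      show ?thesis
      proof (cases "flat s ! 0 = flat s ! 1")
        case True
        obtain y where y: "flat s = [0, 0, y]"
        proof -
          obtain a b d where "flat s = [a, b, d]" using ls by (auto simp: length_Suc_conv numeral_3_eq_3)
          moreover have "count (mset (flat s)) 0 = 2" using s(1) by simp
          ultimately show ?thesis using that True by (auto split: if_splits)
        qed
        have "hd (flat t) = 0" "flat t ! 0 = flat t ! 1"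
          using s(2) t ls True y by (auto simp: theory_Z_def rees_def)
        moreover obtain a b d where "flat t = [a, b, d]" using t(2) by (auto simp: length_Suc_conv numeral_3_eq_3)
        ultimately show ?thesis using t(1,3) by (auto simp: doubleton_eq_iff)
      next
        case False
        then have "flat t = flat s" using s ls t by (auto simp: theory_Z_def rees_def)
        then show ?thesis using s t by simp
      qed
    qed
  qed simp
  then show False by simp
qed

section \<open>Identities with a linear side\<close>

text \<open>With \<open>r = br a \<cdot> q\<close> the hypothesis reads \<open>a = p a r\<close>, so that \<open>a = a
  r\<^sup>\<omega>\<close>, and \<open>a r = a\<^sup>\<omega> q\<close> is a multiple of the idempotent of
  \<open>a\<close>.\<close>

lemma (in epi_monoid) idempotent_factor:
  assumes "a = p * om a * q" shows "om a * a = a"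
proof -
  define r where "r = br a * q"
  have "a = p * a * r" using assms by (simp add: r_def om_def mult.assoc)
  then have "a * om r = a" by (rule power_absorb(2))
  then have "a = a * (br a * q) * br r" by (simp add: om_def r_def mult.assoc)
  then have "a = om a * (q * br r)" by (simp add: om_def mult.assoc)
  then show ?thesis using om_idem by (metis mult.assoc)
qed

lemma (in epi_monoid) letter_factor: "z \<in> set (flat t) \<Longrightarrow> \<exists>p q. ev \<rho> t = p * \<rho> z * q"
proof (induction t)
  case (Var i)
  then show ?case by (intro exI[of _ 1]) simp
next
  case (Mul s t)
  show ?case
  proof (cases "z \<in> set (flat s)")
    case True
    then obtain p q where "ev \<rho> s = p * \<rho> z * q" using Mul by blast
    then show ?thesis by (intro exI[of _ p] exI[of _ "q * ev \<rho> t"]) (simp add: mult.assoc)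
  next
    case False
    then obtain p q where "ev \<rho> t = p * \<rho> z * q" using Mul by auto
    then show ?thesis by (intro exI[of _ "ev \<rho> s * p"] exI[of _ q]) (simp add: mult.assoc)
  qed
next
  case (Bar t)
  then obtain p q where e: "ev \<rho> t = p * \<rho> z * q" by auto
  have "br (ev \<rho> t) = ev \<rho> t * (br (ev \<rho> t) * br (ev \<rho> t))" using br_inner[of "ev \<rho> t"] by (simp add: mult.assoc)
  also have "\<dots> = p * \<rho> z * (q * (br (ev \<rho> t) * br (ev \<rho> t)))" by (subst e) (simp only: mult.assoc)
  finally show ?case unfolding ev.simps by blast
qed

lemma ex_subst:
  assumes "\<And>i y. i \<in> set (flat t) \<Longrightarrow> ex y (\<sigma> i) = (if i = y then 1 else 0)"
  shows "ex y (subst \<sigma> t) = ex y t"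
  using assms by (induction t) auto

lemma ex_word: "xs \<noteq> [] \<Longrightarrow> ex y (word xs) = int (count_list xs y)"
  by (rule ex_occ) (simp add: occ_flat)

lemma ex_tpow: "ex y (tpow t k) = int (Suc k) * ex y t"
  by (induction k) (simp_all add: algebra_simps)

lemma ex_gpt: "ex y (gpt t j) = j * ex y t"
proof -
  have j: "int (Suc (nat j)) - int (Suc (nat (- j))) = j" by simp
  have "ex y (gpt t j) = int (Suc (nat j)) * ex y t - int (Suc (nat (- j))) * ex y t"
    unfolding gpt_def by (simp only: ex.simps ex_tpow mult_minus_right add_uminus_conv_diff)
  also have "\<dots> = j * ex y t" by (simp only: left_diff_distrib[symmetric] j)
  finally show ?thesis .
qed

lemma flat_tpow: "set (flat (tpow t k)) = set (flat t)"
  by (induction k) auto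

lemma flat_gpt: "set (flat (gpt t j)) = set (flat t)"
  by (simp add: gpt_def flat_tpow)

text \<open>In a theory of periodic semigroups, bars can be replaced by powers. Here \<open>tpow t (Suc m)\<close> is
  \<open>t\<^sup>m\<^sup>+\<^sup>2\<close>, which contains \<open>t\<close> at least twice.\<close>

primrec unbar :: "nat \<Rightarrow> uterm \<Rightarrow> uterm" where
  "unbar m (Var i) = Var i"
| "unbar m (Mul s t) = Mul (unbar m s) (unbar m t)"
| "unbar m (Bar t) = tpow (unbar m t) (Suc m)"

lemma hasbar_tpow [simp]: "hasbar (tpow t k) = hasbar t"
  by (induction k) auto

lemma hasbar_unbar [simp]: "\<not> hasbar (unbar m t)"
  by (induction t) (simp_all del: tpow.simps)

lemma set_flat_unbar: "set (flat (unbar m t)) = set (flat t)"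
  by (induction t) (simp_all add: flat_tpow del: tpow.simps)

lemma unbar_id: "\<not> hasbar t \<Longrightarrow> unbar m t = t"
  by (induction t) auto

lemma unbar_repeats: "hasbar t \<Longrightarrow> \<not> distinct (flat (unbar m t))"
proof (induction t)
  case (Bar t)
  obtain x where "x \<in> set (flat (unbar m t))" using flat_nonempty list.set_intros(1) by (metis list.exhaust)
  then show ?case using flat_tpow[of "unbar m t" m] by auto
qed auto

lemma word_pw:
  assumes T: "epi_theory Z" and "t \<noteq> []" shows "(word (pw t (Suc k)), tpow (word t) k) \<in> Z"
proof (rule flat_eq_theory[OF T])
  have f: "flat (tpow (word t) k) = pw t (Suc k)" 
  proof (induction k)
    case 0
    show ?case using assms(2) by simp
  next
    case (Suc k)
    have "flat (tpow (word t) (Suc k)) = flat (tpow (word t) k) @ t" using assms(2) by simp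
    then show ?case by (simp only: Suc pw_Suc_right)
  qed
  show "flat (word (pw t (Suc k))) = flat (tpow (word t) k)" using assms(2) by (subst f, subst flat_word) auto
qed (use assms in \<open>simp_all\<close>)

context epi_monoid
begin

text \<open>All powers from one exponent on lie in subgroups, in a form that covers every class of terms at
  once.\<close>

lemma uniform_index:
  assumes T: "epi_theory Z" and m: "model Z K"
  obtains n where "1 \<le> n" "\<And>t k. n \<le> k \<Longrightarrow> K t ^ k * om (K t) = K t ^ k"
proof -
  obtain n where n: "\<And>t. (Mul (tpow t (Suc n)) (Bar t), tpow t n) \<in> Z" using epi_theory_instances(4)[OF T] by blast
  have a: "K t ^ (Suc n + 1) * br (K t) = K t ^ Suc n" for t
    using n[of t] unfolding K_iff[OF m] K_simps[OF m] K_tpow[OF m] by simp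
  have "K t ^ k * om (K t) = K t ^ k" if k: "Suc n \<le> k" for t k
  proof -
    have "K t ^ (k + 1) * br (K t) = K t ^ k" by (rule power_index_mono[OF a k])
    then show ?thesis by (simp add: om_def mult.assoc[symmetric] power_commutes)
  qed
  then show ?thesis using that[of "Suc n"] by simp
qed

text \<open>A positive period \<open>g\<close> turns the uniform index into \<open>t\<^sup>n =
  t\<^sup>n\<^sup>+\<^sup>g\<close>, and pseudoinverses into the power with exponent \<open>-1\<close> modulo
  \<open>g\<close>.\<close>

lemma periodic_powers:
  assumes m: "model Z K" and g: "int g \<in> periods Z"
    and n: "\<And>t k. n \<le> k \<Longrightarrow> K t ^ k * om (K t) = K t ^ k"
  shows "K t ^ n = K t ^ (n + g)" "n < j * g \<Longrightarrow> br (K t) = K t ^ (j * g - 1)"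
proof -
  have gz: "gp (K t) (i + int g) = gp (K t) i" for i
    by (rule periods_diff[OF m]) (use g in simp)
  have "K t ^ n = gp (K t) (int n)" using n[of n t] by (simp add: gp_unfold)
  also have "\<dots> = gp (K t) (int (n + g))" using gz[of "int n"] by simp
  also have "\<dots> = K t ^ (n + g)" using n[of "n + g" t] gp_unfold[of "K t" "n + g"] by simp
  finally show "K t ^ n = K t ^ (n + g)" .
  assume j: "n < j * g"
  have "gp (K t) (i + int (j * g)) = gp (K t) i" for i
  proof (induction j)
    case (Suc j)
    have "gp (K t) (i + int (Suc j * g)) = gp (K t) (i + int (j * g) + int g)" by (simp add: algebra_simps)
    then show ?case using Suc gz by simp
  qed simp
  from this[of "- 1"] have "br (K t) = gp (K t) (int (j * g) - 1)" by (simp add: gp_neg_1)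
  also have "int (j * g) - 1 = int (j * g - 1)" using j by linarith
  also have "gp (K t) (int (j * g - 1)) = K t ^ (j * g - 1)"
    using n[of "j * g - 1" t] j gp_unfold[of "K t" "j * g - 1"] by simp
  finally show "br (K t) = K t ^ (j * g - 1)" .
qed

text \<open>A power of \<open>y\<close> that is idempotent and acts as a unit on \<open>y\<close> is
  \<open>y\<^sup>\<omega>\<close>.\<close>

lemma om_of_root:
  assumes q: "q * q = q" "q * y = y" and N: "y ^ N = q" "1 \<le> N"
  shows "om y = q"
proof -
  obtain n where n: "\<And>k. n \<le> k \<Longrightarrow> y ^ k * om y = y ^ k" using power_om by blast
  have qk: "q ^ Suc k = q" for k using q(1) by (induction k) auto
  have "y ^ (N * Suc n) = q" using qk by (simp only: power_mult N)
  moreover have "n \<le> N * Suc n" using N(2) mult_le_mono1[of 1 N "Suc n"] by (simp only: mult_1) simp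
  ultimately have "q * om y = q" using n by metis
  moreover have "q * om y = om y" unfolding om_def using q(2) by (simp add: mult.assoc[symmetric])
  ultimately show ?thesis by simp
qed

end

text \<open>Multiplication by a possibly empty word on the left and on the right.\<close>

primrec wrapl :: "nat list \<Rightarrow> uterm \<Rightarrow> uterm" where
  "wrapl [] t = t"
| "wrapl (x # xs) t = Mul (Var x) (wrapl xs t)"

primrec wrapr :: "uterm \<Rightarrow> nat list \<Rightarrow> uterm" where
  "wrapr t [] = t"
| "wrapr t (x # xs) = wrapr (Mul t (Var x)) xs"

lemma flat_wrap: "flat (wrapl xs t) = xs @ flat t" "flat (wrapr t xs) = flat t @ xs"
  by (induction xs arbitrary: t) simp_all

lemma hasbar_wrap: "hasbar (wrapl xs t) = hasbar t" "hasbar (wrapr t xs) = hasbar t"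
  by (induction xs arbitrary: t) simp_all

lemma ex_wrap: "ex y (wrapl xs t) = int (count_list xs y) + ex y t" "ex y (wrapr t xs) = ex y t + int (count_list xs y)"
  by (induction xs arbitrary: t) simp_all

lemma (in epi_monoid) K_wrap:
  assumes "model Z K"
  shows "K (wrapl xs t) = pl (\<lambda>i. K (Var i)) xs * K t" "K (wrapr t xs) = K t * pl (\<lambda>i. K (Var i)) xs"
  by (induction xs arbitrary: t) (simp_all add: K_simps[OF assms] mult.assoc)

text \<open>The local unit \<open>q\<close> times powers \<open>(q x q)\<^sup>\<omega>\<^sup>+\<^sup>d\<close>, one
  for each letter \<open>x\<close>. If \<open>q x q\<close> is a unit at \<open>q\<close> and \<open>d x\<close> is a
  period, this changes the exponent of \<open>x\<close> by \<open>d x\<close> without changing the value.\<close>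

primrec adjust :: "uterm \<Rightarrow> (nat \<Rightarrow> int) \<Rightarrow> nat list \<Rightarrow> uterm" where
  "adjust q d [] = q"
| "adjust q d (x # xs) = Mul (adjust q d xs) (gpt (Mul (Mul q (Var x)) q) (d x))"

lemma ex_adjust: "(\<And>z. ex z q = 0) \<Longrightarrow> distinct xs \<Longrightarrow> ex y (adjust q d xs) = (if y \<in> set xs then d y else 0)"
  by (induction xs) (auto simp: ex_gpt)

lemma flat_adjust: "set (flat (adjust q d xs)) = set (flat q) \<union> set xs"
  by (induction xs) (auto simp: flat_gpt)

lemma hasbar_adjust: "hasbar q \<Longrightarrow> hasbar (adjust q d xs)"
  by (induction xs) auto

text \<open>An identity \<open>u = w\<close> that changes exponents makes the theory periodic, so that bars can be
  replaced by powers and the normal form \<open>A c q B\<close> of \<open>u\<close> is available. In it a letter of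
  \<open>u\<close> is inside \<open>c\<close> or has exactly one occurrence. Only the exponents of the former can be
  wrong. They are corrected next to the idempotent \<open>q\<close>, where each such letter gives a unit.\<close>

lemma periodic_linear_identity:
  assumes T: "epi_theory Z" and d: "distinct u" and u: "u \<noteq> []" and w: "(word u, w) \<in> Z"
    and s: "set (flat w) = set u" and x: "ex x w \<noteq> ex x (word u)"
  shows "\<exists>W. hasbar W \<and> set (flat W) = set u \<and> (\<forall>y. ex y W = ex y (word u)) \<and> (word u, W) \<in> Z"
proof -
  interpret epi_monoid None "tmul Z" "tbr Z" by (rule theory_epi_monoid[OF T])
  note E = epi_equational[OF T] and m = theory_model[OF T]
  note KI = K_iff[OF m]
  define g where "g = nat \<bar>ex x w - ex x (word u)\<bar>"
  have g1: "1 \<le> g" using x by (simp add: g_def)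
  have "ex x w - ex x (word u) \<in> periods Z" by (rule theory_ex[OF T et_sym[OF E w]])
  moreover have "ex x (word u) - ex x w \<in> periods Z" by (rule theory_ex[OF T w])
  ultimately have g: "int g \<in> periods Z" by (auto simp: g_def abs_if)
  obtain n where n: "1 \<le> n" "\<And>t k. n \<le> k \<Longrightarrow> tmul Z (power (cl Z t) k) (om (cl Z t)) = power (cl Z t) k"
    using uniform_index[OF T m] by blast
  have per: "power (cl Z t) n = power (cl Z t) (n + g)" "n < j * g \<Longrightarrow> tbr Z (cl Z t) = power (cl Z t) (j * g - 1)" for t j
    using periodic_powers[where n = n, OF m g] n(2) by blast+
  \<comment> \<open>The pseudoinverse is the power with exponent \<open>(n + 4) * g - 1\<close>; subtracting \<open>2\<close> accounts for the convention of \<open>unbar\<close>.\<close>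
  define M where "M = (n + 4) * g - 3"
  have ng: "n + 4 \<le> (n + 4) * g" using g1 by simp
  then have M: "(n + 4) * g - 1 = Suc (Suc M)" "n < (n + 4) * g" unfolding M_def by linarith+
  have ub: "(t, unbar M t) \<in> Z" for t
  proof (induction t)
    case (Bar t)
    have "tbr Z (cl Z t) = power (cl Z t) (Suc (Suc M))" using per(2)[OF M(2), of t] by (simp only: M(1))
    also have "\<dots> = power (cl Z (unbar M t)) (Suc (Suc M))" using Bar by (simp add: KI)
    finally show ?case unfolding KI unbar.simps K_tpow[OF m] K_simps[OF m] .
  qed (simp_all add: KI K_simps[OF m])
  define w' where "w' = flat (unbar M w)"
  have w'ne: "w' \<noteq> []" by (simp add: w'_def)
  have "(unbar M w, word w') \<in> Z" unfolding w'_def by (rule word_flat[OF T]) simp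
  then have uw': "(word u, word w') \<in> Z" using et_trans[OF E et_trans[OF E w ub]] by blast
  have sw': "set w' = set u" by (simp add: w'_def set_flat_unbar s)
  have "length u \<le> length w'" using card_length[of w'] distinct_card[OF d] sw' by simp
  moreover have "length u \<noteq> length w'"
  proof
    assume "length u = length w'"
    then have "distinct w'" using distinct_card[OF d] sw' by (simp add: card_distinct)
    moreover from this have nb: "\<not> hasbar w" using unbar_repeats by (auto simp: w'_def)
    ultimately have "mset (flat w) = mset u"
      using set_eq_iff_mset_eq_distinct[OF _ d] sw' by (simp add: w'_def unbar_id)
    then have "ex x w = ex x (word u)" using ex_occ[OF occ_flat[OF nb]] ex_word[OF u]
      by (simp flip: count_mset)
    then show False using x by simp
  qed
  ultimately have longer: "length u < length w'" by simp
  \<comment> \<open>Equality of contents is part of the congruence, and the empty word, which is no term, is related only to itself.\<close>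
  define R where "R = (\<lambda>a b. set a = set b \<and> (a \<noteq> [] \<longrightarrow> (word a, word b) \<in> Z))"
  interpret L: word_congruence R u w' n g
  proof
    show "R a a" for a by (simp add: R_def et_refl[OF E])
    show "R b a" if "R a b" for a b using that et_sym[OF E] by (auto simp: R_def)
    show "R a c" if "R a b" "R b c" for a b c using that et_trans[OF E] by (auto simp: R_def)
    show "R (a @ c) (b @ d)" if ab: "R a b" and cd: "R c d" for a b c d
    proof (cases "a = [] \<or> c = []")
      case True
      then show ?thesis using ab cd by (auto simp: R_def)
    next
      case False
      then have ne: "a \<noteq> []" "b \<noteq> []" "c \<noteq> []" "d \<noteq> []" using ab cd by (auto simp: R_def)
      have "(word ([] @ a @ c), word ([] @ b @ c)) \<in> Z" using ab ne by (intro word_context[OF T]) (simp_all add: R_def)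
      moreover have "(word (b @ c @ []), word (b @ d @ [])) \<in> Z" using cd ne by (intro word_context[OF T]) (simp_all add: R_def)
      ultimately have "(word (a @ c), word (b @ d)) \<in> Z"
        using et_trans[OF E, of "word (a @ c)" "word (b @ c)" "word (b @ d)"] by simp
      then show ?thesis using ab cd by (simp add: R_def)
    qed
    show "R (sub \<phi> a) (sub \<phi> b)" if "\<And>x. \<phi> x \<noteq> []" "R a b" for \<phi> a b
    proof (cases "a = []")
      case False
      then have "b \<noteq> []" using that(2) by (auto simp: R_def)
      then have "(word (sub \<phi> a), word (sub \<phi> b)) \<in> Z"
        using that False by (intro word_subst[OF T]) (simp_all add: R_def)
      then show ?thesis using that(2) by (simp add: R_def)
    qed (use that(2) in \<open>auto simp: R_def\<close>)
    show "set a = set b" if "R a b" for a b using that by (simp add: R_def)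
    show "R (pw t n) (pw t (n + g))" if t: "t \<noteq> []" for t
    proof -
      obtain k where k: "n = Suc k" using n(1) by (cases n) auto
      have "(tpow (word t) k, tpow (word t) (k + g)) \<in> Z"
        unfolding KI K_tpow[OF m] using per(1)[of "word t"] by (simp add: k)
      then have "(word (pw t (Suc k)), word (pw t (Suc (k + g)))) \<in> Z"
        using et_trans[OF E et_trans[OF E word_pw[OF T t]] et_sym[OF E word_pw[OF T t]]] by blast
      moreover have "set (pw t (Suc k)) = set (pw t (Suc (k + g)))" by auto
      ultimately show ?thesis unfolding R_def k by simp
    qed
    show "R u w'" using uw' sw' by (simp add: R_def)
  qed (use n g1 d longer in simp_all)
  obtain A c q B where nf: "R u (A @ c @ q @ B)" "c \<noteq> []" "L.idem q" "set q = set c" "R (c @ q) c"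
    and unit: "\<And>x. x \<in> set c \<Longrightarrow> \<exists>N\<ge>2. R (pw (q @ [x] @ q) N) q"
    and cnt: "\<And>x. x \<notin> set c \<Longrightarrow> count_list (A @ B) x \<le> 1"
    by (rule L.normal_form) blast
  let ?K = "cl Z" and ?P = "pl (\<lambda>i. cl Z (Var i))"
  have Kw: "?K (word a) = ?P a" if "a \<noteq> []" for a
    using K_ev[OF m, of "word a"] that by (simp add: ev_word)
  have RK: "?P a = ?P b" if "R a b" "a \<noteq> []" for a b
  proof -
    have "b \<noteq> []" using that by (auto simp: R_def)
    moreover have "?K (word a) = ?K (word b)" using that by (simp add: R_def KI)
    ultimately show ?thesis using Kw that by simp
  qed
  have qne: "q \<noteq> []" using nf(3) by (simp add: L.idem_def)
  have qq: "tmul Z (?P q) (?P q) = ?P q" using RK[of "q @ q" q] nf(3) qne by (simp add: L.idem_def pl_append)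
  have cq: "tmul Z (?P c) (?P q) = ?P c" using RK[OF nf(5)] nf(2) by (simp add: pl_append)
  define Q where "Q = Om (word q)"
  have KQ: "?K Q = ?P q" unfolding Q_def K_Om[OF m] Kw[OF qne] by (simp add: om_def br_idem[OF qq] qq)
  have exQ: "ex z Q = 0" for z by (simp add: Q_def)
  define W0 where "W0 = wrapl A (wrapr (Mul (word c) Q) B)"
  have KW: "?K (wrapl A (wrapr (Mul (word c) t) B)) = tmul Z (?P A) (tmul Z (tmul Z (?P c) (?K t)) (?P B))" for t
    by (simp add: K_wrap[OF m] K_simps(1)[OF m] Kw[OF nf(2)])
  have uK: "?K (word u) = tmul Z (?P A) (tmul Z (?P c) (?P B))"
    using RK[OF nf(1) u] Kw[OF u] cq by (simp add: pl_append mult.assoc[symmetric])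
  then have W0: "(word u, W0) \<in> Z" unfolding KI W0_def KW KQ cq .
  \<comment> \<open>The errors of the exponents are periods, as \<open>u\<close> and \<open>W0\<close> are equal.\<close>
  define e where "e = (\<lambda>y. ex y (word u) - ex y W0)"
  have e: "e y \<in> periods Z" for y unfolding e_def by (rule theory_ex[OF T W0])
  have Kadj: "?K (adjust Q e xs) = ?P q" if "set xs \<subseteq> set c" for xs
    using that
  proof (induction xs)
    case Nil
    show ?case using KQ by simp
  next
    case (Cons y xs)
    let ?y = "Mul (Mul Q (Var y)) Q"
    have Ky: "?K ?y = ?P (q @ [y] @ q)" by (simp add: K_simps(1)[OF m] KQ pl_append mult.assoc)
    obtain N where N: "2 \<le> N" "R (pw (q @ [y] @ q) N) q" using unit[of y] Cons(2) by auto
    have pN: "?P (pw a k) = power (?P a) k" for a k by (induction k) (simp_all add: pl_append)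
    have "pw (q @ [y] @ q) N \<noteq> []" using N(1) by (cases N) auto
    then have "power (?P (q @ [y] @ q)) N = ?P q" using RK[OF N(2)] unfolding pN by blast
    moreover have "tmul Z (?P q) (?P (q @ [y] @ q)) = ?P (q @ [y] @ q)"
      using qq by (simp add: pl_append mult.assoc[symmetric])
    ultimately have "om (?K ?y) = ?P q" unfolding Ky using om_of_root[OF qq] N(1) by simp
    then have "?K (gpt ?y (e y)) = ?P q"
      using periods_gp[OF m e, of ?y y] by (simp add: K_gpt[OF m] gp_0)
    then show ?case using Cons qq by (simp add: K_simps(1)[OF m])
  qed
  obtain xs where xs: "set xs = set c" "distinct xs" using finite_distinct_list[of "set c"] by blast
  define W where "W = wrapl A (wrapr (Mul (word c) (adjust Q e xs)) B)"
  have "(word u, W) \<in> Z" unfolding KI W_def KW using Kadj[of xs] xs cq uK by simp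
  moreover have "hasbar W" by (simp add: W_def hasbar_wrap hasbar_adjust Q_def)
  moreover have sA: "set A \<union> set c \<union> set B = set u" using nf(1,4) by (auto simp: R_def)
  then have "set (flat W) = set u" using nf(2,4) qne xs by (auto simp: W_def flat_wrap flat_adjust Q_def)
  moreover have "ex y W = ex y (word u)" for y
  proof (cases "y \<in> set c")
    case True
    have "ex y W = ex y W0 + e y"
      using True xs by (simp add: W_def W0_def ex_wrap ex_adjust exQ)
    then show ?thesis by (simp add: e_def)
  next
    case False
    have "ex y W = int (count_list (A @ B) y)"
      using False xs by (simp add: W_def ex_wrap ex_adjust exQ ex_word nf(2) count_list_append count_list_0_iff)
    moreover have "count_list (A @ B) y \<le> 1" by (rule cnt[OF False])
    moreover have "count_list (A @ B) y = 0 \<longleftrightarrow> y \<notin> set u" using sA False by (auto simp: count_list_0_iff)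
    moreover have "count_list u y \<le> 1" "count_list u y = 0 \<longleftrightarrow> y \<notin> set u"
      using count_list_distinct[OF d] by (auto simp: count_list_0_iff)
    ultimately show ?thesis unfolding ex_word[OF u] by linarith
  qed
  ultimately show ?thesis by blast
qed

text \<open>An identity whose sides have different letters makes its left side a multiple of a group element: a letter
  that disappears may be replaced by its product with its own idempotent, and a new letter may be given the idempotent
  of the left side as value.\<close>

lemma content_identity:
  assumes T: "epi_theory Z" and w: "(p, w) \<in> Z" and s: "set (flat w) \<noteq> set (flat p)"
  shows "\<exists>W. hasbar W \<and> set (flat W) = set (flat p) \<and> (\<forall>y. ex y W = ex y p) \<and> (p, W) \<in> Z"
proof -
  note E = epi_equational[OF T]
  consider x where "x \<in> set (flat p)" "x \<notin> set (flat w)" | z where "z \<in> set (flat w)" "z \<notin> set (flat p)"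
    using s by blast
  then show ?thesis
  proof cases
    case 1
    let ?\<sigma> = "\<lambda>i. if i = x then Mul (Om (Var x)) (Var x) else Var i"
    let ?W = "subst ?\<sigma> p"
    have "subst ?\<sigma> w = w" by (rule subst_id) (use 1 in auto)
    then have "(?W, w) \<in> Z" using et_subst[OF E w, of ?\<sigma>] by simp
    then have "(p, ?W) \<in> Z" by (rule et_trans[OF E w et_sym[OF E]])
    moreover have "hasbar ?W" using 1 by (auto simp: hasbar_subst)
    moreover have "set (flat ?W) = set (flat p)" by (auto simp: flat_subst split: if_splits)
    moreover have "ex y ?W = ex y p" for y by (rule ex_subst) auto
    ultimately show ?thesis by blast
  next
    case 2
    interpret epi_monoid None "tmul Z" "tbr Z" by (rule theory_epi_monoid[OF T])
    note m = theory_model[OF T]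
    let ?\<sigma> = "\<lambda>i. if i = z then Om p else Var i"
    have "subst ?\<sigma> p = p" by (rule subst_id) (use 2 in auto)
    then have "(p, subst ?\<sigma> w) \<in> Z" using et_subst[OF E w, of ?\<sigma>] by simp
    then have "cl Z p = ev (\<lambda>i. cl Z (?\<sigma> i)) w" by (simp add: K_iff[OF m] K_subst[OF m])
    moreover obtain a b where "ev (\<lambda>i. cl Z (?\<sigma> i)) w = tmul Z (tmul Z a (cl Z (?\<sigma> z))) b"
      using letter_factor[OF 2(1), of "\<lambda>i. cl Z (?\<sigma> i)"] by blast
    ultimately have "cl Z p = tmul Z (tmul Z a (om (cl Z p))) b" by (simp add: K_Om[OF m])
    then have "tmul Z (om (cl Z p)) (cl Z p) = cl Z p" by (rule idempotent_factor)
    then have "(p, Mul (Om p) p) \<in> Z" by (simp add: K_iff[OF m] K_simps(1)[OF m, of "Om p"] K_Om[OF m])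
    moreover have "set (flat (Mul (Om p) p)) = set (flat p)" by simp
    moreover have "ex y (Mul (Om p) p) = ex y p" for y by simp
    moreover have "hasbar (Mul (Om p) p)" by simp
    ultimately show ?thesis by blast
  qed
qed

text \<open>Every identity that changes a linear word beyond a permutation of its letters makes that word vanish, and
  the witness can be chosen with the same letters and exponents. This is what makes witnesses for two different
  theories comparable.\<close>

lemma linear_identity:
  assumes T: "epi_theory Z" and d: "distinct u" and u: "u \<noteq> []" and w: "(word u, w) \<in> Z"
    and np: "\<not> (\<not> hasbar w \<and> mset (flat w) = mset u)"
  shows "\<exists>W. hasbar W \<and> set (flat W) = set u \<and> (\<forall>y. ex y W = ex y (word u)) \<and> (word u, W) \<in> Z"
proof -
  consider "set (flat w) \<noteq> set (flat (word u))"
    | x where "set (flat w) = set u" "ex x w \<noteq> ex x (word u)"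
    | "set (flat w) = set u" "\<forall>x. ex x w = ex x (word u)" using u by auto
  then show ?thesis
  proof cases
    case 1
    show ?thesis using content_identity[OF T w 1] u by simp
  next
    case 2
    then show ?thesis using periodic_linear_identity[OF T d u w] by blast
  next
    case 3
    have "hasbar w"
    proof (rule ccontr)
      assume nb: "\<not> hasbar w"
      have "count_list (flat w) y = count_list u y" for y
        using 3(2) ex_occ[OF occ_flat[OF nb], of y] ex_word[OF u, of y] by simp
      then have "mset (flat w) = mset u" by (intro multiset_eqI) (simp add: count_mset)
      then show False using np nb by simp
    qed
    then show ?thesis using 3 w by blast
  qed
qed

section \<open>Upper-modular theories: sufficiency\<close>

lemma (in epi_monoid) ev_cong: "(\<And>i. i \<in> set (flat t) \<Longrightarrow> \<rho> i = \<rho>' i) \<Longrightarrow> ev \<rho> t = ev \<rho>' t"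
  by (induction t) auto

lemma count_list_replicate: "count_list (replicate j x) x = j"
  by (induction j) auto

lemma occ_single_letter: "set (flat t) = {x} \<Longrightarrow> hasbar t \<Longrightarrow> occ x t = \<infinity>"
proof (induction t)
  case (Mul s t)
  have "set (flat s) = {x}" "set (flat t) = {x}"
    using Mul(3) subset_singletonD[of "set (flat s)" x] subset_singletonD[of "set (flat t)" x] by auto
  then have "occ x s = \<infinity> \<or> occ x t = \<infinity>" using Mul(1,2,4) by auto
  then show ?case by auto
next
  case (Bar t)
  then have "occ x t \<noteq> 0" by (simp add: occ_0_iff)
  then show ?case by simp
qed simp

text \<open>On one letter, a term with a bar is a group element, and an identity between two different powers makes
  the smaller one a group element as well. So \<open>x\<^sup>\<omega>\<close> can be multiplied to the left
  side.\<close>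

lemma power_identity:
  assumes T: "epi_theory Z" and p: "\<not> hasbar p" "flat p = replicate j x" "1 \<le> j" and w: "(p, w) \<in> Z"
    and np: "\<not> (\<not> hasbar w \<and> flat w = replicate j x)"
  shows "\<exists>W. hasbar W \<and> set (flat W) = set (flat p) \<and> (\<forall>y. ex y W = ex y p) \<and> (p, W) \<in> Z"
proof (cases "set (flat w) = set (flat p)")
  case False
  then show ?thesis by (rule content_identity[OF T w])
next
  case True
  interpret epi_monoid None "tmul Z" "tbr Z" by (rule theory_epi_monoid[OF T])
  note m = theory_model[OF T]
  have sx: "set (flat w) = {x}" "set (flat p) = {x}" using True p by auto
  let ?a = "cl Z (Var x)"
  have val: "cl Z t = part ?a (occ x t) (ex x t)" if "set (flat t) = {x}" for t
  proof -
    have "cl Z t = ev (\<lambda>i. if i = x then ?a else None) t"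
      unfolding K_ev[OF m, of t] by (rule ev_cong) (use that in auto)
    also have "\<dots> = part ?a (occ x t) (ex x t)"
      using ev_single[of None ?a x t] by simp
    finally show ?thesis .
  qed
  have oj: "occ x p = enat j" using p by (simp add: occ_flat count_list_replicate)
  then have pj: "cl Z p = power ?a j" using val[OF sx(2)] by (simp add: part_def)
  have pw: "cl Z p = part ?a (occ x w) (ex x w)" using w val[OF sx(1)] by (simp add: K_iff[OF m])
  have "tmul Z (om ?a) (cl Z p) = cl Z p"
  proof (cases "occ x w")
    case infinity
    then have "cl Z p = gp ?a (ex x w)" using pw by (simp add: part_def)
    then show ?thesis by (simp add: om_gp)
  next
    case (enat i)
    have nb: "\<not> hasbar w"
      using occ_single_letter[OF sx(1)] enat by auto
    have fw: "flat w = replicate (length (flat w)) x" using sx(1) by (intro replicate_eqI) auto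
    have "count_list (flat w) x = length (flat w)" by (subst fw) (simp add: count_list_replicate)
    then have i: "i = length (flat w)" using enat occ_flat[OF nb, of x] by simp
    then have ij: "i \<noteq> j" using np nb fw by auto
    have eq: "power ?a j = power ?a i" using pj pw enat by (simp add: part_def)
    have *: "tmul Z (om ?a) (power ?a k) = power ?a k" if k: "k < l" and e: "power ?a k = power ?a l" for k l
    proof -
      obtain r where r: "l = Suc (k + r)" using k less_iff_Suc_add by blast
      have "power ?a k = tmul Z (tmul Z ?a (power ?a k)) (power ?a r)"
        using e by (simp add: r power_add mult.assoc)
      then show ?thesis by (rule power_absorb(1))
    qed
    show ?thesis using *[of i j] *[of j i] ij eq pj by (cases "i < j") auto
  qed
  then have "(p, Mul (Om (Var x)) p) \<in> Z" by (simp add: K_iff[OF m] K_simps(1)[OF m, of "Om (Var x)"] K_Om[OF m])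
  moreover have "hasbar (Mul (Om (Var x)) p)" "set (flat (Mul (Om (Var x)) p)) = set (flat p)" using sx by auto
  moreover have "ex y (Mul (Om (Var x)) p) = ex y p" for y by simp
  ultimately show ?thesis by blast
qed

text \<open>The only identity that decreases the length without changing the letters is \<open>p = cd\<close> with
  \<open>{c, d} = {a, b}\<close>. As \<open>p\<close> contains \<open>cd\<close> or \<open>dc\<close>, it can be
  applied inside \<open>p\<close>, possibly with the letters interchanged, and increases the length there.\<close>

lemma cubic_identity:
  assumes T: "epi_theory Z" and p: "\<not> hasbar p" "length (flat p) = 3" "set (flat p) = {a, b}" "a \<noteq> b"
    and w: "(p, w) \<in> Z" and np: "\<not> (\<not> hasbar w \<and> length (flat w) = 3 \<and> set (flat w) = {a, b})"
  shows "\<exists>W. (hasbar W \<or> 4 \<le> length (flat W)) \<and> set (flat W) = {a, b} \<and> (p, W) \<in> Z"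
proof (cases "set (flat w) = {a, b}")
  case False
  then show ?thesis using content_identity[OF T w] p(3) by auto
next
  case True
  note E = epi_equational[OF T]
  show ?thesis
  proof (cases "hasbar w \<or> 4 \<le> length (flat w)")
    case False
    let ?P = "flat p" and ?W = "flat w"
    have nb: "\<not> hasbar w" and l: "length ?W < 3" using False np True by auto
    have pP: "(p, word ?P) \<in> Z" by (rule word_flat[OF T p(1)])
    have "card (set ?W) = 2" using True p(4) by simp
    then have "length ?W = 2" using card_length[of ?W] l by linarith
    then obtain c d where W: "?W = [c, d]" by (auto simp: length_Suc_conv numeral_2_eq_2)
    have cd: "{c, d} = {a, b}" "c \<noteq> d" using True p(4) W by auto
    have "(word ?P, word [c, d]) \<in> Z"
      using et_trans[OF E et_sym[OF E pP] et_trans[OF E w word_flat[OF T nb]]] by (simp only: W)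
    then have cdP: "(word [c, d], word ?P) \<in> Z" by (rule et_sym[OF E])
    let ?f = "\<lambda>i. if i = c then d else if i = d then c else i"
    have dcP: "(word [d, c], word (map ?f ?P)) \<in> Z" using word_rename[OF T cdP, of ?f] cd by simp
    have fP: "set (map ?f ?P) = {a, b}" using p(3) cd by (auto simp: image_iff)
    have "set ?P = {c, d}" using p(3) cd by simp
    from adjacent_two_letters[OF this cd(2)] obtain g h where "?P = g @ [c, d] @ h \<or> ?P = g @ [d, c] @ h" by blast
    then obtain u v where uv: "?P = g @ u @ h" "(word u, word v) \<in> Z" "length u = 2" "length v = 3" "set v = {a, b}"
    proof (elim disjE)
      assume "?P = g @ [c, d] @ h"
      then show ?thesis using that[of "[c, d]" ?P] cdP p by simp
    next
      assume "?P = g @ [d, c] @ h"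
      then show ?thesis using that[of "[d, c]" "map ?f ?P"] dcP p(2) fP by simp
    qed
    have ne: "u \<noteq> []" "v \<noteq> []" using uv by auto
    let ?V = "g @ v @ h"
    have "(word ?P, word ?V) \<in> Z" unfolding uv(1) by (rule word_context[OF T uv(2) ne])
    then have "(p, word ?V) \<in> Z" using et_trans[OF E pP] by blast
    moreover have "length ?V = 4" using uv p(2) by (simp add: uv(1))
    moreover have "set g \<subseteq> {a, b}" "set h \<subseteq> {a, b}" using uv(1) p(3) by auto
    then have "set ?V = {a, b}" using uv(5) by auto
    moreover have "?V \<noteq> []" using ne by simp
    ultimately show ?thesis by (intro exI[of _ "word ?V"]) (simp del: set_append)
  qed (use True w in blast)
qed

text \<open>Whichever side has more occurrences, the smaller number is an index of the theory.\<close>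

lemma index_change:
  assumes T: "epi_theory A" and st: "(s, t) \<in> A" "occ y s = enat k" "occ y t \<noteq> enat k"
  shows "index A k"
proof (cases "occ y s < occ y t")
  case True
  then show ?thesis using theory_occ[OF T st(1,2)] by blast
next
  case False
  then have l: "occ y t < occ y s" using st by auto
  then obtain i where i: "occ y t = enat i" using st(2) by (cases "occ y t") auto
  then have "index A i" using theory_occ[OF T et_sym[OF epi_equational[OF T] st(1)] i l] by blast
  then show ?thesis using theory_index_mono[OF T] l st(2) i by simp
qed

lemma rtrancl_first_exit:
  assumes "(p, q) \<in> R\<^sup>*" "P p" "\<not> P q"
  obtains s t where "(s, t) \<in> R" "P s" "\<not> P t"
  using assms by (induction rule: rtrancl_induct) blast+

text \<open>The modular law holds for terms that vanish in \<open>X\<close>, since there an identity is determined by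
  exponents and occurrence numbers. For the exponents it reduces to the modular law for the subgroups of periods. For
  the occurrences of a letter, the first step of the chain that changes their number shows that the number is an index
  of \<open>\<Theta>\<close> or of \<open>Z\<close>, and the total change shows that it is one of
  \<open>Y\<close>.\<close>

lemma modular_vanishing:
  assumes T: "epi_theory \<Theta>" and Y: "epi_theory Y" "\<Theta> \<subseteq> Y" and Z: "epi_theory Z"
    and X: "epi_theory X" "permutative X" "\<Theta> \<subseteq> X" "Z \<inter> Y \<subseteq> X"
    and pq: "(p, q) \<in> Y" "(p, q) \<in> (Z \<union> \<Theta>)\<^sup>*" and v: "vanishes X p" "vanishes X q"
  shows "(p, q) \<in> X"
proof (rule theory_vanishes_identity[OF X(1,2) v])
  fix y
  have "\<exists>a\<in>periods Z. \<exists>b\<in>periods \<Theta>. ex y p - ex y q = a + b"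
    using pq(2)
  proof (induction rule: rtrancl_induct)
    case base
    show ?case using theory_periods(1)[OF T] theory_periods(1)[OF Z] by (intro bexI[of _ 0]) auto
  next
    case (step s t)
    then obtain a b where ab: "a \<in> periods Z" "b \<in> periods \<Theta>" "ex y p - ex y s = a + b" by blast
    from step(2) show ?case
    proof
      assume "(s, t) \<in> Z"
      then have "a + (ex y s - ex y t) \<in> periods Z" by (intro periods_add[OF Z] ab theory_ex[OF Z])
      then show ?thesis using ab by (intro bexI[of _ "a + (ex y s - ex y t)"] bexI[of _ b]) auto
    next
      assume "(s, t) \<in> \<Theta>"
      then have "b + (ex y s - ex y t) \<in> periods \<Theta>" by (intro periods_add[OF T] ab theory_ex[OF T])
      then show ?thesis using ab by (intro bexI[of _ a] bexI[of _ "b + (ex y s - ex y t)"]) auto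
    qed
  qed
  then obtain a b where ab: "a \<in> periods Z" "b \<in> periods \<Theta>" "ex y p - ex y q = a + b" by blast
  have "b \<in> periods Y" using ab(2) Y(2) by (auto simp: periods_def)
  then have "(a + b) - b \<in> periods Y" using theory_periods(2)[OF Y(1)] theory_ex[OF Y(1) pq(1), of y] ab(3) by metis
  then have "a \<in> periods X" using ab(1) X(4) by (auto simp: periods_def)
  moreover have "b \<in> periods X" using ab(2) X(3) by (auto simp: periods_def)
  ultimately show "ex y p - ex y q \<in> periods X" unfolding ab(3) by (rule periods_add[OF X(1)])
  \<comment> \<open>The first step of the chain that changes the number \<open>k\<close> of occurrences belongs to \<open>Z\<close> or to \<open>\<Theta>\<close>.\<close>
  have change: "index X k" if st: "(p', q') \<in> Y" "(p', q') \<in> (Z \<union> \<Theta>)\<^sup>*" "occ y p' = enat k" "occ y q' \<noteq> enat k" for p' q' k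
  proof -
    obtain s t where s: "(s, t) \<in> Z \<union> \<Theta>" "occ y s = enat k" "occ y t \<noteq> enat k"
      using rtrancl_first_exit[OF st(2), of "\<lambda>t. occ y t = enat k"] st(3,4) by blast
    from s(1) show ?thesis
    proof
      assume "(s, t) \<in> Z"
      then have "index Z k" using index_change[OF Z] s by blast
      moreover have "index Y k" using index_change[OF Y(1) st(1)] st by blast
      ultimately show ?thesis using X(4) by (auto simp: index_def)
    next
      assume "(s, t) \<in> \<Theta>"
      then have "index \<Theta> k" using index_change[OF T] s by blast
      then show ?thesis using X(3) by (auto simp: index_def)
    qed
  qed
  have qp: "(q, p) \<in> Y" "(q, p) \<in> (Z \<union> \<Theta>)\<^sup>*"
    using pq et_sym[OF epi_equational[OF Y(1)]]
      et_sym[OF equational_theory_join[OF epi_equational[OF Z] epi_equational[OF T]]] by blast+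
  show "occ y p = occ y q \<or> (\<exists>k. index X k \<and> enat k \<le> occ y p \<and> enat k \<le> occ y q)"
  proof (cases "occ y p" "occ y q" rule: linorder_cases)
    case less
    then obtain k where k: "occ y p = enat k" by (cases "occ y p") auto
    then show ?thesis using change[OF pq k] less by (intro disjI2 exI[of _ k]) auto
  next
    case greater
    then obtain k where k: "occ y q = enat k" by (cases "occ y q") auto
    then show ?thesis using change[OF qp k] greater by (intro disjI2 exI[of _ k]) auto
  qed simp
qed

text \<open>A set \<open>P\<close> of equivalent terms that can be left only through an identity that makes them
  vanish, with a witness in \<open>G\<close>. If \<open>Z\<close> leaves \<open>P\<close> by such an identity \<open>s
  = W\<close>, then \<open>Y\<close>, which also leaves \<open>P\<close>, makes \<open>s\<close> vanish as well, and
  the hypothesis \<open>exact\<close> turns this into \<open>s = W\<close> modulo \<open>Y\<close>.\<close>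

lemma modular_escape:
  assumes T: "epi_theory \<Theta>" and Y: "epi_theory Y" "\<Theta> \<subseteq> Y" and Z: "epi_theory Z"
    and X: "epi_theory X" "\<Theta> \<subseteq> X" "Z \<inter> Y \<subseteq> X"
    and escape: "\<And>A s t. epi_theory A \<Longrightarrow> P s \<Longrightarrow> (s, t) \<in> A \<Longrightarrow> \<not> P t \<Longrightarrow> \<exists>W. (s, W) \<in> A \<and> G s W"
    and equiv: "\<And>s t. P s \<Longrightarrow> P t \<Longrightarrow> (s, t) \<in> \<Theta>"
    and van: "\<And>s W. P s \<Longrightarrow> G s W \<Longrightarrow> vanishes \<Theta> W"
    and exact: "\<And>A s W. epi_theory A \<Longrightarrow> \<Theta> \<subseteq> A \<Longrightarrow> P s \<Longrightarrow> G s W \<Longrightarrow> vanishes A s \<Longrightarrow> (s, W) \<in> A"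
    and pq: "(p, q) \<in> Y" "(p, q) \<in> (Z \<union> \<Theta>)\<^sup>*" and p: "P p"
  shows "(p, q) \<in> X \<or> vanishes X p"
proof (cases "P q")
  case True
  then show ?thesis using equiv[OF p] X(2) by blast
next
  case False
  have mono: "vanishes B W" if "vanishes A W" "A \<subseteq> B" for A B W using that by (auto simp: vanishes_def)
  obtain s t where st: "(s, t) \<in> Z \<union> \<Theta>" "P s" "\<not> P t" using rtrancl_first_exit[OF pq(2), of P] p False by blast
  have ps: "(p, s) \<in> \<Theta>" by (rule equiv[OF p st(2)])
  have "\<exists>W. (s, W) \<in> X \<and> G s W"
  proof (cases "(s, t) \<in> \<Theta>")
    case True
    then show ?thesis using escape[OF T st(2) True st(3)] X(2) by blast
  next
    case nt: False
    then have "(s, t) \<in> Z" using st(1) by blast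
    then obtain W where W: "(s, W) \<in> Z" "G s W" using escape[OF Z st(2) _ st(3)] by blast
    have "(s, q) \<in> Y" using et_trans[OF epi_equational[OF Y(1)] _ pq(1)] equiv[OF st(2) p] Y(2) by blast
    then obtain W' where W': "(s, W') \<in> Y" "G s W'" using escape[OF Y(1) st(2) _ False] by blast
    then have "vanishes Y s" using vanishes_related[OF Y(1)] van[OF st(2)] mono Y(2) by blast
    then have "(s, W) \<in> Y" by (rule exact[OF Y st(2) W(2)])
    then show ?thesis using W X(3) by blast
  qed
  then obtain W where W: "(s, W) \<in> X" "G s W" by blast
  then have "vanishes X s" using vanishes_related[OF X(1)] van[OF st(2)] mono X(2) by blast
  then show ?thesis using vanishes_related[OF X(1)] ps X(2) by blast
qed

text \<open>This establishes the hypothesis \<open>exact\<close> for words \<open>s\<close> in which all letters occur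
  equally often: some occurrence number of \<open>s\<close> is an index, hence so is that of each letter of
  \<open>s\<close>.\<close>

lemma vanishing_exact:
  assumes A: "epi_theory A" "permutative A" and s: "\<not> hasbar s" "vanishes A s" and W: "hasbar W"
    "set (flat W) = set (flat s)" "\<And>y. ex y W = ex y s"
    and eq: "\<And>y z. y \<in> set (flat s) \<Longrightarrow> occ z s \<le> occ y s"
    and occ: "\<And>y. y \<in> set (flat s) \<Longrightarrow> occ y s \<le> occ y W"
  shows "(s, W) \<in> A"
proof (rule theory_vanishes_identity[OF A s(2) vanishes_hasbar[OF A(1) W(1)]])
  show "ex y s - ex y W \<in> periods A" for y using theory_periods(1)[OF A(1)] W(3) by simp
  obtain z k where k: "occ z s = enat k" "index A k" using vanishing_word_index[OF A s(2,1)] by blast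
  show "occ y s = occ y W \<or> (\<exists>k. index A k \<and> enat k \<le> occ y s \<and> enat k \<le> occ y W)" for y
  proof (cases "y \<in> set (flat s)")
    case True
    have "enat k \<le> occ y s" using eq[OF True, of z] unfolding k(1) .
    moreover from this have "enat k \<le> occ y W" using occ[OF True] by (rule order_trans)
    ultimately show ?thesis using k(2) by blast
  next
    case False
    then show ?thesis using occ_0_iff[of y s] occ_0_iff[of y W] W(2) by simp
  qed
qed


lemma one_le_enat: "n \<noteq> 0 \<Longrightarrow> (1 :: enat) \<le> n"
  by (cases n) (auto simp: one_enat_def zero_enat_def)

lemma linear_escape:
  assumes T: "epi_theory \<Theta>" and c: "commutative \<Theta>"
    and Y: "epi_theory Y" "\<Theta> \<subseteq> Y" and Z: "epi_theory Z" and X: "epi_theory X" "\<Theta> \<subseteq> X" "Z \<inter> Y \<subseteq> X"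
    and pq: "(p, q) \<in> Y" "(p, q) \<in> (Z \<union> \<Theta>)\<^sup>*" and p: "\<not> hasbar p" "distinct (flat p)"
  shows "(p, q) \<in> X \<or> vanishes X p"
proof (rule modular_escape[OF T Y Z X _ _ _ _ pq, where P = "\<lambda>t. \<not> hasbar t \<and> mset (flat t) = mset (flat p)"
      and G = "\<lambda>s W. hasbar W \<and> set (flat W) = set (flat s) \<and> (\<forall>y. ex y W = ex y s)"])
  let ?P = "\<lambda>t. \<not> hasbar t \<and> mset (flat t) = mset (flat p)"
  fix s assume s: "?P s"
  then have ds: "distinct (flat s)" using p(2) by (metis mset_eq_imp_distinct_iff)
  show "\<exists>W. (s, W) \<in> A \<and> hasbar W \<and> set (flat W) = set (flat s) \<and> (\<forall>y. ex y W = ex y s)"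
    if A: "epi_theory A" and t: "(s, t) \<in> A" "\<not> ?P t" for A t
  proof -
    have sw: "(s, word (flat s)) \<in> A" by (rule word_flat[OF A]) (use s in simp)
    have "(word (flat s), t) \<in> A" using et_trans[OF epi_equational[OF A] et_sym[OF epi_equational[OF A] sw] t(1)] .
    moreover have "\<not> (\<not> hasbar t \<and> mset (flat t) = mset (flat s))" using t(2) s by simp
    ultimately obtain W where W: "hasbar W" "set (flat W) = set (flat s)" "\<forall>y. ex y W = ex y (word (flat s))" "(word (flat s), W) \<in> A"
      using linear_identity[OF A ds flat_nonempty] by blast
    have "ex y (word (flat s)) = ex y s" for y
      using ex_occ[OF occ_flat, of s y] s ex_word[OF flat_nonempty, of y s] by simp
    then show ?thesis using W et_trans[OF epi_equational[OF A] sw W(4)] by auto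
  qed
  show "(s, t) \<in> \<Theta>" if "?P t" for t
  proof -
    have "(word (flat s), word (flat t)) \<in> \<Theta>" by (rule word_mset[OF T c]) (use s that in simp_all)
    then show ?thesis using et_trans[OF epi_equational[OF T]] et_sym[OF epi_equational[OF T]] word_flat[OF T] s that by blast
  qed
  show "(s, W) \<in> A" if A: "epi_theory A" "\<Theta> \<subseteq> A" and W: "hasbar W \<and> set (flat W) = set (flat s) \<and> (\<forall>y. ex y W = ex y s)"
    and v: "vanishes A s" for A W
  proof (rule vanishing_exact[OF A(1) _ _ v])
    show "permutative A" using commutative_permutative[OF T c] A(2) by (auto simp: permutative_def)
    have le: "occ z s \<le> 1" for z
    proof -
      have "count_list (flat s) z \<le> 1" by (rule count_list_distinct[OF ds])
      then show ?thesis using s by (simp add: occ_flat one_enat_def)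
    qed
    show "occ z s \<le> occ y s" "occ y s \<le> occ y W" if "y \<in> set (flat s)" for y z
    proof -
      have "1 \<le> occ y s" "1 \<le> occ y W" using that W by (auto intro!: one_le_enat simp: occ_0_iff)
      then show "occ z s \<le> occ y s" "occ y s \<le> occ y W" using order_trans[OF le[of z]] order_trans[OF le[of y]] by blast+
    qed
  qed (use s W in auto)
qed (use p vanishes_hasbar[OF T] in auto)

lemma power_escape:
  assumes T: "epi_theory \<Theta>" and c: "commutative \<Theta>"
    and Y: "epi_theory Y" "\<Theta> \<subseteq> Y" and Z: "epi_theory Z" and X: "epi_theory X" "\<Theta> \<subseteq> X" "Z \<inter> Y \<subseteq> X"
    and pq: "(p, q) \<in> Y" "(p, q) \<in> (Z \<union> \<Theta>)\<^sup>*" and p: "\<not> hasbar p" "flat p = replicate j x" "1 \<le> j"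
  shows "(p, q) \<in> X \<or> vanishes X p"
proof (rule modular_escape[OF T Y Z X _ _ _ _ pq, where P = "\<lambda>t. \<not> hasbar t \<and> flat t = replicate j x"
      and G = "\<lambda>s W. hasbar W \<and> set (flat W) = set (flat s) \<and> (\<forall>y. ex y W = ex y s)"])
  let ?P = "\<lambda>t. \<not> hasbar t \<and> flat t = replicate j x"
  fix s assume s: "?P s"
  show "\<exists>W. (s, W) \<in> A \<and> hasbar W \<and> set (flat W) = set (flat s) \<and> (\<forall>y. ex y W = ex y s)"
    if "epi_theory A" "(s, t) \<in> A" "\<not> ?P t" for A t
    using power_identity[OF that(1) conjunct1[OF s] conjunct2[OF s] p(3) that(2,3)] by blast
  show "(s, t) \<in> \<Theta>" if "?P t" for t by (rule flat_eq_theory[OF T]) (use s that in simp_all)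
  show "(s, W) \<in> A" if A: "epi_theory A" "\<Theta> \<subseteq> A" and W: "hasbar W \<and> set (flat W) = set (flat s) \<and> (\<forall>y. ex y W = ex y s)"
    and v: "vanishes A s" for A W
  proof (rule vanishing_exact[OF A(1) _ _ v])
    show "permutative A" using commutative_permutative[OF T c] A(2) by (auto simp: permutative_def)
    have sx: "set (flat s) = {x}" using s p(3) by auto
    show "occ z s \<le> occ y s" if "y \<in> set (flat s)" for y z
      using sx that occ_0_iff[of z s] by (cases "z = x") auto
    show "occ y s \<le> occ y W" if "y \<in> set (flat s)" for y
      using occ_single_letter[of W x] W sx that by auto
  qed (use s W in auto)
qed (use p vanishes_hasbar[OF T] in auto)

text \<open>If \<open>x\<^sup>2y = xy\<^sup>2\<close>, then \<open>x\<^sup>2yz = xy\<^sup>2z\<close>, and with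
  \<open>yz\<close> in place of \<open>y\<close> also \<open>x\<^sup>2yz = xy\<^sup>2z\<^sup>2\<close>; so
  \<open>xy\<^sup>2z\<close> is a proper multiple of itself.\<close>

lemma shifted_square:
  assumes T: "epi_theory \<Theta>" and c: "commutative \<Theta>" and sq: "(word [0, 0, 1], word [0, 1, 1]) \<in> \<Theta>"
  shows "i \<in> periods \<Theta>" "index \<Theta> 1" "vanishes \<Theta> (word [0, 0, 1, 2])"
proof -
  note E = epi_equational[OF T]
  have occ: "occ 0 (word [0, 0, 1]) = enat 2" "occ 0 (word [0, 1, 1]) = enat 1" by (simp_all add: occ_flat)
  have "int 2 - int 1 \<in> periods \<Theta>" using theory_ex[OF T sq, of 0] by (simp only: ex_occ[OF occ(1)] ex_occ[OF occ(2)])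
  then have one: "1 \<in> periods \<Theta>" by simp
  show "i \<in> periods \<Theta>" by (rule periods_all[OF T one])
  show "index \<Theta> 1" using index_change[OF T et_sym[OF E sq] occ(2)] occ(1) by simp
  let ?f = "\<lambda>i::nat. if i = 1 then [1, 2] else [i]"
  have "(word (sub ?f [0, 0, 1]), word (sub ?f [0, 1, 1])) \<in> \<Theta>" by (rule word_subst[OF T sq]) auto
  then have a: "(word [0, 0, 1, 2], word [0, 1, 2, 1, 2]) \<in> \<Theta>" by (simp add: sub_def)
  have b: "(word [0, 1, 2, 1, 2], word [0, 1, 1, 2, 2]) \<in> \<Theta>" by (rule word_mset[OF T c]) auto
  have d: "(word ([] @ [0, 0, 1] @ [2]), word ([] @ [0, 1, 1] @ [2])) \<in> \<Theta>" by (rule word_context[OF T sq]) auto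
  then have e: "(word [0, 0, 1, 2], word [0, 1, 1, 2]) \<in> \<Theta>" by simp
  have "(word [0, 1, 1, 2], word ([] @ [0, 1, 1, 2] @ [2])) \<in> \<Theta>"
    using et_trans[OF E et_sym[OF E e] et_trans[OF E a b]] by simp
  then have "vanishes \<Theta> (word [0, 1, 1, 2])" by (rule proper_factor_vanishes[OF T]) auto
  then show "vanishes \<Theta> (word [0, 0, 1, 2])" by (rule vanishes_related[OF T e])
qed

lemma vanishes_instance:
  assumes T: "epi_theory \<Theta>" and c: "commutative \<Theta>" and v: "vanishes \<Theta> (word xs)" "xs \<noteq> []"
    and t: "\<not> hasbar t" "mset (flat t) = mset (sub \<phi> xs)" "\<And>i. \<phi> i \<noteq> []"
  shows "vanishes \<Theta> t"
proof -
  let ?s = "subst (\<lambda>i. word (\<phi> i)) (word xs)"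
  have "flat ?s = sub \<phi> xs" using v(2) t(3) by (simp add: flat_subst)
  moreover have nb: "\<not> hasbar ?s" using v(2) t(3) by (auto simp: hasbar_subst)
  ultimately have "(word (flat t), word (flat ?s)) \<in> \<Theta>" by (intro word_mset[OF T c]) (simp_all add: t)
  then have "(t, ?s) \<in> \<Theta>" using et_trans[OF epi_equational[OF T]] et_sym[OF epi_equational[OF T]]
      word_flat[OF T t(1)] word_flat[OF T nb] by blast
  then show ?thesis using vanishes_related[OF T] vanishes_subst[OF T v(1)] by blast
qed

lemma long_word_repeats:
  assumes "set xs \<subseteq> {a, b}" "4 \<le> length xs"
  shows "\<exists>x y zs. mset xs = mset ([x, x, y] @ zs) \<and> zs \<noteq> []"
proof -
  have "\<not> distinct xs"
  proof
    assume "distinct xs"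
    then have "length xs = card (set xs)" by (simp add: distinct_card)
    also have "\<dots> \<le> card {a, b}" using assms(1) by (intro card_mono) auto
    also have "\<dots> \<le> 2" by (simp add: card_insert_if)
    finally show False using assms(2) by simp
  qed
  then obtain us vs ws x where xs: "xs = us @ [x] @ vs @ [x] @ ws" using not_distinct_decomp by blast
  obtain y zs where yz: "us @ vs @ ws = y # zs" using assms(2) xs by (cases "us @ vs @ ws") auto
  have "zs \<noteq> []" using assms(2) xs arg_cong[OF yz, of length] by auto
  moreover have "mset xs = mset ([x, x, y] @ zs)" using arg_cong[OF yz, of mset] by (simp add: xs)
  ultimately show ?thesis by blast
qed

text \<open>Modulo \<open>x\<^sup>2y = xy\<^sup>2\<close> and commutativity all words of length three with the letters
  \<open>a\<close> and \<open>b\<close> are equal. All exponents are periods and \<open>1\<close> is an index here, so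
  that any two vanishing terms with the same letters are equal.\<close>

lemma cubic_escape:
  assumes T: "epi_theory \<Theta>" and c: "commutative \<Theta>" and sq: "(word [0, 0, 1], word [0, 1, 1]) \<in> \<Theta>"
    and Y: "epi_theory Y" "\<Theta> \<subseteq> Y" and Z: "epi_theory Z" and X: "epi_theory X" "\<Theta> \<subseteq> X" "Z \<inter> Y \<subseteq> X"
    and pq: "(p, q) \<in> Y" "(p, q) \<in> (Z \<union> \<Theta>)\<^sup>*"
    and p: "\<not> hasbar p" "length (flat p) = 3" "set (flat p) = {a, b}" "a \<noteq> b"
  shows "(p, q) \<in> X \<or> vanishes X p"
proof (rule modular_escape[OF T Y Z X _ _ _ _ pq, where P = "\<lambda>t. \<not> hasbar t \<and> length (flat t) = 3 \<and> set (flat t) = {a, b}"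
      and G = "\<lambda>s W. (hasbar W \<or> 4 \<le> length (flat W)) \<and> set (flat W) = {a, b}"])
  let ?P = "\<lambda>t. \<not> hasbar t \<and> length (flat t) = 3 \<and> set (flat t) = {a, b}"
  have van: "vanishes \<Theta> W" if W: "(hasbar W \<or> 4 \<le> length (flat W)) \<and> set (flat W) = {a, b}" for W
  proof (cases "hasbar W")
    case False
    then obtain x y zs where xyz: "mset (flat W) = mset ([x, x, y] @ zs)" "zs \<noteq> []"
      using long_word_repeats[of "flat W" a b] W by auto
    show ?thesis
      by (rule vanishes_instance[OF T c shifted_square(3)[OF T c sq] _ False,
            where \<phi> = "\<lambda>i. if i = 0 then [x] else if i = 1 then [y] else zs"]) (use xyz in \<open>simp_all add: sub_def\<close>)
  qed (rule vanishes_hasbar[OF T])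
  then show "vanishes \<Theta> W" if "(hasbar W \<or> 4 \<le> length (flat W)) \<and> set (flat W) = {a, b}" for W using that .
  fix s assume s: "?P s"
  show "\<exists>W. (s, W) \<in> A \<and> (hasbar W \<or> 4 \<le> length (flat W)) \<and> set (flat W) = {a, b}"
    if "epi_theory A" "(s, t) \<in> A" "\<not> ?P t" for A t
  proof -
    have "\<not> hasbar s" "length (flat s) = 3" "set (flat s) = {a, b}" using s by auto
    from cubic_identity[OF that(1) this p(4) that(2,3)] show ?thesis by blast
  qed
  have square: "mset (flat s) = {#a, a, b#} \<or> mset (flat s) = {#a, b, b#}" if "?P s" for s
  proof -
    have l: "length (flat s) = 3" using that by blast
    obtain x y z where e: "flat s = [x, y, z]"
      by (rule length_le_3_cases[of "flat s"]) (use l in auto)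
    have xyz: "{x, y, z} = {a, b}" using that e by simp
    have "x = a \<or> x = b" "y = a \<or> y = b" "z = a \<or> z = b" using xyz by blast+
    moreover have "\<not> (x = a \<and> y = a \<and> z = a)" "\<not> (x = b \<and> y = b \<and> z = b)" using xyz p(4) by auto
    ultimately have "x = a \<and> y = a \<and> z = b \<or> x = a \<and> y = b \<and> z = a \<or> x = b \<and> y = a \<and> z = a \<or>
      x = a \<and> y = b \<and> z = b \<or> x = b \<and> y = a \<and> z = b \<or> x = b \<and> y = b \<and> z = a" by blast
    then show ?thesis unfolding e by (elim disjE conjE; simp only: mset.simps add_mset_commute simp_thms)
  qed
  let ?f = "\<lambda>i::nat. if i = 0 then a else b"
  have "(word (map ?f [0, 0, 1]), word (map ?f [0, 1, 1])) \<in> \<Theta>" by (rule word_rename[OF T sq]) auto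
  then have ab: "(word [a, a, b], word [a, b, b]) \<in> \<Theta>" by simp
  have to_ab: "(t, word [a, a, b]) \<in> \<Theta>" if t: "?P t" for t
  proof -
    have "(t, word (flat t)) \<in> \<Theta>" using word_flat[OF T] t by blast
    moreover have "(word (flat t), word [a, a, b]) \<in> \<Theta>"
      using square[OF t]
    proof
      assume "mset (flat t) = {#a, a, b#}"
      then show ?thesis by (intro word_mset[OF T c]) simp_all
    next
      assume "mset (flat t) = {#a, b, b#}"
      then have "(word (flat t), word [a, b, b]) \<in> \<Theta>" by (intro word_mset[OF T c]) simp_all
      then show ?thesis using et_trans[OF epi_equational[OF T] _ et_sym[OF epi_equational[OF T] ab]] by blast
    qed
    ultimately show ?thesis using et_trans[OF epi_equational[OF T]] by blast
  qed
  show "(s, t) \<in> \<Theta>" if "?P t" for t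
    using et_trans[OF epi_equational[OF T] to_ab[OF s] et_sym[OF epi_equational[OF T] to_ab[OF that]]] .
  show "(s, W) \<in> A" if A: "epi_theory A" "\<Theta> \<subseteq> A" and W: "(hasbar W \<or> 4 \<le> length (flat W)) \<and> set (flat W) = {a, b}"
    and v: "vanishes A s" for A W
  proof (rule theory_vanishes_identity[OF A(1) _ v])
    show "permutative A" using commutative_permutative[OF T c] A(2) by (auto simp: permutative_def)
    show "vanishes A W" using van[OF W] A(2) by (auto simp: vanishes_def)
    show "ex y s - ex y W \<in> periods A" for y
      using shifted_square(1)[OF T c sq] A(2) by (auto simp: periods_def)
    have "index A 1" using shifted_square(2)[OF T c sq] A(2) by (auto simp: index_def)
    moreover have "occ y s = occ y W \<or> enat 1 \<le> occ y s \<and> enat 1 \<le> occ y W" for y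
    proof (cases "y \<in> {a, b}")
      case True
      then have "occ y s \<noteq> 0" "occ y W \<noteq> 0" using s W by (simp_all add: occ_0_iff)
      then show ?thesis using one_le_enat[of "occ y s"] one_le_enat[of "occ y W"] by (simp add: one_enat_def)
    next
      case False
      then have "occ y s = 0" "occ y W = 0" unfolding occ_0_iff using s W by simp_all
      then show ?thesis by simp
    qed
    ultimately show "occ y s = occ y W \<or> (\<exists>k. index A k \<and> enat k \<le> occ y s \<and> enat k \<le> occ y W)" for y by blast
  qed
qed (use p in auto)

text \<open>If \<open>p\<close> does not vanish in \<open>X\<close>, then it is a word that is linear, a square or
  cube of a letter, or, in the case \<open>x\<^sup>2y = xy\<^sup>2\<close>, a permutation of \<open>xxy\<close>: all
  other words are multiples of vanishing ones. Such a \<open>p\<close> can be separated from \<open>q\<close> only by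
  an identity that makes it vanish in \<open>X\<close>, and the same holds for \<open>q\<close>. If both vanish, the
  modular law is that of the invariants.\<close>

theorem upper_sufficient:
  assumes T: "epi_theory \<Theta>" and c: "commutative \<Theta>"
    and sq: "(word [0, 0, 1], word [0, 1, 1]) \<in> \<Theta> \<or> vanishes \<Theta> (word [0, 0, 1])"
  shows "upper \<Theta>"
  unfolding upper_def
proof (intro allI impI subrelI)
  fix Y Z p q assume Y: "epi_theory Y" "\<Theta> \<subseteq> Y" and Z: "epi_theory Z" and pq: "(p, q) \<in> Y \<inter> (Z \<union> \<Theta>)\<^sup>*"
  let ?X = "(\<Theta> \<union> (Z \<inter> Y))\<^sup>*"
  note E = epi_equational
  have sub: "\<Theta> \<subseteq> ?X" "Z \<inter> Y \<subseteq> ?X" by auto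
  have X: "epi_theory ?X"
    by (rule epi_theory_mono[OF T sub(1) equational_theory_join[OF E[OF T] E[OF epi_theory_Int[OF Z Y(1)]]]])
  have perm: "permutative ?X" using commutative_permutative[OF T c] sub(1) by (auto simp: permutative_def)
  have main: "(s, t) \<in> ?X \<or> vanishes ?X s" if st: "(s, t) \<in> Y" "(s, t) \<in> (Z \<union> \<Theta>)\<^sup>*" for s t
  proof (cases "hasbar s")
    case True
    then show ?thesis using vanishes_hasbar[OF X] by blast
  next
    case nb: False
    note esc = Y Z X sub st nb
    have vX: "vanishes ?X s" if "vanishes \<Theta> s" using that sub(1) by (auto simp: vanishes_def)
    show ?thesis
    proof (cases "distinct (flat s)")
      case True
      then show ?thesis by (rule linear_escape[OF T c esc])
    next
      case False
      then obtain us vs ws x where "flat s = us @ [x] @ vs @ [x] @ ws" using not_distinct_decomp by blast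
      then obtain rs where rs: "mset (flat s) = mset ([x, x] @ rs)" using that[of "us @ vs @ ws"] by simp
      have len: "length (flat s) = 2 + length rs" "set (flat s) = insert x (set rs)"
        using arg_cong[OF rs, of size] arg_cong[OF rs, of set_mset] by simp_all
      show ?thesis
      proof (cases rs)
        case Nil
        then have "flat s = replicate 2 x" using len by (intro replicate_eqI) auto
        then show ?thesis by (rule power_escape[OF T c esc]) simp
      next
        case (Cons y zs)
        from sq show ?thesis
        proof
          assume v: "vanishes \<Theta> (word [0, 0, 1])"
          have "vanishes \<Theta> s"
            by (rule vanishes_instance[OF T c v _ nb, where \<phi> = "\<lambda>i. if i = 0 then [x] else rs"])
              (use rs Cons in \<open>simp_all add: sub_def\<close>)
          then show ?thesis using vX by blast
        next
          assume v: "(word [0, 0, 1], word [0, 1, 1]) \<in> \<Theta>"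
          show ?thesis
          proof (cases "zs = []")
            case True
            show ?thesis
            proof (cases "x = y")
              case True
              then have "flat s = replicate 3 x" using len Cons \<open>zs = []\<close> by (intro replicate_eqI) auto
              then show ?thesis by (rule power_escape[OF T c esc]) simp
            next
              case False
              show ?thesis by (rule cubic_escape[OF T c v esc _ _ False]) (use len Cons \<open>zs = []\<close> in auto)
            qed
          next
            case False
            have "vanishes \<Theta> s"
              by (rule vanishes_instance[OF T c shifted_square(3)[OF T c v] _ nb,
                    where \<phi> = "\<lambda>i. if i = 0 then [x] else if i = 1 then [y] else zs"])
                (use rs Cons False in \<open>simp_all add: sub_def\<close>)
            then show ?thesis using vX by blast
          qed
        qed
      qed
    qed
  qed
  have pq1: "(p, q) \<in> Y" "(p, q) \<in> (Z \<union> \<Theta>)\<^sup>*" using pq by simp_all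
  have qp: "(q, p) \<in> Y" by (rule et_sym[OF E[OF Y(1)] pq1(1)])
  have qp2: "(q, p) \<in> (Z \<union> \<Theta>)\<^sup>*" by (rule et_sym[OF equational_theory_join[OF E[OF Z] E[OF T]] pq1(2)])
  show "(p, q) \<in> ?X"
  proof (rule ccontr)
    assume n: "(p, q) \<notin> ?X"
    then have "(q, p) \<notin> ?X" using et_sym[OF E[OF X]] by blast
    then have "vanishes ?X p" "vanishes ?X q" using main[OF pq1] main[OF qp qp2] n by blast+
    then show False using modular_vanishing[OF T Y Z X perm sub pq1] n by blast
  qed
qed

section \<open>Group, combinatorial and nil factors of a theory\<close>

text \<open>For a subgroup \<open>D\<close> of the integers this is the theory of the Abelian groups with
  \<open>x\<^sup>j = 1\<close> for all \<open>j\<close> in \<open>D\<close>.\<close>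

definition exponent_theory :: "int set \<Rightarrow> identity set" where
  "exponent_theory D = {(p, q). \<forall>y. ex y p - ex y q \<in> D}"

text \<open>Occurrence numbers are compared up to the threshold \<open>m\<close>; this is the theory of \<open>C
  m\<close>.\<close>

definition occurrence_theory :: "nat \<Rightarrow> identity set" where
  "occurrence_theory m = {(p, q). \<forall>y. occ y p = occ y q \<or> enat m \<le> occ y p \<and> enat m \<le> occ y q}"

text \<open>The theory of the nil-semigroups of the variety: all vanishing terms become equal.\<close>

definition nil_theory :: "identity set \<Rightarrow> identity set" where
  "nil_theory \<Theta> = \<Theta> \<union> {(p, q). vanishes \<Theta> p \<and> vanishes \<Theta> q}"

lemma ex_subst_sum:
  "set (flat t) \<subseteq> {..<n} \<Longrightarrow> ex y (subst \<sigma> t) = (\<Sum>i<n. ex i t * ex y (\<sigma> i))"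
proof (induction t)
  case (Var k)
  have "(\<Sum>i<n. ex i (Var k) * ex y (\<sigma> i)) = (\<Sum>i<n. if k = i then ex y (\<sigma> i) else 0)"
    by (rule sum.cong) auto
  then show ?case using Var by simp
qed (simp_all add: sum.distrib distrib_right sum_negf)

lemma occ_Bar: "occ y (Bar t) = \<infinity> * occ y t"
  by (cases "occ y t") (auto simp: zero_enat_def)

text \<open>Occurrence numbers are linear under substitution because of \<open>0 \<cdot> \<infinity> =
  0\<close>.\<close>

lemma occ_subst_sum:
  "set (flat t) \<subseteq> {..<n} \<Longrightarrow> occ y (subst \<sigma> t) = (\<Sum>i<n. occ i t * occ y (\<sigma> i))"
proof (induction t)
  case (Var k)
  have "(\<Sum>i<n. occ i (Var k) * occ y (\<sigma> i)) = (\<Sum>i<n. if k = i then occ y (\<sigma> i) else 0)"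
    by (rule sum.cong) auto
  then show ?case using Var by simp
next
  case (Bar t)
  then show ?case unfolding subst.simps occ_Bar by (simp add: sum_distrib_left mult.assoc)
qed (simp add: sum.distrib distrib_right)

lemma letters_bound: "\<exists>n. set (flat s) \<subseteq> {..<n} \<and> set (flat t) \<subseteq> {..<n :: nat}"
proof -
  have "finite (set (flat s) \<union> set (flat t))" by simp
  then obtain n where "set (flat s) \<union> set (flat t) \<subseteq> {..<n}" by (auto simp: finite_nat_iff_bounded)
  then show ?thesis by blast
qed

lemma exponent_theory:
  assumes D: "0 \<in> D" "\<And>i j. i \<in> D \<Longrightarrow> j \<in> D \<Longrightarrow> i - j \<in> D"
  shows "epi_theory (exponent_theory D)"
proof -
  have neg: "- i \<in> D" if "i \<in> D" for i using D(2)[OF D(1) that] by simp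
  have add: "i + j \<in> D" if "i \<in> D" "j \<in> D" for i j using D(2)[OF that(1) neg[OF that(2)]] by simp
  have mult: "i * k \<in> D" if "i \<in> D" for i k
  proof -
    have n: "i * int n \<in> D" for n by (induction n) (use D(1) add that in \<open>auto simp: algebra_simps\<close>)
    show ?thesis using n[of "nat k"] neg[OF n[of "nat (- k)"]] by (cases "0 \<le> k") auto
  qed
  have "equational_theory (exponent_theory D)"
  proof (rule equational_theoryI)
    show "(s, s) \<in> exponent_theory D" for s using D(1) by (simp add: exponent_theory_def)
    show "(t, s) \<in> exponent_theory D" if "(s, t) \<in> exponent_theory D" for s t
      unfolding exponent_theory_def
    proof (clarify)
      fix y
      have "- (ex y s - ex y t) \<in> D" using that neg unfolding exponent_theory_def by blast
      then show "ex y t - ex y s \<in> D" by simp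
    qed
    show "(s, r) \<in> exponent_theory D" if "(s, t) \<in> exponent_theory D" "(t, r) \<in> exponent_theory D" for s t r
      unfolding exponent_theory_def
    proof (clarify)
      fix y
      have "(ex y s - ex y t) + (ex y t - ex y r) \<in> D" using that add unfolding exponent_theory_def by blast
      then show "ex y s - ex y r \<in> D" by simp
    qed
    show "(Mul s s', Mul t t') \<in> exponent_theory D"
      if "(s, t) \<in> exponent_theory D" "(s', t') \<in> exponent_theory D" for s t s' t'
      unfolding exponent_theory_def
    proof (clarify)
      fix y
      have "(ex y s - ex y t) + (ex y s' - ex y t') \<in> D" using that add unfolding exponent_theory_def by blast
      then show "ex y (Mul s s') - ex y (Mul t t') \<in> D" by (simp add: algebra_simps)
    qed
    show "(Bar s, Bar t) \<in> exponent_theory D" if "(s, t) \<in> exponent_theory D" for s t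
      unfolding exponent_theory_def
    proof (clarify)
      fix y
      have "- (ex y s - ex y t) \<in> D" using that neg unfolding exponent_theory_def by blast
      then show "ex y (Bar s) - ex y (Bar t) \<in> D" by simp
    qed
    show "(subst \<sigma> s, subst \<sigma> t) \<in> exponent_theory D" if st: "(s, t) \<in> exponent_theory D" for s t \<sigma>
      unfolding exponent_theory_def
    proof (clarify)
      fix y
      obtain n where n: "set (flat s) \<subseteq> {..<n}" "set (flat t) \<subseteq> {..<n}" using letters_bound by blast
      have sum: "(\<Sum>i<k. (ex i s - ex i t) * ex y (\<sigma> i)) \<in> D" for k
        by (induction k) (use D(1) add mult st in \<open>auto simp: exponent_theory_def\<close>)
      have "ex y (subst \<sigma> s) - ex y (subst \<sigma> t) = (\<Sum>i<n. (ex i s - ex i t) * ex y (\<sigma> i))"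
        unfolding ex_subst_sum[OF n(1)] ex_subst_sum[OF n(2)] by (simp add: sum_subtractf left_diff_distrib)
      then show "ex y (subst \<sigma> s) - ex y (subst \<sigma> t) \<in> D" using sum by simp
    qed
  qed
  then show ?thesis unfolding epi_theory_def using D(1)
    by (intro conjI exI[of _ 0]) (simp_all add: exponent_theory_def)
qed

lemma occurrence_theory: "epi_theory (occurrence_theory m)"
proof -
  define R where "R = (\<lambda>a b :: enat. a = b \<or> enat m \<le> a \<and> enat m \<le> b)"
  have def: "occurrence_theory m = {(p, q). \<forall>y. R (occ y p) (occ y q)}" by (simp add: occurrence_theory_def R_def)
  have refl: "R a a" for a by (simp add: R_def)
  have add: "R (a + c) (b + d)" if "R a b" "R c d" for a b c d
    using that by (auto simp: R_def add_increasing add_increasing2)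
  have mult: "R (a * c) (b * c)" if "R a b" for a b c
  proof (cases "c = 0")
    case False
    then have "a \<le> a * c" for a using mult_left_mono[OF one_le_enat[OF False], of a] by simp
    then show ?thesis using that by (auto simp: R_def intro: order_trans)
  qed (simp add: R_def)
  have "equational_theory (occurrence_theory m)"
  proof (rule equational_theoryI)
    show "(subst \<sigma> s, subst \<sigma> t) \<in> occurrence_theory m" if st: "(s, t) \<in> occurrence_theory m" for s t \<sigma>
      unfolding def
    proof (clarify)
      fix y
      obtain n where n: "set (flat s) \<subseteq> {..<n}" "set (flat t) \<subseteq> {..<n}" using letters_bound by blast
      have "R (\<Sum>i<k. occ i s * occ y (\<sigma> i)) (\<Sum>i<k. occ i t * occ y (\<sigma> i))" for k
      proof (induction k)
        case (Suc k)
        have "R (occ k s * occ y (\<sigma> k)) (occ k t * occ y (\<sigma> k))" using st unfolding def by (intro mult) blast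
        then show ?case unfolding sum.lessThan_Suc by (rule add[OF Suc])
      qed (simp add: refl)
      then show "R (occ y (subst \<sigma> s)) (occ y (subst \<sigma> t))"
        unfolding occ_subst_sum[OF n(1)] occ_subst_sum[OF n(2)] .
    qed
    show "(Bar s, Bar t) \<in> occurrence_theory m" if st: "(s, t) \<in> occurrence_theory m" for s t
      unfolding def
    proof (clarify)
      fix y
      have "R (occ y s * \<infinity>) (occ y t * \<infinity>)" using st unfolding def by (intro mult) blast
      then show "R (occ y (Bar s)) (occ y (Bar t))" unfolding occ_Bar by (simp add: mult.commute)
    qed
    show "(s, r) \<in> occurrence_theory m" if "(s, t) \<in> occurrence_theory m" "(t, r) \<in> occurrence_theory m" for s t r
      unfolding def
    proof (clarify)
      fix y
      have "R (occ y s) (occ y t)" "R (occ y t) (occ y r)" using that unfolding def by blast+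
      then show "R (occ y s) (occ y r)" by (auto simp: R_def)
    qed
    show "(Mul s s', Mul t t') \<in> occurrence_theory m"
      if "(s, t) \<in> occurrence_theory m" "(s', t') \<in> occurrence_theory m" for s t s' t'
      using that unfolding def by (auto intro!: add)
    show "(t, s) \<in> occurrence_theory m" if "(s, t) \<in> occurrence_theory m" for s t
      using that unfolding def R_def by (simp add: eq_commute conj_commute)
  qed (simp add: def refl)
  moreover have "(Mul (tpow (Var 0) (Suc m)) (Bar (Var 0)), tpow (Var 0) m) \<in> occurrence_theory m"
  proof -
    have o: "occ y (tpow (Var 0) k) = (if y = 0 then enat (Suc k) else 0)" for y k
      by (induction k) (auto simp: one_enat_def zero_enat_def)
    show ?thesis by (auto simp: occurrence_theory_def o simp del: tpow.simps)
  qed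
  ultimately show ?thesis unfolding epi_theory_def
    by (intro conjI exI[of _ m]) (simp_all add: occurrence_theory_def ac_simps del: tpow.simps)
qed

lemma nil_theory:
  assumes T: "epi_theory \<Theta>" shows "epi_theory (nil_theory \<Theta>)"
proof (rule epi_theory_mono[OF T])
  note E = epi_equational[OF T]
  have rel: "vanishes \<Theta> s \<longleftrightarrow> vanishes \<Theta> t" if "(s, t) \<in> nil_theory \<Theta>" for s t
    using that vanishes_related[OF T] et_sym[OF E] unfolding nil_theory_def by blast
  show "equational_theory (nil_theory \<Theta>)"
  proof (rule equational_theoryI)
    show "(s, r) \<in> nil_theory \<Theta>" if "(s, t) \<in> nil_theory \<Theta>" "(t, r) \<in> nil_theory \<Theta>" for s t r
      using that et_trans[OF E] rel[OF that(1)] rel[OF that(2)] unfolding nil_theory_def by blast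
    show "(Mul s s', Mul t t') \<in> nil_theory \<Theta>"
      if "(s, t) \<in> nil_theory \<Theta>" "(s', t') \<in> nil_theory \<Theta>" for s t s' t'
      using that et_Mul[OF E] vanishes_Mul[OF T] unfolding nil_theory_def by blast
    show "(Bar s, Bar t) \<in> nil_theory \<Theta>" for s t
      using vanishes_hasbar[OF T] by (simp add: nil_theory_def)
    show "(subst \<sigma> s, subst \<sigma> t) \<in> nil_theory \<Theta>" if "(s, t) \<in> nil_theory \<Theta>" for s t \<sigma>
      using that et_subst[OF E] vanishes_subst[OF T] unfolding nil_theory_def by blast
  qed (use et_refl[OF E] et_sym[OF E] in \<open>auto simp: nil_theory_def\<close>)
qed (simp add: nil_theory_def)

text \<open>The decomposition of a permutative theory into a group part, a combinatorial part and a nil part.\<close>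

lemma theory_index_exists:
  assumes T: "epi_theory \<Theta>" and p: "permutative \<Theta>" shows "\<exists>k. index \<Theta> k"
proof -
  obtain n where n: "(Mul (tpow (Var 0) (Suc n)) (Bar (Var 0)), tpow (Var 0) n) \<in> \<Theta>"
    using T by (auto simp: epi_theory_def)
  have "vanishes \<Theta> (tpow (Var 0) n)" unfolding vanishes_def
    using et_sym[OF epi_equational[OF T] n] by (intro exI conjI) auto
  moreover have "\<not> hasbar (tpow (Var 0) n)" by simp
  ultimately show ?thesis using vanishing_word_index[OF T p] by blast
qed

text \<open>The decomposition of a permutative theory into a group part, a combinatorial part and a nil part. The
  theory of the nil part differs from \<open>\<Theta>\<close> only on vanishing terms, and there the other two parts
  are exactly the conditions for an identity.\<close>

lemma theory_decomposition:
  assumes T: "epi_theory \<Theta>" and p: "permutative \<Theta>" and m: "index \<Theta> m" "\<And>k. index \<Theta> k \<Longrightarrow> m \<le> k"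
  shows "\<Theta> = exponent_theory (periods \<Theta>) \<inter> occurrence_theory m \<inter> nil_theory \<Theta>"
proof (intro equalityI subrelI)
  fix s t assume st: "(s, t) \<in> \<Theta>"
  have ts: "(t, s) \<in> \<Theta>" by (rule et_sym[OF epi_equational[OF T] st])
  have "occ y s = occ y t \<or> enat m \<le> occ y s \<and> enat m \<le> occ y t" for y
  proof (cases "occ y s" "occ y t" rule: linorder_cases)
    case less
    then obtain k where k: "occ y s = enat k" by (cases "occ y s") auto
    have "m \<le> k" by (rule m(2), rule theory_occ[OF T st k less])
    then have "enat m \<le> occ y s" using k by simp
    then show ?thesis using less by auto
  next
    case greater
    then obtain k where k: "occ y t = enat k" by (cases "occ y t") auto
    have "m \<le> k" by (rule m(2), rule theory_occ[OF T ts k greater])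
    then have "enat m \<le> occ y t" using k by simp
    then show ?thesis using greater by auto
  qed simp
  then show "(s, t) \<in> exponent_theory (periods \<Theta>) \<inter> occurrence_theory m \<inter> nil_theory \<Theta>"
    using st theory_ex[OF T st] by (auto simp: exponent_theory_def occurrence_theory_def nil_theory_def)
next
  fix s t assume st: "(s, t) \<in> exponent_theory (periods \<Theta>) \<inter> occurrence_theory m \<inter> nil_theory \<Theta>"
  show "(s, t) \<in> \<Theta>"
  proof (rule ccontr)
    assume "(s, t) \<notin> \<Theta>"
    then have v: "vanishes \<Theta> s" "vanishes \<Theta> t" using st by (auto simp: nil_theory_def)
    have "(s, t) \<in> \<Theta>"
      by (rule theory_vanishes_identity[OF T p v])
        (use st m(1) in \<open>auto simp: exponent_theory_def occurrence_theory_def\<close>)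
    then show False using \<open>(s, t) \<notin> \<Theta>\<close> by blast
  qed
qed

text \<open>A commutative theory with \<open>x\<^sup>m = x\<^sup>m\<^sup>+\<^sup>1\<close> contains all identities
  that preserve occurrences up to \<open>m\<close>. If a letter occurs at least \<open>m\<close> times, both sides
  vanish, and otherwise they are permutations of each other.\<close>

lemma occurrence_theory_least:
  assumes T: "epi_theory \<Theta>" and c: "commutative \<Theta>" and m: "1 \<le> m"
    and id: "(word (replicate m 0), word (replicate (m + 1) 0)) \<in> \<Theta>"
  shows "occurrence_theory m \<subseteq> \<Theta>"
proof (rule subrelI)
  note E = epi_equational[OF T]
  fix p q assume pq: "(p, q) \<in> occurrence_theory m"
  have ne: "replicate m (0 :: nat) \<noteq> []" using m by auto
  have snoc: "word (replicate (m + 1) 0) = Mul (word (replicate m 0)) (Var 0)"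
    using word_snoc[OF ne, of 0] by (simp add: replicate_append_same)
  have "vanishes \<Theta> (word (replicate m 0))"
    using absorb_vanishes(2)[OF T] id unfolding snoc by blast
  from vanishes_subst[OF T this] have vm: "vanishes \<Theta> (word (replicate m y))" for y
    using subst_Var_word[OF ne, of "\<lambda>_. y"] by (metis map_replicate)
  have van: "vanishes \<Theta> t" if t: "enat m \<le> occ y t" for t y
  proof (cases "hasbar t")
    case False
    have "m \<le> count (mset (flat t)) y" using t False by (simp add: occ_flat count_mset)
    then have "replicate_mset m y \<subseteq># mset (flat t)" by (simp flip: count_le_replicate_mset_subset_eq)
    then obtain R where "mset (flat t) = replicate_mset m y + R" using mset_subset_eq_exists_conv by blast
    then obtain rs where rs: "mset (flat t) = mset (replicate m y @ rs)" using ex_mset[of R] by auto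
    have "vanishes \<Theta> (word ([] @ replicate m y @ rs))" by (rule vanishes_factor[OF T vm]) (use m in auto)
    moreover have "(word (flat t), word (replicate m y @ rs)) \<in> \<Theta>" by (rule word_mset[OF T c rs flat_nonempty])
    ultimately show ?thesis using vanishes_related[OF T] word_flat[OF T False] by (metis append_Nil)
  qed (rule vanishes_hasbar[OF T])
  show "(p, q) \<in> \<Theta>"
  proof (cases "\<exists>y. enat m \<le> occ y p")
    case True
    then obtain y where y: "enat m \<le> occ y p" by blast
    moreover have "occ y p = occ y q \<or> enat m \<le> occ y p \<and> enat m \<le> occ y q"
      using pq by (simp add: occurrence_theory_def)
    ultimately have y: "enat m \<le> occ y p" "enat m \<le> occ y q" by auto
    have o: "occ 0 (word (replicate m 0)) = enat m" "occ 0 (word (replicate (m + 1) 0)) = enat (m + 1)"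
      using m ne by (simp_all add: occ_flat count_list_replicate)
    have "int m - int (m + 1) \<in> periods \<Theta>"
      using theory_ex[OF T id, of 0] unfolding ex_occ[OF o(1)] ex_occ[OF o(2)] .
    then have one: "1 \<in> periods \<Theta>" using theory_periods(2)[OF T theory_periods(1)[OF T], of "-1"] by simp
    note per = periods_all[OF T one]
    have "index \<Theta> m" by (rule index_change[OF T id o(1)]) (simp only: o(2) enat.inject)
    then show ?thesis
      by (intro theory_vanishes_identity[OF T commutative_permutative[OF T c] van[OF y(1)] van[OF y(2)] per])
        (use pq in \<open>auto simp: occurrence_theory_def\<close>)
  next
    case False
    then have eq: "occ y p = occ y q" for y using pq by (auto simp: occurrence_theory_def)
    have inf: "\<exists>y. occ y t = \<infinity>" if "hasbar t" for t
      using that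
    proof (induction t)
      case (Mul s t)
      then obtain y where "occ y s = \<infinity> \<or> occ y t = \<infinity>" by auto
      then show ?case by (intro exI[of _ y]) auto
    next
      case (Bar t)
      obtain y where "y \<in> set (flat t)" using hd_in_set[OF flat_nonempty[of t]] by blast
      then have "occ y t \<noteq> 0" by (simp add: occ_0_iff)
      then show ?case by (intro exI[of _ y]) simp
    qed auto
    have "\<exists>y. enat m \<le> occ y t" if b: "hasbar t" for t
    proof -
      obtain y where "occ y t = \<infinity>" using inf[OF b] by blast
      then show ?thesis by (intro exI[of _ y]) simp
    qed
    from this[of p] this[of q] have nb: "\<not> hasbar p" "\<not> hasbar q" using False eq by auto
    have "count (mset (flat p)) y = count (mset (flat q)) y" for y
      using eq[of y] by (simp add: occ_flat[OF nb(1)] occ_flat[OF nb(2)] count_mset)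
    then have "mset (flat p) = mset (flat q)" by (rule multiset_eqI)
    then have "(word (flat p), word (flat q)) \<in> \<Theta>" by (rule word_mset[OF T c _ flat_nonempty])
    then show ?thesis using et_trans[OF E] et_sym[OF E] word_flat[OF T nb(1)] word_flat[OF T nb(2)] by blast
  qed
qed

section \<open>The factors as varieties\<close>

context associative_algebra
begin

lemma index_shift:
  assumes x: "x \<in> carrier S" and c: "x \<cdot> pinv S x = pinv S x \<cdot> x"
    and n: "1 \<le> n" "spow S x (Suc n) \<cdot> pinv S x = spow S x n"
  shows "spow S x (Suc (n + k)) \<cdot> pinv S x = spow S x (n + k)"
proof (induction k)
  case (Suc k)
  have "spow S x (Suc (n + Suc k)) \<cdot> pinv S x = spow S x (Suc (n + k)) \<cdot> (x \<cdot> pinv S x)"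
    using spow_Suc[of "Suc (n + k)" x] x by (simp add: mult_assoc)
  also have "\<dots> = spow S x (Suc (n + k)) \<cdot> pinv S x \<cdot> x" unfolding c using x by (simp add: mult_assoc)
  also have "\<dots> = spow S x (n + Suc k)" unfolding Suc using spow_Suc[of "n + k" x] n by simp
  finally show ?case .
qed (use n in simp)

lemma power_stable: "1 \<le> m \<Longrightarrow> spow S x (Suc m) = spow S x m \<Longrightarrow> spow S x (m + k) = spow S x m"
  by (induction k) (simp_all add: spow_Suc)

text \<open>An identity \<open>x\<^sup>m = x\<^sup>m\<^sup>+\<^sup>1\<close> bounds the index of \<open>x\<close> by
  \<open>m\<close>.\<close>

lemma aperiodic_index:
  assumes x: "x \<in> carrier S" and d: "drazin x" and m: "1 \<le> m" "spow S x (Suc m) = spow S x m"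
  shows "spow S x (Suc m) \<cdot> pinv S x = spow S x m"
proof -
  obtain n where n: "1 \<le> n" "spow S x (Suc n) \<cdot> pinv S x = spow S x n" and c: "x \<cdot> pinv S x = pinv S x \<cdot> x"
    using d by (auto simp: drazin_def)
  have "spow S x (Suc (n + m)) = spow S x m" "spow S x (n + m) = spow S x m"
    using power_stable[OF m, of "Suc n"] power_stable[OF m, of n] by (simp_all add: add.commute)
  then have "spow S x m \<cdot> pinv S x = spow S x m" using index_shift[OF x c n, of m] by simp
  then show ?thesis by (simp add: m(2))
qed

end

lemma eval_word_replicate: "eval S \<rho> (word (replicate (Suc k) i)) = spow S (\<rho> i) (Suc k)"
proof (induction k)
  case (Suc k)
  have "word (replicate (Suc (Suc k)) i) = Mul (word (replicate (Suc k) i)) (Var i)"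
    using word_snoc[of "replicate (Suc k) i" i] by (simp add: replicate_append_same)
  then have "eval S \<rho> (word (replicate (Suc (Suc k)) i)) = spow S (\<rho> i) (Suc k) \<cdot>\<^bsub>S\<^esub> \<rho> i" by (simp only: eval.simps Suc)
  then show ?case by (simp add: spow_def)
qed (simp add: spow_def)

text \<open>A single epigroup need not have an epigroup theory, as the indices of its elements may be unbounded. Here
  \<open>m\<close> bounds them.\<close>

lemma epi_theory_aperiodic:
  assumes S: "epigroup S" and m: "1 \<le> m" and id: "satisfies S (word (replicate m 0), word (replicate (m + 1) 0))"
  shows "epi_theory (Eq {S})"
proof -
  have alg: "algebra_2_1 S" and asc: "associative S" and dr: "\<And>x. x \<in> carrier S \<Longrightarrow> associative_algebra.drazin S x"
    using S by (auto simp: epigroup_iff)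
  interpret associative_algebra S by unfold_locales (rule alg asc)+
  obtain k where k: "m = Suc k" using m by (cases m) auto
  have st: "spow S x (Suc m) = spow S x m" if "x \<in> carrier S" for x
    using satisfies_one_letter[OF id that]
    unfolding fst_conv snd_conv k Suc_eq_plus1[symmetric] eval_word_replicate by simp
  have "satisfies S (Mul (tpow (Var 0) (Suc k)) (Bar (Var 0)), tpow (Var 0) k)"
    unfolding satisfies_def fst_conv snd_conv eval.simps eval_tpow
    using aperiodic_index[OF _ dr m st] unfolding k by blast
  moreover have "satisfies S (Mul (Mul (Var 0) (Var 1)) (Var 2), Mul (Var 0) (Mul (Var 1) (Var 2)))"
    unfolding satisfies_associative[OF alg] by (rule asc)
  moreover have "satisfies S (Om (Var 0), Mul (Bar (Var 0)) (Var 0))" "satisfies S (Mul (Om (Var 0)) (Bar (Var 0)), Bar (Var 0))"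
    using dr unfolding satisfies_def drazin_def fst_conv snd_conv eval.simps by blast+
  moreover have "equational_theory (Eq {S})" by (rule equational_theory_Eq) (simp add: alg)
  ultimately show ?thesis unfolding epi_theory_def by (auto simp: Eq_def simp del: tpow.simps)
qed

lemma models_occurrence_theory: "models (occurrence_theory m) = (C m :: 'u unary_semigroup set)"
proof (intro Set.set_eqI iffI)
  fix S :: "'u unary_semigroup" assume S: "S \<in> models (occurrence_theory m)"
  have epi: "epigroup S" by (rule models_epigroup[OF occurrence_theory S])
  have sat: "satisfies S p" if "p \<in> occurrence_theory m" for p using S that by (simp add: models_def)
  show "S \<in> C m"
  proof (cases "m = 0")
    case True
    have "satisfies S (Var 0, Var 1)" by (rule sat) (simp add: occurrence_theory_def True flip: zero_enat_def)
    then have eq: "x = y" if "x \<in> carrier S" "y \<in> carrier S" for x y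
      unfolding satisfies_def using that by (auto dest: spec[of _ "\<lambda>i. if i = 0 then x else y"])
    have "carrier S \<noteq> {}" using S by (simp add: models_def algebra_2_1_def)
    then obtain a where "a \<in> carrier S" by blast
    then have "carrier S = {a}" using eq by blast
    then show ?thesis using epi True by (auto simp: C_def trivial_variety_def)
  next
    case False
    have "satisfies S commutative_law"
      by (rule sat) (simp add: occurrence_theory_def commutative_law_eq add.commute)
    moreover have "satisfies S (word (replicate m 0), word (replicate (m + 1) 0))"
    proof (rule sat)
      have "occ y (word (replicate k 0)) = (if y = 0 then enat k else 0)" if "k \<noteq> 0" for y k
        using that by (simp add: occ_flat count_list_replicate zero_enat_def count_list_0_iff)
      then show "(word (replicate m 0), word (replicate (m + 1) 0)) \<in> occurrence_theory m"
        using False unfolding occurrence_theory_def by (auto simp del: replicate_Suc)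
    qed
    ultimately show ?thesis using epi False by (simp add: C_def)
  qed
next
  fix S :: "'u unary_semigroup" assume S: "S \<in> C m"
  then have epi: "epigroup S" by (auto simp: C_def trivial_variety_def split: if_splits)
  then have alg: "algebra_2_1 S" by (simp add: epigroup_def)
  show "S \<in> models (occurrence_theory m)"
  proof (cases "m = 0")
    case True
    then obtain a where a: "carrier S = {a}" using S by (auto simp: C_def trivial_variety_def)
    have "eval S \<rho> t = a" if "\<forall>i. \<rho> i \<in> carrier S" for \<rho> t using eval_closed[OF alg, of \<rho> t] that a by auto
    then show ?thesis using alg by (simp add: models_def satisfies_def)
  next
    case False
    then have c: "satisfies S commutative_law" and id: "satisfies S (word (replicate m 0), word (replicate (m + 1) 0))"
      using S by (simp_all add: C_def)
    have "occurrence_theory m \<subseteq> Eq {S}"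
      by (rule occurrence_theory_least[OF epi_theory_aperiodic[OF epi _ id]])
        (use False c id in \<open>simp_all add: commutative_def Eq_def\<close>)
    then show ?thesis using alg by (auto simp: models_def Eq_def)
  qed
qed

lemma SL_C_1: "(SL :: 'u unary_semigroup set) = C 1"
proof (rule Set.set_eqI)
  fix S :: "'u unary_semigroup"
  have "satisfies S commutative_law \<longleftrightarrow> (\<forall>x\<in>carrier S. \<forall>y\<in>carrier S. x \<cdot>\<^bsub>S\<^esub> y = y \<cdot>\<^bsub>S\<^esub> x)"
  proof (intro iffI ballI)
    fix x y assume "satisfies S commutative_law" "x \<in> carrier S" "y \<in> carrier S"
    then show "x \<cdot>\<^bsub>S\<^esub> y = y \<cdot>\<^bsub>S\<^esub> x"
      unfolding satisfies_def commutative_law_eq by (auto dest: spec[of _ "\<lambda>i. if i = 0 then x else y"])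
  qed (simp add: satisfies_def commutative_law_eq)
  moreover have "satisfies S (word (replicate 1 0), word (replicate (1 + 1) 0)) \<longleftrightarrow> (\<forall>x\<in>carrier S. x \<cdot>\<^bsub>S\<^esub> x = x)"
  proof -
    have w: "word (replicate 1 0) = Var 0" "word (replicate (1 + 1) 0) = Mul (Var 0) (Var 0)" by (simp_all add: word_def)
    show ?thesis unfolding w satisfies_def
    proof (intro iffI ballI)
      fix x assume "\<forall>\<rho>. (\<forall>i. \<rho> i \<in> carrier S) \<longrightarrow> eval S \<rho> (fst (Var 0, Mul (Var 0) (Var 0))) = eval S \<rho> (snd (Var 0, Mul (Var 0) (Var 0)))"
        "x \<in> carrier S"
      then show "x \<cdot>\<^bsub>S\<^esub> x = x" by (auto dest: spec[of _ "\<lambda>_. x"])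
    qed simp
  qed
  ultimately show "S \<in> SL \<longleftrightarrow> S \<in> C 1" by (auto simp: SL_def C_def)
qed

text \<open>The identities \<open>x\<^sup>\<omega> = y\<^sup>\<omega>\<close> and \<open>x\<^sup>\<omega> y =
  y\<close> preserve exponents, so \<open>a \<cdot> pinv S a\<close> is a unit element for every \<open>a\<close>, and
  \<open>pinv S x\<close> is the inverse of \<open>x\<close>.\<close>

lemma models_exponent_theory:
  assumes D: "0 \<in> D" "\<And>i j. i \<in> D \<Longrightarrow> j \<in> D \<Longrightarrow> i - j \<in> D"
  shows "abelian_group_variety (models (exponent_theory D))"
  unfolding abelian_group_variety_def
proof (intro conjI ballI)
  show "epigroup_variety (models (exponent_theory D))" by (rule epigroup_variety_models[OF exponent_theory[OF D]])
  fix S assume S: "S \<in> models (exponent_theory D)"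
  have alg: "algebra_2_1 S" using S by (simp add: models_def)
  have sat: "satisfies S p" if "\<forall>y. ex y (fst p) = ex y (snd p)" for p
    using S that D(1) by (cases p) (auto simp: models_def exponent_theory_def)
  have "carrier S \<noteq> {}" using alg by (simp add: algebra_2_1_def)
  then obtain a where a: "a \<in> carrier S" by blast
  have inst: "eval S (\<lambda>i. if i = 0 then x else if i = 1 then y else z) s = eval S (\<lambda>i. if i = 0 then x else if i = 1 then y else z) t"
    if "\<forall>y. ex y s = ex y t" "x \<in> carrier S" "y \<in> carrier S" "z \<in> carrier S" for s t x y z
    using sat[of "(s, t)"] that by (simp add: satisfies_def)
  let ?e = "a \<cdot>\<^bsub>S\<^esub> pinv S a"
  have cl: "x \<cdot>\<^bsub>S\<^esub> y \<in> carrier S" "pinv S x \<in> carrier S" if "x \<in> carrier S" "y \<in> carrier S" for x y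
    using alg that by (simp_all add: algebra_2_1_def)
  have "comm_group (submonoid_on S (carrier S) ?e)"
  proof (rule comm_groupI)
    fix x assume x: "x \<in> carrier (submonoid_on S (carrier S) ?e)"
    then have x: "x \<in> carrier S" by (simp add: submonoid_on_def)
    show "\<one>\<^bsub>submonoid_on S (carrier S) ?e\<^esub> \<otimes>\<^bsub>submonoid_on S (carrier S) ?e\<^esub> x = x"
      using inst[of "Mul (Om (Var 0)) (Var 1)" "Var 1" a x a] a x by (simp add: submonoid_on_def)
    have "pinv S x \<cdot>\<^bsub>S\<^esub> x = ?e"
      using inst[of "Mul (Bar (Var 1)) (Var 1)" "Om (Var 0)" a x a] a x by simp
    then show "\<exists>y\<in>carrier (submonoid_on S (carrier S) ?e). y \<otimes>\<^bsub>submonoid_on S (carrier S) ?e\<^esub> x = \<one>\<^bsub>submonoid_on S (carrier S) ?e\<^esub>"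
      using cl(2)[OF x x] by (auto simp: submonoid_on_def)
    fix y assume "y \<in> carrier (submonoid_on S (carrier S) ?e)"
    then have y: "y \<in> carrier S" by (simp add: submonoid_on_def)
    show "x \<otimes>\<^bsub>submonoid_on S (carrier S) ?e\<^esub> y \<in> carrier (submonoid_on S (carrier S) ?e)"
      using cl x y by (simp add: submonoid_on_def)
    show "x \<otimes>\<^bsub>submonoid_on S (carrier S) ?e\<^esub> y = y \<otimes>\<^bsub>submonoid_on S (carrier S) ?e\<^esub> x"
      using inst[of "Mul (Var 0) (Var 1)" "Mul (Var 1) (Var 0)" x y a] a x y by (simp add: submonoid_on_def)
    fix z assume "z \<in> carrier (submonoid_on S (carrier S) ?e)"
    then have z: "z \<in> carrier S" by (simp add: submonoid_on_def)
    show "x \<otimes>\<^bsub>submonoid_on S (carrier S) ?e\<^esub> y \<otimes>\<^bsub>submonoid_on S (carrier S) ?e\<^esub> z =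
      x \<otimes>\<^bsub>submonoid_on S (carrier S) ?e\<^esub> (y \<otimes>\<^bsub>submonoid_on S (carrier S) ?e\<^esub> z)"
      using inst[of "Mul (Mul (Var 0) (Var 1)) (Var 2)" "Mul (Var 0) (Mul (Var 1) (Var 2))" x y z] x y z by (simp add: submonoid_on_def)
  qed (use cl a in \<open>simp add: submonoid_on_def\<close>)
  then show "\<exists>e. comm_group (submonoid_on S (carrier S) e)" by blast
qed

lemma abelian_group_identities:
  assumes G: "abelian_group_variety G"
  shows "commutative_law \<in> Eq G" "(Mul (Om s) t, t) \<in> Eq G"
proof -
  have "satisfies S commutative_law \<and> satisfies S (Mul (Om s) t, t)" if S: "S \<in> G" for S
  proof -
    have epi: "epigroup S" using G S by (simp add: abelian_group_variety_def epigroup_variety_def)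
    obtain e where e: "comm_group (submonoid_on S (carrier S) e)" using G S by (auto simp: abelian_group_variety_def)
    interpret comm_group "submonoid_on S (carrier S) e" by (rule e)
    have alg: "algebra_2_1 S" and asc: "associative S" and dr: "\<And>x. x \<in> carrier S \<Longrightarrow> associative_algebra.drazin S x"
      using epi by (auto simp: epigroup_iff)
    interpret S: associative_algebra S by unfold_locales (rule alg asc)+
    have com: "x \<cdot>\<^bsub>S\<^esub> y = y \<cdot>\<^bsub>S\<^esub> x" if "x \<in> carrier S" "y \<in> carrier S" for x y
      using m_comm[of x y] that by (simp add: submonoid_on_def)
    have unit: "x \<cdot>\<^bsub>S\<^esub> pinv S x \<cdot>\<^bsub>S\<^esub> y = y" if x: "x \<in> carrier S" and y: "y \<in> carrier S" for x y
    proof -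
      let ?u = "x \<cdot>\<^bsub>S\<^esub> pinv S x"
      have "?u \<cdot>\<^bsub>S\<^esub> pinv S x = pinv S x" using dr[OF x] unfolding S.drazin_def by blast
      then have "?u \<cdot>\<^bsub>S\<^esub> ?u = ?u" using x com[of x "pinv S x"] by (simp flip: S.mult_assoc)
      then have "?u = e" using l_cancel_one'[of ?u ?u] x by (simp add: submonoid_on_def)
      then show ?thesis using l_one[of y] y by (simp add: submonoid_on_def)
    qed
    show ?thesis unfolding satisfies_def commutative_law_eq using com unit eval_closed[OF alg] by simp
  qed
  then show "commutative_law \<in> Eq G" "(Mul (Om s) t, t) \<in> Eq G" by (auto simp: Eq_def)
qed

text \<open>Every pseudoinverse is a zero, because multiplying a term with a bar by anything gives a term with a
  bar.\<close>

lemma models_nil_theory: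
  assumes T: "epi_theory \<Theta>" shows "nilvariety (models (nil_theory \<Theta>))"
  unfolding nilvariety_def
proof (intro conjI ballI)
  show "epigroup_variety (models (nil_theory \<Theta>))" by (rule epigroup_variety_models[OF nil_theory[OF T]])
  fix S assume S: "S \<in> models (nil_theory \<Theta>)"
  have alg: "algebra_2_1 S" using S by (simp add: models_def)
  have sat: "satisfies S (s, t)" if "vanishes \<Theta> s" "vanishes \<Theta> t" for s t
    using S that by (auto simp: models_def nil_theory_def)
  note hb = vanishes_hasbar[OF T]
  have inst: "eval S (\<lambda>i. if i = 0 then x else y) s = eval S (\<lambda>i. if i = 0 then x else y) t"
    if "vanishes \<Theta> s" "vanishes \<Theta> t" "x \<in> carrier S" "y \<in> carrier S" for s t x y
    using sat[OF that(1,2)] that(3,4) by (simp add: satisfies_def)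
  have "carrier S \<noteq> {}" using alg by (simp add: algebra_2_1_def)
  then obtain a where a: "a \<in> carrier S" by blast
  let ?z = "pinv S a"
  obtain n where n: "(Mul (tpow (Var 0) (Suc n)) (Bar (Var 0)), tpow (Var 0) n) \<in> \<Theta>"
    using T by (auto simp: epi_theory_def)
  have vn: "vanishes \<Theta> (tpow (Var 0) n)" unfolding vanishes_def
    using et_sym[OF epi_equational[OF T] n] by (intro exI conjI) auto
  show "nil_semigroup S" unfolding nil_semigroup_def
  proof (intro bexI[of _ ?z] conjI ballI)
    show "?z \<in> carrier S" using alg a by (simp add: algebra_2_1_def)
    fix x assume x: "x \<in> carrier S"
    show "x \<cdot>\<^bsub>S\<^esub> ?z = ?z" using inst[of "Mul (Var 0) (Bar (Var 1))" "Bar (Var 1)" x a] x a by (simp add: hb)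
    show "?z \<cdot>\<^bsub>S\<^esub> x = ?z" using inst[of "Mul (Bar (Var 1)) (Var 0)" "Bar (Var 1)" x a] x a by (simp add: hb)
    show "\<exists>n\<ge>1. spow S x n = ?z"
      using inst[OF vn, of "Bar (Var 1)" x a] x a by (intro exI[of _ "Suc n"]) (simp add: hb eval_tpow)
  qed
qed

section \<open>Upper-modular strongly permutative varieties\<close>

lemma C_variety:
  assumes "infinite (UNIV :: 'u set)"
  shows "epigroup_variety (C m :: 'u unary_semigroup set)" "Eq (C m :: 'u unary_semigroup set) = occurrence_theory m"
  unfolding models_occurrence_theory[symmetric]
  by (rule epigroup_variety_models[OF occurrence_theory], rule Eq_models[OF assms epi_equational[OF occurrence_theory]])

lemma trivial_or_semilattices:
  fixes M :: "'u unary_semigroup set"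
  shows "M = trivial_variety \<or> M = SL \<longleftrightarrow> (\<exists>m\<le>1. M = C m)"
proof -
  have "(trivial_variety :: 'u unary_semigroup set) = C 0" by (simp add: C_def)
  moreover have "(\<exists>m\<le>1. M = C m) \<longleftrightarrow> M = C 0 \<or> M = C 1" by (auto simp: le_Suc_eq)
  ultimately show ?thesis unfolding SL_C_1 by simp
qed

theorem theorem1p5:
  fixes V :: "'u unary_semigroup set"
  assumes "infinite (UNIV :: 'u set)"
    and "epigroup_variety V"
    and "strongly_permutative V"
  shows "upper_modular EPI V \<longleftrightarrow>
    (\<exists>M N. V = M \<squnion>\<^bsub>EPI\<^esub> N \<and> (M = trivial_variety \<or> M = SL) \<and> nilvariety N \<and>
       class_satisfies N {commutative_law, (word [0, 0, 1], word [0, 1, 1])}) \<or>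
    (\<exists>G m N. V = G \<squnion>\<^bsub>EPI\<^esub> C m \<squnion>\<^bsub>EPI\<^esub> N \<and> abelian_group_variety G \<and> m \<le> 2 \<and>
       epigroup_variety N \<and>
       class_satisfies N ({commutative_law} \<union> zero_law (word [0, 0, 1]) 2))"
    (is "_ \<longleftrightarrow> ?I \<or> ?II")
proof -
  note inf = assms(1)
  define \<Theta> where "\<Theta> = Eq V"
  have T: "epi_theory \<Theta>" and V: "V = models \<Theta>" unfolding \<Theta>_def using epi_theory_Eq[OF inf assms(2)] by simp_all
  note E = epi_equational
  have EqM: "Eq (models A :: 'u unary_semigroup set) = A" if "epi_theory A" for A by (rule Eq_models[OF inf E[OF that]])
  have sat: "class_satisfies N \<Sigma> \<longleftrightarrow> \<Sigma> \<subseteq> Eq N" for N :: "'u unary_semigroup set" and \<Sigma>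
    by (auto simp: class_satisfies_def Eq_def)
  have join: "models A \<squnion>\<^bsub>EPI\<^esub> models B = (models (A \<inter> B) :: 'u unary_semigroup set)"
    if "epi_theory A" "epi_theory B" for A B
    using EPI_join[OF inf epigroup_variety_models[OF that(1)] epigroup_variety_models[OF that(2)]] by (simp add: EqM that)
  obtain n \<pi> where n: "1 \<le> n" and \<pi>: "\<pi> permutes {1..n}" "\<pi> 1 \<noteq> 1" "\<pi> n \<noteq> n"
    and id: "(word [1..<n+1], word (map \<pi> [1..<n+1])) \<in> \<Theta>"
    using assms(3) unfolding strongly_permutative_def sat \<Theta>_def by blast
  have perm: "permutative \<Theta>" by (rule strongly_permutative_theory[OF T n \<pi> id])
  have "upper_modular EPI V \<longleftrightarrow> upper \<Theta>"
    unfolding upper_modular_iff[OF inf assms(2)] upper_def \<Theta>_def by (rule refl)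
  also have "\<dots> \<longleftrightarrow> commutative \<Theta> \<and> ((word [0, 0, 1], word [0, 1, 1]) \<in> \<Theta> \<or> vanishes \<Theta> (word [0, 0, 1]))"
    using upper_commutative[OF T _ n \<pi> id] upper_dichotomy[OF T] upper_sufficient[OF T] by blast
  also have "\<dots> \<longleftrightarrow> ?I \<or> ?II"
  proof (intro iffI)
    assume a: "commutative \<Theta> \<and> ((word [0, 0, 1], word [0, 1, 1]) \<in> \<Theta> \<or> vanishes \<Theta> (word [0, 0, 1]))"
    \<comment> \<open>The combinatorial factor is \<open>C m\<close> for the least index \<open>m\<close>.\<close>
    define m where "m = (LEAST k. index \<Theta> k)"
    have m: "index \<Theta> m" "\<And>k. index \<Theta> k \<Longrightarrow> m \<le> k"
      unfolding m_def using theory_index_exists[OF T perm] by (auto intro: LeastI Least_le)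
    note dec = theory_decomposition[OF T perm m]
    have per: "epi_theory (exponent_theory (periods \<Theta>))"
      by (rule exponent_theory) (rule theory_periods[OF T]; assumption)+
    note N = nil_theory[OF T]
    have Nc: "class_satisfies (models (nil_theory \<Theta>) :: 'u unary_semigroup set) {commutative_law}"
      unfolding sat EqM[OF N] using a by (simp add: nil_theory_def commutative_def)
    from a show "?I \<or> ?II"
    proof (elim conjE disjE)
      assume c: "commutative \<Theta>" and sq: "(word [0, 0, 1], word [0, 1, 1]) \<in> \<Theta>"
      have "periods \<Theta> = UNIV" "m \<le> 1" using shifted_square[OF T c sq] m(2) by auto
      then have "exponent_theory (periods \<Theta>) = UNIV" by (simp add: exponent_theory_def)
      then have "\<Theta> = occurrence_theory m \<inter> nil_theory \<Theta>" using dec by simp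
      then have "V = C m \<squnion>\<^bsub>EPI\<^esub> models (nil_theory \<Theta>)"
        unfolding models_occurrence_theory[symmetric] join[OF occurrence_theory N] V by simp
      moreover have "class_satisfies (models (nil_theory \<Theta>) :: 'u unary_semigroup set) {commutative_law, (word [0, 0, 1], word [0, 1, 1])}"
        using Nc sq unfolding sat EqM[OF N] by (simp add: nil_theory_def)
      ultimately have ?I using trivial_or_semilattices \<open>m \<le> 1\<close> models_nil_theory[OF T] by blast
      then show ?thesis by blast
    next
      assume v: "vanishes \<Theta> (word [0, 0, 1])"
      obtain y k where k: "occ y (word [0, 0, 1]) = enat k" "index \<Theta> k"
        using vanishing_word_index[OF T perm v] by auto
      \<comment> \<open>The index is an occurrence number of a letter in \<open>xxy\<close>.\<close>
      have "k \<le> 2" using k(1) by (auto simp: occ_flat split: if_splits)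
      then have "m \<le> 2" using m(2)[OF k(2)] by simp
      have "V = models (exponent_theory (periods \<Theta>)) \<squnion>\<^bsub>EPI\<^esub> C m \<squnion>\<^bsub>EPI\<^esub> models (nil_theory \<Theta>)"
        unfolding models_occurrence_theory[symmetric] join[OF per occurrence_theory]
          join[OF epi_theory_Int[OF per occurrence_theory] N] V by (rule arg_cong[OF dec])
      moreover have "zero_law (word [0, 0, 1]) 2 \<subseteq> nil_theory \<Theta>"
        using v vanishes_Mul[OF T] by (simp add: zero_law_def nil_theory_def)
      then have "class_satisfies (models (nil_theory \<Theta>) :: 'u unary_semigroup set) ({commutative_law} \<union> zero_law (word [0, 0, 1]) 2)"
        using Nc unfolding sat EqM[OF N] by simp
      moreover have "abelian_group_variety (models (exponent_theory (periods \<Theta>)) :: 'u unary_semigroup set)"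
        by (rule models_exponent_theory) (rule theory_periods[OF T]; assumption)+
      ultimately have ?II using \<open>m \<le> 2\<close> epigroup_variety_models[OF N] by blast
      then show ?thesis by blast
    qed
  next
    have Cc: "commutative_law \<in> occurrence_theory m" for m
      by (simp add: occurrence_theory_def commutative_law_eq add.commute)
    assume "?I \<or> ?II"
    then show "commutative \<Theta> \<and> ((word [0, 0, 1], word [0, 1, 1]) \<in> \<Theta> \<or> vanishes \<Theta> (word [0, 0, 1]))"
    proof
      assume ?I
      then obtain M N where V: "V = M \<squnion>\<^bsub>EPI\<^esub> N" and M: "M = trivial_variety \<or> M = SL" and N: "nilvariety N"
        and id: "class_satisfies N {commutative_law, (word [0, 0, 1], word [0, 1, 1])}" by blast
      obtain m where m: "m \<le> 1" "M = C m" using M unfolding trivial_or_semilattices by blast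
      have "\<Theta> = occurrence_theory m \<inter> Eq N"
        unfolding \<Theta>_def V m(2) using Eq_EPI_join(1)[OF inf C_variety(1)[OF inf], of N m] N C_variety(2)[OF inf, of m]
        by (simp add: nilvariety_def)
      moreover have "(word [0, 0, 1], word [0, 1, 1]) \<in> occurrence_theory m"
        using m(1) by (auto simp: occurrence_theory_def occ_flat le_Suc_eq zero_enat_def one_enat_def)
      ultimately show ?thesis using id Cc unfolding sat commutative_def by simp
    next
      assume ?II
      then obtain G m N where V: "V = G \<squnion>\<^bsub>EPI\<^esub> C m \<squnion>\<^bsub>EPI\<^esub> N" and G: "abelian_group_variety G" and m: "m \<le> 2"
        and N: "epigroup_variety N" and id: "class_satisfies N ({commutative_law} \<union> zero_law (word [0, 0, 1]) 2)" by blast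
      have Gv: "epigroup_variety G" using G by (simp add: abelian_group_variety_def)
      note GC = Eq_EPI_join[OF inf Gv C_variety(1)[OF inf, of m]]
      have \<Theta>: "\<Theta> = Eq G \<inter> occurrence_theory m \<inter> Eq N"
        unfolding \<Theta>_def V using Eq_EPI_join(1)[OF inf GC(2) N] GC(1) C_variety(2)[OF inf, of m] by simp
      \<comment> \<open>The term \<open>x\<^sup>\<omega>xxy\<close> is equal to \<open>xxy\<close> in each of the three factors; in \<open>C m\<close> this is due to \<open>m \<le> 2\<close>.\<close>
      let ?w = "word [0, 0, 1]" and ?p = "Mul (Om (Var 0)) (word [0, 0, 1])"
      have zero: "(Mul (Var 2) ?w, ?w) \<in> Eq N" using id unfolding sat zero_law_def by simp
      have w: "?w = Mul (Mul (Var 0) (Var 0)) (Var 1)" by (simp add: word_def)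
      have "(?p, ?w) \<in> Eq N"
        using et_subst[OF E[OF epi_theory_Eq(1)[OF inf N]] zero, of "\<lambda>i. if i = 2 then Om (Var 0) else Var i"]
        unfolding w by simp
      moreover have "occ y ?p = occ y ?w \<or> enat m \<le> occ y ?p \<and> enat m \<le> occ y ?w" for y
      proof -
        have p: "occ y ?p = (if y = 0 then \<infinity> else occ y ?w)" by simp
        have w0: "occ 0 ?w = enat 2" by (simp add: occ_flat)
        show ?thesis
          unfolding p by (cases "y = 0") (use m in \<open>simp_all only: w0 if_True if_False enat_ord_simps simp_thms\<close>)
      qed
      then have "(?p, ?w) \<in> occurrence_theory m" unfolding occurrence_theory_def by blast
      moreover have "(?p, ?w) \<in> Eq G" by (rule abelian_group_identities(2)[OF G])
      ultimately have "(?p, ?w) \<in> \<Theta>" unfolding \<Theta> by blast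
      then have "(?w, ?p) \<in> \<Theta>" by (rule et_sym[OF E[OF T]])
      moreover have "hasbar ?p" by simp
      ultimately have "vanishes \<Theta> ?w" unfolding vanishes_def by blast
      moreover have "commutative \<Theta>"
        using abelian_group_identities(1)[OF G] Cc id unfolding \<Theta> sat commutative_def by simp
      ultimately show ?thesis by blast
    qed
  qed
  finally show ?thesis .
qed

end
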